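(* Let $i\in\mathbb{Z}_+$, $r\in\mathbb{N}$ and $s\in(-1/2,i]$ satisfy $r>\max\{s,i-1\}$. Let $\psi^1,\psi^2\in C^{\infty}([0,1])$ satisfy $\operatorname{supp}\psi^1\subset[0,\tfrac23]$, $\operatorname{supp}\psi^2\subset[\tfrac13,1]$ and $\psi^1+\psi^2\equiv1$ on $[0,1]$, and extend them by zero to $\mathbb{R}$. Then there is a constant $C$ such that the following holds. Let $\{\Delta_m\}_{m\in\mathcal{M}}$, $\Delta_m=[a_m,b_m]$, be any finite or countable collection of pairwise disjoint intervals in $\mathbb{R}$, with lengths $l_m=b_m-a_m$, such that $0\notin(a_m,b_m)$ for every $m\in\mathcal{M}$, and put $\psi^{\sigma}_m(\xi)=\psi^{\sigma}\big((\xi-a_m)/l_m\big)$, $\sigma=1,2$. For each $m\in\mathcal{M}$ there exist two sequences (indexed by $\nu$) of functions $\psi^{\sigma}_{m,\nu}\in\mathcal{S}(\mathbb{R})$, $\sigma=1,2$ (their choice does not depend on the function $f$ below), such that for every measurable function $f$ on $\mathbb{R}$ for which $M_{i,2,s}f$ is finite at some point, there exist, for each $m\in\mathcal{M}$, two sequences of polynomials $p^{\sigma}_{m,\nu}\in\mathcal{P}_r$, $\sigma=1,2$ (depending on $f$; it is not assumed that $\{p^{\sigma}_{m,\nu}\}_{m\in\mathcal{M}}$ is $l^2$-valued), with the following properties: 1) for each $m$ and $\sigma$, $\psi^{\sigma}_{m,\nu}\to\psi^{\sigma}_m$ in $L^2(\mathbb{R})$ as $\nu\to\infty$; 2) there exist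 two functions $g^{\sigma}=\{g^{\sigma}_m\}_{m\in\mathcal{M}}$, $\sigma=1,2$, in $L^2_{\mathrm{loc}}(\mathbb{R},l^2)$ such that $$\Big\{e^{-2\pi i\,a_mx}\big(\widehat f\,\psi^1_{m,\nu}\big)^{\vee}(x)-p^1_{m,\nu}(x)\Big\}_{m\in\mathcal{M}}\to g^1,\qquad \Big\{e^{-2\pi i\,b_mx}\big(\widehat f\,\psi^2_{m,\nu}\big)^{\vee}(x)-p^2_{m,\nu}(x)\Big\}_{m\in\mathcal{M}}\to g^2$$ as $\nu\to\infty$, where the limits can be taken in $L^2(I,l^2)$ for any (bounded) interval $I$; 3) putting $\widetilde S^{\sigma}f=g^{\sigma}$, we have $$M_{r,2,s}\big(\widetilde S^{\sigma}f\big)\le C\,M_{i,2,s}f\quad\text{pointwise on }\mathbb{R},\qquad\sigma=1,2,$$ where the constant $C$ does not depend on $f$ or $\{\Delta_m\}$.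
   Context: In the exponentials the letter $i$ is the imaginary unit; as a parameter (in $M_{i,2,s}$, $\mathcal{P}_i$) it is a nonnegative integer. $\mathbb{Z}_+=\{0,1,2,\dots\}$, $\mathbb{N}=\{1,2,\dots\}$. $\mathcal{S}=\mathcal{S}(\mathbb{R})$ is the Schwartz class. The Fourier transform is $\widehat f(\xi)=\int f(x)e^{-2\pi i x\xi}\,dx$, extended to tempered distributions, and $^{\vee}$ is its inverse. If $M_{i,2,s}f$ is finite at some point, then $f(x)(1+|x|^{1+\beta})^{-1}$ is integrable for every $\beta>0$ with $\beta>\max\{s,i-1\}$, so $f$ is a tempered distribution, $\widehat f$ is understood in the sense of distributions, and for $\psi\in\mathcal{S}$ the expression $(\widehat f\,\psi)^{\vee}=f*\psi^{\vee}$ is a $C^\infty$ function. $\mathcal{P}_i$ is the space of (complex) algebraic polynomials on $\mathbb{R}$ of degree strictly less than $i$, with $\mathcal{P}_0=\{0\}$. Maximal function: for $s\in\mathbb{R}$, $1\le p<\infty$, $i\in\mathbb{Z}_+$ and a finite or countable collection $h=\{h_m\}$ of measurable functions on $\mathbb{R}$ (a single function is a collection with one element), $$M_{i,p,s}h(x)=\sup_{Q\ni x}\inf_{P}\frac{1}{|Q|^{s}}\bigg(\frac1{|Q|}\int_Q|h-P|_{l^2}^p\bigg)^{1/p},$$ where the supremum is over all bounded intervals $Q$ containing $x$, the infimum is over all collections $P=\{P_m\}$ of polynomials $P_m\in\mathcal{P}_i$, and $|h-P|_{l^2}=(\sum_m|h_m-P_m|^2)^{1/2}\in[0,\infty]$.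 The value $+\infty$ is allowed. *)

theory Defs
  imports "HOL-Analysis.Analysis" "HOL-Computational_Algebra.Polynomial"
begin

section \<open>Smooth functions, Schwartz functions, tempered distributions\<close>

text \<open>Iterated derivative relative to \<open>S\<close>; on \<open>S = {0..1}\<close> it is one-sided at the endpoints.\<close>

definition iter_deriv :: "real set \<Rightarrow> nat \<Rightarrow> (real \<Rightarrow> complex) \<Rightarrow> real \<Rightarrow> complex" where
  "iter_deriv S k f = ((\<lambda>g x. vector_derivative g (at x within S)) ^^ k) f"

definition smooth_on :: "real set \<Rightarrow> (real \<Rightarrow> complex) \<Rightarrow> bool" where
  "smooth_on S f \<longleftrightarrow> (\<forall>k. \<forall>x\<in>S. iter_deriv S k f differentiable (at x within S))"

definition schwartz :: "(real \<Rightarrow> complex) set" where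
  "schwartz = {f. smooth_on UNIV f \<and>
     (\<forall>j k. bounded (range (\<lambda>x. x ^ j *\<^sub>R iter_deriv UNIV k f x)))}"

definition fourier :: "(real \<Rightarrow> complex) \<Rightarrow> real \<Rightarrow> complex" where
  "fourier f \<xi> = (LINT x|lebesgue. f x * cis (- 2 * pi * x * \<xi>))"

definition inv_fourier :: "(real \<Rightarrow> complex) \<Rightarrow> real \<Rightarrow> complex" where
  "inv_fourier f x = (LINT \<xi>|lebesgue. f \<xi> * cis (2 * pi * x * \<xi>))"

text \<open>A tempered distribution is represented by a functional of which only the values on
  \<^const>\<open>schwartz\<close> matter. The operations below are the usual ones, defined by duality.\<close>

type_synonym distr = "(real \<Rightarrow> complex) \<Rightarrow> complex"

definition distr_of :: "(real \<Rightarrow> complex) \<Rightarrow> distr" where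
  "distr_of f = (\<lambda>\<phi>. LINT x|lebesgue. f x * \<phi> x)"

definition distr_fourier :: "distr \<Rightarrow> distr" where
  "distr_fourier T = (\<lambda>\<phi>. T (fourier \<phi>))"

definition distr_inv_fourier :: "distr \<Rightarrow> distr" where
  "distr_inv_fourier T = (\<lambda>\<phi>. T (inv_fourier \<phi>))"

definition distr_mult :: "distr \<Rightarrow> (real \<Rightarrow> complex) \<Rightarrow> distr" where
  "distr_mult T \<psi> = (\<lambda>\<phi>. T (\<lambda>x. \<psi> x * \<phi> x))"

definition represents :: "(real \<Rightarrow> complex) \<Rightarrow> distr \<Rightarrow> bool" where
  "represents F T \<longleftrightarrow>
     (\<forall>\<phi>\<in>schwartz. integrable lebesgue (\<lambda>x. F x * \<phi> x) \<and> distr_of F \<phi> = T \<phi>)"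

text \<open>The inverse Fourier transform of the product of \<open>\<psi>\<close> with the distributional Fourier
  transform of \<open>f\<close>. Continuity singles out the representative that is meant pointwise (it is
  automatically smooth).\<close>

definition freq_mult :: "(real \<Rightarrow> complex) \<Rightarrow> (real \<Rightarrow> complex) \<Rightarrow> real \<Rightarrow> complex" where
  "freq_mult f \<psi> = (THE F. continuous_on UNIV F \<and>
     represents F (distr_inv_fourier (distr_mult (distr_fourier (distr_of f)) \<psi>)))"


section \<open>Collections of functions and the maximal function\<close>

text \<open>A collection is a family together with its index set \<open>M\<close>; a single function is the
  family over the one-element index set \<open>{()}\<close>.\<close>

definition polys_less :: "nat \<Rightarrow> complex poly set" where
  "polys_less i = {p. p = 0 \<or> degree p < i}"

text \<open>Only used for exponents \<open>a > 0\<close>.\<close>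

definition ennreal_powr :: "ennreal \<Rightarrow> real \<Rightarrow> ennreal" where
  "ennreal_powr x a = (if x = \<infinity> then \<infinity> else ennreal (enn2real x powr a))"

definition l2_norm :: "'m set \<Rightarrow> ('m \<Rightarrow> complex) \<Rightarrow> ennreal" where
  "l2_norm M v = ennreal_powr (\<integral>\<^sup>+ m. ennreal ((cmod (v m))\<^sup>2) \<partial>count_space M) (1 / 2)"

definition maximal_fun ::
    "nat \<Rightarrow> real \<Rightarrow> real \<Rightarrow> 'm set \<Rightarrow> ('m \<Rightarrow> real \<Rightarrow> complex) \<Rightarrow> real \<Rightarrow> ennreal" where
  "maximal_fun i p s M h x =
     (SUP Q \<in> {Q. is_interval Q \<and> bounded Q \<and> measure lebesgue Q > 0 \<and> x \<in> Q}.
      INF P \<in> {P. \<forall>m\<in>M. P m \<in> polys_less i}.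
        ennreal (1 / measure lebesgue Q powr s) *
        ennreal_powr
          (ennreal (1 / measure lebesgue Q) *
           (\<integral>\<^sup>+ y\<in>Q. ennreal_powr (l2_norm M (\<lambda>m. h m y - poly (P m) (complex_of_real y))) p
             \<partial>lebesgue))
          (1 / p))"

definition L2_norm_on :: "real set \<Rightarrow> 'm set \<Rightarrow> ('m \<Rightarrow> real \<Rightarrow> complex) \<Rightarrow> ennreal" where
  "L2_norm_on I M F = ennreal_powr (\<integral>\<^sup>+ x\<in>I. (l2_norm M (\<lambda>m. F m x))\<^sup>2 \<partial>lebesgue) (1 / 2)"

text \<open>Membership in \<open>L\<^sup>2(I, l\<^sup>2)\<close> for countable \<open>M\<close>: \<open>l\<^sup>2\<close> is separable, so
  measurability is componentwise.\<close>

definition in_L2_on :: "real set \<Rightarrow> 'm set \<Rightarrow> ('m \<Rightarrow> real \<Rightarrow> complex) \<Rightarrow> bool" where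
  "in_L2_on I M F \<longleftrightarrow>
     (\<forall>m\<in>M. F m \<in> borel_measurable (lebesgue_on I)) \<and> L2_norm_on I M F < \<infinity>"

definition in_L2_loc :: "'m set \<Rightarrow> ('m \<Rightarrow> real \<Rightarrow> complex) \<Rightarrow> bool" where
  "in_L2_loc M F \<longleftrightarrow> (\<forall>I. is_interval I \<and> bounded I \<longrightarrow> in_L2_on I M F)"

definition tendsto_L2_on ::
    "real set \<Rightarrow> 'm set \<Rightarrow> (nat \<Rightarrow> 'm \<Rightarrow> real \<Rightarrow> complex) \<Rightarrow> ('m \<Rightarrow> real \<Rightarrow> complex) \<Rightarrow> bool"
  where
  "tendsto_L2_on I M F G \<longleftrightarrow> (\<forall>\<nu>. in_L2_on I M (F \<nu>)) \<and> in_L2_on I M G \<and>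
     (\<lambda>\<nu>. L2_norm_on I M (\<lambda>m x. F \<nu> m x - G m x)) \<longlonglongrightarrow> 0"

end

theory Submission
  imports Defs "HOL-Probability.Probability"
begin

text \<open>
  Each symbol is smooth except for one jump, which sits at the frequency \<open>c\<close> (\<open>a\<^sub>m\<close> or \<open>b\<^sub>m\<close>).
  After demodulation by \<open>c\<close> the multiplier is the convolution with a kernel whose \<open>j\<close>-th derivative
  decays like \<open>\<bar>u\<bar>\<close> to the power \<open>- 1 - j\<close>. Its \<open>r\<close>-th derivative is thus given by an absolutely
  convergent integral, and \<open>g\<^sub>m\<close> is an \<open>r\<close>-fold antiderivative of that integral, which is unique
  modulo polynomials of degree below \<open>r\<close>. As \<open>0\<close> is not inside \<open>(a\<^sub>m, b\<^sub>m)\<close>, the integral annihilates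
  polynomials of degree below \<open>i\<close>, so \<open>f\<close> may be replaced by its deviation from a polynomial adapted to
  the interval under consideration. The part of the deviation close to the interval is controlled by Plancherel's
  inequality, the part in a distant dyadic annulus by integration by parts and Gallagher's large
  sieve for the disjoint intervals; the annuli sum up because \<open>r > max s (i - 1)\<close>. The functions
  \<open>\<psi>\<^sub>m\<^sub>,\<^sub>\<nu>\<close> are Gaussian averages of the symbols, with parameters such that the \<open>r\<close>-th derivatives are
  in error by at most \<open>2\<close> to the power \<open>- m - \<nu>\<close>, uniformly in \<open>f\<close> relative to a weighted \<open>L\<^sup>1\<close> norm.
\<close>

section \<open>Oscillating exponentials and Gaussians\<close>

text \<open>The obstacle: f has only polynomial growth, while the kernel of a symbol with a jump
  decays like 1/|u|, so neither the multiplier applied to f nor its l2 sum over m converges as it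
  stands. Each derivative of the kernel gains one power of decay at the price of polynomials of
  degree below r. At distance R the kernel bounds combine into |k^(j)|^2 <= C min(l, 1/R) R^(-2j-1),
  and min(l, 1/R) is exactly the weight with which the large sieve sums the squared values of a
  Fourier transform at the end points c_m; this match makes the constant independent of the lengths.
  The exponent \<mu>, larger than s and i - 1 and smaller than r, measures how fast the deviation of
  f from one fixed polynomial may grow; the distance from \<mu> to r gives the geometric series over
  the annuli. Exact annihilation of polynomials also needs the supports of the bumps: either the
  jump sits at frequency 0, where the factor \<xi>^r of the r-th derivative vanishes, or the symbol
  is zero near frequency 0. A direction \<kappa> lets one argument treat both end points.\<close>

definition ee :: "real \<Rightarrow> complex" where "ee x = cis (2 * pi * x)"

lemma norm_ee [simp]: "norm (ee x) = 1"
  by (simp add: ee_def)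

lemma ee_0 [simp]: "ee 0 = 1"
  by (simp add: ee_def)

lemma ee_add: "ee (x + y) = ee x * ee y"
  by (simp add: ee_def cis_mult distrib_left)

lemma ee_minus: "ee (- x) = cnj (ee x)"
  by (simp add: ee_def cis_cnj)

lemma ee_mult_minus [simp]: "ee x * ee (- x) = 1" "ee (- x) * ee x = 1"
  by (simp_all flip: ee_add)

lemma ee_deriv:
  "((\<lambda>x. ee (a * x)) has_vector_derivative (2 * pi * \<i> * a) * ee (a * x)) (at x within S)"
proof -
  have "((\<lambda>z. exp (2 * pi * \<i> * a * z)) has_field_derivative
      (2 * pi * \<i> * a) * exp (2 * pi * \<i> * a * of_real x)) (at (of_real x))"
    by (auto intro!: derivative_eq_intros)
  from has_vector_derivative_real_field[OF this, of S] show ?thesis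
    by (simp add: ee_def cis_conv_exp algebra_simps)
qed

lemma continuous_on_ee [continuous_intros]:
  "continuous_on S f \<Longrightarrow> continuous_on S (\<lambda>x. ee (f x))"
  unfolding ee_def by (intro continuous_intros)

lemma measurable_ee [measurable]: "ee \<in> borel_measurable borel"
  by (intro borel_measurable_continuous_onI continuous_intros)

text \<open>Normalised to be its own Fourier transform with integral 1, so that its dilates form an
  approximate identity without further constants.\<close>

definition gam :: "real \<Rightarrow> real" where "gam x = exp (- pi * x\<^sup>2)"

lemma gam_pos [simp]: "gam x > 0" "gam x \<ge> 0" and gam_le_1 [simp]: "gam x \<le> 1"
  and gam_0 [simp]: "gam 0 = 1" and gam_minus [simp]: "gam (- x) = gam x"
  by (simp_all add: gam_def)

lemma continuous_on_gam [continuous_intros]: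
  "continuous_on S f \<Longrightarrow> continuous_on S (\<lambda>x. gam (f x))"
  unfolding gam_def by (intro continuous_intros)

lemma measurable_gam [measurable]: "gam \<in> borel_measurable borel"
  by (intro borel_measurable_continuous_onI continuous_intros)

lemma gam_density: "gam x = sqrt (2 * pi) * std_normal_density (sqrt (2 * pi) * x)"
  by (simp add: gam_def std_normal_density_def power_mult_distrib)

lemma gam_integrable: "integrable lborel gam"
proof -
  have "integrable lborel (\<lambda>x. std_normal_density (0 + sqrt (2 * pi) * x))"
    by (intro lborel_integrable_real_affine) auto
  then show ?thesis
    unfolding gam_density[abs_def] by simp
qed

text \<open>The characteristic function of the standard normal law, transported by the substitution
  x = \<open>sqrt (2 * pi)\<close> u.\<close>

lemma gam_fourier: "(LINT u|lborel. of_real (gam u) * ee (u * v)) = of_real (gam v)"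
proof -
  define q where "q = sqrt (2 * pi)"
  have q: "q > 0" "q\<^sup>2 = 2 * pi" "q * q = 2 * pi" by (auto simp: q_def)
  have "char std_normal_distribution (q * v)
      = (LINT x|lborel. std_normal_density x *\<^sub>R iexp (q * v * x))"
    unfolding char_def by (subst integral_density) auto
  also have "\<dots> = \<bar>q\<bar> *\<^sub>R (LINT u|lborel. std_normal_density (0 + q * u) *\<^sub>R iexp (q * v * (0 + q * u)))"
    using q by (intro lborel_integral_real_affine) auto
  also have "\<dots> = (LINT u|lborel. \<bar>q\<bar> *\<^sub>R (std_normal_density (0 + q * u) *\<^sub>R iexp (q * v * (0 + q * u))))"
    by (rule integral_scaleR_right[symmetric])
  also have "\<dots> = (LINT u|lborel. of_real (gam u) * ee (u * v))"
  proof (intro Bochner_Integration.integral_cong refl)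
    fix u
    have *: "q * v * (0 + q * u) = 2 * pi * (u * v)"
      unfolding q(3)[symmetric] by simp
    show "\<bar>q\<bar> *\<^sub>R (std_normal_density (0 + q * u) *\<^sub>R iexp (q * v * (0 + q * u)))
       = of_real (gam u) * ee (u * v)"
      using q(1) unfolding gam_density ee_def cis_conv_exp *
      by (simp add: q_def[symmetric] scaleR_conv_of_real)
  qed
  finally have "(LINT u|lborel. of_real (gam u) * ee (u * v)) = of_real (exp (- (q * v)\<^sup>2 / 2))"
    by (simp add: char_std_normal_distribution)
  then show ?thesis using q by (simp add: gam_def power_mult_distrib)
qed

lemma gam_integral: "(LINT u|lborel. gam u) = 1"
  using gam_fourier[of 0] by (simp flip: of_real_eq_iff)

lemma power_mult_gam_bounded: "\<exists>C. \<forall>x. \<bar>x\<bar> ^ n * gam x \<le> C"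
proof (cases "n = 0")
  case True
  then show ?thesis by (auto intro!: exI[of _ 1])
next
  case False
  \<comment> \<open>The inequality (1 + y/n)^n <= exp y at y = pi x^2 yields x^(2n) gam x <= n^n;
    then |x|^n <= 1 + x^(2n).\<close>
  have "\<bar>x\<bar> ^ n * gam x \<le> 1 + real n ^ n" for x
  proof -
    have "(x\<^sup>2 / n) ^ n \<le> (1 + pi * x\<^sup>2 / n) ^ n"
    proof (rule power_mono)
      have "x\<^sup>2 * 1 \<le> x\<^sup>2 * pi" by (intro mult_left_mono) (use pi_gt3 in auto)
      then have "x\<^sup>2 / n \<le> pi * x\<^sup>2 / n" by (intro divide_right_mono) (auto simp: mult.commute)
      then show "x\<^sup>2 / n \<le> 1 + pi * x\<^sup>2 / n" by simp
    qed auto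
    also have "\<dots> \<le> exp (pi * x\<^sup>2)"
    proof (rule exp_ge_one_plus_x_over_n_power_n)
      have "0 \<le> pi * x\<^sup>2" by simp
      then show "- real n \<le> pi * x\<^sup>2" by linarith
    qed (use False in auto)
    finally have "x ^ (2 * n) \<le> real n ^ n * exp (pi * x\<^sup>2)"
      using False by (simp add: power_divide field_simps flip: power_mult)
    then have *: "x ^ (2 * n) * gam x \<le> real n ^ n"
      by (simp add: gam_def exp_minus field_simps)
    have "\<bar>x\<bar> ^ n \<le> 1 + x ^ (2 * n)"
    proof (cases "\<bar>x\<bar> \<le> 1")
      case True then show ?thesis by (simp add: add_increasing2 power_le_one)
    next
      case False
      then have "\<bar>x\<bar> ^ n \<le> \<bar>x\<bar> ^ (2 * n)" by (intro power_increasing) auto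
      then show ?thesis by (simp add: power_even_abs)
    qed
    then have "\<bar>x\<bar> ^ n * gam x \<le> (1 + x ^ (2 * n)) * gam x"
      by (intro mult_right_mono) auto
    also have "\<dots> \<le> 1 + real n ^ n" using * gam_le_1[of x] unfolding distrib_right by linarith
    finally show ?thesis .
  qed
  then show ?thesis by blast
qed

text \<open>Rescaled Hermite polynomials, generated by the product rule: \<open>gd j\<close> is the
  j-th derivative of the Gaussian.\<close>

fun gpoly :: "nat \<Rightarrow> complex poly" where
  "gpoly 0 = 1"
| "gpoly (Suc j) = pderiv (gpoly j) - smult (2 * pi) (pCons 0 (gpoly j))"

definition gd :: "nat \<Rightarrow> real \<Rightarrow> complex" where
  "gd j u = poly (gpoly j) (of_real u) * of_real (gam u)"

lemma gd_0: "gd 0 u = of_real (gam u)"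
  by (simp add: gd_def)

lemma poly_of_real_deriv:
  "((\<lambda>u. poly p (complex_of_real u)) has_vector_derivative poly (pderiv p) (of_real u)) (at u within S)"
  by (rule has_vector_derivative_real_field) (rule poly_DERIV)

lemma gam_deriv: "((\<lambda>u. complex_of_real (gam u)) has_vector_derivative
    of_real (- 2 * pi * u * gam u)) (at u within S)"
  unfolding gam_def
  by (intro has_vector_derivative_of_real) (auto intro!: derivative_eq_intros)

lemma gd_deriv: "(gd j has_vector_derivative gd (Suc j) u) (at u within S)"
proof -
  have "((\<lambda>u. poly (gpoly j) (of_real u) * of_real (gam u)) has_vector_derivative gd (Suc j) u)
    (at u within S)"
    by (rule has_vector_derivative_eq_rhs,
        rule has_vector_derivative_mult[OF poly_of_real_deriv gam_deriv])
       (simp add: gd_def algebra_simps)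
  then show ?thesis by (simp add: gd_def[abs_def])
qed

lemma continuous_on_gd [continuous_intros]:
  "continuous_on S f \<Longrightarrow> continuous_on S (\<lambda>x. gd j (f x))"
  unfolding gd_def by (intro continuous_intros)

lemma measurable_gd [measurable]: "gd j \<in> borel_measurable borel"
  by (intro borel_measurable_continuous_onI continuous_intros)

lemma one_plus_abs_power_le: "(1 + \<bar>x::real\<bar>) ^ n \<le> 2 ^ n * (1 + \<bar>x\<bar> ^ n)"
proof -
  have "(1 + \<bar>x\<bar>) ^ n \<le> (2 * max 1 \<bar>x\<bar>) ^ n" by (intro power_mono) auto
  also have "max 1 \<bar>x\<bar> ^ n \<le> 1 + \<bar>x\<bar> ^ n" by (auto simp: max_def)
  then have "(2 * max 1 \<bar>x\<bar>) ^ n \<le> 2 ^ n * (1 + \<bar>x\<bar> ^ n)"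
    by (auto simp: power_mult_distrib)
  finally show ?thesis .
qed

lemma poly_gam_bounded:
  fixes p :: "complex poly"
  shows "\<exists>C\<ge>0. \<forall>u. \<bar>u\<bar> ^ n * norm (poly p (of_real u) * of_real (gam u)) \<le> C"
proof (induction p arbitrary: n)
  case 0
  then show ?case by auto
next
  case (pCons a p)
  obtain C where C: "C \<ge> 0" "\<And>u. \<bar>u\<bar> ^ Suc n * norm (poly p (of_real u) * of_real (gam u)) \<le> C"
    using pCons by metis
  obtain D where D: "\<And>u. \<bar>u\<bar> ^ n * gam u \<le> D"
    using power_mult_gam_bounded by metis
  have D0: "D \<ge> 0" using D[of 0] by (rule order_trans[rotated]) auto
  have "\<bar>u\<bar> ^ n * norm (poly (pCons a p) (of_real u) * of_real (gam u)) \<le> norm a * D + C" for u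
  proof -
    have "norm (poly (pCons a p) (of_real u) * of_real (gam u))
      \<le> norm a * gam u + \<bar>u\<bar> * norm (poly p (of_real u) * of_real (gam u))"
      using norm_triangle_ineq[of "a * of_real (gam u)" "of_real u * (poly p (of_real u) * of_real (gam u))"]
      by (simp add: algebra_simps norm_mult)
    then have "\<bar>u\<bar> ^ n * norm (poly (pCons a p) (of_real u) * of_real (gam u))
      \<le> norm a * (\<bar>u\<bar> ^ n * gam u) + \<bar>u\<bar> ^ Suc n * norm (poly p (of_real u) * of_real (gam u))"
      by (rule order_trans[OF mult_left_mono]) (auto simp: algebra_simps)
    also have "\<dots> \<le> norm a * D + C"
      by (intro add_mono mult_left_mono C D) auto
    finally show ?thesis .
  qed
  moreover have "norm a * D + C \<ge> 0" using C(1) D0 by simp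
  ultimately show ?case by blast
qed

lemma gd_bounded: "\<exists>C>0. \<forall>u. (1 + \<bar>u\<bar>) ^ n * norm (gd j u) \<le> C"
proof -
  obtain A where A: "A \<ge> 0" "\<And>u. \<bar>u\<bar> ^ 0 * norm (gd j u) \<le> A"
    using poly_gam_bounded unfolding gd_def by metis
  obtain B where B: "B \<ge> 0" "\<And>u. \<bar>u\<bar> ^ n * norm (gd j u) \<le> B"
    using poly_gam_bounded unfolding gd_def by metis
  have "(1 + \<bar>u\<bar>) ^ n * norm (gd j u) \<le> 2 ^ n * (A + B) + 1" for u
  proof -
    have "(1 + \<bar>u\<bar>) ^ n * norm (gd j u) \<le> 2 ^ n * (1 + \<bar>u\<bar> ^ n) * norm (gd j u)"
      by (intro mult_right_mono one_plus_abs_power_le) auto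
    also have "\<dots> = 2 ^ n * (norm (gd j u) + \<bar>u\<bar> ^ n * norm (gd j u))"
      by (simp add: algebra_simps)
    also have "\<dots> \<le> 2 ^ n * (A + B)" using A(2)[of u] B(2)[of u] by (intro mult_left_mono) auto
    finally show ?thesis by simp
  qed
  moreover have "2 ^ n * (A + B) + 1 > 0" using A B by (auto intro!: add_nonneg_pos)
  ultimately show ?thesis by blast
qed

lemma integrable_inverse_square: "integrable lborel (\<lambda>x::real. 1 / (1 + x\<^sup>2))"
  using integrable_inverse_1_plus_square
  by (simp add: set_integrable_def einterval_def inverse_eq_divide)

lemma integrable_inverse_abs_square: "integrable lborel (\<lambda>x::real. 1 / (1 + \<bar>x\<bar>)\<^sup>2)"
proof (rule Bochner_Integration.integrable_bound[OF integrable_inverse_square])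
  show "AE x::real in lborel. norm (1 / (1 + \<bar>x\<bar>)\<^sup>2) \<le> norm (1 / (1 + x\<^sup>2))"
  proof (rule AE_I2)
    fix x :: real
    have "1 + x\<^sup>2 \<le> (1 + \<bar>x\<bar>)\<^sup>2" by (simp add: power2_sum)
    moreover have "0 < 1 + x\<^sup>2" by (simp add: add_pos_nonneg)
    ultimately show "norm (1 / (1 + \<bar>x\<bar>)\<^sup>2) \<le> norm (1 / (1 + x\<^sup>2))"
      by (auto intro!: divide_left_mono simp: abs_of_pos)
  qed
qed auto

lemma integrable_decay:
  fixes f :: "real \<Rightarrow> 'a::{banach, second_countable_topology}"
  assumes [measurable]: "f \<in> borel_measurable borel" and b: "\<And>x. (1 + \<bar>x\<bar>)\<^sup>2 * norm (f x) \<le> C"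
  shows "integrable lborel f"
proof (rule Bochner_Integration.integrable_bound)
  show "integrable lborel (\<lambda>x::real. C * (1 / (1 + \<bar>x\<bar>)\<^sup>2))"
    by (intro integrable_mult_right integrable_inverse_abs_square)
  show "AE x in lborel. norm (f x) \<le> norm (C * (1 / (1 + \<bar>x\<bar>)\<^sup>2))"
  proof (rule AE_I2)
    fix x
    have "norm (f x) \<le> C / (1 + \<bar>x\<bar>)\<^sup>2"
      using b[of x] by (subst pos_le_divide_eq) (auto simp: mult.commute add_pos_nonneg)
    then show "norm (f x) \<le> norm (C * (1 / (1 + \<bar>x\<bar>)\<^sup>2))"
      by (metis abs_ge_self mult.right_neutral order_trans real_norm_def times_divide_eq_right)
  qed
qed auto

section \<open>Differentiation under the integral sign\<close>

lemma has_vector_derivative_quotient: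
  "(f has_vector_derivative D) (at x within S) \<longleftrightarrow>
    ((\<lambda>y. (f y - f x) /\<^sub>R (y - x)) \<longlongrightarrow> D) (at x within S)"
proof -
  have "(f has_vector_derivative D) (at x within S) \<longleftrightarrow>
    ((\<lambda>y. norm ((f y - f x) - (y - x) *\<^sub>R D) / norm (y - x)) \<longlongrightarrow> 0) (at x within S)"
    unfolding has_vector_derivative_def has_derivative_iff_norm
    by (simp add: bounded_linear_scaleR_left)
  also have "\<dots> \<longleftrightarrow> ((\<lambda>y. norm ((f y - f x) /\<^sub>R (y - x) - D)) \<longlongrightarrow> 0) (at x within S)"
  proof (intro filterlim_cong refl, unfold eventually_at_filter, intro always_eventually allI impI)
    fix y assume "y \<noteq> x"
    then have "(f y - f x) - (y - x) *\<^sub>R D = (y - x) *\<^sub>R ((f y - f x) /\<^sub>R (y - x) - D)"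
      by (simp add: scaleR_diff_right)
    then show "norm ((f y - f x) - (y - x) *\<^sub>R D) / norm (y - x) = norm ((f y - f x) /\<^sub>R (y - x) - D)"
      using \<open>y \<noteq> x\<close> by simp
  qed
  also have "\<dots> \<longleftrightarrow> ((\<lambda>y. (f y - f x) /\<^sub>R (y - x)) \<longlongrightarrow> D) (at x within S)"
    by (subst LIM_zero_iff[symmetric]) (simp add: tendsto_norm_zero_iff)
  finally show ?thesis .
qed

text \<open>Dominated convergence for difference quotients, which the mean value inequality bounds
  by g. The bound on F' is local, for |x - x0| < 1, because in the application to convolutions it
  grows with x.\<close>

lemma has_vector_derivative_integral:
  fixes F F' :: "real \<Rightarrow> 'a \<Rightarrow> complex"
  assumes D: "\<And>x t. ((\<lambda>x. F x t) has_vector_derivative F' x t) (at x)"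
    and b: "\<And>x t. \<bar>x - x0\<bar> < 1 \<Longrightarrow> norm (F' x t) \<le> g t"
    and i: "\<And>x. integrable M (F x)" and g: "integrable M g"
  shows "((\<lambda>x. LINT t|M. F x t) has_vector_derivative (LINT t|M. F' x0 t)) (at x0)"
  unfolding has_vector_derivative_quotient tendsto_at_iff_sequentially comp_def
proof (intro allI impI)
  fix X :: "nat \<Rightarrow> real" assume X: "\<forall>n. X n \<in> UNIV - {x0}" "X \<longlonglongrightarrow> x0"
  from X(2) have "\<forall>\<^sub>F n in sequentially. \<bar>X n - x0\<bar> < 1"
    using tendstoD[OF X(2), of 1] by (simp add: dist_real_def)
  then obtain N where N: "\<And>n. n \<ge> N \<Longrightarrow> \<bar>X n - x0\<bar> < 1"
    by (auto simp: eventually_sequentially)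
  have lim: "(\<lambda>n. (F (X n) t - F x0 t) /\<^sub>R (X n - x0)) \<longlonglongrightarrow> F' x0 t" for t
  proof -
    have "((\<lambda>y. (F y t - F x0 t) /\<^sub>R (y - x0)) \<longlongrightarrow> F' x0 t) (at x0)"
      using D by (subst has_vector_derivative_quotient[symmetric])
    then show ?thesis using X
      unfolding tendsto_at_iff_sequentially comp_def by blast
  qed
  have bd: "norm ((F (X n) t - F x0 t) /\<^sub>R (X n - x0)) \<le> g t" if "n \<ge> N" for n t
  proof -
    have "norm (F (X n) t - F x0 t) \<le> g t * norm (X n - x0)"
    proof (rule differentiable_bound[where S="ball x0 1" and f="\<lambda>x. F x t" and f'="\<lambda>x h. h *\<^sub>R F' x t"])
      show "((\<lambda>x. F x t) has_derivative (\<lambda>h. h *\<^sub>R F' x t)) (at x within ball x0 1)" for x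
        using has_vector_derivative_at_within[OF D] by (simp add: has_vector_derivative_def)
      show "onorm (\<lambda>h. h *\<^sub>R F' x t) \<le> g t" if "x \<in> ball x0 1" for x
        using b[of x t] that
        by (intro onorm_le) (auto simp: dist_real_def abs_minus_commute mult.commute intro!: mult_right_mono mult_left_mono)
    qed (use N[OF that] in \<open>auto simp: dist_real_def abs_minus_commute\<close>)
    moreover have "X n \<noteq> x0" using X by auto
    ultimately show ?thesis by (simp add: divide_simps mult.commute)
  qed
  have "(\<lambda>n. LINT t|M. (F (X (n + N)) t - F x0 t) /\<^sub>R (X (n + N) - x0)) \<longlonglongrightarrow> (LINT t|M. F' x0 t)"
  proof (rule integral_dominated_convergence[where w=g])
    have *: "(\<lambda>n. (F (X (n + N)) t - F x0 t) /\<^sub>R (X (n + N) - x0)) \<longlonglongrightarrow> F' x0 t" for t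
      using lim[of t] by (rule LIMSEQ_ignore_initial_segment)
    show "(\<lambda>t. (F (X (n + N)) t - F x0 t) /\<^sub>R (X (n + N) - x0)) \<in> borel_measurable M" for n
      using i[of "X (n + N)"] i[of x0] by (auto dest!: borel_measurable_integrable)
    then show "F' x0 \<in> borel_measurable M"
      using * by (rule borel_measurable_LIMSEQ_metric)
    show "AE t in M. (\<lambda>n. (F (X (n + N)) t - F x0 t) /\<^sub>R (X (n + N) - x0)) \<longlonglongrightarrow> F' x0 t"
      using * by auto
  qed (use g bd in auto)
  then have "(\<lambda>n. LINT t|M. (F (X n) t - F x0 t) /\<^sub>R (X n - x0)) \<longlonglongrightarrow> (LINT t|M. F' x0 t)"
    by (rule LIMSEQ_offset)
  then show "(\<lambda>n. ((LINT t|M. F (X n) t) - (LINT t|M. F x0 t)) /\<^sub>R (X n - x0)) \<longlonglongrightarrow> (LINT t|M. F' x0 t)"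
    using i by simp
qed

lemma fourier_integral_deriv:
  assumes h: "integrable lborel h" "integrable lborel (\<lambda>t. of_real t * h t)"
  shows "((\<lambda>v. LINT t|lborel. h t * ee (v * t)) has_vector_derivative
    (2 * pi * \<i>) * (LINT t|lborel. of_real t * h t * ee (v * t))) (at v)"
proof -
  have [measurable]: "h \<in> borel_measurable lborel" using h by auto
  have "((\<lambda>v. LINT t|lborel. h t * ee (v * t)) has_vector_derivative
    (LINT t|lborel. (2 * pi * \<i>) * (of_real t * h t * ee (v * t)))) (at v)"
  proof (rule has_vector_derivative_integral)
    show "((\<lambda>x. h t * ee (x * t)) has_vector_derivative 2 * pi * \<i> * (of_real t * h t * ee (x * t))) (at x)" for x t
      using has_vector_derivative_mult_right[OF ee_deriv[of t x UNIV], of "h t"]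
      by (simp only: mult_ac)
    show "integrable lborel (\<lambda>t. norm (2 * pi * \<i> * (of_real t * h t)))"
      using h by (intro integrable_norm integrable_mult_right)
    show "integrable lborel (\<lambda>t. h t * ee (x * t))" for x
      by (rule Bochner_Integration.integrable_bound[OF h(1)]) (simp_all add: norm_mult)
  qed (simp add: norm_mult)
  then show ?thesis by simp
qed

lemma integrable_power_gam: "integrable lborel (\<lambda>u. complex_of_real (u ^ j * gam u))"
proof -
  obtain C where C: "C \<ge> 0" "\<And>u. \<bar>u\<bar> ^ 0 * norm (poly (monom 1 j) (of_real u) * complex_of_real (gam u)) \<le> C"
    using poly_gam_bounded[of 0 "monom 1 j"] by blast
  obtain D where D: "D \<ge> 0" "\<And>u. \<bar>u\<bar> ^ 2 * norm (poly (monom 1 j) (of_real u) * complex_of_real (gam u)) \<le> D"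
    using poly_gam_bounded[of 2 "monom 1 j"] by blast
  show ?thesis
  proof (rule integrable_decay)
    show "(1 + \<bar>u\<bar>)\<^sup>2 * norm (complex_of_real (u ^ j * gam u)) \<le> 2 ^ 2 * (C + D)" for u
    proof -
      have "(1 + \<bar>u\<bar>)\<^sup>2 * norm (complex_of_real (u ^ j * gam u))
         \<le> 2 ^ 2 * (1 + \<bar>u\<bar> ^ 2) * norm (complex_of_real (u ^ j * gam u))"
        by (intro mult_right_mono one_plus_abs_power_le) auto
      also have "\<dots> \<le> 2 ^ 2 * (C + D)"
        using C(2)[of u] D(2)[of u] by (simp add: poly_monom algebra_simps norm_mult norm_power)
      finally show ?thesis .
    qed
  qed auto
qed

text \<open>A factor u on one side is a derivative on the other: the derivative of case j in v,
  computed under the integral and from the induction hypothesis, gives case j + 1.\<close>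

lemma gam_moment_fourier:
  "(LINT u|lborel. of_real (u ^ j * gam u) * ee (v * u)) = gd j v / (2 * pi * \<i>) ^ j"
proof (induction j arbitrary: v)
  case 0
  then show ?case using gam_fourier[of v] by (simp add: gd_0 mult.commute)
next
  case (Suc j)
  have "((\<lambda>v. LINT u|lborel. of_real (u ^ j * gam u) * ee (v * u)) has_vector_derivative
    (2 * pi * \<i>) * (LINT t|lborel. of_real t * of_real (t ^ j * gam t) * ee (v * t))) (at v)"
    using integrable_power_gam[of j] integrable_power_gam[of "Suc j"]
    by (intro fourier_integral_deriv) (simp_all add: mult.assoc)
  moreover have "((\<lambda>v. LINT u|lborel. of_real (u ^ j * gam u) * ee (v * u)) has_vector_derivative
    gd (Suc j) v / (2 * pi * \<i>) ^ j) (at v)"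
    unfolding Suc by (intro has_vector_derivative_divide gd_deriv)
  ultimately have "(2 * pi * \<i>) * (LINT t|lborel. of_real t * of_real (t ^ j * gam t) * ee (v * t))
     = gd (Suc j) v / (2 * pi * \<i>) ^ j"
    by (rule vector_derivative_unique_at)
  moreover have "I = Z / q ^ Suc j" if "q * I = Z / q ^ j" "q \<noteq> 0" for q I Z :: complex
    using that by (simp add: field_simps)
  ultimately have "(LINT t|lborel. of_real t * of_real (t ^ j * gam t) * ee (v * t))
     = gd (Suc j) v / (2 * pi * \<i>) ^ Suc j"
    by simp
  then show ?case by (simp only: power_Suc of_real_mult mult.assoc)
qed

section \<open>Plancherel's inequality and the large sieve\<close>

text \<open>The square of the L2 norm on S. Values in \<open>ennreal\<close> allow sums over m and
  infinite norms without integrability conditions.\<close>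

definition sqint :: "real set \<Rightarrow> (real \<Rightarrow> complex) \<Rightarrow> ennreal" where
  "sqint S h = (\<integral>\<^sup>+t\<in>S. ennreal ((norm (h t))\<^sup>2) \<partial>lborel)"

lemma sqint_mono: "(\<And>t. t \<in> S \<Longrightarrow> t \<in> T \<and> norm (h t) \<le> norm (g t)) \<Longrightarrow> sqint S h \<le> sqint T g"
  unfolding sqint_def
  by (intro nn_integral_mono) (auto split: split_indicator intro!: ennreal_leI power_mono)

lemma norm_add_sq_le:
  fixes x y :: "'a::real_normed_vector"
  shows "(norm (x + y))\<^sup>2 \<le> 2 * (norm x)\<^sup>2 + 2 * (norm y)\<^sup>2"
proof -
  have "(norm (x + y))\<^sup>2 \<le> (norm x + norm y)\<^sup>2"
    by (intro power_mono norm_triangle_ineq) auto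
  also have "\<dots> \<le> 2 * (norm x)\<^sup>2 + 2 * (norm y)\<^sup>2"
    using sum_squares_bound[of "norm x" "norm y"] by (simp add: power2_sum)
  finally show ?thesis .
qed

lemma sqint_add:
  assumes [measurable]: "h \<in> borel_measurable borel" "g \<in> borel_measurable borel" "S \<in> sets borel"
  shows "sqint S (\<lambda>t. h t + g t) \<le> 2 * sqint S h + 2 * sqint S g"
proof -
  have "sqint S (\<lambda>t. h t + g t) \<le> (\<integral>\<^sup>+t. 2 * (ennreal ((norm (h t))\<^sup>2) * indicator S t)
      + 2 * (ennreal ((norm (g t))\<^sup>2) * indicator S t) \<partial>lborel)"
    unfolding sqint_def
  proof (intro nn_integral_mono)
    fix t
    have "ennreal ((norm (h t + g t))\<^sup>2) \<le> ennreal (2 * (norm (h t))\<^sup>2 + 2 * (norm (g t))\<^sup>2)"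
      by (intro ennreal_leI norm_add_sq_le)
    also have "\<dots> = 2 * ennreal ((norm (h t))\<^sup>2) + 2 * ennreal ((norm (g t))\<^sup>2)"
      by (simp add: ennreal_mult)
    finally show "ennreal ((norm (h t + g t))\<^sup>2) * indicator S t
      \<le> 2 * (ennreal ((norm (h t))\<^sup>2) * indicator S t) + 2 * (ennreal ((norm (g t))\<^sup>2) * indicator S t)"
      by (auto split: split_indicator)
  qed
  also have "\<dots> = 2 * sqint S h + 2 * sqint S g"
    unfolding sqint_def by (simp add: nn_integral_add nn_integral_cmult)
  finally show ?thesis .
qed

lemma sqint_cmult:
  assumes [measurable]: "h \<in> borel_measurable borel" "S \<in> sets borel"
  shows "sqint S (\<lambda>t. a * h t) = ennreal ((norm a)\<^sup>2) * sqint S h"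
  unfolding sqint_def
  by (subst nn_integral_cmult[symmetric])
     (auto simp: norm_mult power_mult_distrib ennreal_mult mult.assoc)

lemma sqint_L1:
  assumes [measurable]: "h \<in> borel_measurable borel" "S \<in> sets borel"
  shows "(\<integral>\<^sup>+t\<in>S. ennreal (norm (h t)) \<partial>lborel)\<^sup>2 \<le> emeasure lborel S * sqint S h"
proof -
  have "(\<integral>\<^sup>+t\<in>S. ennreal (norm (h t)) \<partial>lborel)\<^sup>2
      = (\<integral>\<^sup>+t. indicator S t * (ennreal (norm (h t)) * indicator S t) \<partial>lborel)\<^sup>2"
    by (intro arg_cong[where f="\<lambda>x. x\<^sup>2"] nn_integral_cong) (auto split: split_indicator)
  also have "\<dots> \<le> (\<integral>\<^sup>+t. (indicator S t)\<^sup>2 \<partial>lborel) * (\<integral>\<^sup>+t. (ennreal (norm (h t)) * indicator S t)\<^sup>2 \<partial>lborel)"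
    by (intro Cauchy_Schwarz_nn_integral) auto
  also have "(\<integral>\<^sup>+t. (indicator S t)\<^sup>2 \<partial>lborel) = (\<integral>\<^sup>+t. indicator S t \<partial>lborel)"
    by (intro nn_integral_cong) (auto split: split_indicator)
  also have "(\<integral>\<^sup>+t. (ennreal (norm (h t)) * indicator S t)\<^sup>2 \<partial>lborel) = sqint S h"
    unfolding sqint_def
    by (intro nn_integral_cong) (auto split: split_indicator simp: ennreal_power)
  finally show ?thesis by simp
qed

lemma integrable_of_sqint:
  assumes [measurable]: "h \<in> borel_measurable borel" and fin: "sqint {a..b} h < \<infinity>"
    and 0: "\<And>t. t \<notin> {a..b} \<Longrightarrow> h t = 0"
  shows "integrable lborel h"
proof -
  have "(\<integral>\<^sup>+t. ennreal (norm (h t)) \<partial>lborel)\<^sup>2 = (\<integral>\<^sup>+t\<in>{a..b}. ennreal (norm (h t)) \<partial>lborel)\<^sup>2"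
    using 0 by (intro arg_cong[where f="\<lambda>x. x\<^sup>2"] nn_integral_cong) (auto split: split_indicator)
  also have "\<dots> \<le> emeasure lborel {a..b} * sqint {a..b} h"
    by (intro sqint_L1) auto
  also have "\<dots> < \<infinity>"
    using fin by (cases "a \<le> b") (auto intro!: ennreal_mult_less_top[THEN iffD2])
  finally have "(\<integral>\<^sup>+t. ennreal (norm (h t)) \<partial>lborel) < \<infinity>"
    by (auto simp: power2_eq_square ennreal_mult_less_top)
  then show ?thesis by (simp add: integrable_iff_bounded)
qed

lemma sqint_UNIV:
  assumes "\<And>t. t \<notin> S \<Longrightarrow> h t = 0"
  shows "sqint UNIV h = sqint S h"
  unfolding sqint_def using assms
  by (intro nn_integral_cong) (auto split: split_indicator)

text \<open>The tensor product of A and h is integrable and K is bounded, so Fubini applies. It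
  serves for exponentials, for the indicator of y <= x (\<open>op_by_parts\<close>) and for a kernel
  made bounded by weights (\<open>conv_swap\<close>).\<close>

lemma bounded_kernel_swap:
  fixes A h :: "real \<Rightarrow> complex" and K :: "real \<times> real \<Rightarrow> complex"
  assumes A: "integrable lborel A" and h: "integrable lborel h"
    and K [measurable]: "K \<in> borel_measurable borel" and B: "\<And>z. norm (K z) \<le> B"
  shows "(LINT x|lborel. A x * (LINT y|lborel. h y * K (x, y))) =
         (LINT y|lborel. h y * (LINT x|lborel. A x * K (x, y)))"
proof -
  have [measurable]: "A \<in> borel_measurable borel" "h \<in> borel_measurable borel"
    using A h by auto
  have [measurable]: "K \<in> borel_measurable (borel \<Otimes>\<^sub>M borel)"
    using K by (simp add: borel_prod)
  have 1: "integrable (lborel \<Otimes>\<^sub>M lborel) (\<lambda>(x, y). A x * h y)"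
    unfolding integrable_iff_bounded
  proof
    have "(\<integral>\<^sup>+z. ennreal (norm (case z of (x, y) \<Rightarrow> A x * h y)) \<partial>(lborel \<Otimes>\<^sub>M lborel))
       = (\<integral>\<^sup>+x. \<integral>\<^sup>+y. ennreal (norm (A x)) * ennreal (norm (h y)) \<partial>lborel \<partial>lborel)"
      by (subst lborel.nn_integral_fst[symmetric])
         (auto simp: norm_mult ennreal_mult)
    also have "\<dots> = (\<integral>\<^sup>+x. ennreal (norm (A x)) \<partial>lborel) * (\<integral>\<^sup>+y. ennreal (norm (h y)) \<partial>lborel)"
      by (simp add: nn_integral_cmult nn_integral_multc)
    also have "\<dots> < \<infinity>"
      using A h by (auto simp: integrable_iff_bounded ennreal_mult_less_top)
    finally show "(\<integral>\<^sup>+z. ennreal (norm (case z of (x, y) \<Rightarrow> A x * h y)) \<partial>(lborel \<Otimes>\<^sub>M lborel)) < \<infinity>" .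
  qed auto
  have "integrable (lborel \<Otimes>\<^sub>M lborel) (\<lambda>(x, y). A x * h y * K (x, y))"
  proof (rule Bochner_Integration.integrable_bound)
    show "integrable (lborel \<Otimes>\<^sub>M lborel) (\<lambda>z. B * norm (case z of (x, y) \<Rightarrow> A x * h y))"
      using 1 by (intro integrable_mult_right integrable_norm)
    show "AE z in lborel \<Otimes>\<^sub>M lborel. norm (case z of (x, y) \<Rightarrow> A x * h y * K (x, y))
        \<le> norm (B * norm (case z of (x, y) \<Rightarrow> A x * h y))"
    proof (rule AE_I2, clarify)
      fix x y
      have "norm (A x * h y) * norm (K (x, y)) \<le> norm (A x * h y) * \<bar>B\<bar>"
        using B[of "(x, y)"] by (intro mult_left_mono) auto
      then show "norm (A x * h y * K (x, y)) \<le> norm (B * norm (A x * h y))"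
        by (simp add: norm_mult abs_mult mult_ac)
    qed
  qed (auto simp: case_prod_unfold)
  then have "(LINT y|lborel. LINT x|lborel. A x * h y * K (x, y)) =
             (LINT x|lborel. LINT y|lborel. A x * h y * K (x, y))"
    by (rule lborel_pair.Fubini_integral)
  also have "(\<lambda>y. LINT x|lborel. A x * h y * K (x, y)) = (\<lambda>y. h y * (LINT x|lborel. A x * K (x, y)))"
    by (simp add: fun_eq_iff mult.assoc mult.left_commute flip: integral_mult_right_zero)
  also have "(\<lambda>x. LINT y|lborel. A x * h y * K (x, y)) = (\<lambda>x. A x * (LINT y|lborel. h y * K (x, y)))"
    by (simp add: fun_eq_iff mult.assoc flip: integral_mult_right_zero)
  finally show ?thesis ..
qed

lemma measurable_cnj [measurable]: "cnj \<in> borel_measurable borel"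
  by (intro borel_measurable_continuous_onI continuous_intros)

lemma measurable_ee_mult: "(\<lambda>z::real \<times> real. ee (fst z * snd z)) \<in> borel_measurable borel"
  by (intro borel_measurable_continuous_onI continuous_intros)

lemma fourier_swap:
  assumes "integrable lborel A" "integrable lborel h"
  shows "(LINT x|lborel. A x * (LINT y|lborel. h y * ee (x * y))) =
         (LINT y|lborel. h y * (LINT x|lborel. A x * ee (x * y)))"
  using bounded_kernel_swap[OF assms measurable_ee_mult, of 1] by simp

lemma fourier_integral_norm_le:
  "norm (LINT y|lborel. h y * ee (x * y)) \<le> (LINT y|lborel. norm (h y))"
  using integral_norm_bound[of lborel "\<lambda>y. h y * ee (x * y)"] by (simp add: norm_mult)

text \<open>The damped version follows from Fubini, as the Fourier transform of the Gaussian weight is an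
  approximate identity; the weight is then removed by Fatou's lemma.\<close>

lemma fourier_gam_scaled:
  assumes "\<epsilon> > 0"
  shows "(LINT \<xi>|lborel. of_real (gam (\<epsilon> * \<xi>)) * ee (\<xi> * v)) = of_real (gam (v / \<epsilon>) / \<epsilon>)"
proof -
  have "of_real (gam (v / \<epsilon>)) = (LINT u|lborel. of_real (gam u) * ee (u * (v / \<epsilon>)))"
    by (simp only: gam_fourier)
  also have "\<dots> = \<bar>\<epsilon>\<bar> *\<^sub>R (LINT u|lborel. of_real (gam (0 + \<epsilon> * u)) * ee ((0 + \<epsilon> * u) * (v / \<epsilon>)))"
    using assms by (intro lborel_integral_real_affine) auto
  finally show ?thesis using assms by (simp add: scaleR_conv_of_real)
qed

lemma gam_scaled_nn_integral:
  assumes "\<epsilon> > 0"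
  shows "(\<integral>\<^sup>+y. ennreal (gam ((x - y) / \<epsilon>) / \<epsilon>) \<partial>lborel) = 1"
proof -
  have "1 = (\<integral>\<^sup>+u. ennreal (gam u) \<partial>lborel)"
    using gam_integral gam_integrable by (subst nn_integral_eq_integral) auto
  also have "\<dots> = \<bar>- 1 / \<epsilon>\<bar> * (\<integral>\<^sup>+u. ennreal (gam (x / \<epsilon> + (- 1 / \<epsilon>) * u)) \<partial>lborel)"
    using assms by (intro nn_integral_real_affine) auto
  also have "\<dots> = (\<integral>\<^sup>+y. ennreal (gam ((x - y) / \<epsilon>) / \<epsilon>) \<partial>lborel)"
    using assms
    by (subst nn_integral_cmult[symmetric])
       (auto simp: diff_divide_distrib simp flip: ennreal_mult)
  finally show ?thesis ..
qed

lemma integrable_gam_scaled: "\<epsilon> \<noteq> 0 \<Longrightarrow> integrable lborel (\<lambda>\<xi>. gam (\<epsilon> * \<xi>))"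
  using lborel_integrable_real_affine[OF gam_integrable, of \<epsilon> 0] by simp

lemma damped_plancherel_le:
  assumes h: "integrable lborel h" and e: "\<epsilon> > 0"
  defines "H \<equiv> \<lambda>\<xi>. LINT x|lborel. h x * ee (\<xi> * x)"
  shows "(\<integral>\<^sup>+\<xi>. ennreal ((norm (H \<xi>))\<^sup>2 * gam (\<epsilon> * \<xi>)) \<partial>lborel) \<le> sqint UNIV h"
proof -
  define N where "N = (LINT y|lborel. norm (h y))"
  have [measurable]: "h \<in> borel_measurable borel" using h by auto
  have [measurable]: "H \<in> borel_measurable borel" unfolding H_def by measurable
  have HN: "norm (H \<xi>) \<le> N" for \<xi>
    unfolding H_def N_def by (rule fourier_integral_norm_le)
  have N0: "N \<ge> 0" unfolding N_def by simp
  \<comment> \<open>With this A the weighted |H|^2 equals A H, and expanding the remaining factor H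
    lets Fubini move the transform onto A.\<close>
  define A where "A = (\<lambda>\<xi>. of_real (gam (\<epsilon> * \<xi>)) * cnj (H \<xi>))"
  have A: "integrable lborel A"
  proof (rule Bochner_Integration.integrable_bound)
    show "integrable lborel (\<lambda>\<xi>. gam (\<epsilon> * \<xi>) * N)"
      using integrable_gam_scaled[of \<epsilon>] e by simp
    show "AE \<xi> in lborel. norm (A \<xi>) \<le> norm (gam (\<epsilon> * \<xi>) * N)"
      using HN N0 by (auto simp: A_def norm_mult intro!: mult_left_mono)
  qed (auto simp: A_def)
  define g where "g = (\<lambda>v. gam (v / \<epsilon>) / \<epsilon>)"
  have g0: "g v \<ge> 0" for v using e by (simp add: g_def)
  have gsym: "g (x - y) = g (y - x)" for x y
    using gam_minus[of "(x - y) / \<epsilon>"] by (simp add: g_def minus_divide_left)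
  have [measurable]: "g \<in> borel_measurable borel" unfolding g_def by measurable
  have inner: "(LINT \<xi>|lborel. A \<xi> * ee (\<xi> * x)) = (LINT y|lborel. cnj (h y) * of_real (g (x - y)))" for x
  proof -
    have cH: "cnj (H \<xi>) = (LINT y|lborel. cnj (h y) * ee (- \<xi> * y))" for \<xi>
      unfolding H_def by (simp add: ee_minus del: integral_mult_right_zero flip: complex_cnj_mult)
    have "(LINT \<xi>|lborel. A \<xi> * ee (\<xi> * x))
        = (LINT \<xi>|lborel. (of_real (gam (\<epsilon> * \<xi>)) * ee (\<xi> * x)) * (LINT y|lborel. cnj (h y) * ee (- \<xi> * y)))"
      unfolding A_def cH by (simp add: mult_ac)
    also have "\<dots> = (LINT y|lborel. cnj (h y) * (LINT \<xi>|lborel. (of_real (gam (\<epsilon> * \<xi>)) * ee (\<xi> * x)) * ee (- \<xi> * y)))"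
    proof (rule bounded_kernel_swap[where K="\<lambda>z. ee (- fst z * snd z)" and B=1, unfolded fst_conv snd_conv])
      show "integrable lborel (\<lambda>\<xi>. complex_of_real (gam (\<epsilon> * \<xi>)) * ee (\<xi> * x))"
        by (rule Bochner_Integration.integrable_bound[OF integrable_gam_scaled[of \<epsilon>]])
           (use e in \<open>auto simp: norm_mult\<close>)
      show "(\<lambda>z::real \<times> real. ee (- fst z * snd z)) \<in> borel_measurable borel"
        by (intro borel_measurable_continuous_onI continuous_intros)
    qed (use h in auto)
    also have "\<dots> = (LINT y|lborel. cnj (h y) * (LINT \<xi>|lborel. of_real (gam (\<epsilon> * \<xi>)) * ee (\<xi> * (x - y))))"
      by (simp add: right_diff_distrib mult.assoc flip: ee_add)
    also have "\<dots> = (LINT y|lborel. cnj (h y) * of_real (g (x - y)))"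
      by (simp only: fourier_gam_scaled[OF e] g_def)
    finally show ?thesis .
  qed
  have int2: "integrable lborel (\<lambda>\<xi>. (norm (H \<xi>))\<^sup>2 * gam (\<epsilon> * \<xi>))"
  proof (rule Bochner_Integration.integrable_bound)
    show "integrable lborel (\<lambda>\<xi>. N\<^sup>2 * gam (\<epsilon> * \<xi>))"
      using integrable_gam_scaled[of \<epsilon>] e by simp
    show "AE \<xi> in lborel. norm ((norm (H \<xi>))\<^sup>2 * gam (\<epsilon> * \<xi>)) \<le> norm (N\<^sup>2 * gam (\<epsilon> * \<xi>))"
      using HN by (auto simp: abs_mult intro!: mult_right_mono power_mono)
  qed auto
  have "complex_of_real (LINT \<xi>|lborel. (norm (H \<xi>))\<^sup>2 * gam (\<epsilon> * \<xi>))
      = (LINT \<xi>|lborel. A \<xi> * H \<xi>)"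
    by (subst integral_complex_of_real[symmetric])
       (auto simp: A_def complex_norm_square mult_ac simp del: of_real_power intro!: Bochner_Integration.integral_cong)
  also have "\<dots> = (LINT x|lborel. h x * (LINT y|lborel. cnj (h y) * of_real (g (x - y))))"
    unfolding H_def fourier_swap[OF A h] inner ..
  finally have eq: "complex_of_real (LINT \<xi>|lborel. (norm (H \<xi>))\<^sup>2 * gam (\<epsilon> * \<xi>)) = \<dots>" .
  have "(\<integral>\<^sup>+\<xi>. ennreal ((norm (H \<xi>))\<^sup>2 * gam (\<epsilon> * \<xi>)) \<partial>lborel)
      = ennreal (LINT \<xi>|lborel. (norm (H \<xi>))\<^sup>2 * gam (\<epsilon> * \<xi>))"
    using int2 by (intro nn_integral_eq_integral) auto
  \<comment> \<open>A non-integrable function has Bochner integral 0, so the norm bound holds in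
    that case as well.\<close>
  also have "\<dots> \<le> ennreal (norm (LINT x|lborel. h x * (LINT y|lborel. cnj (h y) * of_real (g (x - y)))))"
    unfolding eq[symmetric] by (intro ennreal_leI) simp
  also have "\<dots> \<le> (\<integral>\<^sup>+x. ennreal (norm (h x * (LINT y|lborel. cnj (h y) * of_real (g (x - y))))) \<partial>lborel)"
    by (cases "integrable lborel (\<lambda>x. h x * (LINT y|lborel. cnj (h y) * of_real (g (x - y))))")
       (auto simp: not_integrable_integral_eq intro: integral_norm_bound_ennreal)
  also have "\<dots> \<le> (\<integral>\<^sup>+x. \<integral>\<^sup>+y. ennreal (norm (h x) * norm (h y) * g (x - y)) \<partial>lborel \<partial>lborel)"
  proof (intro nn_integral_mono)
    fix x
    have "ennreal (norm (LINT y|lborel. cnj (h y) * of_real (g (x - y))))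
      \<le> (\<integral>\<^sup>+y. ennreal (norm (cnj (h y) * of_real (g (x - y)))) \<partial>lborel)"
      by (cases "integrable lborel (\<lambda>y. cnj (h y) * of_real (g (x - y)))")
         (auto simp: not_integrable_integral_eq intro: integral_norm_bound_ennreal)
    then have "ennreal (norm (h x)) * ennreal (norm (LINT y|lborel. cnj (h y) * of_real (g (x - y))))
      \<le> ennreal (norm (h x)) * (\<integral>\<^sup>+y. ennreal (norm (h y) * g (x - y)) \<partial>lborel)"
      using g0 by (intro mult_left_mono) (auto simp: norm_mult)
    also have "\<dots> = (\<integral>\<^sup>+y. ennreal (norm (h x) * norm (h y) * g (x - y)) \<partial>lborel)"
      using g0 by (subst nn_integral_cmult[symmetric]) (auto simp: mult.assoc simp flip: ennreal_mult)
    finally show "ennreal (norm (h x * (LINT y|lborel. cnj (h y) * of_real (g (x - y))))) \<le> \<dots>"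
      by (simp add: norm_mult ennreal_mult)
  qed
  finally have X: "(\<integral>\<^sup>+\<xi>. ennreal ((norm (H \<xi>))\<^sup>2 * gam (\<epsilon> * \<xi>)) \<partial>lborel) \<le> \<dots>" .
  \<comment> \<open>Schur's test: 2|h(x)||h(y)| <= |h(x)|^2 + |h(y)|^2, and each square is
    integrated against a symmetric Gaussian of mass 1. The factor 2 on both sides is cancelled at
    the end.\<close>
  have "2 * (\<integral>\<^sup>+x. \<integral>\<^sup>+y. ennreal (norm (h x) * norm (h y) * g (x - y)) \<partial>lborel \<partial>lborel)
     = (\<integral>\<^sup>+x. \<integral>\<^sup>+y. ennreal (2 * (norm (h x) * norm (h y) * g (x - y))) \<partial>lborel \<partial>lborel)"
    using g0 by (simp add: ennreal_mult nn_integral_cmult)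
  also have "\<dots> \<le> (\<integral>\<^sup>+x. \<integral>\<^sup>+y. ennreal ((norm (h x))\<^sup>2) * ennreal (g (x - y))
       + ennreal ((norm (h y))\<^sup>2) * ennreal (g (y - x)) \<partial>lborel \<partial>lborel)"
  proof (intro nn_integral_mono)
    fix x y
    have "2 * (norm (h x) * norm (h y) * g (x - y)) = (2 * norm (h x) * norm (h y)) * g (x - y)" by simp
    also have "\<dots> \<le> ((norm (h x))\<^sup>2 + (norm (h y))\<^sup>2) * g (x - y)"
      by (intro mult_right_mono sum_squares_bound g0)
    finally have "ennreal (2 * (norm (h x) * norm (h y) * g (x - y)))
        \<le> ennreal ((norm (h x))\<^sup>2 * g (x - y) + (norm (h y))\<^sup>2 * g (y - x))"
      by (intro ennreal_leI) (simp add: distrib_right gsym[of y x])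
    also have "\<dots> = ennreal ((norm (h x))\<^sup>2) * ennreal (g (x - y)) + ennreal ((norm (h y))\<^sup>2) * ennreal (g (y - x))"
      using g0 by (simp add: ennreal_mult)
    finally show "ennreal (2 * (norm (h x) * norm (h y) * g (x - y))) \<le> \<dots>" .
  qed
  also have "\<dots> = (\<integral>\<^sup>+x. \<integral>\<^sup>+y. ennreal ((norm (h x))\<^sup>2) * ennreal (g (x - y)) \<partial>lborel \<partial>lborel)
     + (\<integral>\<^sup>+x. \<integral>\<^sup>+y. ennreal ((norm (h y))\<^sup>2) * ennreal (g (y - x)) \<partial>lborel \<partial>lborel)"
    by (simp add: nn_integral_add)
  also have "(\<integral>\<^sup>+x. \<integral>\<^sup>+y. ennreal ((norm (h y))\<^sup>2) * ennreal (g (y - x)) \<partial>lborel \<partial>lborel)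
     = (\<integral>\<^sup>+y. \<integral>\<^sup>+x. ennreal ((norm (h y))\<^sup>2) * ennreal (g (y - x)) \<partial>lborel \<partial>lborel)"
    by (rule lborel_pair.Fubini') simp
  also have "(\<integral>\<^sup>+x. \<integral>\<^sup>+y. ennreal ((norm (h x))\<^sup>2) * ennreal (g (x - y)) \<partial>lborel \<partial>lborel) = sqint UNIV h"
    unfolding sqint_def g_def by (simp add: nn_integral_cmult gam_scaled_nn_integral[OF e])
  also have "sqint UNIV h + sqint UNIV h = 2 * sqint UNIV h"
    by (simp add: mult_2)
  finally have "(\<integral>\<^sup>+x. \<integral>\<^sup>+y. ennreal (norm (h x) * norm (h y) * g (x - y)) \<partial>lborel \<partial>lborel) \<le> sqint UNIV h"
    by (subst (asm) ennreal_mult_le_mult_iff) auto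
  with X show ?thesis by (rule order_trans)
qed

lemma plancherel_le:
  assumes h: "integrable lborel h"
  shows "sqint UNIV (\<lambda>\<xi>. LINT x|lborel. h x * ee (\<xi> * x)) \<le> sqint UNIV h"
proof -
  define H where "H = (\<lambda>\<xi>. LINT x|lborel. h x * ee (\<xi> * x))"
  have [measurable]: "h \<in> borel_measurable borel" using h by auto
  have [measurable]: "H \<in> borel_measurable borel" unfolding H_def by measurable
  define F where "F = (\<lambda>n \<xi>. ennreal ((norm (H \<xi>))\<^sup>2 * gam (1 / Suc n * \<xi>)))"
  have lim: "liminf (\<lambda>n. F n \<xi>) = ennreal ((norm (H \<xi>))\<^sup>2)" for \<xi>
  proof (rule lim_imp_Liminf)
    have "(\<lambda>n. 1 / Suc n * \<xi>) \<longlonglongrightarrow> 0 * \<xi>"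
      by (intro tendsto_mult_right LIMSEQ_Suc[OF lim_1_over_n])
    then have "(\<lambda>n. gam (1 / Suc n * \<xi>)) \<longlonglongrightarrow> gam (0 * \<xi>)"
      by (intro continuous_on_tendsto_compose[of UNIV gam]) (auto intro!: continuous_intros)
    then have "(\<lambda>n. (norm (H \<xi>))\<^sup>2 * gam (1 / Suc n * \<xi>)) \<longlonglongrightarrow> (norm (H \<xi>))\<^sup>2 * 1"
      by (intro tendsto_mult_left) simp
    then show "(\<lambda>n. F n \<xi>) \<longlonglongrightarrow> ennreal ((norm (H \<xi>))\<^sup>2)"
      unfolding F_def by (intro tendsto_ennrealI) simp
  qed simp
  have "sqint UNIV H = (\<integral>\<^sup>+\<xi>. liminf (\<lambda>n. F n \<xi>) \<partial>lborel)"
    unfolding sqint_def lim by simp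
  also have "\<dots> \<le> liminf (\<lambda>n. \<integral>\<^sup>+\<xi>. F n \<xi> \<partial>lborel)"
    by (intro nn_integral_liminf) (simp add: F_def)
  also have "\<dots> \<le> liminf (\<lambda>n::nat. sqint UNIV h)"
    unfolding F_def H_def
    by (intro Liminf_mono always_eventually allI damped_plancherel_le h) auto
  also have "\<dots> = sqint UNIV h" by (simp add: Liminf_const)
  finally show ?thesis unfolding H_def .
qed

text \<open>The side of c on which the symbol lives: to the right of a left end point for \<kappa> =
  1, to the left of a right end point for \<kappa> = -1.\<close>

definition half_iv :: "real \<Rightarrow> real \<Rightarrow> real \<Rightarrow> real set" where
  "half_iv \<kappa> c l = {\<xi>. 0 < \<kappa> * (\<xi> - c) \<and> \<kappa> * (\<xi> - c) < l}"

lemma half_iv_borel [measurable]: "half_iv \<kappa> c l \<in> sets borel"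
  unfolding half_iv_def by measurable

lemma half_iv_mono: "l \<le> l' \<Longrightarrow> half_iv \<kappa> c l \<subseteq> half_iv \<kappa> c l'"
  by (auto simp: half_iv_def)

lemma half_iv_cases:
  "\<kappa> = 1 \<Longrightarrow> half_iv \<kappa> c l = {c<..<c + l}" "\<kappa> = - 1 \<Longrightarrow> half_iv \<kappa> c l = {c - l<..<c}"
  by (auto simp: half_iv_def)

lemma emeasure_half_iv: "\<kappa> \<in> {1, - 1} \<Longrightarrow> l \<ge> 0 \<Longrightarrow> emeasure lborel (half_iv \<kappa> c l) = ennreal l"
  by (auto simp: half_iv_cases)

lemma increment_le_nn_integral:
  fixes F :: "real \<Rightarrow> complex"
  assumes D: "\<And>x. (F has_vector_derivative F' x) (at x)" and c: "continuous_on UNIV F'"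
  shows "ennreal (norm (F b - F a)) \<le> (\<integral>\<^sup>+x\<in>{min a b..max a b}. ennreal (norm (F' x)) \<partial>lborel)"
proof -
  have *: "ennreal (norm (F b - F a)) \<le> (\<integral>\<^sup>+x\<in>{a..b}. ennreal (norm (F' x)) \<partial>lborel)" if "a \<le> b" for a b
  proof -
    have "has_bochner_integral lborel (\<lambda>x. indicator {a..b} x *\<^sub>R F' x) (F b - F a)"
      using that D c
      by (intro has_bochner_integral_FTC_Icc) (auto intro: has_vector_derivative_at_within continuous_on_subset)
    then have i: "integrable lborel (\<lambda>x. indicator {a..b} x *\<^sub>R F' x)"
      and e: "(LINT x|lborel. indicator {a..b} x *\<^sub>R F' x) = F b - F a"
      by (auto simp: has_bochner_integral_iff)
    have "ennreal (norm (F b - F a)) \<le> (\<integral>\<^sup>+x. ennreal (norm (indicator {a..b} x *\<^sub>R F' x)) \<partial>lborel)"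
      unfolding e[symmetric] using i by (rule integral_norm_bound_ennreal)
    also have "\<dots> = (\<integral>\<^sup>+x\<in>{a..b}. ennreal (norm (F' x)) \<partial>lborel)"
      by (intro nn_integral_cong) (auto split: split_indicator)
    finally show ?thesis .
  qed
  show ?thesis
    using *[of a b] *[of b a] by (cases "a \<le> b") (auto simp: min_def max_def norm_minus_commute)
qed

text \<open>The inequality |F(v)|^2 <= 2|F(\<xi>)|^2 + 2|F(v) - F(\<xi>)|^2 is integrated over \<xi>
  in the adjacent interval of length \<delta>; Cauchy-Schwarz bounds the increment by \<delta> times
  the square integral of F'.\<close>

lemma point_value_le_sqint:
  fixes F :: "real \<Rightarrow> complex"
  assumes D: "\<And>x. (F has_vector_derivative F' x) (at x)" and c: "continuous_on UNIV F'"
    and k: "\<kappa> \<in> {1, - 1}" and d: "\<delta> > 0"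
  shows "ennreal (\<delta> * (norm (F v))\<^sup>2) \<le> 2 * sqint (half_iv \<kappa> v \<delta>) F + 2 * ennreal (\<delta>\<^sup>2) * sqint (half_iv \<kappa> v \<delta>) F'"
proof -
  let ?I = "half_iv \<kappa> v \<delta>"
  have "continuous_on UNIV F"
    using D by (meson continuous_at_imp_continuous_on has_vector_derivative_continuous)
  then have [measurable]: "F \<in> borel_measurable borel" "F' \<in> borel_measurable borel"
    using c by (auto intro: borel_measurable_continuous_onI)
  define X where "X = (\<integral>\<^sup>+x\<in>?I. ennreal (norm (F' x)) \<partial>lborel)"
  have pt: "ennreal ((norm (F v))\<^sup>2) \<le> 2 * ennreal ((norm (F \<xi>))\<^sup>2) + 2 * X\<^sup>2" if "\<xi> \<in> ?I" for \<xi>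
  proof -
    \<comment> \<open>The open interval does not contain v, so the end points of the segment from v
      to \<xi> are discarded as null sets.\<close>
    have "AE x in lborel. x \<noteq> v" "AE x in lborel. x \<noteq> \<xi>"
      by (rule AE_lborel_singleton)+
    then have "(\<integral>\<^sup>+x\<in>{min \<xi> v..max \<xi> v}. ennreal (norm (F' x)) \<partial>lborel) \<le> X"
      unfolding X_def using that k
      by (intro nn_integral_mono_AE) (auto elim!: eventually_elim2 simp: half_iv_def split: split_indicator)
    then have 1: "ennreal (norm (F v - F \<xi>)) \<le> X"
      using increment_le_nn_integral[OF D c, of v \<xi>] by (metis order_trans)
    have "ennreal ((norm (F v))\<^sup>2) \<le> ennreal (2 * (norm (F \<xi>))\<^sup>2 + 2 * (norm (F v - F \<xi>))\<^sup>2)"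
      using norm_add_sq_le[of "F \<xi>" "F v - F \<xi>"] by (intro ennreal_leI) simp
    also have "\<dots> = 2 * ennreal ((norm (F \<xi>))\<^sup>2) + 2 * (ennreal (norm (F v - F \<xi>)))\<^sup>2"
      by (simp add: ennreal_mult ennreal_power)
    also have "\<dots> \<le> 2 * ennreal ((norm (F \<xi>))\<^sup>2) + 2 * X\<^sup>2"
      using 1 by (intro add_left_mono mult_left_mono power_mono) auto
    finally show ?thesis .
  qed
  have "X\<^sup>2 \<le> emeasure lborel ?I * sqint ?I F'"
    unfolding X_def by (rule sqint_L1) auto
  also have "emeasure lborel ?I = ennreal \<delta>"
    using k d by (intro emeasure_half_iv) auto
  finally have X2: "X\<^sup>2 \<le> ennreal \<delta> * sqint ?I F'" .
  have "ennreal (\<delta> * (norm (F v))\<^sup>2) = (\<integral>\<^sup>+\<xi>. ennreal ((norm (F v))\<^sup>2) * indicator ?I \<xi> \<partial>lborel)"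
    using emeasure_half_iv[OF k, of \<delta> v] d
    by (subst nn_integral_cmult) (auto simp: ennreal_mult mult.commute)
  also have "\<dots> \<le> (\<integral>\<^sup>+\<xi>. 2 * (ennreal ((norm (F \<xi>))\<^sup>2) * indicator ?I \<xi>) + 2 * X\<^sup>2 * indicator ?I \<xi> \<partial>lborel)"
    using pt by (intro nn_integral_mono) (auto split: split_indicator)
  also have "\<dots> = 2 * sqint ?I F + 2 * X\<^sup>2 * ennreal \<delta>"
    using emeasure_half_iv[OF k, of \<delta> v] d
    by (simp add: nn_integral_add nn_integral_cmult sqint_def)
  also have "\<dots> \<le> 2 * sqint ?I F + 2 * (ennreal \<delta> * sqint ?I F') * ennreal \<delta>"
    by (intro add_left_mono mult_left_mono mult_right_mono X2) auto
  also have "\<dots> = 2 * sqint ?I F + 2 * ennreal (\<delta>\<^sup>2) * sqint ?I F'"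
    using d by (simp add: power2_eq_square ennreal_mult mult_ac)
  finally show ?thesis .
qed

lemma sum_sqint_disjoint_le:
  assumes "finite M" "disjoint_family_on I M"
    and [measurable]: "h \<in> borel_measurable borel" "\<And>m. m \<in> M \<Longrightarrow> I m \<in> sets borel"
  shows "(\<Sum>m\<in>M. sqint (I m) h) \<le> sqint UNIV h"
proof -
  have "(\<Sum>m\<in>M. sqint (I m) h) = (\<integral>\<^sup>+t. (\<Sum>m\<in>M. ennreal ((norm (h t))\<^sup>2) * indicator (I m) t) \<partial>lborel)"
    unfolding sqint_def by (subst nn_integral_sum) auto
  also have "\<dots> \<le> (\<integral>\<^sup>+t. ennreal ((norm (h t))\<^sup>2) * 1 \<partial>lborel)"
  proof (rule nn_integral_mono)
    fix t
    have "(\<Sum>m\<in>M. indicator (I m) t :: ennreal) = indicator (\<Union>m\<in>M. I m) t"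
      using assms(1,2) by (rule indicator_UN_disjoint[symmetric])
    also have "\<dots> \<le> 1" by (auto split: split_indicator)
    finally show "(\<Sum>m\<in>M. ennreal ((norm (h t))\<^sup>2) * indicator (I m) t) \<le> ennreal ((norm (h t))\<^sup>2) * 1"
      unfolding sum_distrib_left[symmetric] by (intro mult_left_mono) auto
  qed
  finally show ?thesis by (simp add: sqint_def)
qed

lemma continuous_on_fourier_integral:
  assumes "integrable lborel h"
  shows "continuous_on UNIV (\<lambda>v. LINT t|lborel. h t * ee (v * t))"
  unfolding continuous_on_sequentially comp_def
proof (intro allI ballI impI, elim conjE)
  fix X :: "nat \<Rightarrow> real" and v assume X: "X \<longlonglongrightarrow> v"
  show "(\<lambda>n. LINT t|lborel. h t * ee (X n * t)) \<longlonglongrightarrow> (LINT t|lborel. h t * ee (v * t))"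
  proof (rule integral_dominated_convergence[where w="\<lambda>t. norm (h t)"])
    have "(\<lambda>n. ee (X n * t)) \<longlonglongrightarrow> ee (v * t)" for t
      by (rule continuous_on_tendsto_compose[of UNIV ee])
         (use X in \<open>auto intro!: continuous_intros tendsto_mult_right\<close>)
    then show "AE t in lborel. (\<lambda>n. h t * ee (X n * t)) \<longlonglongrightarrow> h t * ee (v * t)"
      by (intro AE_I2 tendsto_mult_left)
  qed (use assms in \<open>auto simp: norm_mult\<close>)
qed

text \<open>Gallagher's form of the large sieve: a pointwise value is dominated by averages of the
  function and its derivative over an adjacent interval, and these intervals are disjoint.\<close>

lemma large_sieve_origin:
  assumes M: "finite M" and l: "\<And>m. m \<in> M \<Longrightarrow> l m > 0" and k: "\<kappa> \<in> {1, - 1}" and R: "R > 0"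
    and disj: "disjoint_family_on (\<lambda>m. half_iv \<kappa> (c m) (l m)) M"
    and hm [measurable]: "h \<in> borel_measurable borel" and supp: "\<And>t. t \<notin> {0..R} \<Longrightarrow> h t = 0"
  shows "(\<Sum>m\<in>M. ennreal (min (l m) (1 / R) * (norm (LINT t|lborel. h t * ee (c m * t)))\<^sup>2))
    \<le> 100 * sqint {0..R} h"
proof (cases "sqint {0..R} h < \<infinity>")
  case False
  then have "100 * sqint {0..R} h = \<infinity>" by (simp add: less_top[symmetric] ennreal_mult_eq_top_iff)
  then show ?thesis by simp
next
  case True
  define h' where "h' t = of_real t * h t" for t
  have [measurable]: "h' \<in> borel_measurable borel" unfolding h'_def by measurable
  have norm_h': "norm (h' t) \<le> R * norm (h t)" for t
    using supp[of t] R by (cases "t \<in> {0..R}") (auto simp: h'_def norm_mult intro!: mult_right_mono)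
  have h: "integrable lborel h"
    by (rule integrable_of_sqint[OF hm True]) (use supp in auto)
  have h': "integrable lborel h'"
    by (rule Bochner_Integration.integrable_bound[OF integrable_mult_right[OF integrable_norm[OF h], of R]])
       (use norm_h' R in \<open>auto intro!: AE_I2\<close>)
  define F F' where "F v = (LINT t|lborel. h t * ee (v * t))"
    and "F' v = 2 * pi * \<i> * (LINT t|lborel. h' t * ee (v * t))" for v
  have D: "(F has_vector_derivative F' x) (at x)" for x
    using fourier_integral_deriv[OF h, of x] h' unfolding F_def[abs_def] F'_def h'_def by simp
  have c': "continuous_on UNIV F'"
    unfolding F'_def by (intro continuous_on_mult_left continuous_on_fourier_integral h')
  have [measurable]: "F \<in> borel_measurable borel" "F' \<in> borel_measurable borel"
    unfolding F_def F'_def by measurable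
  have sF: "sqint UNIV F \<le> sqint {0..R} h"
    using plancherel_le[OF h] sqint_UNIV[of "{0..R}" h] supp unfolding F_def by simp
  have "sqint UNIV F' = ennreal ((2 * pi)\<^sup>2) * sqint UNIV (\<lambda>v. LINT t|lborel. h' t * ee (v * t))"
    unfolding F'_def by (subst sqint_cmult) (simp_all add: norm_mult)
  also have "\<dots> \<le> ennreal ((2 * pi)\<^sup>2) * sqint UNIV h'"
    by (intro mult_left_mono plancherel_le h') auto
  also have "sqint UNIV h' \<le> sqint UNIV (\<lambda>t. of_real R * h t)"
    using norm_h' R by (intro sqint_mono) (auto simp: norm_mult)
  also have "sqint UNIV (\<lambda>t. of_real R * h t) = ennreal (R\<^sup>2) * sqint {0..R} h"
    using sqint_UNIV[of "{0..R}" h] supp by (subst sqint_cmult) simp_all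
  finally have sF': "sqint UNIV F' \<le> ennreal ((2 * pi)\<^sup>2) * (ennreal (R\<^sup>2) * sqint {0..R} h)"
    by (simp add: mult_left_mono)
  \<comment> \<open>Shrinking the intervals to length at most 1/R keeps them disjoint and
    compensates the factor R that F' costs, since differentiation multiplies h by t with 0 <= t <=
    R.\<close>
  let ?d = "\<lambda>m. min (l m) (1 / R)"
  have dpos: "?d m > 0" "?d m \<le> 1 / R" if "m \<in> M" for m using l[OF that] R by auto
  have disj': "disjoint_family_on (\<lambda>m. half_iv \<kappa> (c m) (?d m)) M"
    using disj half_iv_mono[OF min.cobounded1] unfolding disjoint_family_on_def by blast
  have "(\<Sum>m\<in>M. ennreal (?d m * (norm (F (c m)))\<^sup>2))
    \<le> (\<Sum>m\<in>M. 2 * sqint (half_iv \<kappa> (c m) (?d m)) F + 2 * ennreal ((1 / R)\<^sup>2) * sqint (half_iv \<kappa> (c m) (?d m)) F')"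
  proof (rule sum_mono)
    fix m assume m: "m \<in> M"
    have "ennreal (?d m * (norm (F (c m)))\<^sup>2) \<le> 2 * sqint (half_iv \<kappa> (c m) (?d m)) F
        + 2 * ennreal ((?d m)\<^sup>2) * sqint (half_iv \<kappa> (c m) (?d m)) F'"
      by (rule point_value_le_sqint[OF D c' k dpos(1)[OF m]])
    also have "\<dots> \<le> 2 * sqint (half_iv \<kappa> (c m) (?d m)) F
        + 2 * ennreal ((1 / R)\<^sup>2) * sqint (half_iv \<kappa> (c m) (?d m)) F'"
      using dpos[OF m] by (intro add_left_mono mult_left_mono mult_right_mono ennreal_leI power_mono) auto
    finally show "ennreal (?d m * (norm (F (c m)))\<^sup>2) \<le> \<dots>" .
  qed
  also have "\<dots> = 2 * (\<Sum>m\<in>M. sqint (half_iv \<kappa> (c m) (?d m)) F)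
      + 2 * ennreal ((1 / R)\<^sup>2) * (\<Sum>m\<in>M. sqint (half_iv \<kappa> (c m) (?d m)) F')"
    by (simp add: sum.distrib sum_distrib_left)
  also have "\<dots> \<le> 2 * sqint UNIV F + 2 * ennreal ((1 / R)\<^sup>2) * sqint UNIV F'"
    by (intro add_mono mult_left_mono sum_sqint_disjoint_le M disj') auto
  also have "\<dots> \<le> 2 * sqint {0..R} h + 2 * ennreal ((1 / R)\<^sup>2) * (ennreal ((2 * pi)\<^sup>2) * (ennreal (R\<^sup>2) * sqint {0..R} h))"
    by (intro add_mono mult_left_mono sF sF') auto
  also have "\<dots> = (2 + 2 * ennreal ((1 / R)\<^sup>2 * (2 * pi)\<^sup>2 * R\<^sup>2)) * sqint {0..R} h"
    by (simp add: ennreal_mult distrib_right mult.assoc)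
  also have "(1 / R)\<^sup>2 * (2 * pi)\<^sup>2 * R\<^sup>2 = (2 * pi)\<^sup>2"
    using R by (simp add: power_divide)
  \<comment> \<open>The powers of R have cancelled, and 2 + 8 pi^2 < 100.\<close>
  also have "(2 + 2 * ennreal ((2 * pi)\<^sup>2)) * sqint {0..R} h \<le> 100 * sqint {0..R} h"
  proof (intro mult_right_mono)
    have "pi * pi \<le> 3.5 * 3.5" using pi_less_4 pi_approx by (intro mult_mono) auto
    then have "2 + 2 * (2 * pi)\<^sup>2 \<le> 100" by (simp add: power2_eq_square)
    then have "ennreal (2 + 2 * (2 * pi)\<^sup>2) \<le> ennreal 100" by (rule ennreal_leI)
    then show "2 + 2 * ennreal ((2 * pi)\<^sup>2) \<le> 100" by (simp add: ennreal_mult)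
  qed auto
  finally show ?thesis by (simp add: F_def)
qed

text \<open>Translating the support to [0, R] changes the integrals only by phases. The exponentials
  carry - c, so the frequencies are reflected and the adjacent intervals change side: hence -
  \<kappa> in the proof.\<close>

lemma large_sieve:
  assumes M: "finite M" and l: "\<And>m. m \<in> M \<Longrightarrow> l m > 0" and k: "\<kappa> \<in> {1, - 1}" and R: "R > 0"
    and disj: "disjoint_family_on (\<lambda>m. half_iv \<kappa> (c m) (l m)) M"
    and hm [measurable]: "h \<in> borel_measurable borel" and supp: "\<And>t. t \<notin> {\<alpha>..\<alpha> + R} \<Longrightarrow> h t = 0"
  shows "(\<Sum>m\<in>M. ennreal (min (l m) (1 / R) * (norm (LINT t|lborel. ee (- c m * t) * h t))\<^sup>2))
    \<le> 100 * sqint {\<alpha>..\<alpha> + R} h"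
proof -
  define g where "g t = h (\<alpha> + 1 * t)" for t
  have [measurable]: "g \<in> borel_measurable borel" unfolding g_def by measurable
  have disj': "disjoint_family_on (\<lambda>m. half_iv (- \<kappa>) (- c m) (l m)) M"
    unfolding disjoint_family_on_def
  proof (intro ballI impI equals0I)
    fix m n x assume mn: "m \<in> M" "n \<in> M" "m \<noteq> n"
      and x: "x \<in> half_iv (- \<kappa>) (- c m) (l m) \<inter> half_iv (- \<kappa>) (- c n) (l n)"
    have "- x \<in> half_iv \<kappa> (c m) (l m) \<inter> half_iv \<kappa> (c n) (l n)"
      using x by (auto simp: half_iv_def algebra_simps)
    then show False using disj mn unfolding disjoint_family_on_def by blast
  qed
  have ee_shift: "ee (- (c m * (\<alpha> + t))) = ee (- (c m * \<alpha>)) * ee (- (c m * t))" for m t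
    by (simp add: distrib_left flip: ee_add)
  have 1: "norm (LINT t|lborel. ee (- c m * t) * h t) = norm (LINT t|lborel. g t * ee (- c m * t))" for m
  proof -
    have "(LINT t|lborel. ee (- c m * t) * h t) = \<bar>1\<bar> *\<^sub>R (LINT t|lborel. ee (- c m * (\<alpha> + 1 * t)) * h (\<alpha> + 1 * t))"
      by (rule lborel_integral_real_affine) auto
    also have "\<dots> = (LINT t|lborel. ee (- c m * \<alpha>) * (g t * ee (- c m * t)))"
      by (simp add: g_def ee_shift mult_ac)
    also have "norm \<dots> = norm (LINT t|lborel. g t * ee (- c m * t))"
      by (simp only: integral_mult_right_zero norm_mult norm_ee mult_1)
    finally show ?thesis .
  qed
  have "sqint {0..R} g = (\<integral>\<^sup>+t. ennreal ((norm (h (\<alpha> + 1 * t)))\<^sup>2) * indicator {\<alpha>..\<alpha>+R} (\<alpha> + 1 * t) \<partial>lborel)"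
    unfolding sqint_def g_def by (intro nn_integral_cong) (auto split: split_indicator)
  also have "\<dots> = sqint {\<alpha>..\<alpha> + R} h"
    unfolding sqint_def
    by (subst nn_integral_real_affine[where c=1 and t=\<alpha> and f="\<lambda>t. ennreal ((norm (h t))\<^sup>2) * indicator {\<alpha>..\<alpha>+R} t"]) auto
  finally show ?thesis
    unfolding 1 using large_sieve_origin[OF M l _ R disj', of g] k supp by (auto simp: g_def)
qed

section \<open>Polynomials of bounded degree\<close>

lemma polys_less_iff: "p \<in> polys_less i \<longleftrightarrow> (\<forall>n\<ge>i. coeff p n = 0)"
proof
  assume "p \<in> polys_less i"
  then show "\<forall>n\<ge>i. coeff p n = 0"
    by (auto simp: polys_less_def intro: coeff_eq_0)
next
  assume *: "\<forall>n\<ge>i. coeff p n = 0"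
  show "p \<in> polys_less i"
  proof (cases "p = 0")
    case False
    then have "coeff p (degree p) \<noteq> 0" by simp
    with * have "degree p < i" by (meson not_le)
    then show ?thesis by (simp add: polys_less_def)
  qed (simp add: polys_less_def)
qed

lemma polys_less_0 [simp]: "0 \<in> polys_less i"
  and polys_less_add: "p \<in> polys_less i \<Longrightarrow> q \<in> polys_less i \<Longrightarrow> p + q \<in> polys_less i"
  and polys_less_diff: "p \<in> polys_less i \<Longrightarrow> q \<in> polys_less i \<Longrightarrow> p - q \<in> polys_less i"
  and polys_less_smult: "p \<in> polys_less i \<Longrightarrow> smult a p \<in> polys_less i"
  and polys_less_mono: "p \<in> polys_less i \<Longrightarrow> i \<le> j \<Longrightarrow> p \<in> polys_less j"
  by (auto simp: polys_less_iff)

lemma polys_less_zero_iff [simp]: "p \<in> polys_less 0 \<longleftrightarrow> p = 0"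
  by (auto simp: polys_less_def)

lemma polys_less_degree: "p \<in> polys_less i \<Longrightarrow> i > 0 \<Longrightarrow> degree p < i"
  by (auto simp: polys_less_def)

lemma polys_less_sum: "(\<And>j. j \<in> A \<Longrightarrow> f j \<in> polys_less i) \<Longrightarrow> sum f A \<in> polys_less i"
  by (auto simp: polys_less_iff coeff_sum)

lemma measurable_poly_of_real [measurable]:
  "(\<lambda>t. poly p (complex_of_real t)) \<in> borel_measurable borel"
  by (intro borel_measurable_continuous_onI continuous_intros)

lemma poly_lagrange:
  fixes p :: "complex poly"
  assumes p: "p \<in> polys_less n" and s: "inj_on s {..<n}"
  shows "poly p z = (\<Sum>j<n. poly p (s j) * (\<Prod>k\<in>{..<n} - {j}. (z - s k) / (s j - s k)))"
proof (cases "n = 0")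
  case True
  then show ?thesis using p by simp
next
  case n: False
  define L where "L j = (\<Prod>k\<in>{..<n} - {j}. smult (1 / (s j - s k)) [:- s k, 1:])" for j
  define q where "q = (\<Sum>j<n. smult (poly p (s j)) (L j))"
  have polyL: "poly (L j) z = (\<Prod>k\<in>{..<n} - {j}. (z - s k) / (s j - s k))" for j z
    unfolding L_def poly_prod by (intro prod.cong) (auto simp: diff_divide_distrib)
  have degL: "degree (L j) < n" if "j < n" for j
  proof -
    have "degree (L j) \<le> (\<Sum>k\<in>{..<n} - {j}. degree (smult (1 / (s j - s k)) [:- s k, 1:]))"
      unfolding L_def by (rule order_trans[OF degree_prod_sum_le]) auto
    also have "\<dots> \<le> (\<Sum>k\<in>{..<n} - {j}. 1)"
      by (intro sum_mono) auto
    also have "\<dots> < n" using that by simp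
    finally show ?thesis .
  qed
  have "L j \<in> polys_less n" if "j < n" for j
    using degL[OF that] by (simp add: polys_less_def)
  then have "q \<in> polys_less n"
    unfolding q_def by (intro polys_less_sum polys_less_smult) auto
  have qs: "poly q (s m) = poly p (s m)" if "m < n" for m
  proof -
    have "poly (L j) (s m) = (if j = m then 1 else 0)" if "j < n" for j
    proof (cases "j = m")
      case True
      have "s m - s k \<noteq> 0" if "k \<in> {..<n} - {m}" for k
        using s that \<open>m < n\<close> by (auto simp: inj_on_def)
      then show ?thesis unfolding polyL using True
        by (auto intro!: prod.neutral)
    next
      case False
      then show ?thesis unfolding polyL using \<open>m < n\<close> by (auto intro!: prod_zero)
    qed
    then have "poly q (s m) = (\<Sum>j<n. if j = m then poly p (s j) else 0)"
      unfolding q_def poly_sum by (intro sum.cong) auto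
    then show ?thesis using that by simp
  qed
  have "p = q"
  proof (rule poly_eqI_degree[where A="s ` {..<n}"])
    show "card (s ` {..<n}) > degree p" "card (s ` {..<n}) > degree q"
      using p \<open>q \<in> polys_less n\<close> n by (auto simp: card_image[OF s] polys_less_degree)
  qed (use qs in auto)
  then have "poly p z = poly q z" by simp
  then show ?thesis by (simp add: q_def poly_sum polyL)
qed

text \<open>Every interval of length comparable to \<open>\<sigma>\<close> contains a point where the polynomial is at most its
  quadratic mean; interpolation at well separated points of this kind bounds it everywhere.\<close>

lemma poly_pointwise_bound:
  "\<exists>C>0. \<forall>p\<in>polys_less i. \<forall>x \<sigma> t N. \<sigma> > 0 \<and> N \<ge> 0 \<and>
     sqint {x - \<sigma>..x + \<sigma>} (\<lambda>t. poly p (of_real t)) \<le> ennreal N \<longrightarrow>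
     (norm (poly p (of_real t)))\<^sup>2 \<le> C * (1 + \<bar>t - x\<bar> / \<sigma>) ^ (2 * (i - 1)) * N / \<sigma>"
proof (cases "i = 0")
  case True
  then show ?thesis by (auto intro!: exI[of _ 1])
next
  case i: False
  \<comment> \<open>Interpolation has i terms, each at most
    \<open>sqrt (N / d) * Y ^ (i - 1)\<close>. Squaring gives i^2 N/d = 2 i^3 N/\<sigma>, and Y
    contributes the powers of 2 i.\<close>
  define C where "C = 2 * real i ^ 3 * (2 * real i) ^ (2 * (i - 1))"
  have "(norm (poly p (of_real t)))\<^sup>2 \<le> C * (1 + \<bar>t - x\<bar> / \<sigma>) ^ (2 * (i - 1)) * N / \<sigma>"
    if p: "p \<in> polys_less i" and sg: "\<sigma> > 0" and N: "N \<ge> 0"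
      and le: "sqint {x - \<sigma>..x + \<sigma>} (\<lambda>t. poly p (of_real t)) \<le> ennreal N" for p x \<sigma> t N
  proof -
    \<comment> \<open>With this d, i cells of length d separated by gaps of length d fit into
      [x, x + \<sigma>]; one node is taken in each cell, so distinct nodes are at least d
      apart.\<close>
    define d where "d = \<sigma> / (2 * i)"
    have d: "d > 0" using sg i by (simp add: d_def)
    have di: "2 * i * d = \<sigma>" using i by (simp add: d_def)
    have "\<exists>s\<in>{x + 2 * j * d..x + (2 * j + 1) * d}. (norm (poly p (of_real s)))\<^sup>2 \<le> N / d" if j: "j < i" for j
    proof -
      let ?J = "{x + 2 * real j * d..x + (2 * real j + 1) * d}"
      have "\<exists>s\<in>?J. \<forall>y\<in>?J. norm (poly p (of_real s)) \<le> norm (poly p (of_real y))"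
        using d by (intro continuous_attains_inf) (auto intro!: continuous_intros mult_right_mono)
      then obtain s where s: "s \<in> ?J" "\<And>y. y \<in> ?J \<Longrightarrow> norm (poly p (of_real s)) \<le> norm (poly p (of_real y))"
        by blast
      have "(2 * real j + 1) * d \<le> 2 * i * d" using j d by (intro mult_right_mono) auto
      moreover have "0 \<le> 2 * real j * d" using d by simp
      ultimately have sub: "?J \<subseteq> {x - \<sigma>..x + \<sigma>}" using sg
        unfolding di by (intro subsetI) (simp only: atLeastAtMost_iff, linarith)
      have "ennreal ((norm (poly p (of_real s)))\<^sup>2 * d)
          = (\<integral>\<^sup>+y. ennreal ((norm (poly p (of_real s)))\<^sup>2) * indicator ?J y \<partial>lborel)"
        using d by (subst nn_integral_cmult) (auto simp: ennreal_mult algebra_simps)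
      also have "\<dots> \<le> sqint {x - \<sigma>..x + \<sigma>} (\<lambda>t. poly p (of_real t))"
        unfolding sqint_def using s(2) sub
        by (intro nn_integral_mono) (auto split: split_indicator intro!: ennreal_leI power_mono)
      also note le
      finally have "(norm (poly p (of_real s)))\<^sup>2 * d \<le> N" using N by (simp add: ennreal_le_iff)
      then have "(norm (poly p (of_real s)))\<^sup>2 \<le> N / d" using d by (simp add: field_simps)
      then show ?thesis using s(1) by blast
    qed
    then have "\<forall>j. \<exists>s. j < i \<longrightarrow> s \<in> {x + 2 * real j * d..x + (2 * real j + 1) * d} \<and> (norm (poly p (of_real s)))\<^sup>2 \<le> N / d"
      by blast
    then obtain s where s: "\<And>j. j < i \<Longrightarrow> s j \<in> {x + 2 * real j * d..x + (2 * real j + 1) * d}"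
      "\<And>j. j < i \<Longrightarrow> (norm (poly p (of_real (s j))))\<^sup>2 \<le> N / d"
      unfolding choice_iff by blast
    have sep': "s k - s j \<ge> d" if "j < k" "k < i" for j k
    proof -
      have "(2 * real j + 2) * d \<le> 2 * real k * d" using that d by (intro mult_right_mono) auto
      moreover have "s j \<le> x + (2 * real j + 1) * d" "s k \<ge> x + 2 * real k * d" using s(1)[of j] s(1)[of k] that by auto
      ultimately show ?thesis by (simp add: algebra_simps)
    qed
    have sep: "\<bar>s j - s k\<bar> \<ge> d" if "j < i" "k < i" "j \<noteq> k" for j k
      using sep'[of j k] sep'[of k j] that by (cases "j < k") auto
    define Y where "Y = 2 * real i * (1 + \<bar>t - x\<bar> / \<sigma>)"
    have Y: "Y \<ge> 0" using sg by (simp add: Y_def)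
    have fac: "norm ((complex_of_real t - of_real (s k)) / (of_real (s j) - of_real (s k))) \<le> Y"
      if "j < i" "k < i" "j \<noteq> k" for j k
    proof -
      have "(2 * real k + 1) * d \<le> 2 * i * d" using that d by (intro mult_right_mono) auto
      moreover have "0 \<le> 2 * real k * d" using d by simp
      moreover have "x + 2 * real k * d \<le> s k" "s k \<le> x + (2 * real k + 1) * d"
        using s(1)[OF that(2)] by auto
      ultimately have "\<bar>s k - x\<bar> \<le> \<sigma>" using sg unfolding di abs_le_iff by linarith
      then have "\<bar>t - s k\<bar> \<le> \<bar>t - x\<bar> + \<sigma>" by linarith
      then have "\<bar>t - s k\<bar> / \<bar>s j - s k\<bar> \<le> (\<bar>t - x\<bar> + \<sigma>) / d"
        using sep[OF that] d by (intro frac_le) auto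
      also have "\<dots> = Y" using sg i by (simp add: Y_def d_def field_simps)
      finally show ?thesis by (simp add: norm_divide flip: of_real_diff)
    qed
    have pt: "norm (poly p (of_real (s j)) * (\<Prod>k\<in>{..<i} - {j}. (of_real t - of_real (s k)) / (of_real (s j) - of_real (s k))))
      \<le> sqrt (N / d) * Y ^ (i - 1)" if "j < i" for j
      unfolding norm_mult
    proof (rule mult_mono)
      show "norm (poly p (of_real (s j))) \<le> sqrt (N / d)"
        using s(2)[OF that] by (simp add: real_le_rsqrt)
      have "norm (\<Prod>k\<in>{..<i} - {j}. (complex_of_real t - of_real (s k)) / (of_real (s j) - of_real (s k))) \<le> (\<Prod>k\<in>{..<i} - {j}. Y)"
        unfolding prod_norm[symmetric] using that by (intro prod_mono conjI norm_ge_zero fac) auto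
      then show "norm (\<Prod>k\<in>{..<i} - {j}. (complex_of_real t - of_real (s k)) / (of_real (s j) - of_real (s k))) \<le> Y ^ (i - 1)"
        using that by simp
    qed (use N d in auto)
    have "inj_on (\<lambda>j. complex_of_real (s j)) {..<i}"
      using sep d by (intro inj_onI) fastforce
    from poly_lagrange[OF p this, of "of_real t"]
    have "norm (poly p (of_real t)) \<le> (\<Sum>j<i. sqrt (N / d) * Y ^ (i - 1))"
      by (simp only:) (intro order_trans[OF norm_sum] sum_mono pt, simp)
    then have "norm (poly p (of_real t)) \<le> i * (sqrt (N / d) * Y ^ (i - 1))" by simp
    then have "(norm (poly p (of_real t)))\<^sup>2 \<le> (i * (sqrt (N / d) * Y ^ (i - 1)))\<^sup>2"
      by (intro power_mono) auto
    also have "\<dots> = (real i)\<^sup>2 * (N / d) * Y ^ (2 * (i - 1))"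
      using N d by (simp add: power_mult_distrib real_sqrt_pow2 power_even_eq)
    also have "\<dots> = C * (1 + \<bar>t - x\<bar> / \<sigma>) ^ (2 * (i - 1)) * N / \<sigma>"
      using sg i unfolding C_def Y_def d_def power_mult_distrib
      by (simp add: power2_eq_square power3_eq_cube)
    finally show ?thesis .
  qed
  moreover have "C > 0" using i by (simp add: C_def)
  ultimately show ?thesis by blast
qed

section \<open>Iterated antiderivatives\<close>

text \<open>A tower in which each entry is the derivative of the preceding one, up to order r;
  entries beyond r are unconstrained. Naming the tower avoids iterated derivative operators.\<close>

definition chain :: "nat \<Rightarrow> (nat \<Rightarrow> real \<Rightarrow> complex) \<Rightarrow> bool" where
  "chain r U \<longleftrightarrow> (\<forall>j<r. \<forall>x. (U j has_vector_derivative U (Suc j) x) (at x))"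

lemma chain_Suc_iff:
  "chain (Suc r) U \<longleftrightarrow> (\<forall>x. (U 0 has_vector_derivative U 1 x) (at x)) \<and> chain r (\<lambda>j. U (Suc j))"
  unfolding chain_def by (auto simp: less_Suc_eq_0_disj)

lemma chain_diff: "chain r U \<Longrightarrow> chain r V \<Longrightarrow> chain r (\<lambda>j x. U j x - V j x)"
  unfolding chain_def by (auto intro!: has_vector_derivative_diff)

lemma chain_add: "chain r U \<Longrightarrow> chain r V \<Longrightarrow> chain r (\<lambda>j x. U j x + V j x)"
  unfolding chain_def by (auto intro!: has_vector_derivative_add)

lemma continuous_on_deriv:
  "(\<And>x. (f has_vector_derivative f' x) (at x)) \<Longrightarrow> continuous_on S f"
  by (meson continuous_at_imp_continuous_on has_vector_derivative_continuous)

lemma chain_continuous: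
  assumes "chain r U" "continuous_on UNIV (U r)" "j \<le> r"
  shows "continuous_on UNIV (U j)"
  using assms by (cases "j < r") (auto simp: chain_def intro!: continuous_on_deriv)

lemma poly_antideriv: "p \<in> polys_less r \<Longrightarrow> \<exists>q\<in>polys_less (Suc r). pderiv q = p"
proof (induction r arbitrary: p)
  case 0
  then show ?case by (auto intro!: bexI[of _ 0])
next
  case (Suc r)
  define c where "c = coeff p r"
  have "coeff (p - monom c r) n = 0" if "n \<ge> r" for n
    using Suc.prems that by (cases "n = r") (auto simp: polys_less_iff c_def coeff_monom)
  then have "p - monom c r \<in> polys_less r"
    by (simp add: polys_less_iff)
  then obtain q where q: "q \<in> polys_less (Suc r)" "pderiv q = p - monom c r"
    using Suc.IH by blast
  have "pderiv (monom (c / of_nat (Suc r)) (Suc r) + q) = p"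
    using q(2) by (simp add: pderiv_add pderiv_monom del: of_nat_Suc)
  moreover have "monom (c / of_nat (Suc r)) (Suc r) + q \<in> polys_less (Suc (Suc r))"
    using q(1) by (auto simp: polys_less_iff coeff_monom)
  ultimately show ?case by blast
qed

text \<open>Applied to the difference of two towers with the same top function, this is the
  uniqueness of r-fold antiderivatives modulo polynomials of degree below r.\<close>

lemma chain_zero_poly:
  assumes "chain r U" "\<And>x. U r x = 0"
  shows "\<exists>p\<in>polys_less r. \<forall>x. U 0 x = poly p (of_real x)"
  using assms
proof (induction r arbitrary: U)
  case 0
  then show ?case by auto
next
  case (Suc r)
  from Suc.prems have D: "\<And>x. (U 0 has_vector_derivative U 1 x) (at x)" and "chain r (\<lambda>j. U (Suc j))"
    by (auto simp: chain_Suc_iff)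
  with Suc.IH[of "\<lambda>j. U (Suc j)"] Suc.prems
  obtain p where p: "p \<in> polys_less r" "\<And>x. U 1 x = poly p (of_real x)" by auto
  obtain q where q: "q \<in> polys_less (Suc r)" "pderiv q = p"
    using poly_antideriv[OF p(1)] by blast
  have "((\<lambda>x. U 0 x - poly q (of_real x)) has_vector_derivative 0) (at x within UNIV)" for x
    using has_vector_derivative_diff[OF D[of x] poly_of_real_deriv[of q x UNIV]] p(2) q(2) by simp
  then obtain c where c: "\<And>x. U 0 x - poly q (of_real x) = c"
    using has_vector_derivative_zero_constant[of UNIV "\<lambda>x. U 0 x - poly q (of_real x)"] by auto
  have "q + [:c:] \<in> polys_less (Suc r)"
    using q(1) by (auto simp: polys_less_iff coeff_pCons split: nat.splits)
  moreover have "U 0 x = poly (q + [:c:]) (of_real x)" for x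
    using c[of x] by (simp add: algebra_simps)
  ultimately show ?case by blast
qed

lemma ex_antideriv:
  fixes h :: "real \<Rightarrow> complex"
  assumes h: "continuous_on UNIV h"
  shows "\<exists>H. H x0 = 0 \<and> (\<forall>x. (H has_vector_derivative h x) (at x))"
proof -
  define H where "H u = (LBINT y=ereal x0..ereal u. h y)" for u
  have "(H has_vector_derivative h x) (at x)" for x
  proof -
    let ?a = "min x0 x - 1" and ?b = "max x0 x + 1"
    have "(H has_vector_derivative h x) (at x within {?a..?b})"
      unfolding H_def[abs_def]
      by (rule interval_integral_FTC2) (use h in \<open>auto intro: continuous_on_subset\<close>)
    then have "(H has_vector_derivative h x) (at x within {?a<..<?b})"
      by (rule has_vector_derivative_within_subset) auto
    then show ?thesis
      by (subst (asm) has_vector_derivative_within_open) auto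
  qed
  moreover have "H x0 = 0" by (simp add: H_def)
  ultimately show ?thesis by blast
qed

text \<open>The lower entries are made to vanish at x0 so that the top function controls U 0 around
  x0 (\<open>chain_bound\<close>, \<open>chain_sqint_le\<close>).\<close>

lemma chain_exists:
  assumes "continuous_on UNIV h"
  shows "\<exists>U. chain r U \<and> U r = h \<and> (\<forall>j<r. U j x0 = 0)"
proof (induction r)
  case 0
  then show ?case by (auto simp: chain_def intro!: exI[of _ "\<lambda>_. h"])
next
  case (Suc r)
  then obtain U where U: "chain r U" "U r = h" "\<forall>j<r. U j x0 = 0" by blast
  have "continuous_on UNIV (U 0)"
    using chain_continuous[OF U(1)] U(2) assms by simp
  then obtain H where H: "H x0 = 0" "\<And>x. (H has_vector_derivative U 0 x) (at x)"
    using ex_antideriv by blast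
  then show ?case using U
    by (intro exI[of _ "case_nat H U"]) (auto simp: chain_Suc_iff less_Suc_eq_0_disj)
qed

lemma chain_bound:
  assumes "chain r U" "\<And>j. j < r \<Longrightarrow> U j x0 = 0" "\<And>y. \<bar>y - x0\<bar> \<le> \<rho> \<Longrightarrow> norm (U r y) \<le> B"
    and y: "\<bar>y - x0\<bar> \<le> \<rho>"
  shows "norm (U 0 y) \<le> \<rho> ^ r * B"
  using assms
proof (induction r arbitrary: U y)
  case 0
  then show ?case by simp
next
  case (Suc r)
  have D: "\<And>x. (U 0 has_vector_derivative U 1 x) (at x)" and "chain r (\<lambda>j. U (Suc j))"
    using Suc.prems by (auto simp: chain_Suc_iff)
  then have b: "norm (U 1 y) \<le> \<rho> ^ r * B" if "\<bar>y - x0\<bar> \<le> \<rho>" for y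
    using Suc.IH[of "\<lambda>j. U (Suc j)" y] Suc.prems that by auto
  have \<rho>: "\<rho> \<ge> 0" using Suc.prems(4) by linarith
  have "norm (U 0 y - U 0 x0) \<le> (\<rho> ^ r * B) * norm (y - x0)"
  proof (rule differentiable_bound[where S="cball x0 \<rho>" and f'="\<lambda>x h. h *\<^sub>R U 1 x"])
    show "(U 0 has_derivative (\<lambda>h. h *\<^sub>R U 1 x)) (at x within cball x0 \<rho>)" for x
      using has_vector_derivative_at_within[OF D] by (simp add: has_vector_derivative_def)
    show "onorm (\<lambda>h. h *\<^sub>R U 1 x) \<le> \<rho> ^ r * B" if "x \<in> cball x0 \<rho>" for x
    proof (rule onorm_le)
      fix h :: real
      have "norm (U 1 x) \<le> \<rho> ^ r * B" using that b by (auto simp: dist_real_def abs_minus_commute)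
      then show "norm (h *\<^sub>R U 1 x) \<le> \<rho> ^ r * B * norm h"
        by (simp add: mult.commute[of "\<bar>h\<bar>"] mult_right_mono)
    qed
  qed (use Suc.prems(4) \<rho> in \<open>auto simp: dist_real_def abs_minus_commute\<close>)
  also have "\<dots> \<le> (\<rho> ^ r * B) * \<rho>"
    using Suc.prems(4) order_trans[OF norm_ge_zero b[OF Suc.prems(4)]] by (intro mult_left_mono) auto
  finally show ?case using Suc.prems(2)[of 0] by (simp add: mult_ac)
qed

text \<open>Cauchy-Schwarz bounds |V|^2 pointwise by 2 \<rho> times the square integral of W;
  integration over length 2 \<rho> gives the second factor.\<close>

lemma antideriv_sqint_le:
  assumes D: "\<And>x. (V has_vector_derivative W x) (at x)" and c: "continuous_on UNIV W"
    and 0: "V x0 = 0" and \<rho>: "\<rho> \<ge> 0"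
  shows "sqint {x0 - \<rho>..x0 + \<rho>} V \<le> ennreal (4 * \<rho>\<^sup>2) * sqint {x0 - \<rho>..x0 + \<rho>} W"
proof -
  let ?B = "{x0 - \<rho>..x0 + \<rho>}"
  have [measurable]: "W \<in> borel_measurable borel"
    using c by (rule borel_measurable_continuous_onI)
  have "ennreal ((norm (V y))\<^sup>2) \<le> ennreal (2 * \<rho>) * sqint ?B W" if "y \<in> ?B" for y
  proof -
    have "ennreal (norm (V y - V x0)) \<le> (\<integral>\<^sup>+x\<in>{min x0 y..max x0 y}. ennreal (norm (W x)) \<partial>lborel)"
      by (rule increment_le_nn_integral[OF D c])
    also have "\<dots> \<le> (\<integral>\<^sup>+x\<in>?B. ennreal (norm (W x)) \<partial>lborel)"
      using that \<rho> by (intro nn_integral_mono) (auto split: split_indicator)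
    finally have "(ennreal (norm (V y)))\<^sup>2 \<le> (\<integral>\<^sup>+x\<in>?B. ennreal (norm (W x)) \<partial>lborel)\<^sup>2"
      using 0 by (intro power_mono) auto
    also have "\<dots> \<le> emeasure lborel ?B * sqint ?B W" by (rule sqint_L1) auto
    finally show ?thesis using \<rho> by (simp add: ennreal_power)
  qed
  then have "sqint ?B V \<le> (\<integral>\<^sup>+y. ennreal (2 * \<rho>) * sqint ?B W * indicator ?B y \<partial>lborel)"
    unfolding sqint_def[of _ V] by (intro nn_integral_mono) (auto split: split_indicator)
  also have "\<dots> = ennreal (2 * \<rho>) * sqint ?B W * ennreal (2 * \<rho>)"
    using \<rho> by (simp add: nn_integral_cmult)
  also have "\<dots> = ennreal (2 * \<rho> * (2 * \<rho>)) * sqint ?B W"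
    using \<rho> by (subst ennreal_mult) (auto simp: mult_ac)
  finally show ?thesis by (simp add: power2_eq_square)
qed

lemma chain_sqint_le:
  assumes "chain r U" "\<And>j. j < r \<Longrightarrow> U j x0 = 0" "continuous_on UNIV (U r)" and \<rho>: "\<rho> \<ge> 0"
  shows "sqint {x0 - \<rho>..x0 + \<rho>} (U 0) \<le> ennreal ((4 * \<rho>\<^sup>2) ^ r) * sqint {x0 - \<rho>..x0 + \<rho>} (U r)"
  using assms(1-3)
proof (induction r arbitrary: U)
  case 0
  then show ?case by simp
next
  case (Suc r)
  have D: "\<And>x. (U 0 has_vector_derivative U 1 x) (at x)" and c: "chain r (\<lambda>j. U (Suc j))"
    using Suc.prems by (auto simp: chain_Suc_iff)
  have cont: "continuous_on UNIV (U 1)"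
    using chain_continuous[OF Suc.prems(1,3), of 1] by simp
  have "sqint {x0 - \<rho>..x0 + \<rho>} (U 0) \<le> ennreal (4 * \<rho>\<^sup>2) * sqint {x0 - \<rho>..x0 + \<rho>} (U 1)"
    using Suc.prems(2)[of 0] by (intro antideriv_sqint_le D cont \<rho>) auto
  also have "\<dots> \<le> ennreal (4 * \<rho>\<^sup>2) * (ennreal ((4 * \<rho>\<^sup>2) ^ r) * sqint {x0 - \<rho>..x0 + \<rho>} (U (Suc r)))"
    using Suc.IH[OF c] Suc.prems by (intro mult_left_mono) auto
  finally show ?case by (simp add: ennreal_mult mult.assoc)
qed

section \<open>Kernels with a jump at the origin of the frequency line\<close>

text \<open>The j-th derivative of the inverse Fourier transform of \<theta>.\<close>

definition osc :: "(real \<Rightarrow> complex) \<Rightarrow> nat \<Rightarrow> real \<Rightarrow> complex" where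
  "osc \<theta> j u = (LINT \<xi>|lborel. \<theta> \<xi> * (2 * pi * \<i> * \<xi>) ^ j * ee (u * \<xi>))"

lemma integrable_compact_support:
  fixes h :: "real \<Rightarrow> complex"
  assumes [measurable]: "h \<in> borel_measurable borel"
    and "\<And>\<xi>. norm (h \<xi>) \<le> B" "\<And>\<xi>. \<xi> \<notin> {a..b} \<Longrightarrow> h \<xi> = 0"
  shows "integrable lborel h"
proof (rule Bochner_Integration.integrable_bound)
  show "integrable lborel (\<lambda>\<xi>. B * indicator {a..b} \<xi> :: real)"
    by (cases "a \<le> b") (auto intro!: integrable_mult_right)
  show "AE \<xi> in lborel. norm (h \<xi>) \<le> norm (B * indicator {a..b} \<xi> :: real)"
    using assms(2,3) by (auto split: split_indicator intro: order_trans[OF _ abs_ge_self])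
qed auto

text \<open>D k is the k-th derivative of D 0 on [0, 1]. Vanishing of all orders at 1 removes
  boundary terms there, while the values at 0 are free: they are the jump.\<close>

definition smooth_seq :: "(nat \<Rightarrow> real \<Rightarrow> complex) \<Rightarrow> bool" where
  "smooth_seq D \<longleftrightarrow> (\<forall>k. \<forall>x\<in>{0..1}. (D k has_vector_derivative D (Suc k) x) (at x within {0..1})) \<and>
     (\<forall>k. D k 1 = 0)"

lemma smooth_seq_continuous: "smooth_seq D \<Longrightarrow> continuous_on {0..1} (D k)"
  unfolding smooth_seq_def continuous_on_eq_continuous_within
  by (meson has_vector_derivative_continuous)

text \<open>\<open>D k = h\<^sup>(\<^sup>k\<^sup>)\<close> is turned into the derivatives of \<open>c h + \<xi> h'\<close>.\<close>

lemma smooth_seq_euler: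
  assumes "smooth_seq D"
  shows "smooth_seq (\<lambda>k x. of_real (c + k) * D k x + of_real x * D (Suc k) x)"
  unfolding smooth_seq_def
proof (intro conjI allI ballI)
  fix k and x :: real assume x: "x \<in> {0..1}"
  have D: "(D k has_vector_derivative D (Suc k) x) (at x within {0..1})" for k
    using assms x by (auto simp: smooth_seq_def)
  have x': "((\<lambda>x. complex_of_real x) has_vector_derivative of_real 1) (at x within {0..1})"
    by (intro has_vector_derivative_of_real) (auto intro!: derivative_eq_intros)
  have "((\<lambda>x. of_real (c + k) * D k x + of_real x * D (Suc k) x) has_vector_derivative
    (of_real (c + k) * D (Suc k) x + (of_real x * D (Suc (Suc k)) x + of_real 1 * D (Suc k) x))) (at x within {0..1})"
    by (intro has_vector_derivative_add has_vector_derivative_mult_right has_vector_derivative_mult[OF x'] D)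
  then show "((\<lambda>x. of_real (c + k) * D k x + of_real x * D (Suc k) x) has_vector_derivative
    of_real (c + Suc k) * D (Suc k) x + of_real x * D (Suc (Suc k)) x) (at x within {0..1})"
    by (simp add: algebra_simps)
qed (use assms in \<open>simp add: smooth_seq_def\<close>)

definition unit_osc :: "(real \<Rightarrow> complex) \<Rightarrow> real \<Rightarrow> complex" where
  "unit_osc h u = (LINT \<xi>|lborel. indicator {0..1} \<xi> *\<^sub>R (h \<xi> * ee (u * \<xi>)))"

lemma unit_osc_integrable:
  assumes "continuous_on {0..1} h"
  shows "integrable lborel (\<lambda>\<xi>. indicator {0..1} \<xi> *\<^sub>R (h \<xi> * ee (u * \<xi>)))"
  by (rule borel_integrable_compact) (auto intro!: continuous_intros assms)

lemma unit_osc_bounded: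
  assumes h: "continuous_on {0..1} h"
  shows "\<exists>C. \<forall>u. norm (unit_osc h u) \<le> C"
proof (intro exI allI)
  fix u
  have "norm (unit_osc h u) \<le> (LINT \<xi>|lborel. norm (indicator {0..1} \<xi> *\<^sub>R (h \<xi> * ee (u * \<xi>))))"
    unfolding unit_osc_def by (rule integral_norm_bound)
  also have "\<dots> = (LINT \<xi>|lborel. indicator {0..1} \<xi> * norm (h \<xi>))"
    by (intro Bochner_Integration.integral_cong) (auto simp: norm_mult split: split_indicator)
  finally show "norm (unit_osc h u) \<le> (LINT \<xi>|lborel. indicator {0..1} \<xi> * norm (h \<xi>))" .
qed

lemma unit_osc_by_parts:
  assumes D: "\<And>x. x \<in> {0..1} \<Longrightarrow> (h has_vector_derivative h' x) (at x within {0..1})"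
    and c: "continuous_on {0..1} h'" and 1: "h 1 = 0"
  shows "of_real (2 * pi) * \<i> * of_real u * unit_osc h u = - h 0 - unit_osc h' u"
proof -
  have ch: "continuous_on {0..1} h"
    using D unfolding continuous_on_eq_continuous_within by (meson has_vector_derivative_continuous)
  have "(LINT \<xi>|lborel. indicator {0..1} \<xi> *\<^sub>R (h \<xi> * ((2 * pi * \<i> * u) * ee (u * \<xi>)) + h' \<xi> * ee (u * \<xi>)))
     = h 1 * ee (u * 1) - h 0 * ee (u * 0)"
  proof (rule integral_FTC_Icc)
    show "continuous_on {0..1} (\<lambda>\<xi>. h \<xi> * (2 * pi * \<i> * u * ee (u * \<xi>)) + h' \<xi> * ee (u * \<xi>))"
      by (intro continuous_intros ch c)
    show "((\<lambda>\<xi>. h \<xi> * ee (u * \<xi>)) has_vector_derivative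
       h x * (2 * pi * \<i> * u * ee (u * x)) + h' x * ee (u * x)) (at x within {0..1})" if "0 \<le> x" "x \<le> 1" for x
      using that by (intro has_vector_derivative_mult D ee_deriv) auto
  qed auto
  also have "(LINT \<xi>|lborel. indicator {0..1} \<xi> *\<^sub>R (h \<xi> * ((2 * pi * \<i> * u) * ee (u * \<xi>)) + h' \<xi> * ee (u * \<xi>)))
    = (LINT \<xi>|lborel. (2 * pi * \<i> * u) * (indicator {0..1} \<xi> *\<^sub>R (h \<xi> * ee (u * \<xi>)))
        + indicator {0..1} \<xi> *\<^sub>R (h' \<xi> * ee (u * \<xi>)))"
    by (intro Bochner_Integration.integral_cong) (auto simp: mult_ac scaleR_add_right)
  also have "\<dots> = (2 * pi * \<i> * u) * unit_osc h u + unit_osc h' u"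
    unfolding unit_osc_def using unit_osc_integrable[OF ch, of u] unit_osc_integrable[OF c, of u]
    by (subst Bochner_Integration.integral_add)
       (auto simp del: mult_scaleR_right intro!: integrable_mult_right)
  finally show ?thesis using 1 by (simp add: algebra_simps)
qed

text \<open>For \<xi>^(j+1) h, integration by parts produces no boundary term: h vanishes at 1 and
  the power vanishes at 0. It gains a factor 1/u and leaves \<xi>^j times (j + 1) h + \<xi> h', of
  the same kind, so D must vary in the induction. At j = 0 the jump h(0) survives, which limits the
  decay to one last power.\<close>

lemma unit_osc_power_decay:
  "smooth_seq D \<Longrightarrow> \<exists>C. \<forall>u. \<bar>u\<bar> ^ Suc j * norm (unit_osc (\<lambda>\<xi>. of_real \<xi> ^ j * D 0 \<xi>) u) \<le> C"
proof (induction j arbitrary: D)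
  case 0
  have D1: "\<And>x. x \<in> {0..1} \<Longrightarrow> (D 0 has_vector_derivative D (Suc 0) x) (at x within {0..1})" "D 0 1 = 0"
    using 0 by (auto simp: smooth_seq_def)
  have c: "continuous_on {0..1} (D (Suc 0))" using 0 by (rule smooth_seq_continuous)
  obtain C where C: "\<And>u. norm (unit_osc (D (Suc 0)) u) \<le> C"
    using unit_osc_bounded[OF c] by blast
  have "\<bar>u\<bar> ^ Suc 0 * norm (unit_osc (\<lambda>\<xi>. of_real \<xi> ^ 0 * D 0 \<xi>) u) \<le> norm (D 0 0) + C" for u
  proof -
    have "2 * pi * (\<bar>u\<bar> * norm (unit_osc (D 0) u)) = norm (of_real (2 * pi) * \<i> * of_real u * unit_osc (D 0) u)"
      by (simp add: norm_mult)
    also have "\<dots> = norm (- D 0 0 - unit_osc (D (Suc 0)) u)"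
      by (subst unit_osc_by_parts[OF D1(1) c D1(2)]) auto
    also have "\<dots> \<le> norm (D 0 0) + norm (unit_osc (D (Suc 0)) u)"
      using norm_triangle_ineq4[of "- D 0 0" "unit_osc (D (Suc 0)) u"] by simp
    also have "\<dots> \<le> norm (D 0 0) + C" using C by simp
    finally have *: "2 * pi * (\<bar>u\<bar> * norm (unit_osc (D 0) u)) \<le> norm (D 0 0) + C" .
    have "1 * (\<bar>u\<bar> * norm (unit_osc (D 0) u)) \<le> 2 * pi * (\<bar>u\<bar> * norm (unit_osc (D 0) u))"
      using pi_gt3 by (intro mult_right_mono) auto
    with * show ?thesis by simp
  qed
  then show ?case by blast
next
  case (Suc j)
  \<comment> \<open>The tower of (j + 1) h + \<xi> h', so that \<xi>^j E_0 is the derivative of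
    \<xi>^(j+1) D_0.\<close>
  define E where "E k x = of_real (Suc j + k) * D k x + of_real x * D (Suc k) x" for k x
  have E: "smooth_seq E"
    using smooth_seq_euler[OF Suc.prems, of "Suc j"] by (simp add: E_def[abs_def])
  obtain C where C: "\<And>u. \<bar>u\<bar> ^ Suc j * norm (unit_osc (\<lambda>\<xi>. of_real \<xi> ^ j * E 0 \<xi>) u) \<le> C"
    using Suc.IH[OF E] by blast
  have "\<bar>u\<bar> ^ Suc (Suc j) * norm (unit_osc (\<lambda>\<xi>. of_real \<xi> ^ Suc j * D 0 \<xi>) u) \<le> C" for u
  proof -
    have "of_real (2 * pi) * \<i> * of_real u * unit_osc (\<lambda>\<xi>. of_real \<xi> ^ Suc j * D 0 \<xi>) u
      = - (of_real 0 ^ Suc j * D 0 0) - unit_osc (\<lambda>\<xi>. of_real \<xi> ^ j * E 0 \<xi>) u"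
    proof (rule unit_osc_by_parts)
      fix x :: real assume x: "x \<in> {0..1}"
      have "((\<lambda>x. complex_of_real (x ^ Suc j)) has_vector_derivative of_real (real (Suc j) * x ^ j)) (at x within {0..1})"
        using DERIV_pow[of "Suc j" x "{0..1}"] by (intro has_vector_derivative_of_real) simp
      moreover have "(D 0 has_vector_derivative D (Suc 0) x) (at x within {0..1})"
        using Suc.prems x by (auto simp: smooth_seq_def)
      ultimately have "((\<lambda>x. complex_of_real (x ^ Suc j) * D 0 x) has_vector_derivative
        (complex_of_real (x ^ Suc j) * D (Suc 0) x + of_real (real (Suc j) * x ^ j) * D 0 x)) (at x within {0..1})"
        by (rule has_vector_derivative_mult)
      then show "((\<lambda>x. complex_of_real x ^ Suc j * D 0 x) has_vector_derivative
        complex_of_real x ^ j * E 0 x) (at x within {0..1})"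
        by (simp add: E_def algebra_simps)
    next
      show "continuous_on {0..1} (\<lambda>\<xi>. of_real \<xi> ^ j * E 0 \<xi>)"
        by (intro continuous_intros smooth_seq_continuous[OF E])
    qed (use Suc.prems in \<open>simp add: smooth_seq_def\<close>)
    then have "norm (of_real (2 * pi) * \<i> * of_real u * unit_osc (\<lambda>\<xi>. of_real \<xi> ^ Suc j * D 0 \<xi>) u)
      = norm (- (of_real 0 ^ Suc j * D 0 0) - unit_osc (\<lambda>\<xi>. of_real \<xi> ^ j * E 0 \<xi>) u)"
      by (simp only:)
    then have eq: "2 * pi * (\<bar>u\<bar> * norm (unit_osc (\<lambda>\<xi>. of_real \<xi> ^ Suc j * D 0 \<xi>) u))
      = norm (unit_osc (\<lambda>\<xi>. of_real \<xi> ^ j * E 0 \<xi>) u)"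
      by (simp add: norm_mult)
    have "1 * (\<bar>u\<bar> * norm (unit_osc (\<lambda>\<xi>. of_real \<xi> ^ Suc j * D 0 \<xi>) u))
      \<le> 2 * pi * (\<bar>u\<bar> * norm (unit_osc (\<lambda>\<xi>. of_real \<xi> ^ Suc j * D 0 \<xi>) u))"
      using pi_gt3 by (intro mult_right_mono) auto
    then have "\<bar>u\<bar> ^ Suc j * (\<bar>u\<bar> * norm (unit_osc (\<lambda>\<xi>. of_real \<xi> ^ Suc j * D 0 \<xi>) u))
      \<le> \<bar>u\<bar> ^ Suc j * norm (unit_osc (\<lambda>\<xi>. of_real \<xi> ^ j * E 0 \<xi>) u)"
      unfolding eq by (intro mult_left_mono) auto
    also have "\<dots> \<le> C" by (rule C)
    finally show ?thesis by (simp add: mult_ac)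
  qed
  then show ?case by blast
qed

text \<open>\<open>\<kappa> = 1\<close> for a symbol on \<open>[0, 1]\<close> and \<open>\<kappa> = - 1\<close> for one on \<open>[- 1, 0]\<close>.
  The condition \<open>decay\<close> expresses that the symbol is smooth except for a jump at \<open>0\<close>.\<close>

locale jump_symbol =
  fixes \<theta> :: "real \<Rightarrow> complex" and \<kappa> B :: real
  assumes \<kappa>: "\<kappa> \<in> {1, - 1}"
    and \<theta>_borel [measurable]: "\<theta> \<in> borel_measurable borel"
    and \<theta>_bound: "\<And>\<xi>. norm (\<theta> \<xi>) \<le> B"
    and \<theta>_supp: "\<And>\<xi>. \<theta> \<xi> \<noteq> 0 \<Longrightarrow> 0 \<le> \<kappa> * \<xi> \<and> \<kappa> * \<xi> \<le> 1"
    and decay: "\<And>j. \<exists>C. \<forall>u. \<bar>u\<bar> ^ Suc j * norm (osc \<theta> j u) \<le> C"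
begin

lemma B_nonneg: "B \<ge> 0"
  using \<theta>_bound[of 0] norm_ge_zero[of "\<theta> 0"] by linarith

lemma \<theta>_outside: "\<xi> \<notin> {-1..1} \<Longrightarrow> \<theta> \<xi> = 0"
  using \<theta>_supp[of \<xi>] \<kappa> by (cases "\<theta> \<xi> = 0") auto

lemma integrable_symbol: "integrable lborel (\<lambda>\<xi>. \<theta> \<xi> * (2 * pi * \<i> * \<xi>) ^ j)"
proof (rule integrable_compact_support[where a="-1" and b=1 and B="B * (2 * pi) ^ j"])
  show "norm (\<theta> \<xi> * (2 * pi * \<i> * \<xi>) ^ j) \<le> B * (2 * pi) ^ j" for \<xi>
  proof (cases "\<bar>\<xi>\<bar> \<le> 1")
    case True
    then show ?thesis using \<theta>_bound[of \<xi>] B_nonneg unfolding norm_mult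
      by (intro mult_mono) (auto simp: norm_mult norm_power power_mult_distrib power_le_one mult_left_le)
  next
    case False
    then have "\<theta> \<xi> = 0" by (intro \<theta>_outside) (auto simp: abs_le_iff)
    then show ?thesis using B_nonneg by auto
  qed
qed (use \<theta>_outside in auto)

lemma osc_bounded: "\<exists>C. \<forall>u. norm (osc \<theta> j u) \<le> C"
  unfolding osc_def by (intro exI allI) (rule fourier_integral_norm_le)

lemma osc_deriv: "(osc \<theta> j has_vector_derivative osc \<theta> (Suc j) u) (at u)"
proof -
  have 1: "z * (w * (c * z) ^ j) = w * (c * z) ^ Suc j / c" if "c \<noteq> 0" for z w c :: complex
    using that by (simp add: field_simps)
  have *: "of_real \<xi> * (\<theta> \<xi> * (2 * pi * \<i> * \<xi>) ^ j) = (\<theta> \<xi> * (2 * pi * \<i> * \<xi>) ^ Suc j) / (2 * pi * \<i>)" for \<xi>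
    by (rule 1) simp
  have "((\<lambda>u. osc \<theta> j u) has_vector_derivative
    2 * pi * \<i> * (LINT \<xi>|lborel. of_real \<xi> * (\<theta> \<xi> * (2 * pi * \<i> * \<xi>) ^ j) * ee (u * \<xi>))) (at u)"
    unfolding osc_def
  proof (rule fourier_integral_deriv[OF integrable_symbol])
    show "integrable lborel (\<lambda>\<xi>. of_real \<xi> * (\<theta> \<xi> * (2 * pi * \<i> * \<xi>) ^ j))"
      unfolding * by (intro integrable_divide integrable_symbol)
  qed
  also have "2 * pi * \<i> * (LINT \<xi>|lborel. of_real \<xi> * (\<theta> \<xi> * (2 * pi * \<i> * \<xi>) ^ j) * ee (u * \<xi>))
    = (LINT \<xi>|lborel. 2 * pi * \<i> * (of_real \<xi> * (\<theta> \<xi> * (2 * pi * \<i> * \<xi>) ^ j) * ee (u * \<xi>)))"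
    by simp
  also have "\<dots> = osc \<theta> (Suc j) u"
    unfolding osc_def by (intro Bochner_Integration.integral_cong refl) (simp add: mult_ac)
  finally show ?thesis .
qed

text \<open>The j-th derivative of the kernel whose symbol is \<theta>(\<xi>/l); compare
  \<open>kern_fourier\<close>.\<close>

definition kern :: "real \<Rightarrow> nat \<Rightarrow> real \<Rightarrow> complex" where
  "kern l j u = of_real (l ^ Suc j) * osc \<theta> j (l * u)"

lemma kern_deriv: "(kern l j has_vector_derivative kern l (Suc j) u) (at u)"
proof -
  have "((\<lambda>u. osc \<theta> j (l * u)) has_vector_derivative l *\<^sub>R osc \<theta> (Suc j) (l * u)) (at u)"
  proof (rule vector_diff_chain_at[unfolded o_def])
    show "((\<lambda>u. l * u) has_vector_derivative l) (at u)"
      by (auto intro!: derivative_eq_intros simp flip: has_real_derivative_iff_has_vector_derivative)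
  qed (rule osc_deriv)
  from has_vector_derivative_mult_right[OF this, of "of_real (l ^ Suc j)"] show ?thesis
    by (simp add: kern_def[abs_def] scaleR_conv_of_real mult_ac)
qed

lemma continuous_on_kern [continuous_intros]:
  "continuous_on S f \<Longrightarrow> continuous_on S (\<lambda>x. kern l j (f x))"
  using continuous_on_deriv[OF kern_deriv, of UNIV l j] continuous_on_compose2[of UNIV "kern l j" S f] by auto

lemma measurable_kern [measurable]: "kern l j \<in> borel_measurable borel"
  by (intro borel_measurable_continuous_onI continuous_intros)

text \<open>Since |u|^(j+1) |k^(j)(u)| is invariant under dilation of the symbol, one constant
  serves all l. The first bound is the better one for |u| below 1/l.\<close>

lemma kern_bounds:
  "\<exists>C>0. \<forall>l>0. \<forall>u. norm (kern l j u) \<le> C * l ^ Suc j \<and> \<bar>u\<bar> ^ Suc j * norm (kern l j u) \<le> C"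
proof -
  obtain C1 where C1: "\<And>u. norm (osc \<theta> j u) \<le> C1" using osc_bounded by blast
  obtain C2 where C2: "\<And>u. \<bar>u\<bar> ^ Suc j * norm (osc \<theta> j u) \<le> C2" using decay by blast
  define C where "C = max 1 (max C1 C2)"
  have "norm (kern l j u) \<le> C * l ^ Suc j" if "l > 0" for l u
  proof -
    have "norm (osc \<theta> j (l * u)) \<le> C" using C1[of "l * u"] by (simp add: C_def)
    then have "l ^ Suc j * norm (osc \<theta> j (l * u)) \<le> l ^ Suc j * C" using that by (intro mult_left_mono) auto
    then show ?thesis using that by (simp add: kern_def norm_mult norm_power mult_ac)
  qed
  moreover have "\<bar>u\<bar> ^ Suc j * norm (kern l j u) \<le> C" if "l > 0" for l u
  proof -
    have "\<bar>u\<bar> ^ Suc j * norm (kern l j u) = \<bar>l * u\<bar> ^ Suc j * norm (osc \<theta> j (l * u))"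
      using that by (simp add: kern_def norm_mult norm_power power_mult_distrib abs_mult)
    also have "\<dots> \<le> C" using C2[of "l * u"] by (simp add: C_def)
    finally show ?thesis .
  qed
  moreover have "C > 0" by (simp add: C_def)
  ultimately show ?thesis by blast
qed

text \<open>The constant depends on l. The bound serves for convergence of integrals and for the
  choice of regularisation parameters, never for the constant of the final estimate.\<close>

lemma kern_decay:
  assumes l: "l > 0"
  shows "\<exists>C>0. \<forall>u. norm (kern l j u) \<le> C * (1 + \<bar>u\<bar>) powr (- real (Suc j))"
proof -
  obtain C where C: "C > 0" "\<And>u. norm (kern l j u) \<le> C * l ^ Suc j" "\<And>u. \<bar>u\<bar> ^ Suc j * norm (kern l j u) \<le> C"
    using kern_bounds[of j] l by blast
  define C' where "C' = 2 ^ Suc j * (C * l ^ Suc j + C)"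
  have "norm (kern l j u) \<le> C' * (1 + \<bar>u\<bar>) powr (- real (Suc j))" for u
  proof -
    have "(1 + \<bar>u\<bar>) ^ Suc j * norm (kern l j u) \<le> 2 ^ Suc j * (1 + \<bar>u\<bar> ^ Suc j) * norm (kern l j u)"
      by (intro mult_right_mono one_plus_abs_power_le) auto
    also have "\<dots> = 2 ^ Suc j * (norm (kern l j u) + \<bar>u\<bar> ^ Suc j * norm (kern l j u))"
      by (simp add: algebra_simps)
    also have "\<dots> \<le> C'"
      unfolding C'_def by (intro mult_left_mono add_mono C) auto
    finally have "norm (kern l j u) \<le> C' / (1 + \<bar>u\<bar>) ^ Suc j"
      by (subst pos_le_divide_eq) (auto simp: mult.commute)
    also have "(1 + \<bar>u\<bar>) ^ Suc j = (1 + \<bar>u\<bar>) powr real (Suc j)"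
      by (subst powr_realpow) auto
    finally show ?thesis by (simp only: powr_minus divide_inverse)
  qed
  moreover have "C' > 0" unfolding C'_def
    using C(1) l by (intro mult_pos_pos add_pos_pos zero_less_power) auto
  ultimately show ?thesis by blast
qed

end

section \<open>Jump symbols from bumps on the unit interval\<close>

lemma smooth_on_unit_seq:
  assumes sm: "smooth_on {0..1} \<psi>" and 0: "\<And>x. x \<in> {2/3<..1} \<Longrightarrow> \<psi> x = 0"
  shows "smooth_seq (\<lambda>k. iter_deriv {0..1} k \<psi>)"
proof -
  have D: "(iter_deriv {0..1} k \<psi> has_vector_derivative iter_deriv {0..1} (Suc k) \<psi> x) (at x within {0..1})"
    if "x \<in> {0..1}" for k x
    using sm that unfolding smooth_on_def
    by (auto simp: iter_deriv_def vector_derivative_works)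
  \<comment> \<open>Only the values at 1 are wanted, but the induction over derivatives has to run
    on a set that is relatively open in [0, 1].\<close>
  have z: "\<forall>x\<in>{2/3<..1}. iter_deriv {0..1} k \<psi> x = 0" for k
  proof (induction k)
    case 0
    then show ?case using assms(2) by (simp add: iter_deriv_def)
  next
    case (Suc k)
    show ?case
    proof
      fix x :: real assume x: "x \<in> {2/3<..1}"
      have "((\<lambda>_. 0 :: complex) has_vector_derivative 0) (at x within {0..1})" by simp
      then have "(iter_deriv {0..1} k \<psi> has_vector_derivative 0) (at x within {0..1})"
        by (rule has_vector_derivative_transform_within[where d="x - 2/3"])
           (use x Suc in \<open>auto simp: dist_real_def\<close>)
      with D[of x k] x show "iter_deriv {0..1} (Suc k) \<psi> x = 0"
        by (intro vector_derivative_unique_within[of x "{0..1}"]) (auto simp: trivial_limit_within islimpt_Icc)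
    qed
  qed
  show ?thesis unfolding smooth_seq_def using D z by auto
qed

lemma smooth_seq_borel:
  assumes "smooth_seq D" "\<And>x. x \<in> {0..1} \<Longrightarrow> h x = D 0 x" "\<And>x. x \<notin> {0..1} \<Longrightarrow> h x = 0"
  shows "h \<in> borel_measurable borel"
proof -
  have "(\<lambda>x. indicator {0..1} x *\<^sub>R D 0 x) \<in> borel_measurable borel"
    by (rule borel_measurable_continuous_on_indicator) (auto intro: smooth_seq_continuous assms(1))
  moreover have "(\<lambda>x. indicator {0..1} x *\<^sub>R D 0 x) = h"
    using assms(2,3) by (auto simp: fun_eq_iff split: split_indicator)
  ultimately show ?thesis by simp
qed

lemma smooth_seq_bounded:
  assumes "smooth_seq D" "\<And>x. x \<in> {0..1} \<Longrightarrow> h x = D 0 x" "\<And>x. x \<notin> {0..1} \<Longrightarrow> h x = 0"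
  shows "\<exists>B. \<forall>x. norm (h x) \<le> B"
proof -
  have "bounded (D 0 ` {0..1})"
    by (intro compact_imp_bounded compact_continuous_image smooth_seq_continuous assms(1)) auto
  then obtain B where "\<forall>x\<in>{0..1}. norm (D 0 x) \<le> B" unfolding bounded_iff by auto
  then have "norm (h x) \<le> max 0 B" for x
    using assms(2,3)[of x] by (cases "x \<in> {0..1}") (auto simp: le_max_iff_disj)
  then show ?thesis by blast
qed

lemma smooth_seq_osc_decay:
  assumes D: "smooth_seq D" and h: "\<And>x. x \<in> {0..1} \<Longrightarrow> h x = D 0 x" "\<And>x. x \<notin> {0..1} \<Longrightarrow> h x = 0"
  shows "\<exists>C. \<forall>u. \<bar>u\<bar> ^ Suc j * norm (osc h j u) \<le> C"
proof -
  obtain C where C: "\<And>u. \<bar>u\<bar> ^ Suc j * norm (unit_osc (\<lambda>\<xi>. of_real \<xi> ^ j * D 0 \<xi>) u) \<le> C"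
    using unit_osc_power_decay[OF D] by blast
  have "osc h j u = (2 * pi * \<i>) ^ j * unit_osc (\<lambda>\<xi>. of_real \<xi> ^ j * D 0 \<xi>) u" for u
  proof -
    have "osc h j u = (LINT \<xi>|lborel. (2 * pi * \<i>) ^ j * (indicator {0..1} \<xi> *\<^sub>R (of_real \<xi> ^ j * D 0 \<xi> * ee (u * \<xi>))))"
      unfolding osc_def using h
      by (intro Bochner_Integration.integral_cong) (auto simp: power_mult_distrib split: split_indicator)
    then show ?thesis by (simp add: unit_osc_def del: mult_scaleR_right)
  qed
  then have "\<bar>u\<bar> ^ Suc j * norm (osc h j u) \<le> (2 * pi) ^ j * C" for u
    using mult_left_mono[OF C[of u], of "(2 * pi) ^ j"] by (simp add: norm_mult norm_power mult_ac)
  then show ?thesis by blast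
qed

lemma jump_symbol_left:
  assumes D: "smooth_seq D" and h: "\<And>x. x \<in> {0..1} \<Longrightarrow> h x = D 0 x" "\<And>x. x \<notin> {0..1} \<Longrightarrow> h x = 0"
  shows "\<exists>B. jump_symbol h 1 B"
proof -
  obtain B where "\<And>x. norm (h x) \<le> B" using smooth_seq_bounded[OF assms] by blast
  moreover have "0 \<le> 1 * \<xi> \<and> 1 * \<xi> \<le> 1" if "h \<xi> \<noteq> 0" for \<xi>
    using h(2)[of \<xi>] that by auto
  moreover have "h \<in> borel_measurable borel" by (rule smooth_seq_borel[OF D]) (use h in auto)
  moreover have "\<exists>C. \<forall>u. \<bar>u\<bar> ^ Suc j * norm (osc h j u) \<le> C" for j
    by (rule smooth_seq_osc_decay[OF D]) (use h in auto)
  ultimately have "jump_symbol h 1 B"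
    unfolding jump_symbol_def by blast
  then show ?thesis ..
qed

lemma osc_reflect:
  assumes [measurable]: "h \<in> borel_measurable borel"
  shows "osc (\<lambda>x. h (- x)) j u = (- 1) ^ j * osc h j (- u)"
proof -
  have "osc h j (- u) = \<bar>- 1\<bar> *\<^sub>R (LINT \<xi>|lborel. h (0 + - 1 * \<xi>) * (2 * pi * \<i> * of_real (0 + - 1 * \<xi>)) ^ j * ee (- u * (0 + - 1 * \<xi>)))"
    unfolding osc_def by (rule lborel_integral_real_affine) auto
  also have "\<dots> = (LINT \<xi>|lborel. (- 1) ^ j * (h (- \<xi>) * (2 * pi * \<i> * \<xi>) ^ j * ee (u * \<xi>)))"
  proof -
    have "(2 * pi * \<i> * of_real (0 + - 1 * \<xi>)) ^ j = (- 1) ^ j * (2 * pi * \<i> * \<xi>) ^ j" for \<xi>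
      by (subst power_mult_distrib[symmetric]) simp
    then show ?thesis by (simp add: mult_ac)
  qed
  also have "\<dots> = (- 1) ^ j * osc (\<lambda>x. h (- x)) j u"
    by (simp add: osc_def)
  finally show ?thesis by (simp add: power_mult_distrib[symmetric] flip: mult.assoc)
qed

lemma jump_symbol_right:
  assumes D: "smooth_seq D" and h: "\<And>x. x \<in> {0..1} \<Longrightarrow> h x = D 0 x" "\<And>x. x \<notin> {0..1} \<Longrightarrow> h x = 0"
  shows "\<exists>B. jump_symbol (\<lambda>x. h (- x)) (- 1) B"
proof -
  obtain B where "jump_symbol h 1 B" using jump_symbol_left[OF assms] by blast
  then interpret H: jump_symbol h 1 B .
  have "jump_symbol (\<lambda>x. h (- x)) (- 1) B"
  proof
    fix j
    obtain C where "\<And>u. \<bar>u\<bar> ^ Suc j * norm (osc h j u) \<le> C" using H.decay by blast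
    from this[of "- u" for u] show "\<exists>C. \<forall>u. \<bar>u\<bar> ^ Suc j * norm (osc (\<lambda>x. h (- x)) j u) \<le> C"
      unfolding osc_reflect[OF H.\<theta>_borel] by (auto simp: norm_mult norm_power)
  next
    show "0 \<le> - 1 * \<xi> \<and> - 1 * \<xi> \<le> 1" if "h (- \<xi>) \<noteq> 0" for \<xi>
      using H.\<theta>_supp[OF that] by simp
  qed (use H.\<theta>_bound in auto)
  then show ?thesis ..
qed

section \<open>Convolution with functions of polynomial growth\<close>

definition wt :: "real \<Rightarrow> real \<Rightarrow> real" where
  "wt a t = (1 + \<bar>t\<bar>) powr (- a)"

lemma wt_pos [simp]: "wt a t > 0" "wt a t \<ge> 0"
  unfolding wt_def by (auto simp: add_pos_nonneg)

lemma wt_nonzero [simp]: "wt a t \<noteq> 0"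
  using wt_pos(1)[of a t] by linarith

lemma measurable_wt [measurable]: "wt a \<in> borel_measurable borel"
  unfolding wt_def by measurable

lemma wt_0 [simp]: "wt 0 t = 1"
  by (simp add: wt_def)

lemma wt_antimono: "a \<le> b \<Longrightarrow> wt b t \<le> wt a t"
  unfolding wt_def by (intro powr_mono) auto

lemma wt_mult: "wt a t * wt b t = wt (a + b) t"
  unfolding wt_def by (simp flip: powr_add)

text \<open>Peetre's inequality, 1 + |t| <= (1 + |x|)(1 + |x - t|), raised to the power a.\<close>

lemma wt_shift:
  assumes "a \<ge> 0"
  shows "wt a (x - t) \<le> (1 + \<bar>x\<bar>) powr a * wt a t"
proof -
  have "1 + \<bar>t\<bar> \<le> (1 + \<bar>x\<bar>) * (1 + \<bar>x - t\<bar>)"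
  proof -
    have "1 + \<bar>t\<bar> \<le> 1 + \<bar>x\<bar> + \<bar>x - t\<bar>" by linarith
    also have "\<dots> \<le> (1 + \<bar>x\<bar>) * (1 + \<bar>x - t\<bar>)" by (simp add: algebra_simps)
    finally show ?thesis .
  qed
  then have "(1 + \<bar>t\<bar>) powr a \<le> ((1 + \<bar>x\<bar>) * (1 + \<bar>x - t\<bar>)) powr a"
    using assms by (intro powr_mono2) auto
  also have "\<dots> = (1 + \<bar>x\<bar>) powr a * (1 + \<bar>x - t\<bar>) powr a" by (rule powr_mult)
  finally show ?thesis
    by (simp add: wt_def powr_minus field_simps add_pos_nonneg)
qed

text \<open>The weighted L1 class that contains every Borel f satisfying \<open>well_approx\<close>
  at some point, as soon as a > \<mu> + 1 (\<open>well_approx_wint\<close>). It is also the norm in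
  which regularisation errors are measured.\<close>

definition wint :: "real \<Rightarrow> (real \<Rightarrow> complex) \<Rightarrow> bool" where
  "wint a f \<longleftrightarrow> f \<in> borel_measurable borel \<and> integrable lborel (\<lambda>t. norm (f t) * wt a t)"

definition wnorm :: "real \<Rightarrow> (real \<Rightarrow> complex) \<Rightarrow> real" where
  "wnorm a f = (LINT t|lborel. norm (f t) * wt a t)"

lemma wnorm_nonneg [simp]: "wnorm a f \<ge> 0"
  unfolding wnorm_def by (intro Bochner_Integration.integral_nonneg) auto

lemma wint_borel: "wint a f \<Longrightarrow> f \<in> borel_measurable borel"
  by (simp add: wint_def)

lemma wint_mono:
  assumes "wint a f" "a \<le> b"
  shows "wint b f"
proof -
  have [measurable]: "f \<in> borel_measurable borel" using assms by (simp add: wint_def)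
  have "integrable lborel (\<lambda>t. norm (f t) * wt b t)"
    by (rule Bochner_Integration.integrable_bound[of lborel "\<lambda>t. norm (f t) * wt a t"])
       (use assms in \<open>auto simp: wint_def intro!: mult_left_mono wt_antimono\<close>)
  then show ?thesis by (simp add: wint_def)
qed

lemma wint_norm_le:
  assumes "wint a f" and [measurable]: "g \<in> borel_measurable borel" and "\<And>t. norm (g t) \<le> norm (f t)"
  shows "wint a g"
proof -
  have "integrable lborel (\<lambda>t. norm (g t) * wt a t)"
    by (rule Bochner_Integration.integrable_bound[of lborel "\<lambda>t. norm (f t) * wt a t"])
       (use assms in \<open>auto simp: wint_def intro!: mult_right_mono\<close>)
  then show ?thesis by (simp add: wint_def)
qed

lemma wint_integrable: "integrable lborel f \<Longrightarrow> wint 0 f"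
  by (auto simp: wint_def)

lemma wint_add:
  assumes "wint a f" "wint a g"
  shows "wint a (\<lambda>t. f t + g t)"
proof -
  have [measurable]: "f \<in> borel_measurable borel" "g \<in> borel_measurable borel"
    using assms by (auto simp: wint_def)
  have "integrable lborel (\<lambda>t. norm (f t + g t) * wt a t)"
  proof (rule Bochner_Integration.integrable_bound)
    show "integrable lborel (\<lambda>t. norm (f t) * wt a t + norm (g t) * wt a t)"
      using assms by (auto simp: wint_def)
    show "AE t in lborel. norm (norm (f t + g t) * wt a t) \<le> norm (norm (f t) * wt a t + norm (g t) * wt a t)"
      by (auto simp: distrib_right[symmetric] abs_mult intro!: mult_right_mono norm_triangle_ineq)
  qed auto
  then show ?thesis by (simp add: wint_def)
qed

lemma wint_cmult: "wint a f \<Longrightarrow> wint a (\<lambda>t. c * f t)"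
  by (auto simp: wint_def norm_mult mult.assoc)

definition conv :: "(real \<Rightarrow> complex) \<Rightarrow> (real \<Rightarrow> complex) \<Rightarrow> real \<Rightarrow> complex" where
  "conv K f y = (LINT t|lborel. K (y - t) * f t)"

lemma conv_dominated:
  fixes K f :: "real \<Rightarrow> complex"
  assumes a: "a \<ge> 0" and K: "\<And>u. norm (K u) \<le> C * wt a u"
  shows "norm (K (y - t) * f t) \<le> C * (1 + \<bar>y\<bar>) powr a * (norm (f t) * wt a t)"
proof -
  have C: "C \<ge> 0" using order_trans[OF norm_ge_zero K[of 0]] by (simp add: wt_def)
  have "norm (K (y - t) * f t) \<le> C * wt a (y - t) * norm (f t)"
    unfolding norm_mult by (intro mult_right_mono K) auto
  also have "\<dots> \<le> C * ((1 + \<bar>y\<bar>) powr a * wt a t) * norm (f t)"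
    by (intro mult_right_mono mult_left_mono wt_shift a C) auto
  finally show ?thesis by (simp add: mult_ac)
qed

lemma conv_integrable:
  assumes "a \<ge> 0" "\<And>u. norm (K u) \<le> C * wt a u" and [measurable]: "K \<in> borel_measurable borel" and f: "wint a f"
  shows "integrable lborel (\<lambda>t. K (y - t) * f t)"
proof (rule Bochner_Integration.integrable_bound)
  have [measurable]: "f \<in> borel_measurable borel" using f by (rule wint_borel)
  show "integrable lborel (\<lambda>t. C * (1 + \<bar>y\<bar>) powr a * (norm (f t) * wt a t))"
    using f by (intro integrable_mult_right) (simp add: wint_def)
  show "(\<lambda>t. K (y - t) * f t) \<in> borel_measurable lborel" by measurable
  show "AE t in lborel. norm (K (y - t) * f t) \<le> norm (C * (1 + \<bar>y\<bar>) powr a * (norm (f t) * wt a t))"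
    using conv_dominated[OF assms(1,2), of y] by (auto intro!: AE_I2 order_trans[OF _ abs_ge_self])
qed

lemma conv_norm_le:
  assumes "a \<ge> 0" "\<And>u. norm (K u) \<le> C * wt a u" "K \<in> borel_measurable borel" and f: "wint a f"
  shows "norm (conv K f y) \<le> C * (1 + \<bar>y\<bar>) powr a * wnorm a f"
proof -
  have "norm (conv K f y) \<le> (LINT t|lborel. C * (1 + \<bar>y\<bar>) powr a * (norm (f t) * wt a t))"
    unfolding conv_def
  proof (rule order_trans[OF integral_norm_bound], rule integral_mono)
    show "integrable lborel (\<lambda>t. norm (K (y - t) * f t))"
      by (intro integrable_norm conv_integrable[OF assms])
    show "integrable lborel (\<lambda>t. C * (1 + \<bar>y\<bar>) powr a * (norm (f t) * wt a t))"
      using f by (intro integrable_mult_right) (simp add: wint_def)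
  qed (rule conv_dominated[OF assms(1,2)])
  then show ?thesis by (simp add: wnorm_def)
qed

lemma conv_deriv:
  assumes a: "a \<ge> 0" and K: "\<And>u. norm (K u) \<le> C * wt a u" and K': "\<And>u. norm (K' u) \<le> C' * wt a u"
    and D: "\<And>u. (K has_vector_derivative K' u) (at u)" and f: "wint a f"
  shows "(conv K f has_vector_derivative conv K' f y) (at y)"
proof -
  have [measurable]: "K \<in> borel_measurable borel"
    using continuous_on_deriv[OF D] by (rule borel_measurable_continuous_onI)
  have "C' \<ge> 0" using order_trans[OF norm_ge_zero K'[of 0]] by (simp add: wt_def)
  have "((\<lambda>y. LINT t|lborel. K (y - t) * f t) has_vector_derivative (LINT t|lborel. K' (y - t) * f t)) (at y)"
  proof (rule has_vector_derivative_integral)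
    show "((\<lambda>y. K (y - t) * f t) has_vector_derivative K' (x - t) * f t) (at x)" for x t
    proof -
      have "((\<lambda>y. K (y - t)) has_vector_derivative 1 *\<^sub>R K' (x - t)) (at x)"
        by (rule vector_diff_chain_at[unfolded o_def, OF _ D])
           (auto intro!: derivative_eq_intros simp flip: has_real_derivative_iff_has_vector_derivative)
      then show ?thesis by (intro has_vector_derivative_mult_left) simp
    qed
    show "norm (K' (x - t) * f t) \<le> C' * (2 + \<bar>y\<bar>) powr a * (norm (f t) * wt a t)" if "\<bar>x - y\<bar> < 1" for x t
    proof -
      have "norm (K' (x - t) * f t) \<le> C' * (1 + \<bar>x\<bar>) powr a * (norm (f t) * wt a t)"
        by (rule conv_dominated[OF a K'])
      also have "\<dots> \<le> C' * (2 + \<bar>y\<bar>) powr a * (norm (f t) * wt a t)"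
        using that a \<open>C' \<ge> 0\<close> by (intro mult_right_mono mult_left_mono powr_mono2) auto
      finally show ?thesis .
    qed
    show "integrable lborel (\<lambda>t. K (x - t) * f t)" for x
      by (rule conv_integrable[OF a K _ f]) measurable
    show "integrable lborel (\<lambda>t. C' * (2 + \<bar>y\<bar>) powr a * (norm (f t) * wt a t))"
      using f by (intro integrable_mult_right) (simp add: wint_def)
  qed
  then show ?thesis by (simp add: conv_def[abs_def])
qed

section \<open>Growth of functions with local polynomial approximation\<close>

lemma ennreal_le_of_power2_le:
  assumes "X\<^sup>2 \<le> ennreal (y\<^sup>2)" "y \<ge> 0"
  shows "X \<le> ennreal y"
proof (cases X)
  case (real x)
  then have "x\<^sup>2 \<le> y\<^sup>2" using assms by (simp add: ennreal_power ennreal_le_iff)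
  then have "x \<le> y" using assms(2) by (rule power2_le_imp_le)
  then show ?thesis using real by (simp add: ennreal_leI)
next
  case top
  then show ?thesis using assms(1) by (simp add: power2_eq_square top_unique)
qed

lemma powr_two_nat: "(2::real) ^ k = 2 powr real k"
  by (simp add: powr_realpow)

lemma powr_power2: "(x powr a)\<^sup>2 = x powr (2 * a)" for x :: real
  by (simp add: power2_eq_square flip: powr_add)

lemma term_le_suminf: "F k \<le> suminf F" for F :: "nat \<Rightarrow> ennreal"
  using sum_le_suminf[of F "{k}"] by simp

text \<open>The term of the least k with |x - t| <= 2^k suffices. For k > 0 minimality gives |x - t|
  > 2^(k-1), and the loss of one dyadic step is the factor 2^a.\<close>

lemma wt_dyadic:
  assumes a: "a \<ge> 0"
  shows "ennreal (wt a (x - t)) \<le> (\<Sum>k. ennreal (2 powr a * 2 powr (- a * real k)) * indicator {x - 2 ^ k..x + 2 ^ k} t)"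
    (is "_ \<le> (\<Sum>k. ?F k)")
proof -
  obtain n where n: "\<bar>x - t\<bar> \<le> 2 ^ n" using real_arch_pow[of 2 "\<bar>x - t\<bar>"] by (auto intro: less_imp_le)
  define k where "k = (LEAST k. \<bar>x - t\<bar> \<le> 2 ^ k)"
  have k: "\<bar>x - t\<bar> \<le> 2 ^ k" unfolding k_def by (rule LeastI[of _ n]) (rule n)
  have "wt a (x - t) \<le> 2 powr a * 2 powr (- a * real k)"
  proof (cases k)
    case 0
    have "wt a (x - t) \<le> 1" using wt_antimono[of 0 a] a by simp
    also have "1 \<le> 2 powr a" using a by (intro ge_one_powr_ge_zero) auto
    finally show ?thesis using 0 by simp
  next
    case (Suc j)
    have "\<not> \<bar>x - t\<bar> \<le> 2 ^ j" using not_less_Least[of j "\<lambda>k. \<bar>x - t\<bar> \<le> 2 ^ k"] Suc by (simp add: k_def)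
    then have "wt a (x - t) \<le> (2 ^ j) powr (- a)"
      unfolding wt_def using a by (intro powr_mono2') auto
    also have "\<dots> = 2 powr a * 2 powr (- a * real k)"
      by (simp add: Suc powr_two_nat powr_powr flip: powr_add) (simp add: algebra_simps)
    finally show ?thesis .
  qed
  then have "ennreal (wt a (x - t)) \<le> ?F k"
    using k by (auto intro!: ennreal_leI simp: abs_le_iff split: split_indicator)
  also have "\<dots> \<le> (\<Sum>j. ?F j)"
    by (rule term_le_suminf)
  finally show ?thesis .
qed

text \<open>Cauchy-Schwarz on intervals of radius 2^k turns growth 2^(k(2 \<mu> + 1)) of the square
  integrals into growth 2^(k(\<mu> + 1)) of the L1 norms; the weight 2^(-ak) makes the series
  geometric because a > \<mu> + 1.\<close>

lemma wint_of_growth: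
  assumes [measurable]: "h \<in> borel_measurable borel" and E: "E \<ge> 0" and \<mu>: "\<mu> \<ge> 0" and a: "a > \<mu> + 1"
    and g: "\<And>k. sqint {x - 2 ^ k..x + 2 ^ k} h \<le> ennreal (E * 2 powr (real k * (2 * \<mu> + 1)))"
  shows "wint a h"
proof -
  have L1: "(\<integral>\<^sup>+t\<in>{x - 2 ^ k..x + 2 ^ k}. ennreal (norm (h t)) \<partial>lborel) \<le> ennreal (sqrt (2 * E) * 2 powr (real k * (\<mu> + 1)))" for k
  proof (rule ennreal_le_of_power2_le)
    have "(\<integral>\<^sup>+t\<in>{x - 2 ^ k..x + 2 ^ k}. ennreal (norm (h t)) \<partial>lborel)\<^sup>2 \<le> emeasure lborel {x - 2 ^ k..x + 2 ^ k} * sqint {x - 2 ^ k..x + 2 ^ k} h"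
      by (rule sqint_L1) auto
    also have "\<dots> \<le> ennreal (2 * 2 ^ k) * ennreal (E * 2 powr (real k * (2 * \<mu> + 1)))"
      by (intro mult_mono g) auto
    also have "\<dots> = ennreal (2 * E * 2 powr (real k + real k * (2 * \<mu> + 1)))"
      using E by (simp add: ennreal_mult[symmetric] powr_two_nat powr_add mult_ac)
    also have "2 * E * 2 powr (real k + real k * (2 * \<mu> + 1)) = (sqrt (2 * E) * 2 powr (real k * (\<mu> + 1)))\<^sup>2"
      using E by (simp add: power_mult_distrib powr_power) (simp add: algebra_simps)
    finally show "(\<integral>\<^sup>+t\<in>{x - 2 ^ k..x + 2 ^ k}. ennreal (norm (h t)) \<partial>lborel)\<^sup>2 \<le> \<dots>" .
  qed (use E in simp)
  define q where "q = 2 powr (\<mu> + 1 - a)"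
  have q: "0 \<le> q" "q < 1" using a powr_less_mono[of "\<mu> + 1 - a" 0 2] by (auto simp: q_def)
  have "(\<integral>\<^sup>+t. ennreal (norm (h t) * wt a (x - t)) \<partial>lborel)
     \<le> (\<integral>\<^sup>+t. (\<Sum>k. ennreal (2 powr a * 2 powr (- a * real k)) * (ennreal (norm (h t)) * indicator {x - 2 ^ k..x + 2 ^ k} t)) \<partial>lborel)"
  proof (rule nn_integral_mono)
    fix t
    have "ennreal (norm (h t) * wt a (x - t)) = ennreal (norm (h t)) * ennreal (wt a (x - t))"
      by (simp add: ennreal_mult)
    also have "\<dots> \<le> ennreal (norm (h t)) * (\<Sum>k. ennreal (2 powr a * 2 powr (- a * real k)) * indicator {x - 2 ^ k..x + 2 ^ k} t)"
      using a \<mu> by (intro mult_left_mono wt_dyadic) auto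
    also have "\<dots> = (\<Sum>k. ennreal (2 powr a * 2 powr (- a * real k)) * (ennreal (norm (h t)) * indicator {x - 2 ^ k..x + 2 ^ k} t))"
      by (subst ennreal_suminf_cmult[symmetric]) (simp add: mult_ac)
    finally show "ennreal (norm (h t) * wt a (x - t)) \<le> \<dots>" .
  qed
  also have "\<dots> = (\<Sum>k. ennreal (2 powr a * 2 powr (- a * real k)) * (\<integral>\<^sup>+t\<in>{x - 2 ^ k..x + 2 ^ k}. ennreal (norm (h t)) \<partial>lborel))"
    by (subst nn_integral_suminf) (auto simp: nn_integral_cmult)
  also have "\<dots> \<le> (\<Sum>k. ennreal (2 powr a * sqrt (2 * E) * q ^ k))"
  proof (rule suminf_le)
    fix k
    have "ennreal (2 powr a * 2 powr (- a * real k)) * (\<integral>\<^sup>+t\<in>{x - 2 ^ k..x + 2 ^ k}. ennreal (norm (h t)) \<partial>lborel)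
      \<le> ennreal (2 powr a * 2 powr (- a * real k)) * ennreal (sqrt (2 * E) * 2 powr (real k * (\<mu> + 1)))"
      by (intro mult_left_mono L1) auto
    also have "\<dots> = ennreal (2 powr a * sqrt (2 * E) * (2 powr (- a * real k) * 2 powr (real k * (\<mu> + 1))))"
      using E by (simp add: ennreal_mult[symmetric] mult_ac)
    also have "2 powr (- a * real k) * 2 powr (real k * (\<mu> + 1)) = q ^ k"
      unfolding q_def by (simp add: powr_power flip: powr_add) (simp add: algebra_simps)
    finally show "ennreal (2 powr a * 2 powr (- a * real k)) * (\<integral>\<^sup>+t\<in>{x - 2 ^ k..x + 2 ^ k}. ennreal (norm (h t)) \<partial>lborel) \<le> ennreal (2 powr a * sqrt (2 * E) * q ^ k)" .
  qed auto
  also have "\<dots> = ennreal (2 powr a * sqrt (2 * E) * (\<Sum>k. q ^ k))"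
    using q E by (subst suminf_ennreal2) (auto simp: suminf_mult summable_geometric intro!: summable_mult)
  also have "\<dots> < \<infinity>" by simp
  finally have fin: "(\<integral>\<^sup>+t. ennreal (norm (h t) * wt a (x - t)) \<partial>lborel) < \<infinity>" .
  have i: "integrable lborel (\<lambda>t. norm (h t) * wt a (x - t))"
    unfolding integrable_iff_bounded using fin by (simp add: abs_mult)
  have "integrable lborel (\<lambda>t. norm (h t) * wt a t)"
  proof (rule Bochner_Integration.integrable_bound)
    show "integrable lborel (\<lambda>t. (1 + \<bar>x\<bar>) powr a * (norm (h t) * wt a (x - t)))"
      using i by (rule integrable_mult_right)
    show "AE t in lborel. norm (norm (h t) * wt a t) \<le> norm ((1 + \<bar>x\<bar>) powr a * (norm (h t) * wt a (x - t)))"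
    proof (rule AE_I2)
      fix t
      have "norm (h t) * wt a t \<le> norm (h t) * ((1 + \<bar>x\<bar>) powr a * wt a (x - t))"
        using wt_shift[of a x "x - t"] a \<mu> by (intro mult_left_mono) auto
      then show "norm (norm (h t) * wt a t) \<le> norm ((1 + \<bar>x\<bar>) powr a * (norm (h t) * wt a (x - t)))"
        by (simp add: abs_mult mult_ac)
    qed
  qed auto
  then show ?thesis by (simp add: wint_def)
qed

lemma sqint_le_bound:
  assumes "\<And>t. t \<in> {x - \<sigma>..x + \<sigma>} \<Longrightarrow> norm (h t) \<le> K" "\<sigma> \<ge> 0" "K \<ge> 0"
  shows "sqint {x - \<sigma>..x + \<sigma>} h \<le> ennreal (2 * \<sigma> * K\<^sup>2)"
proof -
  have "sqint {x - \<sigma>..x + \<sigma>} h \<le> (\<integral>\<^sup>+t. ennreal (K\<^sup>2) * indicator {x - \<sigma>..x + \<sigma>} t \<partial>lborel)"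
    unfolding sqint_def using assms(1)
    by (intro nn_integral_mono) (auto split: split_indicator intro!: ennreal_leI power_mono)
  also have "\<dots> = ennreal (2 * \<sigma> * K\<^sup>2)"
    using assms(2,3) by (simp add: nn_integral_cmult ennreal_mult[symmetric] mult_ac)
  finally show ?thesis .
qed

lemma wint_power:
  assumes "a > real j + 1"
  shows "wint a (\<lambda>t. of_real t ^ j)"
proof (rule wint_of_growth[where \<mu>="real j" and x=0 and E=2])
  fix k
  have "sqint {0 - 2 ^ k..0 + 2 ^ k} (\<lambda>t. complex_of_real t ^ j) \<le> ennreal (2 * 2 ^ k * (((2 ^ k) ^ j)\<^sup>2))"
    by (rule sqint_le_bound) (auto simp: norm_power abs_le_iff intro!: power_mono)
  also have "2 * 2 ^ k * (((2 ^ k) ^ j)\<^sup>2) = 2 * 2 powr (real k * (2 * real j + 1))"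
  proof -
    have "2 * 2 ^ k * (((2 ^ k) ^ j)\<^sup>2) = 2 * (2::real) ^ (k * (2 * j + 1))"
      by (simp add: power_add power_mult mult_ac) (simp add: power_mult[symmetric] power2_eq_square power_add[symmetric] mult_ac mult_2)
    then show ?thesis by (simp add: powr_two_nat algebra_simps)
  qed
  finally show "sqint {0 - 2 ^ k..0 + 2 ^ k} (\<lambda>t. complex_of_real t ^ j) \<le> ennreal (2 * 2 powr (real k * (2 * real j + 1)))" .
qed (use assms in auto)

lemma poly_eq_sum_polys_less: "p \<in> polys_less i \<Longrightarrow> poly p z = (\<Sum>j<i. coeff p j * z ^ j)"
proof -
  assume p: "p \<in> polys_less i"
  have "(\<Sum>j\<le>degree p. coeff p j * z ^ j) = (\<Sum>j\<in>{..degree p} \<union> {..<i}. coeff p j * z ^ j)"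
    by (intro sum.mono_neutral_left) (auto simp: coeff_eq_0 not_le)
  also have "\<dots> = (\<Sum>j<i. coeff p j * z ^ j)"
    using p by (intro sum.mono_neutral_right) (auto simp: polys_less_iff)
  finally show ?thesis by (simp add: poly_altdef)
qed

lemma wint_sum:
  "finite A \<Longrightarrow> (\<And>j. j \<in> A \<Longrightarrow> wint a (f j)) \<Longrightarrow> wint a (\<lambda>t. \<Sum>j\<in>A. f j t)"
  by (induction A rule: finite_induct) (auto intro: wint_add simp: wint_def[of _ "\<lambda>_. 0"])

lemma wint_poly:
  assumes p: "p \<in> polys_less i" and a: "a > real i"
  shows "wint a (\<lambda>t. poly p (of_real t))"
  unfolding poly_eq_sum_polys_less[OF p] using a
  by (intro wint_sum wint_cmult wint_power) auto

text \<open>\<open>well_approx i s f x A\<close> is the finiteness of the maximal function at \<open>x\<close>, restricted to the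
  intervals centred at \<open>x\<close>.\<close>

definition well_approx :: "nat \<Rightarrow> real \<Rightarrow> (real \<Rightarrow> complex) \<Rightarrow> real \<Rightarrow> real \<Rightarrow> bool" where
  "well_approx i s f x A \<longleftrightarrow> (\<forall>\<sigma>>0. \<exists>p\<in>polys_less i.
     sqint {x - \<sigma>..x + \<sigma>} (\<lambda>t. f t - poly p (of_real t)) \<le> ennreal (A\<^sup>2 * \<sigma> powr (2 * s + 1)))"

lemma sum_geometric_powr_le:
  assumes "e > 0"
  shows "(\<Sum>j<k. 2 powr (- e * real j)) \<le> 1 / (1 - 2 powr (- e))"
proof -
  define q where "q = (2::real) powr (- e)"
  have q: "0 \<le> q" "q < 1" using assms powr_less_mono[of "- e" 0 2] by (auto simp: q_def)
  have "(\<Sum>j<k. 2 powr (- e * real j)) = (\<Sum>j<k. q ^ j)"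
    unfolding q_def by (intro sum.cong refl) (simp add: powr_power mult.commute)
  also have "\<dots> \<le> (\<Sum>j. q ^ j)"
    using q by (intro sum_le_suminf summable_geometric) auto
  also have "\<dots> = 1 / (1 - q)" using q by (intro suminf_geometric) auto
  finally show ?thesis by (simp add: q_def)
qed

text \<open>Telescoping over the approximating polynomials on doubling intervals. Two consecutive
  ones differ by at most a constant times A (2^j \<rho>)^s at radius 2^j \<rho>, and a polynomial of
  degree below i grows by at most a constant times 2^((k-j)(i-1)) up to radius 2^k \<rho>. Since
  \<mu> >= i - 1, the product of these powers is at most \<rho>^s 2^(k \<mu>) 2^(-(\<mu> - s) j),
  summable in j because \<mu> > s.\<close>

lemma well_approx_growth:
  assumes \<mu>: "\<mu> > s" "\<mu> \<ge> real (i - 1)"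
  shows "\<exists>C>0. \<forall>f x A \<rho> p0 k. f \<in> borel_measurable borel \<and> A \<ge> 0 \<and> \<rho> > 0 \<and> well_approx i s f x A \<and> p0 \<in> polys_less i \<and>
     sqint {x - \<rho>..x + \<rho>} (\<lambda>t. f t - poly p0 (of_real t)) \<le> ennreal (A\<^sup>2 * \<rho> powr (2 * s + 1)) \<longrightarrow>
     sqint {x - 2 ^ k * \<rho>..x + 2 ^ k * \<rho>} (\<lambda>t. f t - poly p0 (of_real t))
       \<le> ennreal (C * A\<^sup>2 * \<rho> powr (2 * s + 1) * 2 powr (real k * (2 * \<mu> + 1)))"
proof -
  obtain Cp where Cp: "Cp > 0" and Cpb: "\<And>p x \<sigma> t N. p \<in> polys_less i \<Longrightarrow> \<sigma> > 0 \<Longrightarrow> N \<ge> 0 \<Longrightarrow>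
     sqint {x - \<sigma>..x + \<sigma>} (\<lambda>t. poly p (of_real t)) \<le> ennreal N \<Longrightarrow>
     (norm (poly p (of_real t)))\<^sup>2 \<le> Cp * (1 + \<bar>t - x\<bar> / \<sigma>) ^ (2 * (i - 1)) * N / \<sigma>"
    using poly_pointwise_bound[of i] by blast
  define S where "S = 2 powr (2 * s + 1)"
  have S: "S > 0" by (simp add: S_def)
  \<comment> \<open>c1 bounds the square integral of a difference of consecutive polynomials, S
    being the growth of the admissible error under doubling; c2 adds the interpolation constant and
    the factor 2 in 1 + |t - x|/\<sigma> <= 2 * 2^(k-j); c3 adds the geometric series.\<close>
  define c1 where "c1 = 2 * (1 + S)"
  define c2 where "c2 = sqrt (Cp * c1) * 2 ^ (i - 1)"
  define c3 where "c3 = c2 / (1 - 2 powr (- (\<mu> - s)))"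
  have c1: "c1 > 0" using S by (simp add: c1_def)
  have c2: "c2 > 0" using c1 Cp by (simp add: c2_def)
  have c3: "c3 > 0" using c2 \<mu>(1) powr_less_mono[of "- (\<mu> - s)" 0 2] by (simp add: c3_def)
  have main: "sqint {x - 2 ^ k * \<rho>..x + 2 ^ k * \<rho>} (\<lambda>t. f t - poly p0 (of_real t))
       \<le> ennreal ((2 + 4 * c3\<^sup>2) * A\<^sup>2 * \<rho> powr (2 * s + 1) * 2 powr (real k * (2 * \<mu> + 1)))"
    if [measurable]: "f \<in> borel_measurable borel" and A: "A \<ge> 0" and \<rho>: "\<rho> > 0" and wa: "well_approx i s f x A" and p0: "p0 \<in> polys_less i"
     and le0: "sqint {x - \<rho>..x + \<rho>} (\<lambda>t. f t - poly p0 (of_real t)) \<le> ennreal (A\<^sup>2 * \<rho> powr (2 * s + 1))"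
   for f x A \<rho> p0 k
  proof -
    \<comment> \<open>At j = 0 the given p0 is kept, so that the telescoping sum starts from
      it.\<close>
    have "\<exists>p. p \<in> polys_less i \<and> sqint {x - 2 ^ j * \<rho>..x + 2 ^ j * \<rho>} (\<lambda>t. f t - poly p (of_real t))
       \<le> ennreal (A\<^sup>2 * (2 ^ j * \<rho>) powr (2 * s + 1)) \<and> (j = 0 \<longrightarrow> p = p0)" for j
    proof (cases "j = 0")
      case True
      then show ?thesis using p0 le0 by auto
    next
      case False
      then show ?thesis using wa[unfolded well_approx_def, rule_format, of "2 ^ j * \<rho>"] \<rho> by auto
    qed
    then obtain P where P: "\<And>j. P j \<in> polys_less i"
      "\<And>j. sqint {x - 2 ^ j * \<rho>..x + 2 ^ j * \<rho>} (\<lambda>t. f t - poly (P j) (of_real t))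
       \<le> ennreal (A\<^sup>2 * (2 ^ j * \<rho>) powr (2 * s + 1))" "P 0 = p0"
      by metis
    have pw: "(2 ^ j * \<rho>) powr e = 2 powr (real j * e) * \<rho> powr e" for j e
      using \<rho> by (simp add: powr_mult powr_two_nat powr_powr)
    have step: "norm (poly (P (Suc j)) (of_real t) - poly (P j) (of_real t))
        \<le> c2 * A * \<rho> powr s * 2 powr (real k * \<mu>) * 2 powr (- (\<mu> - s) * real j)"
      if j: "j < k" and t: "\<bar>t - x\<bar> \<le> 2 ^ k * \<rho>" for j t
    proof (rule power2_le_imp_le)
      let ?\<sigma> = "2 ^ j * \<rho>"
      let ?N = "c1 * A\<^sup>2 * ?\<sigma> powr (2 * s + 1)"
      have sg: "?\<sigma> > 0" using \<rho> by simp
      have "sqint {x - ?\<sigma>..x + ?\<sigma>} (\<lambda>t. poly (P (Suc j) - P j) (of_real t))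
        = sqint {x - ?\<sigma>..x + ?\<sigma>} (\<lambda>t. (f t - poly (P j) (of_real t)) + (- 1) * (f t - poly (P (Suc j)) (of_real t)))"
        by (simp add: algebra_simps)
      also have "\<dots> \<le> 2 * sqint {x - ?\<sigma>..x + ?\<sigma>} (\<lambda>t. f t - poly (P j) (of_real t))
          + 2 * sqint {x - ?\<sigma>..x + ?\<sigma>} (\<lambda>t. (- 1) * (f t - poly (P (Suc j)) (of_real t)))"
        by (rule sqint_add) measurable
      also have "sqint {x - ?\<sigma>..x + ?\<sigma>} (\<lambda>t. (- 1) * (f t - poly (P (Suc j)) (of_real t)))
         \<le> sqint {x - 2 ^ Suc j * \<rho>..x + 2 ^ Suc j * \<rho>} (\<lambda>t. f t - poly (P (Suc j)) (of_real t))"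
        using sg by (intro sqint_mono) (auto simp: norm_mult norm_minus_commute)
      also have "2 * sqint {x - ?\<sigma>..x + ?\<sigma>} (\<lambda>t. f t - poly (P j) (of_real t))
          + 2 * sqint {x - 2 ^ Suc j * \<rho>..x + 2 ^ Suc j * \<rho>} (\<lambda>t. f t - poly (P (Suc j)) (of_real t))
         \<le> 2 * ennreal (A\<^sup>2 * ?\<sigma> powr (2 * s + 1)) + 2 * ennreal (A\<^sup>2 * (2 ^ Suc j * \<rho>) powr (2 * s + 1))"
        by (intro add_mono mult_left_mono P) auto
      also have "\<dots> = ennreal (2 * (A\<^sup>2 * ?\<sigma> powr (2 * s + 1)) + 2 * (A\<^sup>2 * (2 ^ Suc j * \<rho>) powr (2 * s + 1)))"
        by (simp add: ennreal_mult)
      also have "(2 ^ Suc j * \<rho>) powr (2 * s + 1) = S * ?\<sigma> powr (2 * s + 1)"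
        using powr_mult[of 2 ?\<sigma> "2 * s + 1"] by (simp add: S_def mult.assoc)
      also have "2 * (A\<^sup>2 * ?\<sigma> powr (2 * s + 1)) + 2 * (A\<^sup>2 * (S * ?\<sigma> powr (2 * s + 1))) = ?N"
        by (simp add: c1_def algebra_simps)
      finally have le: "sqint {x - ?\<sigma>..x + ?\<sigma>} (\<lambda>t. poly (P (Suc j) - P j) (of_real t)) \<le> ennreal ?N"
        by (simp add: add_left_mono mult_left_mono)
      have "(norm (poly (P (Suc j) - P j) (of_real t)))\<^sup>2 \<le> Cp * (1 + \<bar>t - x\<bar> / ?\<sigma>) ^ (2 * (i - 1)) * ?N / ?\<sigma>"
        using c1 by (intro Cpb polys_less_diff P sg le) auto
      also have "\<dots> \<le> Cp * (2 * 2 ^ (k - j)) ^ (2 * (i - 1)) * ?N / ?\<sigma>"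
      proof (intro divide_right_mono mult_right_mono mult_left_mono power_mono)
        have "\<bar>t - x\<bar> / ?\<sigma> \<le> 2 ^ k * \<rho> / ?\<sigma>" using t sg by (intro divide_right_mono) auto
        also have "\<dots> = 2 ^ (k - j)" using \<rho> j by (simp add: power_diff)
        finally show "1 + \<bar>t - x\<bar> / ?\<sigma> \<le> 2 * 2 ^ (k - j)"
          using one_le_power[of "2::real" "k - j"] by linarith
      qed (use Cp c1 sg in auto)
      also have "?N / ?\<sigma> = c1 * A\<^sup>2 * ?\<sigma> powr (2 * s)"
        using sg by (simp add: powr_add)
      then have "Cp * (2 * 2 ^ (k - j)) ^ (2 * (i - 1)) * ?N / ?\<sigma> = (sqrt (Cp * c1))\<^sup>2 * ((2 ^ (i - 1))\<^sup>2 * ((2 ^ (k - j)) ^ (i - 1))\<^sup>2) * A\<^sup>2 * ?\<sigma> powr (2 * s)"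
        using Cp c1 by (simp add: power_mult_distrib power_mult mult.commute[of 2] flip: times_divide_eq_right)
      also have "?\<sigma> powr (2 * s) = (\<rho> powr s * 2 powr (real j * s))\<^sup>2"
        unfolding pw by (simp add: power_mult_distrib powr_power2) (simp add: algebra_simps)
      also have "(sqrt (Cp * c1))\<^sup>2 * ((2 ^ (i - 1))\<^sup>2 * ((2 ^ (k - j)) ^ (i - 1))\<^sup>2) * A\<^sup>2 * (\<rho> powr s * 2 powr (real j * s))\<^sup>2
        = (c2 * A * \<rho> powr s * ((2 ^ (k - j)) ^ (i - 1) * 2 powr (real j * s)))\<^sup>2"
        by (simp add: c2_def power_mult_distrib mult_ac)
      \<comment> \<open>The exponent (k - j)(i - 1) + j s is at most (k - j) \<mu> + j s = k \<mu> -
        (\<mu> - s) j.\<close>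
      also have "\<dots> \<le> (c2 * A * \<rho> powr s * (2 powr (real k * \<mu>) * 2 powr (- (\<mu> - s) * real j)))\<^sup>2"
      proof (intro power_mono mult_left_mono)
        have "((2::real) ^ (k - j)) ^ (i - 1) * 2 powr (real j * s) = 2 powr (real (k - j) * real (i - 1) + real j * s)"
          by (simp add: powr_two_nat powr_power powr_add mult_ac)
        also have "\<dots> \<le> 2 powr (real (k - j) * \<mu> + real j * s)"
          using \<mu>(2) by (intro powr_mono add_right_mono mult_left_mono) auto
        also have "\<dots> = 2 powr (real k * \<mu>) * 2 powr (- (\<mu> - s) * real j)"
          using j by (simp add: of_nat_diff algebra_simps flip: powr_add)
        finally show "((2::real) ^ (k - j)) ^ (i - 1) * 2 powr (real j * s) \<le> 2 powr (real k * \<mu>) * 2 powr (- (\<mu> - s) * real j)" .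
      qed (use c2 A in auto)
      finally show "(norm (poly (P (Suc j)) (of_real t) - poly (P j) (of_real t)))\<^sup>2
         \<le> (c2 * A * \<rho> powr s * 2 powr (real k * \<mu>) * 2 powr (- (\<mu> - s) * real j))\<^sup>2"
        by (simp add: mult.assoc)
    qed (use c2 A in auto)
    have tele: "norm (poly (P k) (of_real t) - poly p0 (of_real t)) \<le> c3 * A * \<rho> powr s * 2 powr (real k * \<mu>)"
      if t: "\<bar>t - x\<bar> \<le> 2 ^ k * \<rho>" for t
    proof -
      have "poly (P k) (of_real t) - poly p0 (of_real t) = (\<Sum>j<k. poly (P (Suc j)) (of_real t) - poly (P j) (complex_of_real t))"
        by (subst sum_lessThan_telescope) (simp add: P(3))
      also have "norm \<dots> \<le> (\<Sum>j<k. c2 * A * \<rho> powr s * 2 powr (real k * \<mu>) * 2 powr (- (\<mu> - s) * real j))"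
        by (rule sum_norm_le) (use step t in auto)
      also have "\<dots> = c2 * A * \<rho> powr s * 2 powr (real k * \<mu>) * (\<Sum>j<k. 2 powr (- (\<mu> - s) * real j))"
        by (simp only: sum_distrib_left)
      also have "\<dots> \<le> c2 * A * \<rho> powr s * 2 powr (real k * \<mu>) * (1 / (1 - 2 powr (- (\<mu> - s))))"
        using \<mu>(1) c2 A by (intro mult_left_mono sum_geometric_powr_le) auto
      finally show ?thesis by (simp add: c3_def)
    qed
    let ?B = "{x - 2 ^ k * \<rho>..x + 2 ^ k * \<rho>}"
    have "sqint ?B (\<lambda>t. f t - poly p0 (of_real t))
       = sqint ?B (\<lambda>t. (f t - poly (P k) (of_real t)) + (poly (P k) (of_real t) - poly p0 (of_real t)))"
      by simp
    also have "\<dots> \<le> 2 * sqint ?B (\<lambda>t. f t - poly (P k) (of_real t)) + 2 * sqint ?B (\<lambda>t. poly (P k) (of_real t) - poly p0 (of_real t))"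
      by (rule sqint_add) measurable
    also have "\<dots> \<le> 2 * ennreal (A\<^sup>2 * (2 ^ k * \<rho>) powr (2 * s + 1)) + 2 * ennreal (2 * (2 ^ k * \<rho>) * (c3 * A * \<rho> powr s * 2 powr (real k * \<mu>))\<^sup>2)"
      using \<rho> c3 A tele by (intro add_mono mult_left_mono P sqint_le_bound) (auto simp: abs_le_iff)
    also have "\<dots> = ennreal (2 * (A\<^sup>2 * (2 ^ k * \<rho>) powr (2 * s + 1)) + 4 * (2 ^ k * \<rho>) * (c3 * A * \<rho> powr s * 2 powr (real k * \<mu>))\<^sup>2)"
      using \<rho> by (simp add: ennreal_mult[symmetric] flip: ennreal_plus ennreal_numeral)
    also have "\<dots> \<le> ennreal ((2 + 4 * c3\<^sup>2) * A\<^sup>2 * \<rho> powr (2 * s + 1) * 2 powr (real k * (2 * \<mu> + 1)))"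
    proof (rule ennreal_leI)
      have "A\<^sup>2 * (2 ^ k * \<rho>) powr (2 * s + 1) \<le> A\<^sup>2 * (2 powr (real k * (2 * \<mu> + 1)) * \<rho> powr (2 * s + 1))"
        unfolding pw using \<mu>(1) by (intro mult_left_mono mult_right_mono powr_mono) auto
      moreover have "(2 ^ k * \<rho>) * (c3 * A * \<rho> powr s * 2 powr (real k * \<mu>))\<^sup>2 = c3\<^sup>2 * A\<^sup>2 * (\<rho> powr (2 * s + 1) * 2 powr (real k * (2 * \<mu> + 1)))"
      proof -
        have "\<rho> powr (2 * s + 1) = \<rho> powr (2 * s) * \<rho>" using \<rho> by (simp add: powr_add)
        moreover have "2 powr (real k * (2 * \<mu> + 1)) = 2 powr (2 * (real k * \<mu>)) * 2 powr real k"
          by (simp add: distrib_left powr_add mult_ac)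
        ultimately show ?thesis
          by (simp only: power_mult_distrib powr_power2 powr_two_nat mult_ac)
      qed
      moreover have "2 * a + 4 * u * v \<le> (2 + 4 * d) * e * p * q" if "a \<le> e * (q * p)" "u * v = d * e * (p * q)" for a u v d e p q :: real
      proof -
        have "4 * u * v = 4 * (d * e * (p * q))" using that(2) by (simp add: mult.assoc)
        then show ?thesis using that(1) by (simp add: algebra_simps)
      qed
      ultimately show "2 * (A\<^sup>2 * (2 ^ k * \<rho>) powr (2 * s + 1)) + 4 * (2 ^ k * \<rho>) * (c3 * A * \<rho> powr s * 2 powr (real k * \<mu>))\<^sup>2
        \<le> (2 + 4 * c3\<^sup>2) * A\<^sup>2 * \<rho> powr (2 * s + 1) * 2 powr (real k * (2 * \<mu> + 1))"
        by blast
    qed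
    finally show ?thesis .
  qed
  have "2 + 4 * c3\<^sup>2 > 0" by (simp add: add_pos_nonneg)
  with main show ?thesis by blast
qed

lemma well_approx_wint:
  assumes f: "f \<in> borel_measurable borel" and wa: "well_approx i s f x A" and A: "A \<ge> 0"
    and \<mu>: "\<mu> > s" "\<mu> \<ge> real (i - 1)" and a: "a > \<mu> + 1"
  shows "wint a f"
proof -
  note [measurable] = f
  obtain C where "C > 0" and C: "\<And>f x A \<rho> p0 k. f \<in> borel_measurable borel \<Longrightarrow> A \<ge> 0 \<Longrightarrow> \<rho> > 0 \<Longrightarrow> well_approx i s f x A \<Longrightarrow> p0 \<in> polys_less i \<Longrightarrow>
     sqint {x - \<rho>..x + \<rho>} (\<lambda>t. f t - poly p0 (of_real t)) \<le> ennreal (A\<^sup>2 * \<rho> powr (2 * s + 1)) \<Longrightarrow>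
     sqint {x - 2 ^ k * \<rho>..x + 2 ^ k * \<rho>} (\<lambda>t. f t - poly p0 (of_real t))
       \<le> ennreal (C * A\<^sup>2 * \<rho> powr (2 * s + 1) * 2 powr (real k * (2 * \<mu> + 1)))"
    using well_approx_growth[OF \<mu>] by blast
  obtain p0 where p0: "p0 \<in> polys_less i"
     "sqint {x - 1..x + 1} (\<lambda>t. f t - poly p0 (of_real t)) \<le> ennreal (A\<^sup>2 * 1 powr (2 * s + 1))"
    using wa[unfolded well_approx_def, rule_format, of 1] by auto
  have \<mu>0: "\<mu> \<ge> 0" using \<mu>(2) by (rule order_trans[rotated]) simp
  have "wint a (\<lambda>t. f t - poly p0 (of_real t))"
  proof (rule wint_of_growth[where x=x and E="C * A\<^sup>2" and \<mu>=\<mu>])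
    show "sqint {x - 2 ^ k..x + 2 ^ k} (\<lambda>t. f t - poly p0 (complex_of_real t)) \<le> ennreal (C * A\<^sup>2 * 2 powr (real k * (2 * \<mu> + 1)))" for k
      using C[OF f A _ wa p0, of k] by simp
  qed (use \<open>C > 0\<close> \<mu>0 a in auto)
  moreover have "wint a (\<lambda>t. poly p0 (of_real t))"
  proof (cases "i = 0")
    case True
    then show ?thesis using p0 by (simp add: wint_def)
  next
    case False
    then show ?thesis using \<mu>(2) a by (intro wint_poly[OF p0(1)]) (simp add: of_nat_diff)
  qed
  ultimately have "wint a (\<lambda>t. (f t - poly p0 (of_real t)) + poly p0 (of_real t))"
    by (rule wint_add)
  then show ?thesis by simp
qed

section \<open>Local and distant parts of the operator\<close>

text \<open>Equal to [a_m, b_m] both for \<kappa> = 1, c = a_m and for \<kappa> = -1, c = b_m, when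
  l is the length.\<close>

definition civ :: "real \<Rightarrow> real \<Rightarrow> real \<Rightarrow> real set" where
  "civ \<kappa> c l = {\<xi>. 0 \<le> \<kappa> * (\<xi> - c) \<and> \<kappa> * (\<xi> - c) \<le> l}"

lemma half_iv_subset_civ: "half_iv \<kappa> c l \<subseteq> civ \<kappa> c l"
  by (auto simp: half_iv_def civ_def)

lemma half_iv_disjoint:
  "disjoint_family_on (\<lambda>m. civ \<kappa> (c m) (l m)) M \<Longrightarrow> disjoint_family_on (\<lambda>m. half_iv \<kappa> (c m) (l m)) M"
  using half_iv_subset_civ unfolding disjoint_family_on_def by blast

text \<open>If f is not integrable, its Bochner integral is 0 by convention and the bound is
  trivial.\<close>

lemma norm_integral_le_nn_integral:
  fixes f :: "'a \<Rightarrow> complex"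
  shows "ennreal (norm (LINT x|M. f x)) \<le> (\<integral>\<^sup>+x. ennreal (norm (f x)) \<partial>M)"
  by (cases "integrable M f") (auto simp: not_integrable_integral_eq intro: integral_norm_bound_ennreal)

definition modulate :: "real \<Rightarrow> (real \<Rightarrow> complex) \<Rightarrow> real \<Rightarrow> complex" where
  "modulate c h t = ee (- c * t) * h t"

lemma norm_modulate [simp]: "norm (modulate c h t) = norm (h t)"
  by (simp add: modulate_def norm_mult)

lemma measurable_modulate [measurable (raw)]:
  assumes [measurable]: "h \<in> borel_measurable borel"
  shows "modulate c h \<in> borel_measurable borel"
  unfolding modulate_def by measurable

lemma wint_modulate: "wint a h \<Longrightarrow> wint a (modulate c h)"
  by (rule wint_norm_le) (auto simp: wint_def)

lemma wnorm_modulate: "wnorm a (modulate c h) = wnorm a h"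
  by (simp add: wnorm_def)

context jump_symbol
begin

text \<open>At j = 0 and for integrable h this is the multiplier with symbol \<theta>((\<xi> -
  c)/l), demodulated by c. For h of polynomial growth the integral converges absolutely once j + 1
  reaches the weight exponent of h, which is the reason for working with j = r.\<close>

definition op :: "nat \<Rightarrow> real \<Rightarrow> real \<Rightarrow> (real \<Rightarrow> complex) \<Rightarrow> real \<Rightarrow> complex" where
  "op j c l h = conv (kern l j) (modulate c h)"

lemma kern_wt:
  assumes "l > 0" "a \<le> real (Suc j)"
  shows "\<exists>C>0. \<forall>u. norm (kern l j u) \<le> C * wt a u"
proof -
  obtain C where "C > 0" and C: "\<And>u. norm (kern l j u) \<le> C * wt (real (Suc j)) u"
    using kern_decay[OF assms(1), of j] unfolding wt_def by blast
  then show ?thesis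
    using wt_antimono[OF assms(2)] by (meson order_trans mult_left_mono less_imp_le)
qed

lemma op_deriv:
  assumes "l > 0" "a \<ge> 0" "a \<le> real (Suc j)" "wint a h"
  shows "(op j c l h has_vector_derivative op (Suc j) c l h y) (at y)"
proof -
  obtain C C' where "\<And>u. norm (kern l j u) \<le> C * wt a u" "\<And>u. norm (kern l (Suc j) u) \<le> C' * wt a u"
    using kern_wt[OF assms(1,3)] kern_wt[of l a "Suc j"] assms(1,3) by auto
  then show ?thesis unfolding op_def
    by (intro conv_deriv[OF assms(2)] kern_deriv wint_modulate[OF assms(4)])
qed

lemma op_continuous:
  assumes "l > 0" "a \<ge> 0" "a \<le> real (Suc j)" "wint a h"
  shows "continuous_on S (op j c l h)"
  by (rule continuous_on_deriv[OF op_deriv[OF assms]])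

lemma op_integrable:
  assumes "l > 0" "a \<ge> 0" "a \<le> real (Suc j)" "wint a h"
  shows "integrable lborel (\<lambda>t. kern l j (y - t) * modulate c h t)"
proof -
  obtain C where "\<And>u. norm (kern l j u) \<le> C * wt a u"
    using kern_wt[OF assms(1,3)] by auto
  then show ?thesis
    by (rule conv_integrable[OF assms(2) _ measurable_kern wint_modulate[OF assms(4)]])
qed

lemma op_add:
  assumes "l > 0" "a \<ge> 0" "a \<le> real (Suc j)" "wint a f" "wint a g"
  shows "op j c l (\<lambda>t. f t + g t) y = op j c l f y + op j c l g y"
  using op_integrable[OF assms(1-4), of y c] op_integrable[OF assms(1-3,5), of y c]
  by (simp add: op_def conv_def modulate_def distrib_left)

subsection \<open>The local part\<close>

lemma kern_0_fourier:
  assumes "l > 0"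
  shows "kern l 0 u = (LINT \<xi>|lborel. \<theta> (\<xi> / l) * ee (u * \<xi>))"
proof -
  have "(LINT \<xi>|lborel. \<theta> (\<xi> / l) * ee (u * \<xi>)) = \<bar>l\<bar> *\<^sub>R (LINT \<xi>|lborel. \<theta> ((0 + l * \<xi>) / l) * ee (u * (0 + l * \<xi>)))"
    using assms by (intro lborel_integral_real_affine) auto
  then show ?thesis using assms
    by (simp add: kern_def osc_def scaleR_conv_of_real mult_ac)
qed

lemma symbol_scaled_outside: "l > 0 \<Longrightarrow> \<xi> \<notin> {- l..l} \<Longrightarrow> \<theta> (\<xi> / l) = 0"
  by (rule \<theta>_outside) (auto simp: field_simps)

lemma integrable_symbol_scaled: "l > 0 \<Longrightarrow> integrable lborel (\<lambda>\<xi>. \<theta> (\<xi> / l))"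
  by (rule integrable_compact_support[where a="- l" and b=l and B=B])
     (use \<theta>_bound symbol_scaled_outside in auto)

lemma local_part_fourier:
  assumes l: "l > 0" and h: "integrable lborel h"
  shows "op 0 c l h y = (LINT \<xi>|lborel. (\<theta> (\<xi> / l) * (LINT t|lborel. h t * ee ((- \<xi> - c) * t))) * ee (y * \<xi>))"
proof -
  have [measurable]: "h \<in> borel_measurable borel" using h by auto
  have hm: "integrable lborel (modulate c h)"
    by (rule Bochner_Integration.integrable_bound[OF h]) auto
  have e: "ee ((y - t) * \<xi>) = ee (y * \<xi>) * ee (- t * \<xi>)" for t \<xi>
    by (simp add: left_diff_distrib flip: ee_add)
  have "op 0 c l h y = (LINT t|lborel. modulate c h t * (LINT \<xi>|lborel. (\<theta> (\<xi> / l) * ee (y * \<xi>)) * ee (- t * \<xi>)))"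
    unfolding op_def conv_def kern_0_fourier[OF l]
    by (intro Bochner_Integration.integral_cong refl, simp only: e) (simp add: mult_ac)
  also have "\<dots> = (LINT \<xi>|lborel. (\<theta> (\<xi> / l) * ee (y * \<xi>)) * (LINT t|lborel. modulate c h t * ee (- t * \<xi>)))"
  proof (rule bounded_kernel_swap[where K="\<lambda>z. ee (- fst z * snd z)" and B=1, unfolded fst_conv snd_conv])
    show "integrable lborel (\<lambda>\<xi>. \<theta> (\<xi> / l) * ee (y * \<xi>))"
      by (rule Bochner_Integration.integrable_bound[OF integrable_symbol_scaled[OF l]]) (auto simp: norm_mult)
    show "(\<lambda>z::real \<times> real. ee (- fst z * snd z)) \<in> borel_measurable borel"
      by (intro borel_measurable_continuous_onI continuous_intros)
  qed (auto intro: hm)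
  also have "\<dots> = (LINT \<xi>|lborel. (\<theta> (\<xi> / l) * (LINT t|lborel. h t * ee ((- \<xi> - c) * t))) * ee (y * \<xi>))"
  proof (intro Bochner_Integration.integral_cong refl)
    fix \<xi>
    have "ee (- c * t) * ee (- t * \<xi>) = ee ((- \<xi> - c) * t)" for t
      by (simp add: algebra_simps flip: ee_add)
    then have "modulate c h t * ee (- t * \<xi>) = h t * ee ((- \<xi> - c) * t)" for t
      unfolding modulate_def by (metis mult.assoc mult.commute)
    then show "(\<theta> (\<xi> / l) * ee (y * \<xi>)) * (LINT t|lborel. modulate c h t * ee (- t * \<xi>))
      = (\<theta> (\<xi> / l) * (LINT t|lborel. h t * ee ((- \<xi> - c) * t))) * ee (y * \<xi>)"
      by (simp add: mult_ac)
  qed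
  finally show ?thesis .
qed

text \<open>Plancherel is used twice, from each output to the frequency side and from the frequency
  side back to h. In between, at each frequency at most one of the dilated symbols is non-zero, so
  the sum of their squared moduli is at most B^2.\<close>

lemma local_part_le:
  assumes M: "finite M" and l: "\<And>m. m \<in> M \<Longrightarrow> l m > 0"
    and disj: "disjoint_family_on (\<lambda>m. civ \<kappa> (c m) (l m)) M"
    and h: "integrable lborel h"
  shows "(\<Sum>m\<in>M. sqint UNIV (op 0 (c m) (l m) h)) \<le> ennreal (B\<^sup>2) * sqint UNIV h"
proof -
  have [measurable]: "h \<in> borel_measurable borel" using h by auto
  define H where "H v = (LINT t|lborel. h t * ee (v * t))" for v
  have [measurable]: "H \<in> borel_measurable borel" unfolding H_def by measurable
  have 1: "sqint UNIV (op 0 (c m) (l m) h)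
      \<le> (\<integral>\<^sup>+\<xi>. ennreal ((norm (\<theta> ((- \<xi> - c m) / l m)))\<^sup>2) * ennreal ((norm (H \<xi>))\<^sup>2) \<partial>lborel)" if m: "m \<in> M" for m
  proof -
    let ?X = "\<lambda>\<xi>. \<theta> (\<xi> / l m) * H (- \<xi> - c m)"
    have "integrable lborel ?X"
    proof (rule integrable_compact_support[where a="- l m" and b="l m" and B="B * (LINT t|lborel. norm (h t))"])
      show "norm (?X \<xi>) \<le> B * (LINT t|lborel. norm (h t))" for \<xi>
        unfolding norm_mult H_def using B_nonneg by (intro mult_mono \<theta>_bound fourier_integral_norm_le) auto
    qed (use symbol_scaled_outside[OF l[OF m]] in auto)
    from plancherel_le[OF this]
    have "sqint UNIV (op 0 (c m) (l m) h) \<le> sqint UNIV ?X"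
      by (simp add: local_part_fourier[OF l[OF m] h] H_def[symmetric] sqint_def)
    also have "\<dots> = (\<integral>\<^sup>+\<xi>. ennreal ((norm (\<theta> (\<xi> / l m)))\<^sup>2) * ennreal ((norm (H (- \<xi> - c m)))\<^sup>2) \<partial>lborel)"
      by (simp add: sqint_def norm_mult power_mult_distrib ennreal_mult)
    also have "\<dots> = ennreal \<bar>-1\<bar> * (\<integral>\<^sup>+\<xi>. ennreal ((norm (\<theta> ((- c m + (- 1) * \<xi>) / l m)))\<^sup>2) * ennreal ((norm (H (- (- c m + (- 1) * \<xi>) - c m)))\<^sup>2) \<partial>lborel)"
      by (intro nn_integral_real_affine) auto
    finally show ?thesis by (simp add: add.commute)
  qed
  have "(\<Sum>m\<in>M. sqint UNIV (op 0 (c m) (l m) h))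
     \<le> (\<Sum>m\<in>M. (\<integral>\<^sup>+\<xi>. ennreal ((norm (\<theta> ((- \<xi> - c m) / l m)))\<^sup>2) * ennreal ((norm (H \<xi>))\<^sup>2) \<partial>lborel))"
    by (intro sum_mono 1)
  also have "\<dots> = (\<integral>\<^sup>+\<xi>. (\<Sum>m\<in>M. ennreal ((norm (\<theta> ((- \<xi> - c m) / l m)))\<^sup>2) * ennreal ((norm (H \<xi>))\<^sup>2)) \<partial>lborel)"
    by (subst nn_integral_sum) auto
  also have "\<dots> \<le> (\<integral>\<^sup>+\<xi>. ennreal (B\<^sup>2) * ennreal ((norm (H \<xi>))\<^sup>2) \<partial>lborel)"
  proof (intro nn_integral_mono)
    fix \<xi>
    have "(\<Sum>m\<in>M. ennreal ((norm (\<theta> ((- \<xi> - c m) / l m)))\<^sup>2)) \<le> (\<Sum>m\<in>M. ennreal (B\<^sup>2) * indicator (civ \<kappa> (c m) (l m)) (- \<xi>))"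
    proof (rule sum_mono)
      fix m assume m: "m \<in> M"
      show "ennreal ((norm (\<theta> ((- \<xi> - c m) / l m)))\<^sup>2) \<le> ennreal (B\<^sup>2) * indicator (civ \<kappa> (c m) (l m)) (- \<xi>)"
      proof (cases "\<theta> ((- \<xi> - c m) / l m) = 0")
        case False
        then have "- \<xi> \<in> civ \<kappa> (c m) (l m)"
          using \<theta>_supp[OF False] l[OF m] by (simp add: civ_def zero_le_divide_iff divide_le_eq)
        then show ?thesis using \<theta>_bound by (auto intro!: ennreal_leI power_mono)
      qed simp
    qed
    also have "\<dots> = ennreal (B\<^sup>2) * indicator (\<Union>m\<in>M. civ \<kappa> (c m) (l m)) (- \<xi>)"
      by (subst indicator_UN_disjoint[OF M disj]) (simp add: sum_distrib_left)
    also have "\<dots> \<le> ennreal (B\<^sup>2)" by (auto split: split_indicator)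
    finally show "(\<Sum>m\<in>M. ennreal ((norm (\<theta> ((- \<xi> - c m) / l m)))\<^sup>2) * ennreal ((norm (H \<xi>))\<^sup>2)) \<le> ennreal (B\<^sup>2) * ennreal ((norm (H \<xi>))\<^sup>2)"
      unfolding sum_distrib_right[symmetric] by (rule mult_right_mono) auto
  qed
  also have "\<dots> = ennreal (B\<^sup>2) * sqint UNIV H"
    by (simp add: nn_integral_cmult sqint_def)
  also have "\<dots> \<le> ennreal (B\<^sup>2) * sqint UNIV h"
    unfolding H_def by (intro mult_left_mono plancherel_le h) auto
  finally show ?thesis .
qed

subsection \<open>The distant part\<close>

text \<open>Writing \<open>k (y - t)\<close> as its value at the right end point plus an integral of \<open>k'\<close> reduces the
  integral over an interval to the exponential sums controlled by the large sieve.\<close>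

lemma op_by_parts:
  fixes c \<alpha> R l :: real and h :: "real \<Rightarrow> complex"
  assumes l: "l > 0" and R: "R > 0" and h: "integrable lborel h" and supp: "\<And>t. t \<notin> {\<alpha>..\<alpha> + R} \<Longrightarrow> h t = 0"
  defines "\<Phi> \<equiv> \<lambda>\<tau>. LINT t|lborel. ee (- c * t) * (h t * indicator {..\<tau>} t)"
  shows "op j c l h y = kern l j (y - (\<alpha> + R)) * \<Phi> (\<alpha> + R)
     + (LINT \<tau>|lborel. indicator {\<alpha>..\<alpha> + R} \<tau> *\<^sub>R kern l (Suc j) (y - \<tau>) * \<Phi> \<tau>)"
proof -
  let ?\<beta> = "\<alpha> + R"
  have [measurable]: "h \<in> borel_measurable borel" using h by auto
  have hm: "integrable lborel (modulate c h)"
    by (rule Bochner_Integration.integrable_bound[OF h]) auto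
  \<comment> \<open>The indicator of t <= \<tau>. Integrated against the modulated h it gives the
    partial integrals \<Phi>; integrated against A it gives increments of the kernel.\<close>
  define K :: "real \<times> real \<Rightarrow> complex" where "K z = (if snd z \<le> fst z then 1 else 0)" for z
  define A where "A \<tau> = indicator {\<alpha>..?\<beta>} \<tau> *\<^sub>R kern l (Suc j) (y - \<tau>)" for \<tau>
  have A: "integrable lborel A"
    unfolding A_def by (rule borel_integrable_compact) (auto intro!: continuous_intros)
  have \<Phi>: "\<Phi> \<tau> = (LINT t|lborel. modulate c h t * K (\<tau>, t))" for \<tau>
    unfolding \<Phi>_def K_def modulate_def
    by (intro Bochner_Integration.integral_cong) (auto split: split_indicator)
  have \<Phi>\<beta>: "\<Phi> ?\<beta> = (LINT t|lborel. modulate c h t)"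
    unfolding \<Phi>_def modulate_def using supp
    by (intro Bochner_Integration.integral_cong) (auto split: split_indicator)
  have D: "((\<lambda>\<tau>. - kern l j (y - \<tau>)) has_vector_derivative kern l (Suc j) (y - \<tau>)) (at \<tau> within S)" for \<tau> S
  proof -
    have "((\<lambda>\<tau>. kern l j (y - \<tau>)) has_vector_derivative (- 1) *\<^sub>R kern l (Suc j) (y - \<tau>)) (at \<tau>)"
      by (rule vector_diff_chain_at[unfolded o_def, OF _ kern_deriv])
         (auto intro!: derivative_eq_intros simp flip: has_real_derivative_iff_has_vector_derivative)
    from has_vector_derivative_minus[OF this] show ?thesis
      by (simp add: has_vector_derivative_at_within)
  qed
  have inner: "modulate c h t * (LINT \<tau>|lborel. A \<tau> * K (\<tau>, t)) = modulate c h t * (kern l j (y - t) - kern l j (y - ?\<beta>))" for t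
  proof (cases "t \<in> {\<alpha>..?\<beta>}")
    case True
    have "(LINT \<tau>|lborel. A \<tau> * K (\<tau>, t)) = (LINT \<tau>|lborel. indicator {t..?\<beta>} \<tau> *\<^sub>R kern l (Suc j) (y - \<tau>))"
      unfolding A_def K_def using True by (intro Bochner_Integration.integral_cong) (auto split: split_indicator)
    also have "\<dots> = - kern l j (y - ?\<beta>) - - kern l j (y - t)"
      using True by (intro integral_FTC_Icc D) (auto intro!: continuous_intros)
    finally show ?thesis by simp
  next
    case False
    then show ?thesis using supp by (simp add: modulate_def)
  qed
  have "(LINT \<tau>|lborel. A \<tau> * \<Phi> \<tau>) = (LINT t|lborel. modulate c h t * (LINT \<tau>|lborel. A \<tau> * K (\<tau>, t)))"
    unfolding \<Phi>
  proof (rule bounded_kernel_swap[where B=1])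
    have "K \<in> borel_measurable (borel \<Otimes>\<^sub>M borel)" unfolding K_def[abs_def] by measurable
    then show "K \<in> borel_measurable borel" by (simp add: borel_prod)
  qed (auto intro: A hm simp: K_def)
  also have "\<dots> = (LINT t|lborel. kern l j (y - t) * modulate c h t - kern l j (y - ?\<beta>) * modulate c h t)"
    unfolding inner by (simp add: algebra_simps)
  also have "\<dots> = op j c l h y - kern l j (y - ?\<beta>) * \<Phi> ?\<beta>"
    using op_integrable[OF l order_refl _ wint_integrable[OF h], of j y c] hm
    by (simp add: \<Phi>\<beta> op_def conv_def)
  finally show ?thesis by (simp add: A_def)
qed

text \<open>With \<delta> = min(l, 1/R), both kernel bounds give |k^(j)| <= D \<delta>^(j+1): the
  first for l <= 1/R, the second otherwise. Of the 2j + 2 factors \<delta> in the square, one is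
  retained as the weight of the large sieve and the others are estimated by 1/R.\<close>

lemma kern_distant_bound:
  "\<exists>C>0. \<forall>l R u. l > 0 \<and> R > 0 \<and> \<bar>u\<bar> \<ge> R / 2 \<longrightarrow>
     (norm (kern l j u))\<^sup>2 \<le> C * min l (1 / R) / R ^ (2 * j + 1)"
proof -
  obtain C where C: "C > 0" "\<And>l u. l > 0 \<Longrightarrow> norm (kern l j u) \<le> C * l ^ Suc j"
    "\<And>l u. l > 0 \<Longrightarrow> \<bar>u\<bar> ^ Suc j * norm (kern l j u) \<le> C"
    using kern_bounds[of j] by blast
  define D where "D = C * 2 ^ Suc j"
  have D: "D > 0" using C by (simp add: D_def)
  have "(norm (kern l j u))\<^sup>2 \<le> D\<^sup>2 * min l (1 / R) / R ^ (2 * j + 1)" if l: "l > 0" and R: "R > 0" and u: "\<bar>u\<bar> \<ge> R / 2" for l R u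
  proof -
    define \<delta> where "\<delta> = min l (1 / R)"
    have \<delta>: "\<delta> > 0" "\<delta> \<le> 1 / R" using l R by (auto simp: \<delta>_def)
    have "norm (kern l j u) \<le> D * \<delta> ^ Suc j"
    proof (cases "l \<le> 1 / R")
      case True
      have "C * l ^ Suc j \<le> D * l ^ Suc j"
        using C(1) l one_le_power[of "2::real" "Suc j"] by (intro mult_right_mono) (auto simp: D_def)
      then show ?thesis using C(2)[OF l, of u] True by (simp add: \<delta>_def)
    next
      case False
      have "(R / 2) ^ Suc j * norm (kern l j u) \<le> \<bar>u\<bar> ^ Suc j * norm (kern l j u)"
        using u R by (intro mult_right_mono power_mono) auto
      also have "\<dots> \<le> C" by (rule C(3)[OF l])
      finally have "norm (kern l j u) \<le> C / (R / 2) ^ Suc j"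
        using R by (subst pos_le_divide_eq) (auto simp: mult.commute)
      also have "\<dots> = D * (1 / R) ^ Suc j"
        using R by (simp add: D_def power_divide)
      finally show ?thesis using False by (simp add: \<delta>_def)
    qed
    then have "(norm (kern l j u))\<^sup>2 \<le> (D * \<delta> ^ Suc j)\<^sup>2" by (intro power_mono) auto
    also have "(\<delta> ^ Suc j)\<^sup>2 = \<delta> * \<delta> ^ (2 * j + 1)"
      by (simp only: power2_eq_square power_add[symmetric] power_Suc[symmetric]) (simp add: mult_2)
    then have "(D * \<delta> ^ Suc j)\<^sup>2 = D\<^sup>2 * \<delta> * \<delta> ^ (2 * j + 1)"
      by (simp only: power_mult_distrib mult.assoc)
    also have "\<dots> \<le> D\<^sup>2 * \<delta> * (1 / R) ^ (2 * j + 1)"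
      using \<delta> by (intro mult_left_mono power_mono) auto
    finally show ?thesis by (simp add: \<delta>_def power_divide)
  qed
  moreover have "D\<^sup>2 > 0" using D by simp
  ultimately show ?thesis by blast
qed

text \<open>The sieve is applied to \<Phi> at the right end point and, for each \<tau>, to
  \<Phi>(\<tau>). The integral over \<tau> costs R^2 after Cauchy-Schwarz, and the additional
  derivative of the kernel returns R^(-2), so both terms have size R^(-2j-1).\<close>

lemma distant_piece_le:
  "\<exists>C>0. \<forall>M c l h y \<alpha> R. finite M \<and> (\<forall>m\<in>M. l m > 0) \<and> disjoint_family_on (\<lambda>m. civ \<kappa> (c m) (l m)) M \<and>
     R > 0 \<and> integrable lborel h \<and> (\<forall>t. t \<notin> {\<alpha>..\<alpha> + R} \<longrightarrow> h t = 0) \<and> (\<forall>t\<in>{\<alpha>..\<alpha> + R}. \<bar>y - t\<bar> \<ge> R / 2) \<longrightarrow>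
     (\<Sum>m\<in>(M::nat set). ennreal ((norm (op j (c m) (l m) h y))\<^sup>2)) \<le> ennreal (C / R ^ (2 * j + 1)) * sqint {\<alpha>..\<alpha> + R} h"
proof -
  obtain C1 where C1: "C1 > 0" "\<And>l R u. l > 0 \<Longrightarrow> R > 0 \<Longrightarrow> \<bar>u\<bar> \<ge> R / 2 \<Longrightarrow>
     (norm (kern l j u))\<^sup>2 \<le> C1 * min l (1 / R) / R ^ (2 * j + 1)"
    using kern_distant_bound[of j] by blast
  obtain C2 where C2: "C2 > 0" "\<And>l R u. l > 0 \<Longrightarrow> R > 0 \<Longrightarrow> \<bar>u\<bar> \<ge> R / 2 \<Longrightarrow>
     (norm (kern l (Suc j) u))\<^sup>2 \<le> C2 * min l (1 / R) / R ^ (2 * Suc j + 1)"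
    using kern_distant_bound[of "Suc j"] by blast
  \<comment> \<open>A factor 2 from splitting the square of a sum in two and a factor 100 from
    \<open>large_sieve\<close>.\<close>
  define C where "C = 200 * (C1 + C2)"
  have main: "(\<Sum>m\<in>M. ennreal ((norm (op j (c m) (l m) h y))\<^sup>2)) \<le> ennreal (C / R ^ (2 * j + 1)) * sqint {\<alpha>..\<alpha> + R} h"
    if M: "finite M" and l: "\<And>m. m \<in> M \<Longrightarrow> l m > 0" and disj: "disjoint_family_on (\<lambda>m. civ \<kappa> (c m) (l m)) M"
      and R: "R > 0" and h: "integrable lborel h" and supp: "\<And>t. t \<notin> {\<alpha>..\<alpha> + R} \<Longrightarrow> h t = 0"
      and far: "\<And>t. t \<in> {\<alpha>..\<alpha> + R} \<Longrightarrow> \<bar>y - t\<bar> \<ge> R / 2"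
    for M :: "nat set" and c l h y \<alpha> R
  proof -
    have [measurable]: "h \<in> borel_measurable borel" using h by auto
    let ?E = "{\<alpha>..\<alpha> + R}"
    let ?\<beta> = "\<alpha> + R"
    define N where "N = sqint ?E h"
    define \<Phi> where "\<Phi> m \<tau> = (LINT t|lborel. ee (- c m * t) * (h t * indicator {..\<tau>} t))" for m \<tau>
    have [measurable]: "\<Phi> m \<in> borel_measurable borel" for m
    proof -
      have "h t * indicator {..\<tau>} t = (if t \<le> \<tau> then h t else 0)" for t \<tau>
        by (auto split: split_indicator)
      then show ?thesis unfolding \<Phi>_def[abs_def] by simp
    qed
    let ?\<delta> = "\<lambda>m. min (l m) (1 / R)"
    have sieve: "(\<Sum>m\<in>M. ennreal (?\<delta> m * (norm (\<Phi> m \<tau>))\<^sup>2)) \<le> 100 * N" for \<tau>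
    proof -
      have "(\<Sum>m\<in>M. ennreal (?\<delta> m * (norm (\<Phi> m \<tau>))\<^sup>2)) \<le> 100 * sqint ?E (\<lambda>t. h t * indicator {..\<tau>} t)"
        unfolding \<Phi>_def by (rule large_sieve[OF M l \<kappa> R half_iv_disjoint[OF disj]]) (use supp in auto)
      also have "sqint ?E (\<lambda>t. h t * indicator {..\<tau>} t) \<le> N"
        unfolding N_def by (intro sqint_mono) (auto split: split_indicator)
      finally show ?thesis by (simp add: mult_left_mono)
    qed
    have pt: "ennreal ((norm (op j (c m) (l m) h y))\<^sup>2)
       \<le> ennreal (2 * C1 / R ^ (2 * j + 1)) * ennreal (?\<delta> m * (norm (\<Phi> m ?\<beta>))\<^sup>2)
         + ennreal (2 * C2 / R ^ (2 * j + 2)) * (\<integral>\<^sup>+\<tau>\<in>?E. ennreal (?\<delta> m * (norm (\<Phi> m \<tau>))\<^sup>2) \<partial>lborel)" if m: "m \<in> M" for m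
    proof -
      note lm = l[OF m]
      have \<delta>0: "?\<delta> m \<ge> 0" using lm R by simp
      define I where "I = (LINT \<tau>|lborel. indicator ?E \<tau> *\<^sub>R kern (l m) (Suc j) (y - \<tau>) * \<Phi> m \<tau>)"
      have "(ennreal (norm I))\<^sup>2 \<le> (\<integral>\<^sup>+\<tau>\<in>?E. ennreal (norm (kern (l m) (Suc j) (y - \<tau>) * \<Phi> m \<tau>)) \<partial>lborel)\<^sup>2"
      proof (rule power_mono)
        have "ennreal (norm I) \<le> (\<integral>\<^sup>+\<tau>. ennreal (norm (indicator ?E \<tau> *\<^sub>R kern (l m) (Suc j) (y - \<tau>) * \<Phi> m \<tau>)) \<partial>lborel)"
          unfolding I_def by (rule norm_integral_le_nn_integral)
        also have "\<dots> = (\<integral>\<^sup>+\<tau>\<in>?E. ennreal (norm (kern (l m) (Suc j) (y - \<tau>) * \<Phi> m \<tau>)) \<partial>lborel)"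
          by (intro nn_integral_cong) (auto split: split_indicator)
        finally show "ennreal (norm I) \<le> \<dots>" .
      qed simp
      also have "\<dots> \<le> emeasure lborel ?E * sqint ?E (\<lambda>\<tau>. kern (l m) (Suc j) (y - \<tau>) * \<Phi> m \<tau>)"
        by (rule sqint_L1) measurable
      also have "\<dots> \<le> ennreal R * (\<integral>\<^sup>+\<tau>. ennreal (C2 / R ^ (2 * Suc j + 1)) * (ennreal (?\<delta> m * (norm (\<Phi> m \<tau>))\<^sup>2) * indicator ?E \<tau>) \<partial>lborel)"
      proof (intro mult_mono)
        show "sqint ?E (\<lambda>\<tau>. kern (l m) (Suc j) (y - \<tau>) * \<Phi> m \<tau>)
          \<le> (\<integral>\<^sup>+\<tau>. ennreal (C2 / R ^ (2 * Suc j + 1)) * (ennreal (?\<delta> m * (norm (\<Phi> m \<tau>))\<^sup>2) * indicator ?E \<tau>) \<partial>lborel)"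
          unfolding sqint_def
        proof (intro nn_integral_mono)
          fix \<tau>
          show "ennreal ((norm (kern (l m) (Suc j) (y - \<tau>) * \<Phi> m \<tau>))\<^sup>2) * indicator ?E \<tau>
            \<le> ennreal (C2 / R ^ (2 * Suc j + 1)) * (ennreal (?\<delta> m * (norm (\<Phi> m \<tau>))\<^sup>2) * indicator ?E \<tau>)"
          proof (cases "\<tau> \<in> ?E")
            case True
            have "(norm (kern (l m) (Suc j) (y - \<tau>) * \<Phi> m \<tau>))\<^sup>2 = (norm (kern (l m) (Suc j) (y - \<tau>)))\<^sup>2 * (norm (\<Phi> m \<tau>))\<^sup>2"
              by (simp add: norm_mult power_mult_distrib)
            also have "\<dots> \<le> C2 * ?\<delta> m / R ^ (2 * Suc j + 1) * (norm (\<Phi> m \<tau>))\<^sup>2"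
              by (intro mult_right_mono C2(2) lm R far True) auto
            also have "\<dots> = C2 / R ^ (2 * Suc j + 1) * (?\<delta> m * (norm (\<Phi> m \<tau>))\<^sup>2)" by simp
            finally have "ennreal ((norm (kern (l m) (Suc j) (y - \<tau>) * \<Phi> m \<tau>))\<^sup>2) \<le> ennreal (C2 / R ^ (2 * Suc j + 1) * (?\<delta> m * (norm (\<Phi> m \<tau>))\<^sup>2))"
              by (rule ennreal_leI)
            also have "\<dots> = ennreal (C2 / R ^ (2 * Suc j + 1)) * ennreal (?\<delta> m * (norm (\<Phi> m \<tau>))\<^sup>2)"
              using \<delta>0 C2(1) R by (intro ennreal_mult) auto
            finally show ?thesis using True by simp
          qed simp
        qed
      qed (use R in auto)
      also have "\<dots> = ennreal (C2 / R ^ (2 * j + 2)) * (\<integral>\<^sup>+\<tau>\<in>?E. ennreal (?\<delta> m * (norm (\<Phi> m \<tau>))\<^sup>2) \<partial>lborel)"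
      proof -
        have "R * (C2 / R ^ (2 * Suc j + 1)) = C2 / R ^ (2 * j + 2)" using R by simp
        then have "ennreal R * ennreal (C2 / R ^ (2 * Suc j + 1)) = ennreal (C2 / R ^ (2 * j + 2))"
          using R C2(1) by (subst ennreal_mult[symmetric]) auto
        then show ?thesis
          by (subst nn_integral_cmult) (auto simp: mult.assoc[symmetric])
      qed
      finally have I: "ennreal ((norm I)\<^sup>2) \<le> \<dots>" by (simp add: ennreal_power)
      have "op j (c m) (l m) h y = kern (l m) j (y - ?\<beta>) * \<Phi> m ?\<beta> + I"
        unfolding I_def \<Phi>_def by (rule op_by_parts[OF lm R h supp])
      then have "(norm (op j (c m) (l m) h y))\<^sup>2 \<le> 2 * (norm (kern (l m) j (y - ?\<beta>) * \<Phi> m ?\<beta>))\<^sup>2 + 2 * (norm I)\<^sup>2"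
        using norm_add_sq_le by metis
      also have "(norm (kern (l m) j (y - ?\<beta>) * \<Phi> m ?\<beta>))\<^sup>2 = (norm (kern (l m) j (y - ?\<beta>)))\<^sup>2 * (norm (\<Phi> m ?\<beta>))\<^sup>2"
        by (simp add: norm_mult power_mult_distrib)
      also have "\<dots> \<le> (C1 * ?\<delta> m / R ^ (2 * j + 1)) * (norm (\<Phi> m ?\<beta>))\<^sup>2"
        using R by (intro mult_right_mono C1(2) lm far) auto
      finally have "ennreal ((norm (op j (c m) (l m) h y))\<^sup>2) \<le> ennreal ((2 * C1 / R ^ (2 * j + 1)) * (?\<delta> m * (norm (\<Phi> m ?\<beta>))\<^sup>2) + 2 * (norm I)\<^sup>2)"
        by (intro ennreal_leI) (simp add: mult_ac)
      also have "\<dots> = ennreal (2 * C1 / R ^ (2 * j + 1)) * ennreal (?\<delta> m * (norm (\<Phi> m ?\<beta>))\<^sup>2) + 2 * ennreal ((norm I)\<^sup>2)"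
      proof -
        have ep: "ennreal (a * b + 2 * z) = ennreal a * ennreal b + 2 * ennreal z" if "a \<ge> 0" "b \<ge> 0" "z \<ge> 0" for a b z :: real
          using that by (simp add: ennreal_mult)
        show ?thesis by (rule ep) (use C1(1) R \<delta>0 in auto)
      qed
      also have "2 * ennreal ((norm I)\<^sup>2) \<le> 2 * (ennreal (C2 / R ^ (2 * j + 2)) * (\<integral>\<^sup>+\<tau>\<in>?E. ennreal (?\<delta> m * (norm (\<Phi> m \<tau>))\<^sup>2) \<partial>lborel))"
        by (intro mult_left_mono I) auto
      also have "\<dots> = ennreal (2 * C2 / R ^ (2 * j + 2)) * (\<integral>\<^sup>+\<tau>\<in>?E. ennreal (?\<delta> m * (norm (\<Phi> m \<tau>))\<^sup>2) \<partial>lborel)"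
      proof -
        have "2 * ennreal (C2 / R ^ (2 * j + 2)) = ennreal (2 * (C2 / R ^ (2 * j + 2)))"
          using C2(1) R by (subst ennreal_mult) auto
        then show ?thesis by (simp add: mult.assoc[symmetric])
      qed
      finally show ?thesis by (simp add: add_left_mono)
    qed
    have "(\<Sum>m\<in>M. ennreal ((norm (op j (c m) (l m) h y))\<^sup>2))
      \<le> (\<Sum>m\<in>M. ennreal (2 * C1 / R ^ (2 * j + 1)) * ennreal (?\<delta> m * (norm (\<Phi> m ?\<beta>))\<^sup>2)
         + ennreal (2 * C2 / R ^ (2 * j + 2)) * (\<integral>\<^sup>+\<tau>\<in>?E. ennreal (?\<delta> m * (norm (\<Phi> m \<tau>))\<^sup>2) \<partial>lborel))"
      by (intro sum_mono pt)
    also have "\<dots> = ennreal (2 * C1 / R ^ (2 * j + 1)) * (\<Sum>m\<in>M. ennreal (?\<delta> m * (norm (\<Phi> m ?\<beta>))\<^sup>2))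
       + ennreal (2 * C2 / R ^ (2 * j + 2)) * (\<integral>\<^sup>+\<tau>. (\<Sum>m\<in>M. ennreal (?\<delta> m * (norm (\<Phi> m \<tau>))\<^sup>2)) * indicator ?E \<tau> \<partial>lborel)"
      by (simp add: sum.distrib sum_distrib_left[symmetric] sum_distrib_right nn_integral_sum)
    also have "\<dots> \<le> ennreal (2 * C1 / R ^ (2 * j + 1)) * (100 * N)
       + ennreal (2 * C2 / R ^ (2 * j + 2)) * (\<integral>\<^sup>+\<tau>. (100 * N) * indicator ?E \<tau> \<partial>lborel)"
      by (intro add_mono mult_left_mono nn_integral_mono mult_right_mono sieve) auto
    also have "(\<integral>\<^sup>+\<tau>. (100 * N) * indicator ?E \<tau> \<partial>lborel) = (100 * N) * ennreal R"
      using R by (simp add: nn_integral_cmult)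
    also have "ennreal (2 * C2 / R ^ (2 * j + 2)) * (100 * N * ennreal R) = ennreal (2 * C2 / R ^ (2 * j + 1)) * (100 * N)"
    proof -
      have "2 * C2 / R ^ (2 * j + 2) * R = 2 * C2 / R ^ (2 * j + 1)" using R by simp
      then have "ennreal (2 * C2 / R ^ (2 * j + 2)) * ennreal R = ennreal (2 * C2 / R ^ (2 * j + 1))"
        using R C2(1) by (subst ennreal_mult[symmetric]) auto
      moreover have "x * (y * z) = x * z * y" for x y z :: ennreal by (simp only: mult_ac)
      ultimately show ?thesis by (simp only:)
    qed
    also have "ennreal (2 * C1 / R ^ (2 * j + 1)) * (100 * N) + ennreal (2 * C2 / R ^ (2 * j + 1)) * (100 * N)
      = ennreal (C / R ^ (2 * j + 1)) * N"
    proof -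
      have ep: "ennreal ((a + b) * 100) = (ennreal a + ennreal b) * 100" if "a \<ge> 0" "b \<ge> 0" for a b :: real
        using that by (subst ennreal_mult) auto
      have "C / R ^ (2 * j + 1) = (2 * C1 / R ^ (2 * j + 1) + 2 * C2 / R ^ (2 * j + 1)) * 100"
        by (simp add: C_def algebra_simps add_divide_distrib)
      also have "ennreal \<dots> = (ennreal (2 * C1 / R ^ (2 * j + 1)) + ennreal (2 * C2 / R ^ (2 * j + 1))) * 100"
        by (rule ep) (use C1(1) C2(1) R in auto)
      finally have "ennreal (C / R ^ (2 * j + 1)) = (ennreal (2 * C1 / R ^ (2 * j + 1)) + ennreal (2 * C2 / R ^ (2 * j + 1))) * 100" .
      moreover have "a * (100 * z) + b * (100 * z) = (a + b) * 100 * z" for a b z :: ennreal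
        by (simp only: distrib_right mult.assoc)
      ultimately show ?thesis by (simp only:)
    qed
    finally show ?thesis unfolding N_def .
  qed
  have "\<forall>M c l h y \<alpha> R. finite M \<and> (\<forall>m\<in>M. l m > 0) \<and> disjoint_family_on (\<lambda>m. civ \<kappa> (c m) (l m)) M \<and>
     R > 0 \<and> integrable lborel h \<and> (\<forall>t. t \<notin> {\<alpha>..\<alpha> + R} \<longrightarrow> h t = 0) \<and> (\<forall>t\<in>{\<alpha>..\<alpha> + R}. \<bar>y - t\<bar> \<ge> R / 2) \<longrightarrow>
     (\<Sum>m\<in>(M::nat set). ennreal ((norm (op j (c m) (l m) h y))\<^sup>2)) \<le> ennreal (C / R ^ (2 * j + 1)) * sqint {\<alpha>..\<alpha> + R} h"
    by (intro allI impI; elim conjE; rule main; simp)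
  moreover have "C > 0" using C1 C2 by (simp add: C_def)
  ultimately show ?thesis by (intro exI[of _ C] conjI)
qed


lemma kern_fourier:
  assumes "l > 0"
  shows "kern l j u = (LINT \<xi>|lborel. (\<theta> (\<xi> / l) * (2 * pi * \<i> * \<xi>) ^ j) * ee (u * \<xi>))"
proof -
  have "(LINT \<xi>|lborel. (\<theta> (\<xi> / l) * (2 * pi * \<i> * \<xi>) ^ j) * ee (u * \<xi>))
     = \<bar>l\<bar> *\<^sub>R (LINT \<xi>|lborel. (\<theta> ((0 + l * \<xi>) / l) * (2 * pi * \<i> * of_real (0 + l * \<xi>)) ^ j) * ee (u * (0 + l * \<xi>)))"
    using assms by (intro lborel_integral_real_affine) auto
  also have "\<dots> = \<bar>l\<bar> *\<^sub>R (LINT \<xi>|lborel. of_real (l ^ j) * (\<theta> \<xi> * (2 * pi * \<i> * \<xi>) ^ j * ee (l * u * \<xi>)))"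
    using assms by (simp add: power_mult_distrib mult_ac)
  also have "\<dots> = kern l j u"
    using assms by (simp only: integral_mult_right_zero kern_def osc_def scaleR_conv_of_real
      abs_of_pos power_Suc of_real_mult mult.assoc)
  finally show ?thesis ..
qed

lemma integrable_symbol_scaled_power:
  assumes "l > 0"
  shows "integrable lborel (\<lambda>\<xi>. \<theta> (\<xi> / l) * (2 * pi * \<i> * \<xi>) ^ j)"
proof (rule integrable_compact_support[where a="- l" and b=l and B="B * (2 * pi * l) ^ j"])
  show "norm (\<theta> (\<xi> / l) * (2 * pi * \<i> * \<xi>) ^ j) \<le> B * (2 * pi * l) ^ j" for \<xi>
  proof (cases "\<xi> \<in> {- l..l}")
    case True
    then have "norm ((2 * pi * \<i> * \<xi>) ^ j) \<le> (2 * pi * l) ^ j"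
      unfolding norm_power by (intro power_mono) (auto simp: norm_mult abs_le_iff)
    then show ?thesis unfolding norm_mult using \<theta>_bound B_nonneg by (intro mult_mono) auto
  next
    case False
    then show ?thesis using symbol_scaled_outside[OF assms False] B_nonneg assms by simp
  qed
qed (use symbol_scaled_outside[OF assms] in auto)

subsection \<open>Polynomials are annihilated\<close>

text \<open>The symbol vanishes to order \<open>r\<close> at frequency \<open>- c\<close>, where the spectrum of a modulated polynomial
  is concentrated. The integral over \<open>u\<close> is evaluated by Gaussian summation.\<close>

lemma kern_moment_zero:
  assumes l: "l > 0" and j: "j < r"
    and van: "\<And>\<xi>. \<bar>\<xi>\<bar> ^ r * norm (\<theta> (\<xi> / l)) \<le> K * \<bar>\<xi> + c\<bar> ^ r"
  shows "(LINT u|lborel. of_real u ^ j * ee (c * u) * kern l r u) = 0"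
proof -
  define \<epsilon> :: "nat \<Rightarrow> real" where "\<epsilon> n = 1 / Suc n" for n
  have \<epsilon>: "\<epsilon> n > 0" for n by (simp add: \<epsilon>_def)
  have \<epsilon>0: "\<epsilon> \<longlonglongrightarrow> 0" unfolding \<epsilon>_def[abs_def] by (rule LIMSEQ_Suc[OF lim_1_over_n])
  define A where "A n u = of_real u ^ j * of_real (gam (\<epsilon> n * u)) * ee (c * u)" for n u
  have [measurable]: "A n \<in> borel_measurable borel" for n unfolding A_def[abs_def] by measurable
  define J where "J n = (LINT u|lborel. A n u * kern l r u)" for n
  define S where "S \<xi> = \<theta> (\<xi> / l) * (2 * pi * \<i> * \<xi>) ^ r" for \<xi>
  have [measurable]: "S \<in> borel_measurable borel" unfolding S_def by measurable
  have S: "integrable lborel S" unfolding S_def by (rule integrable_symbol_scaled_power[OF l])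
  have K0: "K \<ge> 0"
  proof -
    \<comment> \<open>At \<xi> = 1 - c the right-hand side of \<open>van\<close> is K
      itself.\<close>
    have "0 \<le> \<bar>1 - c\<bar> ^ r * norm (\<theta> ((1 - c) / l))" by simp
    also have "\<dots> \<le> K * \<bar>(1 - c) + c\<bar> ^ r" by (rule van)
    finally show ?thesis by simp
  qed
  obtain C where "C > 0" and C: "\<And>u. norm (kern l r u) \<le> C * wt (real (Suc r)) u"
    using kern_wt[OF l order_refl] by blast
  have lim: "J \<longlonglongrightarrow> (LINT u|lborel. of_real u ^ j * ee (c * u) * kern l r u)"
    unfolding J_def
  proof (rule integral_dominated_convergence)
    \<comment> \<open>Since j < r, the power u^j against decay |u|^(-r-1) leaves at most |u|^(-2),
      which is integrable at infinity.\<close>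
    have "wint (real (Suc r)) (\<lambda>u. of_real u ^ j)" using j by (intro wint_power) auto
    then show "integrable lborel (\<lambda>u. C * (norm (complex_of_real u ^ j) * wt (real (Suc r)) u))"
      unfolding wint_def by (intro integrable_mult_right) auto
    show "AE u in lborel. (\<lambda>n. A n u * kern l r u) \<longlonglongrightarrow> of_real u ^ j * ee (c * u) * kern l r u"
    proof (intro AE_I2 tendsto_mult_right)
      fix u
      have "(\<lambda>n. \<epsilon> n * u) \<longlonglongrightarrow> 0 * u" by (intro tendsto_mult_right \<epsilon>0)
      then have "(\<lambda>n. gam (\<epsilon> n * u)) \<longlonglongrightarrow> gam (0 * u)"
        by (intro continuous_on_tendsto_compose[of UNIV gam]) (auto intro!: continuous_intros)
      then have "(\<lambda>n. of_real u ^ j * complex_of_real (gam (\<epsilon> n * u)) * ee (c * u)) \<longlonglongrightarrow> of_real u ^ j * of_real 1 * ee (c * u)"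
        by (intro tendsto_intros) simp
      then show "(\<lambda>n. A n u) \<longlonglongrightarrow> of_real u ^ j * ee (c * u)" by (simp add: A_def)
    qed
    show "AE u in lborel. norm (A n u * kern l r u) \<le> C * (norm (complex_of_real u ^ j) * wt (real (Suc r)) u)" for n
    proof (rule AE_I2)
      fix u
      have "norm (A n u) \<le> norm (complex_of_real u ^ j) * 1"
        unfolding A_def norm_mult by (simp add: mult_left_le)
      then have "norm (A n u * kern l r u) \<le> norm (complex_of_real u ^ j) * (C * wt (real (Suc r)) u)"
        unfolding norm_mult by (intro mult_mono C) auto
      then show "norm (A n u * kern l r u) \<le> C * (norm (complex_of_real u ^ j) * wt (real (Suc r)) u)"
        by (simp add: mult_ac)
    qed
  qed (auto simp: A_def)
  define G where "G = (\<integral>\<^sup>+v. ennreal (\<bar>v\<bar> ^ r * norm (gd j v)) \<partial>lborel)"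
  have G: "G < \<infinity>"
  proof -
    obtain D where D: "\<And>u. (1 + \<bar>u\<bar>) ^ (r + 2) * norm (gd j u) \<le> D" using gd_bounded by metis
    have "integrable lborel (\<lambda>v. complex_of_real (\<bar>v\<bar> ^ r) * gd j v)"
    proof (rule integrable_decay)
      fix v :: real
      have "(1 + \<bar>v\<bar>)\<^sup>2 * norm (complex_of_real (\<bar>v\<bar> ^ r) * gd j v) = (1 + \<bar>v\<bar>)\<^sup>2 * (\<bar>v\<bar> ^ r * norm (gd j v))"
        by (simp add: norm_mult norm_power)
      also have "\<dots> \<le> (1 + \<bar>v\<bar>)\<^sup>2 * ((1 + \<bar>v\<bar>) ^ r * norm (gd j v))"
        by (intro mult_left_mono mult_right_mono power_mono) auto
      also have "\<dots> = (1 + \<bar>v\<bar>) ^ (r + 2) * norm (gd j v)" by (simp add: power_add power2_eq_square mult_ac)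
      also have "\<dots> \<le> D" by (rule D)
      finally show "(1 + \<bar>v\<bar>)\<^sup>2 * norm (complex_of_real (\<bar>v\<bar> ^ r) * gd j v) \<le> D" .
    qed auto
    then show ?thesis unfolding G_def integrable_iff_bounded by (simp add: norm_mult norm_power)
  qed
  define D where "D = (2 * pi) ^ r * K * enn2real G"
  \<comment> \<open>Fubini pairs the symbol S with the transform of A n, a j-th Gaussian derivative
    of width \<epsilon> around \<xi> = - c and height \<epsilon>^(-j-1). In the variable v = (\<xi>
    + c)/\<epsilon> the vanishing of S contributes \<epsilon>^r and the substitution contributes
    \<epsilon>; altogether \<epsilon>^(r-j) remains.\<close>
  have bound: "norm (J n) \<le> D * \<epsilon> n ^ (r - j)" for n
  proof -
    let ?e = "\<epsilon> n"
    have A: "integrable lborel (A n)"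
    proof -
      have "integrable lborel (\<lambda>u. complex_of_real ((0 + ?e * u) ^ j * gam (0 + ?e * u)))"
        using \<epsilon>[of n] by (intro lborel_integrable_real_affine integrable_power_gam) auto
      then have "integrable lborel (\<lambda>u. (1 / of_real (?e ^ j)) * complex_of_real ((?e * u) ^ j * gam (?e * u)))"
        by (intro integrable_mult_right) simp
      then have "integrable lborel (\<lambda>u. complex_of_real (u ^ j * gam (?e * u)))"
        using \<epsilon>[of n] by (simp add: power_mult_distrib)
      then show ?thesis
        by (rule Bochner_Integration.integrable_bound) (auto simp: A_def norm_mult)
    qed
    have inner: "(LINT u|lborel. A n u * ee (u * \<xi>)) = of_real (1 / ?e ^ Suc j) * (gd j ((\<xi> + c) / ?e) / (2 * pi * \<i>) ^ j)" for \<xi>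
    proof -
      have e2: "ee (c * u) * ee (u * \<xi>) = ee ((\<xi> + c) / ?e * (?e * u))" for u
      proof -
        have "(\<xi> + c) / ?e * (?e * u) = c * u + u * \<xi>"
          using \<epsilon>[of n] by (simp add: algebra_simps add_divide_distrib)
        then show ?thesis by (simp only: ee_add)
      qed
      have "gd j ((\<xi> + c) / ?e) / (2 * pi * \<i>) ^ j = (LINT u|lborel. of_real (u ^ j * gam u) * ee ((\<xi> + c) / ?e * u))"
        by (rule gam_moment_fourier[symmetric])
      also have "\<dots> = \<bar>?e\<bar> *\<^sub>R (LINT u|lborel. of_real ((0 + ?e * u) ^ j * gam (0 + ?e * u)) * ee ((\<xi> + c) / ?e * (0 + ?e * u)))"
        using \<epsilon>[of n] by (intro lborel_integral_real_affine) auto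
      also have "\<dots> = \<bar>?e\<bar> *\<^sub>R (LINT u|lborel. of_real (?e ^ j) * (A n u * ee (u * \<xi>)))"
        unfolding A_def add_0 e2[symmetric] by (simp add: power_mult_distrib mult_ac)
      also have "\<dots> = of_real (?e ^ Suc j) * (LINT u|lborel. A n u * ee (u * \<xi>))"
        using \<epsilon>[of n] by (simp add: scaleR_conv_of_real)
      finally show ?thesis using \<epsilon>[of n] by simp
    qed
    have "J n = (LINT u|lborel. A n u * (LINT \<xi>|lborel. S \<xi> * ee (u * \<xi>)))"
      unfolding J_def S_def kern_fourier[OF l] ..
    also have "\<dots> = (LINT \<xi>|lborel. S \<xi> * (LINT u|lborel. A n u * ee (u * \<xi>)))"
      by (rule fourier_swap[OF A S])
    finally have "ennreal (norm (J n)) \<le> (\<integral>\<^sup>+\<xi>. ennreal (norm (S \<xi> * (LINT u|lborel. A n u * ee (u * \<xi>)))) \<partial>lborel)"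
      using norm_integral_le_nn_integral by metis
    also have "\<dots> \<le> (\<integral>\<^sup>+\<xi>. ennreal ((2 * pi) ^ r * K * (\<bar>\<xi> + c\<bar> ^ r * (1 / ?e ^ Suc j * norm (gd j ((\<xi> + c) / ?e))))) \<partial>lborel)"
    proof (intro nn_integral_mono ennreal_leI)
      fix \<xi>
      have "norm (S \<xi>) = (2 * pi) ^ r * (\<bar>\<xi>\<bar> ^ r * norm (\<theta> (\<xi> / l)))"
        by (simp add: S_def norm_mult norm_power power_mult_distrib)
      also have "\<dots> \<le> (2 * pi) ^ r * (K * \<bar>\<xi> + c\<bar> ^ r)"
        by (intro mult_left_mono van) auto
      finally have 1: "norm (S \<xi>) \<le> (2 * pi) ^ r * K * \<bar>\<xi> + c\<bar> ^ r" by simp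
      have pi1: "1 \<le> (2 * pi) ^ j" using pi_gt3 by (intro one_le_power) auto
      have "norm (gd j ((\<xi> + c) / ?e) / (2 * pi * \<i>) ^ j) = norm (gd j ((\<xi> + c) / ?e)) / (2 * pi) ^ j"
        by (simp add: norm_divide norm_mult norm_power)
      also have "\<dots> \<le> norm (gd j ((\<xi> + c) / ?e)) / 1"
        using pi1 by (intro divide_left_mono) auto
      finally have "norm (LINT u|lborel. A n u * ee (u * \<xi>)) \<le> 1 / ?e ^ Suc j * norm (gd j ((\<xi> + c) / ?e))"
        unfolding inner norm_mult using \<epsilon>[of n]
        by (intro mult_mono) (auto simp: norm_divide norm_mult norm_power)
      with 1 have "norm (S \<xi>) * norm (LINT u|lborel. A n u * ee (u * \<xi>)) \<le> ((2 * pi) ^ r * K * \<bar>\<xi> + c\<bar> ^ r) * (1 / ?e ^ Suc j * norm (gd j ((\<xi> + c) / ?e)))"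
        using K0 by (intro mult_mono) auto
      then show "norm (S \<xi> * (LINT u|lborel. A n u * ee (u * \<xi>))) \<le> (2 * pi) ^ r * K * (\<bar>\<xi> + c\<bar> ^ r * (1 / ?e ^ Suc j * norm (gd j ((\<xi> + c) / ?e))))"
        by (simp add: norm_mult mult.assoc)
    qed
    also have "\<dots> = ennreal \<bar>?e\<bar> * (\<integral>\<^sup>+v. ennreal ((2 * pi) ^ r * K * (\<bar>(- c + ?e * v) + c\<bar> ^ r * (1 / ?e ^ Suc j * norm (gd j (((- c + ?e * v) + c) / ?e))))) \<partial>lborel)"
      using \<epsilon>[of n] by (intro nn_integral_real_affine) auto
    also have "\<dots> = (\<integral>\<^sup>+v. ennreal ((2 * pi) ^ r * K * ?e ^ (r - j)) * ennreal (\<bar>v\<bar> ^ r * norm (gd j v)) \<partial>lborel)"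
    proof (subst nn_integral_cmult[symmetric])
      have "?e * ((2 * pi) ^ r * K * (\<bar>(- c + ?e * v) + c\<bar> ^ r * (1 / ?e ^ Suc j * norm (gd j (((- c + ?e * v) + c) / ?e)))))
        = (2 * pi) ^ r * K * ?e ^ (r - j) * (\<bar>v\<bar> ^ r * norm (gd j v))" for v
      proof -
        have "?e ^ r = ?e ^ (r - j) * ?e ^ j" using j by (simp flip: power_add)
        then show ?thesis using \<epsilon>[of n] by (simp add: abs_mult power_mult_distrib)
      qed
      then show "(\<integral>\<^sup>+v. ennreal \<bar>?e\<bar> * ennreal ((2 * pi) ^ r * K * (\<bar>(- c + ?e * v) + c\<bar> ^ r * (1 / ?e ^ Suc j * norm (gd j (((- c + ?e * v) + c) / ?e))))) \<partial>lborel)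
        = (\<integral>\<^sup>+v. ennreal ((2 * pi) ^ r * K * ?e ^ (r - j)) * ennreal (\<bar>v\<bar> ^ r * norm (gd j v)) \<partial>lborel)"
        using \<epsilon>[of n] K0 by (simp add: abs_of_pos flip: ennreal_mult)
    qed auto
    also have "\<dots> = ennreal ((2 * pi) ^ r * K * ?e ^ (r - j)) * G"
      by (simp add: nn_integral_cmult G_def)
    also have "\<dots> = ennreal (D * ?e ^ (r - j))"
    proof -
      have "ennreal a * G = ennreal (a * enn2real G)" if "a \<ge> 0" for a
        using that G by (cases G) (auto simp: ennreal_mult)
      then show ?thesis using K0 \<epsilon>[of n] by (simp add: D_def mult_ac)
    qed
    finally show ?thesis using K0 \<epsilon>[of n] by (subst (asm) ennreal_le_iff) (auto simp: D_def)
  qed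
  have "(\<lambda>n. D * \<epsilon> n ^ (r - j)) \<longlonglongrightarrow> D * 0 ^ (r - j)"
    by (intro tendsto_intros \<epsilon>0)
  then have "(\<lambda>n. D * \<epsilon> n ^ (r - j)) \<longlonglongrightarrow> 0" using j by (simp add: power_0_left)
  then have "J \<longlonglongrightarrow> 0" by (rule Lim_null_comparison[rotated]) (use bound in auto)
  then show ?thesis using lim by (rule LIMSEQ_unique[rotated])
qed

text \<open>For fixed y, p(y - u) is a polynomial q in u of degree below r, so the integral is a
  combination of the moments that \<open>kern_moment_zero\<close> makes vanish.\<close>

lemma op_poly_zero:
  assumes l: "l > 0" and p: "p \<in> polys_less r"
    and van: "\<And>\<xi>. \<bar>\<xi>\<bar> ^ r * norm (\<theta> (\<xi> / l)) \<le> K * \<bar>\<xi> + c\<bar> ^ r"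
  shows "op r c l (\<lambda>t. poly p (of_real t)) y = 0"
proof -
  define q where "q = pcompose p [:complex_of_real y, - 1:]"
  have q: "q \<in> polys_less r"
    using p by (auto simp: q_def polys_less_def degree_pcompose)
  have int: "integrable lborel (\<lambda>u. of_real u ^ j * ee (c * u) * kern l r u)" if "j < r" for j
  proof -
    obtain C where "\<And>u. norm (kern l r u) \<le> C * wt (real (Suc r)) u" using kern_wt[OF l order_refl] by blast
    moreover have "wint (real (Suc r)) (\<lambda>u. of_real (- u) ^ j * ee (c * (- u)))"
      by (rule wint_norm_le[OF wint_power[of j]]) (use that in \<open>auto simp: norm_mult norm_power\<close>)
    ultimately have "integrable lborel (\<lambda>t. kern l r (0 - t) * (of_real (- t) ^ j * ee (c * (- t))))"
      by (intro conv_integrable) auto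
    then have "integrable lborel (\<lambda>t. (\<lambda>t. kern l r (0 - t) * (of_real (- t) ^ j * ee (c * (- t)))) (0 + (- 1) * t))"
      by (intro lborel_integrable_real_affine) auto
    then show ?thesis by (simp add: mult_ac)
  qed
  have "op r c l (\<lambda>t. poly p (of_real t)) y
     = \<bar>- 1\<bar> *\<^sub>R (LINT u|lborel. kern l r (y - (y + (- 1) * u)) * modulate c (\<lambda>t. poly p (of_real t)) (y + (- 1) * u))"
    unfolding op_def conv_def by (intro lborel_integral_real_affine) auto
  also have "\<dots> = (LINT u|lborel. (\<Sum>j<r. ee (- c * y) * coeff q j * (of_real u ^ j * ee (c * u) * kern l r u)))"
  proof -
    have 1: "poly p (of_real y - of_real u) = (\<Sum>j<r. coeff q j * of_real u ^ j)" for u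
      using poly_eq_sum_polys_less[OF q, of "of_real u"] by (simp add: q_def poly_pcompose)
    have 2: "ee (- (c * (y - u))) = ee (- (c * y)) * ee (c * u)" for u
      by (simp add: algebra_simps flip: ee_add)
    show ?thesis
      by (simp add: modulate_def 1 2 sum_distrib_left sum_distrib_right mult_ac)
  qed
  also have "\<dots> = (\<Sum>j<r. ee (- c * y) * coeff q j * (LINT u|lborel. of_real u ^ j * ee (c * u) * kern l r u))"
    using int by (subst Bochner_Integration.integral_sum) auto
  also have "\<dots> = 0"
    using kern_moment_zero[OF l _ van] by simp
  finally show ?thesis .
qed

subsection \<open>Summation of the distant pieces\<close>

text \<open>The annulus between radii 2^k \<rho> and 2^(k+1) \<rho> consists of two intervals of
  length 2^k \<rho>. The growth 2^(k(2 \<mu> + 1)) of h against the factor 2^(-k(2r+1)) of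
  \<open>distant_piece_le\<close> makes its l2 contribution decay like 2^(-(r - \<mu>) k). The
  contributions are added by Minkowski's inequality in l2.\<close>

lemma distant_part_le:
  assumes \<mu>: "\<mu> < real r"
  shows "\<exists>C>0. \<forall>M c l h x y \<rho> E. finite M \<and> (\<forall>m\<in>M. l m > 0) \<and> disjoint_family_on (\<lambda>m. civ \<kappa> (c m) (l m)) M \<and>
     \<rho> > 0 \<and> E \<ge> 0 \<and> \<bar>y - x\<bar> \<le> \<rho> / 2 \<and> wint (real (Suc r)) h \<and>
     (\<forall>k. sqint {x - 2 ^ k * \<rho>..x + 2 ^ k * \<rho>} h \<le> ennreal (E * 2 powr (real k * (2 * \<mu> + 1)))) \<longrightarrow>
     (\<Sum>m\<in>(M::nat set). ennreal ((norm (op r (c m) (l m) (\<lambda>t. if \<bar>t - x\<bar> > \<rho> then h t else 0) y))\<^sup>2)) \<le> ennreal (C * E / \<rho> ^ (2 * r + 1))"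
proof -
  obtain C0 where C0: "C0 > 0" and C0': "\<forall>M c l h y \<alpha> R. finite M \<and> (\<forall>m\<in>M. l m > 0) \<and> disjoint_family_on (\<lambda>m. civ \<kappa> (c m) (l m)) M \<and>
     R > 0 \<and> integrable lborel h \<and> (\<forall>t. t \<notin> {\<alpha>..\<alpha> + R} \<longrightarrow> h t = 0) \<and> (\<forall>t\<in>{\<alpha>..\<alpha> + R}. \<bar>y - t\<bar> \<ge> R / 2) \<longrightarrow>
     (\<Sum>m\<in>(M::nat set). ennreal ((norm (op r (c m) (l m) h y))\<^sup>2)) \<le> ennreal (C0 / R ^ (2 * r + 1)) * sqint {\<alpha>..\<alpha> + R} h"
    using distant_piece_le[of r] by (elim exE conjE) (rule that)
  define q where "q = 1 / (1 - 2 powr (- (real r - \<mu>)))"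
  have q: "q > 0" using \<mu> powr_less_mono[of "- (real r - \<mu>)" 0 2] by (simp add: q_def)
  \<comment> \<open>This comes from (2 D q)^2 below: 2 for the two sides of x, q for the geometric
    series, and 2^(2 \<mu> + 1) because the growth of h enters at the outer radius of each
    annulus.\<close>
  define C where "C = 4 * q\<^sup>2 * (C0 * 2 powr (2 * \<mu> + 1))"
  have main: "(\<Sum>m\<in>M. ennreal ((norm (op r (c m) (l m) (\<lambda>t. if \<bar>t - x\<bar> > \<rho> then h t else 0) y))\<^sup>2)) \<le> ennreal (C * E / \<rho> ^ (2 * r + 1))"
    if M: "finite M" and l: "\<And>m. m \<in> M \<Longrightarrow> l m > 0" and disj: "disjoint_family_on (\<lambda>m. civ \<kappa> (c m) (l m)) M"
      and \<rho>: "\<rho> > 0" and E: "E \<ge> 0" and y: "\<bar>y - x\<bar> \<le> \<rho> / 2" and wh: "wint (real (Suc r)) h"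
      and g: "\<And>k. sqint {x - 2 ^ k * \<rho>..x + 2 ^ k * \<rho>} h \<le> ennreal (E * 2 powr (real k * (2 * \<mu> + 1)))"
    for M :: "nat set" and c l h x y \<rho> E
  proof -
    have [measurable]: "h \<in> borel_measurable borel" using wh by (rule wint_borel)
    define D where "D = sqrt (C0 * E * 2 powr (2 * \<mu> + 1) / \<rho> ^ (2 * r + 1))"
    have D0: "D \<ge> 0" using C0 E \<rho> by (simp add: D_def)
    define X where "X k = D * 2 powr (- (real r - \<mu>) * real k)" for k :: nat
    have X2: "C0 / (2 ^ k * \<rho>) ^ (2 * r + 1) * (E * 2 powr (real (Suc k) * (2 * \<mu> + 1))) = (X k)\<^sup>2" for k
    proof -
      have a: "(2 ^ k * \<rho>) ^ (2 * r + 1) = 2 powr (real k * (2 * real r + 1)) * \<rho> ^ (2 * r + 1)"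
      proof -
        have "((2::real) ^ k) ^ (2 * r + 1) = 2 powr real (k * (2 * r + 1))"
          by (subst powr_two_nat[symmetric]) (rule power_mult[symmetric])
        also have "real (k * (2 * r + 1)) = real k * (2 * real r + 1)" by (simp add: algebra_simps)
        finally show ?thesis by (simp only: power_mult_distrib)
      qed
      have b: "2 powr (real (Suc k) * (2 * \<mu> + 1)) = 2 powr (2 * \<mu> + 1) * (2 powr (- (real r - \<mu>) * real k))\<^sup>2 * 2 powr (real k * (2 * real r + 1))"
        unfolding powr_power2 powr_add[symmetric] by (simp add: algebra_simps)
      have "C0 / (2 ^ k * \<rho>) ^ (2 * r + 1) * (E * 2 powr (real (Suc k) * (2 * \<mu> + 1)))
        = (C0 * E * 2 powr (2 * \<mu> + 1) / \<rho> ^ (2 * r + 1)) * (2 powr (- (real r - \<mu>) * real k))\<^sup>2"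
        unfolding a b by simp
      also have "C0 * E * 2 powr (2 * \<mu> + 1) / \<rho> ^ (2 * r + 1) = D\<^sup>2"
        using C0 E \<rho> by (simp add: D_def)
      finally show ?thesis by (simp add: X_def power_mult_distrib)
    qed
    have X0: "X k \<ge> 0" for k using D0 by (simp add: X_def)
    have piece: "L2_set (\<lambda>m. norm (op r (c m) (l m) g' y)) M \<le> X k"
      if g': "g' \<in> borel_measurable borel" "\<And>t. norm (g' t) \<le> norm (h t)" "\<And>t. t \<notin> {\<alpha>..\<alpha> + 2 ^ k * \<rho>} \<Longrightarrow> g' t = 0"
        and \<alpha>: "\<alpha> = x + 2 ^ k * \<rho> \<or> \<alpha> + 2 ^ k * \<rho> = x - 2 ^ k * \<rho>" for g' \<alpha> k
    proof -
      note [measurable] = g'(1)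
      let ?E = "{\<alpha>..\<alpha> + 2 ^ k * \<rho>}"
      have R: "2 ^ k * \<rho> > 0" using \<rho> by simp
      have k1: "\<rho> \<le> 2 ^ k * \<rho>" using \<rho> by simp
      have "sqint ?E g' \<le> sqint {x - 2 ^ Suc k * \<rho>..x + 2 ^ Suc k * \<rho>} h"
      proof (rule sqint_mono)
        fix t assume t: "t \<in> ?E"
        have e: "2 ^ Suc k * \<rho> = 2 * (2 ^ k * \<rho>)" by simp
        have "x - 2 * (2 ^ k * \<rho>) \<le> t \<and> t \<le> x + 2 * (2 ^ k * \<rho>)"
          using t \<alpha> R unfolding atLeastAtMost_iff by linarith
        then show "t \<in> {x - 2 ^ Suc k * \<rho>..x + 2 ^ Suc k * \<rho>} \<and> norm (g' t) \<le> norm (h t)"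
          using g'(2) unfolding e atLeastAtMost_iff by blast
      qed
      also note g[of "Suc k"]
      finally have le: "sqint ?E g' \<le> ennreal (E * 2 powr (real (Suc k) * (2 * \<mu> + 1)))" .
      have ig: "integrable lborel g'"
        by (rule integrable_of_sqint[OF g'(1) _ g'(3)]) (use le in \<open>auto intro: le_less_trans\<close>)
      have "(\<Sum>m\<in>M. ennreal ((norm (op r (c m) (l m) g' y))\<^sup>2)) \<le> ennreal (C0 / (2 ^ k * \<rho>) ^ (2 * r + 1)) * sqint ?E g'"
      proof (rule C0'[rule_format], intro conjI ballI allI impI M l disj R ig g'(3))
        \<comment> \<open>Here |t - x| >= 2^k \<rho>, while |y - x| <= \<rho>/2 <= 2^k
          \<rho>/2.\<close>
        show "\<bar>y - t\<bar> \<ge> 2 ^ k * \<rho> / 2" if "t \<in> ?E" for t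
          using that \<alpha> y k1 unfolding atLeastAtMost_iff by linarith
      qed
      also have "\<dots> \<le> ennreal (C0 / (2 ^ k * \<rho>) ^ (2 * r + 1)) * ennreal (E * 2 powr (real (Suc k) * (2 * \<mu> + 1)))"
        by (intro mult_left_mono le) auto
      also have "\<dots> = ennreal ((X k)\<^sup>2)"
        unfolding X2[symmetric] using C0 E \<rho> by (subst ennreal_mult) auto
      finally have "(\<Sum>m\<in>M. (norm (op r (c m) (l m) g' y))\<^sup>2) \<le> (X k)\<^sup>2"
        by (subst (asm) sum_ennreal) (auto simp: ennreal_le_iff)
      then show ?thesis using X0 by (simp add: L2_set_def real_le_lsqrt sum_nonneg)
    qed
    \<comment> \<open>Truncation at radius 2^n \<rho> leaves n annuli. The bound is uniform in n,
      and the limit is taken separately for each of the finitely many m.\<close>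
    define H where "H n t = (if \<bar>t - x\<bar> > \<rho> \<and> \<bar>t - x\<bar> \<le> 2 ^ n * \<rho> then h t else 0)" for n :: nat and t
    have [measurable]: "H n \<in> borel_measurable borel" for n unfolding H_def by measurable
    have wr: "real (Suc r) \<ge> 0" by simp
    have wH: "wint (real (Suc r)) (H n)" for n by (rule wint_norm_le[OF wh]) (auto simp: H_def)
    have part: "L2_set (\<lambda>m. norm (op r (c m) (l m) (H n) y)) M \<le> (\<Sum>k<n. 2 * X k)" for n
    proof (induction n)
      case 0
      have "H 0 = (\<lambda>t. 0)" by (auto simp: H_def fun_eq_iff)
      then show ?case by (simp add: op_def conv_def modulate_def[abs_def] L2_set_def)
    next
      case (Suc k)
      define R where "R = 2 ^ k * \<rho>"
      have e1: "2 ^ k * \<rho> = R" and e2: "2 ^ Suc k * \<rho> = 2 * R" by (auto simp: R_def)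
      define hp where "hp t = (if x + R < t \<and> t \<le> x + 2 * R then h t else 0)" for t
      define hm where "hm t = (if x - 2 * R \<le> t \<and> t < x - R then h t else 0)" for t
      have [measurable]: "hp \<in> borel_measurable borel" "hm \<in> borel_measurable borel"
        unfolding hp_def hm_def by measurable
      have w: "wint (real (Suc r)) hp" "wint (real (Suc r)) hm"
        by (rule wint_norm_le[OF wh]; auto simp: hp_def hm_def)+
      have k1: "\<rho> \<le> R" "R > 0" using \<rho> by (auto simp: R_def)
      have "H (Suc k) = (\<lambda>t. H k t + (hp t + hm t))"
        using k1 \<rho> unfolding H_def e1 e2 hp_def hm_def fun_eq_iff by auto
      then have eq: "op r (c m) (l m) (H (Suc k)) y = op r (c m) (l m) (H k) y + (op r (c m) (l m) hp y + op r (c m) (l m) hm y)"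
        if "m \<in> M" for m
        using op_add[OF l[OF that] wr order_refl wH[of k] wint_add[OF w], of "c m" y] op_add[OF l[OF that] wr order_refl w, of "c m" y] by simp
      have "L2_set (\<lambda>m. norm (op r (c m) (l m) (H (Suc k)) y)) M
        \<le> L2_set (\<lambda>m. norm (op r (c m) (l m) (H k) y) + (norm (op r (c m) (l m) hp y) + norm (op r (c m) (l m) hm y))) M"
        by (rule L2_set_mono) (auto simp: eq intro: norm_triangle_le norm_triangle_ineq add_mono)
      also have "\<dots> \<le> L2_set (\<lambda>m. norm (op r (c m) (l m) (H k) y)) M + L2_set (\<lambda>m. norm (op r (c m) (l m) hp y) + norm (op r (c m) (l m) hm y)) M"
        by (rule L2_set_triangle_ineq)
      also have "L2_set (\<lambda>m. norm (op r (c m) (l m) hp y) + norm (op r (c m) (l m) hm y)) M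
          \<le> L2_set (\<lambda>m. norm (op r (c m) (l m) hp y)) M + L2_set (\<lambda>m. norm (op r (c m) (l m) hm y)) M"
        by (rule L2_set_triangle_ineq)
      also have "L2_set (\<lambda>m. norm (op r (c m) (l m) hp y)) M \<le> X k"
        by (rule piece[where \<alpha>="x + R"]) (auto simp: hp_def e1)
      also have "L2_set (\<lambda>m. norm (op r (c m) (l m) hm y)) M \<le> X k"
        by (rule piece[where \<alpha>="x - 2 * R"]) (auto simp: hm_def e1)
      finally show ?case using Suc by simp
    qed
    have X_sum: "(\<Sum>k<n. 2 * X k) \<le> 2 * D * q" for n
    proof -
      have "(\<Sum>k<n. 2 * X k) = 2 * D * (\<Sum>k<n. 2 powr (- (real r - \<mu>) * real k))"
        by (simp add: X_def sum_distrib_left mult.assoc)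
      also have "\<dots> \<le> 2 * D * q"
        unfolding q_def using D0 \<mu> by (intro mult_left_mono sum_geometric_powr_le) auto
      finally show ?thesis .
    qed
    have part2: "(\<Sum>m\<in>M. (norm (op r (c m) (l m) (H n) y))\<^sup>2) \<le> (2 * D * q)\<^sup>2" for n
    proof -
      have "L2_set (\<lambda>m. norm (op r (c m) (l m) (H n) y)) M \<le> 2 * D * q"
        using part[of n] X_sum[of n] by linarith
      then have "(L2_set (\<lambda>m. norm (op r (c m) (l m) (H n) y)) M)\<^sup>2 \<le> (2 * D * q)\<^sup>2"
        by (intro power_mono) (auto simp: L2_set_nonneg)
      then show ?thesis by (simp add: L2_set_def sum_nonneg)
    qed
    define F where "F t = (if \<bar>t - x\<bar> > \<rho> then h t else 0)" for t
    have [measurable]: "F \<in> borel_measurable borel" unfolding F_def by measurable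
    have lim: "(\<lambda>n. op r (c m) (l m) (H n) y) \<longlonglongrightarrow> op r (c m) (l m) F y" if m: "m \<in> M" for m
      unfolding op_def conv_def
    proof (rule integral_dominated_convergence)
      show "integrable lborel (\<lambda>t. norm (kern (l m) r (y - t) * modulate (c m) h t))"
        by (intro integrable_norm op_integrable[OF l[OF m] wr order_refl wh])
      show "AE t in lborel. (\<lambda>n. kern (l m) r (y - t) * modulate (c m) (H n) t) \<longlonglongrightarrow> kern (l m) r (y - t) * modulate (c m) F t"
      proof (rule AE_I2)
        fix t
        obtain N where N: "\<bar>t - x\<bar> / \<rho> \<le> 2 ^ N" using real_arch_pow[of 2 "\<bar>t - x\<bar> / \<rho>"] by (auto intro: less_imp_le)
        have "H n t = F t" if "n \<ge> N" for n
        proof -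
          have "\<bar>t - x\<bar> / \<rho> \<le> 2 ^ n" using N power_increasing[OF that, of "2::real"] by linarith
          then show ?thesis using \<rho> by (auto simp: H_def F_def field_simps)
        qed
        then show "(\<lambda>n. kern (l m) r (y - t) * modulate (c m) (H n) t) \<longlonglongrightarrow> kern (l m) r (y - t) * modulate (c m) F t"
          by (intro tendsto_eventually) (auto simp: eventually_sequentially modulate_def intro!: exI[of _ N])
      qed
      show "AE t in lborel. norm (kern (l m) r (y - t) * modulate (c m) (H n) t) \<le> norm (kern (l m) r (y - t) * modulate (c m) h t)" for n
        by (auto simp: norm_mult H_def)
    qed auto
    have "(\<lambda>n. \<Sum>m\<in>M. (norm (op r (c m) (l m) (H n) y))\<^sup>2) \<longlonglongrightarrow> (\<Sum>m\<in>M. (norm (op r (c m) (l m) F y))\<^sup>2)"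
      by (intro tendsto_sum tendsto_power tendsto_norm lim)
    then have "(\<Sum>m\<in>M. (norm (op r (c m) (l m) F y))\<^sup>2) \<le> (2 * D * q)\<^sup>2"
      by (rule LIMSEQ_le_const2) (use part2 in auto)
    also have "\<dots> = C * E / \<rho> ^ (2 * r + 1)"
      using C0 E \<rho> by (simp add: C_def D_def power_mult_distrib)
    finally show ?thesis
      by (subst sum_ennreal) (auto simp: F_def[abs_def] intro!: ennreal_leI)
  qed
  have "\<forall>M c l h x y \<rho> E. finite M \<and> (\<forall>m\<in>M. l m > 0) \<and> disjoint_family_on (\<lambda>m. civ \<kappa> (c m) (l m)) M \<and>
     \<rho> > 0 \<and> E \<ge> 0 \<and> \<bar>y - x\<bar> \<le> \<rho> / 2 \<and> wint (real (Suc r)) h \<and>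
     (\<forall>k. sqint {x - 2 ^ k * \<rho>..x + 2 ^ k * \<rho>} h \<le> ennreal (E * 2 powr (real k * (2 * \<mu> + 1)))) \<longrightarrow>
     (\<Sum>m\<in>(M::nat set). ennreal ((norm (op r (c m) (l m) (\<lambda>t. if \<bar>t - x\<bar> > \<rho> then h t else 0) y))\<^sup>2)) \<le> ennreal (C * E / \<rho> ^ (2 * r + 1))"
    by (intro allI impI; elim conjE; rule main; simp)
  moreover have "C > 0" using C0 q by (simp add: C_def)
  ultimately show ?thesis by (intro exI[of _ C] conjI)
qed

end

section \<open>Mean oscillation of the antiderivatives\<close>

lemma ennreal_sum_sqint_le:
  assumes "finite F" and [measurable]: "\<And>m. m \<in> F \<Longrightarrow> h m \<in> borel_measurable borel"
    and le: "\<And>y. y \<in> {x - \<rho>..x + \<rho>} \<Longrightarrow> (\<Sum>m\<in>F. ennreal ((norm (h m y))\<^sup>2)) \<le> ennreal K"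
    and "\<rho> \<ge> 0" "K \<ge> 0"
  shows "(\<Sum>m\<in>F. sqint {x - \<rho>..x + \<rho>} (h m)) \<le> ennreal (2 * \<rho> * K)"
proof -
  have "(\<Sum>m\<in>F. sqint {x - \<rho>..x + \<rho>} (h m)) = (\<integral>\<^sup>+y. (\<Sum>m\<in>F. ennreal ((norm (h m y))\<^sup>2) * indicator {x - \<rho>..x + \<rho>} y) \<partial>lborel)"
    unfolding sqint_def by (subst nn_integral_sum) auto
  also have "\<dots> \<le> (\<integral>\<^sup>+y. ennreal K * indicator {x - \<rho>..x + \<rho>} y \<partial>lborel)"
    using le by (intro nn_integral_mono) (auto split: split_indicator)
  also have "\<dots> = ennreal (2 * \<rho> * K)"
    using assms(4,5) by (simp add: nn_integral_cmult ennreal_mult[symmetric] mult_ac)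
  finally show ?thesis .
qed

context jump_symbol
begin

text \<open>The symbol \<xi>^r \<theta>(\<xi>/l) vanishes to order r at \<xi> = - c, the demodulated
  position of frequency 0. K may depend on c and l, because only the exact annihilation of
  polynomials is drawn from it.\<close>

definition vanishing :: "nat \<Rightarrow> real \<Rightarrow> real \<Rightarrow> bool" where
  "vanishing r c l \<longleftrightarrow> (\<exists>K. \<forall>\<xi>. \<bar>\<xi>\<bar> ^ r * norm (\<theta> (\<xi> / l)) \<le> K * \<bar>\<xi> + c\<bar> ^ r)"

definition admissible :: "nat \<Rightarrow> nat set \<Rightarrow> (nat \<Rightarrow> real) \<Rightarrow> (nat \<Rightarrow> real) \<Rightarrow> bool" where
  "admissible r M c l \<longleftrightarrow> (\<forall>m\<in>M. l m > 0 \<and> vanishing r (c m) (l m)) \<and> disjoint_family_on (\<lambda>m. civ \<kappa> (c m) (l m)) M"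

text \<open>\<open>U m\<close> is an \<open>r\<close>-fold antiderivative of the absolutely convergent integral \<open>op r\<close>; modulo
  polynomials it plays the role of the operator itself.\<close>

lemma oscillation_estimate:
  assumes \<mu>: "\<mu> > s" "\<mu> \<ge> real (i - 1)" "\<mu> < real r" and ir: "i \<le> r"
  shows "\<exists>C>0. \<forall>M c l f x A \<rho> U. admissible r M c l \<and> f \<in> borel_measurable borel \<and> A \<ge> 0 \<and> \<rho> > 0 \<and> well_approx i s f x A \<and>
      (\<forall>m\<in>M. chain r (U m) \<and> U m r = op r (c m) (l m) f) \<longrightarrow>
      (\<exists>P. (\<forall>m\<in>M. P m \<in> polys_less r) \<and> (\<forall>F. finite F \<and> F \<subseteq> M \<longrightarrow>
         (\<Sum>m\<in>F. sqint {x - \<rho>..x + \<rho>} (\<lambda>y. U m 0 y - poly (P m) (of_real y))) \<le> ennreal (C * A\<^sup>2 * \<rho> powr (2 * s + 1))))"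
proof -
  obtain Cg where Cg: "Cg > 0" and Cg': "\<forall>f x A \<rho> p0 k. f \<in> borel_measurable borel \<and> A \<ge> 0 \<and> \<rho> > 0 \<and> well_approx i s f x A \<and> p0 \<in> polys_less i \<and>
     sqint {x - \<rho>..x + \<rho>} (\<lambda>t. f t - poly p0 (of_real t)) \<le> ennreal (A\<^sup>2 * \<rho> powr (2 * s + 1)) \<longrightarrow>
     sqint {x - 2 ^ k * \<rho>..x + 2 ^ k * \<rho>} (\<lambda>t. f t - poly p0 (of_real t))
       \<le> ennreal (Cg * A\<^sup>2 * \<rho> powr (2 * s + 1) * 2 powr (real k * (2 * \<mu> + 1)))"
    using well_approx_growth[OF \<mu>(1,2)] by (elim exE conjE) (rule that)
  obtain Cd where Cd: "Cd > 0" and Cd': "\<forall>M c l h x y \<rho> E. finite M \<and> (\<forall>m\<in>M. l m > 0) \<and> disjoint_family_on (\<lambda>m. civ \<kappa> (c m) (l m)) M \<and>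
     \<rho> > 0 \<and> E \<ge> 0 \<and> \<bar>y - x\<bar> \<le> \<rho> / 2 \<and> wint (real (Suc r)) h \<and>
     (\<forall>k. sqint {x - 2 ^ k * \<rho>..x + 2 ^ k * \<rho>} h \<le> ennreal (E * 2 powr (real k * (2 * \<mu> + 1)))) \<longrightarrow>
     (\<Sum>m\<in>(M::nat set). ennreal ((norm (op r (c m) (l m) (\<lambda>t. if \<bar>t - x\<bar> > \<rho> then h t else 0) y))\<^sup>2)) \<le> ennreal (Cd * E / \<rho> ^ (2 * r + 1))"
    using distant_part_le[OF \<mu>(3)] by (elim exE conjE) (rule that)
  \<comment> \<open>The local part gives B^2, the distant part Cd Cg, each doubled by splitting a
    square; the power of 2 comes from approximating f at radius R = 2 \<rho>.\<close>
  define C where "C = (2 * B\<^sup>2 + 2 * (Cd * Cg)) * 2 powr (2 * s + 1)"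
  have main: "\<exists>P. (\<forall>m\<in>M. P m \<in> polys_less r) \<and> (\<forall>F. finite F \<and> F \<subseteq> M \<longrightarrow>
         (\<Sum>m\<in>F. sqint {x - \<rho>..x + \<rho>} (\<lambda>y. U m 0 y - poly (P m) (of_real y))) \<le> ennreal (C * A\<^sup>2 * \<rho> powr (2 * s + 1)))"
    if adm: "admissible r M c l" and f [measurable]: "f \<in> borel_measurable borel" and A: "A \<ge> 0" and \<rho>: "\<rho> > 0"
      and wa: "well_approx i s f x A" and U: "\<forall>m\<in>M. chain r (U m) \<and> U m r = op r (c m) (l m) f"
    for M c l f x A \<rho> U
  proof -
    have l: "l m > 0" and van: "vanishing r (c m) (l m)" if "m \<in> M" for m
      using adm that by (auto simp: admissible_def)
    have disj: "disjoint_family_on (\<lambda>m. civ \<kappa> (c m) (l m)) F" if "F \<subseteq> M" for F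
      using adm that by (auto simp: admissible_def intro: disjoint_family_on_mono)
    \<comment> \<open>Doubling the radius leaves every y of the interval within R/2 of x, hence at
      distance at least R/2 from the region |t - x| > R.\<close>
    define R where "R = 2 * \<rho>"
    have R: "R > 0" using \<rho> by (simp add: R_def)
    define T where "T = A\<^sup>2 * R powr (2 * s + 1)"
    have T: "T \<ge> 0" by (simp add: T_def)
    obtain p0 where p0: "p0 \<in> polys_less i"
      and le0: "sqint {x - R..x + R} (\<lambda>t. f t - poly p0 (of_real t)) \<le> ennreal T"
      using wa R unfolding well_approx_def T_def by blast
    define h where "h t = f t - poly p0 (of_real t)" for t
    have [measurable]: "h \<in> borel_measurable borel" unfolding h_def by measurable
    have growth: "sqint {x - 2 ^ k * R..x + 2 ^ k * R} h \<le> ennreal (Cg * T * 2 powr (real k * (2 * \<mu> + 1)))" for k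
      using Cg'[rule_format, OF conjI[OF f conjI[OF A conjI[OF R conjI[OF wa conjI[OF p0 le0[unfolded T_def]]]]]], of k]
      by (simp add: h_def[abs_def] T_def mult.assoc)
    let ?a = "real (Suc r)"
    have a0: "?a \<ge> 0" by simp
    have wf: "wint ?a f" by (rule well_approx_wint[OF f wa A \<mu>(1,2)]) (use \<mu>(3) in auto)
    have wp: "wint ?a (\<lambda>t. poly p0 (of_real t))" by (rule wint_poly[OF p0]) (use ir in auto)
    have wh: "wint ?a h"
      using wint_add[OF wf wint_cmult[OF wp, of "- 1"]] by (simp add: h_def[abs_def])
    define f1 where "f1 t = (if \<bar>t - x\<bar> \<le> R then h t else 0)" for t
    define f2 where "f2 t = (if \<bar>t - x\<bar> > R then h t else 0)" for t
    have [measurable]: "f1 \<in> borel_measurable borel" "f2 \<in> borel_measurable borel"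
      unfolding f1_def f2_def by measurable
    have w1: "wint ?a f1" and w2: "wint ?a f2"
      by (rule wint_norm_le[OF wh]; auto simp: f1_def f2_def)+
    have s1: "sqint UNIV f1 \<le> ennreal T"
    proof -
      have "sqint UNIV f1 = sqint {x - R..x + R} f1"
        by (rule sqint_UNIV) (auto simp: f1_def abs_le_iff)
      also have "\<dots> \<le> sqint {x - R..x + R} h" by (rule sqint_mono) (auto simp: f1_def)
      finally show ?thesis using le0 by (simp add: h_def[abs_def])
    qed
    have i1: "integrable lborel f1"
    proof (rule integrable_of_sqint[of f1 "x - R" "x + R"])
      have "sqint {x - R..x + R} f1 \<le> sqint UNIV f1" by (rule sqint_mono) auto
      also note s1
      finally show "sqint {x - R..x + R} f1 < \<infinity>" by (rule le_less_trans) simp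
    qed (auto simp: f1_def abs_le_iff)
    have opf: "op r (c m) (l m) f y = op r (c m) (l m) f1 y + op r (c m) (l m) f2 y" if m: "m \<in> M" for m y
    proof -
      have "f = (\<lambda>t. poly p0 (of_real t) + (f1 t + f2 t))"
        by (auto simp: fun_eq_iff f1_def f2_def h_def)
      then have "op r (c m) (l m) f y = op r (c m) (l m) (\<lambda>t. poly p0 (of_real t)) y + (op r (c m) (l m) f1 y + op r (c m) (l m) f2 y)"
        using op_add[OF l[OF m] a0 order_refl wp wint_add[OF w1 w2], of "c m" y] op_add[OF l[OF m] a0 order_refl w1 w2, of "c m" y] by simp
      moreover have "op r (c m) (l m) (\<lambda>t. poly p0 (of_real t)) y = 0"
        using van[OF m] op_poly_zero[OF l[OF m] polys_less_mono[OF p0 ir]] unfolding vanishing_def by blast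
      ultimately show ?thesis by simp
    qed
    \<comment> \<open>The local piece f1 is integrable, so all orders of the operator are defined on
      it and form a tower; its bottom entry is accessible to Plancherel.\<close>
    define V where "V m j = op j (c m) (l m) f1" for m j
    have V: "chain r (V m)" if "m \<in> M" for m
      unfolding chain_def V_def using op_deriv[OF l[OF that] order_refl _ wint_integrable[OF i1]] by auto
    have cont: "continuous_on UNIV (op r (c m) (l m) f2)" if "m \<in> M" for m
      by (rule op_continuous[OF l[OF that] a0 order_refl w2])
    \<comment> \<open>For the distant piece only the r-th derivative is controlled; its
      antiderivatives are normalised to vanish at x.\<close>
    have "\<exists>W. m \<in> M \<longrightarrow> chain r W \<and> W r = op r (c m) (l m) f2 \<and> (\<forall>j<r. W j x = 0)" for m
      using chain_exists[OF cont] by blast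
    then obtain W where W: "\<And>m. m \<in> M \<Longrightarrow> chain r (W m)" "\<And>m. m \<in> M \<Longrightarrow> W m r = op r (c m) (l m) f2"
      "\<And>m j. m \<in> M \<Longrightarrow> j < r \<Longrightarrow> W m j x = 0"
      by metis
    \<comment> \<open>U and V + W have the same r-th derivative, since the polynomial p0 is
      annihilated. The resulting P is fixed before any finite set F, so the bound will pass to all
      of M.\<close>
    have "\<exists>p. m \<in> M \<longrightarrow> p \<in> polys_less r \<and> (\<forall>y. U m 0 y - (V m 0 y + W m 0 y) = poly p (of_real y))" for m
    proof (cases "m \<in> M")
      case True
      have "\<exists>p\<in>polys_less r. \<forall>y. (\<lambda>j y. U m j y - (V m j y + W m j y)) 0 y = poly p (of_real y)"
      proof (rule chain_zero_poly)
        show "chain r (\<lambda>j y. U m j y - (V m j y + W m j y))"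
          using U True by (intro chain_diff chain_add V W) auto
        show "U m r y - (V m r y + W m r y) = 0" for y
          using U True opf[OF True, of y] W(2)[OF True] by (simp add: V_def)
      qed
      then show ?thesis by blast
    qed auto
    then obtain P where P: "\<And>m. m \<in> M \<Longrightarrow> P m \<in> polys_less r"
      "\<And>m y. m \<in> M \<Longrightarrow> U m 0 y - (V m 0 y + W m 0 y) = poly (P m) (of_real y)"
      by metis
    let ?I = "{x - \<rho>..x + \<rho>}"
    have "(\<Sum>m\<in>F. sqint ?I (\<lambda>y. U m 0 y - poly (P m) (of_real y))) \<le> ennreal (C * A\<^sup>2 * \<rho> powr (2 * s + 1))"
      if F: "finite F" "F \<subseteq> M" for F
    proof -
      have mV [measurable]: "V m 0 \<in> borel_measurable borel" and mW [measurable]: "W m 0 \<in> borel_measurable borel"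
        and mo: "op r (c m) (l m) f2 \<in> borel_measurable borel" if "m \<in> F" for m
      proof -
        have m: "m \<in> M" using that F by auto
        show "V m 0 \<in> borel_measurable borel" unfolding V_def
          by (rule borel_measurable_continuous_onI, rule op_continuous[OF l[OF m] order_refl _ wint_integrable[OF i1]]) auto
        show "W m 0 \<in> borel_measurable borel"
          using chain_continuous[OF W(1)[OF m], of 0] W(2)[OF m] cont[OF m] by (auto intro: borel_measurable_continuous_onI)
        show "op r (c m) (l m) f2 \<in> borel_measurable borel"
          using cont[OF m] by (rule borel_measurable_continuous_onI)
      qed
      have lF: "\<And>m. m \<in> F \<Longrightarrow> l m > 0" using l F by auto
      have "(\<Sum>m\<in>F. sqint ?I (\<lambda>y. U m 0 y - poly (P m) (of_real y))) \<le> (\<Sum>m\<in>F. 2 * sqint ?I (V m 0) + 2 * sqint ?I (W m 0))"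
      proof (rule sum_mono)
        fix m assume m: "m \<in> F"
        then have "U m 0 y - poly (P m) (of_real y) = V m 0 y + W m 0 y" for y
          using P(2)[of m y] F by (auto simp: algebra_simps)
        then show "sqint ?I (\<lambda>y. U m 0 y - poly (P m) (of_real y)) \<le> 2 * sqint ?I (V m 0) + 2 * sqint ?I (W m 0)"
          using sqint_add[OF mV[OF m] mW[OF m], of ?I] by simp
      qed
      also have "\<dots> = 2 * (\<Sum>m\<in>F. sqint ?I (V m 0)) + 2 * (\<Sum>m\<in>F. sqint ?I (W m 0))"
        by (simp add: sum.distrib sum_distrib_left)
      also have "(\<Sum>m\<in>F. sqint ?I (V m 0)) \<le> ennreal (B\<^sup>2 * T)"
      proof -
        have "(\<Sum>m\<in>F. sqint ?I (V m 0)) \<le> (\<Sum>m\<in>F. sqint UNIV (V m 0))"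
          by (intro sum_mono sqint_mono) auto
        also have "\<dots> \<le> ennreal (B\<^sup>2) * sqint UNIV f1"
          unfolding V_def by (rule local_part_le[OF F(1) lF disj[OF F(2)] i1])
        also have "\<dots> \<le> ennreal (B\<^sup>2) * ennreal T" by (intro mult_left_mono s1) auto
        finally show ?thesis using T by (simp add: ennreal_mult)
      qed
      also have "(\<Sum>m\<in>F. sqint ?I (W m 0)) \<le> ennreal (Cd * Cg * T)"
      proof -
        have "(\<Sum>m\<in>F. sqint ?I (W m 0)) \<le> (\<Sum>m\<in>F. ennreal ((4 * \<rho>\<^sup>2) ^ r) * sqint ?I (op r (c m) (l m) f2))"
        proof (rule sum_mono)
          fix m assume "m \<in> F"
          then have m: "m \<in> M" using F by auto
          show "sqint ?I (W m 0) \<le> ennreal ((4 * \<rho>\<^sup>2) ^ r) * sqint ?I (op r (c m) (l m) f2)"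
            using chain_sqint_le[OF W(1)[OF m], of x \<rho>] W(2,3)[OF m] cont[OF m] \<rho> by simp
        qed
        also have "\<dots> = ennreal ((4 * \<rho>\<^sup>2) ^ r) * (\<Sum>m\<in>F. sqint ?I (op r (c m) (l m) f2))"
          by (rule sum_distrib_left[symmetric])
        also have "(\<Sum>m\<in>F. sqint ?I (op r (c m) (l m) f2)) \<le> ennreal (2 * \<rho> * (Cd * (Cg * T) / R ^ (2 * r + 1)))"
        proof (rule ennreal_sum_sqint_le[OF F(1) mo])
          fix y assume y: "y \<in> ?I"
          show "(\<Sum>m\<in>F. ennreal ((norm (op r (c m) (l m) f2 y))\<^sup>2)) \<le> ennreal (Cd * (Cg * T) / R ^ (2 * r + 1))"
            unfolding f2_def[abs_def]
          proof (rule Cd'[rule_format], intro conjI ballI allI F(1) lF disj[OF F(2)] R wh growth)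
            show "\<bar>y - x\<bar> \<le> R / 2" using y by (auto simp: R_def abs_le_iff)
          qed (use Cg T in auto)
        qed (use \<rho> R Cd Cg T in auto)
        \<comment> \<open>The r antiderivatives cost (2 \<rho>)^(2r) and integration of the
          pointwise bound costs 2 \<rho>; together this is R^(2r+1), the denominator of the distant
          estimate.\<close>
        also have "ennreal ((4 * \<rho>\<^sup>2) ^ r) * ennreal (2 * \<rho> * (Cd * (Cg * T) / R ^ (2 * r + 1))) = ennreal (Cd * Cg * T)"
        proof (subst ennreal_mult[symmetric])
          have "4 * \<rho>\<^sup>2 = R\<^sup>2" by (simp add: R_def power_mult_distrib)
          then have "(4 * \<rho>\<^sup>2) ^ r * (2 * \<rho>) = R ^ (2 * r + 1)" by (simp add: power_mult R_def)
          then show "ennreal ((4 * \<rho>\<^sup>2) ^ r * (2 * \<rho> * (Cd * (Cg * T) / R ^ (2 * r + 1)))) = ennreal (Cd * Cg * T)"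
            using R by (simp add: mult.assoc[symmetric])
        qed (use \<rho> R Cd Cg T in auto)
        finally show ?thesis by (simp add: mult_left_mono)
      qed
      also have "2 * ennreal (B\<^sup>2 * T) + 2 * ennreal (Cd * Cg * T) = ennreal (2 * (B\<^sup>2 * T) + 2 * (Cd * Cg * T))"
        using T Cd Cg by (simp add: ennreal_mult)
      also have "2 * (B\<^sup>2 * T) + 2 * (Cd * Cg * T) = C * A\<^sup>2 * \<rho> powr (2 * s + 1)"
        using \<rho> by (simp add: C_def T_def R_def powr_mult algebra_simps)
      finally show ?thesis by (simp add: add_mono mult_left_mono)
    qed
    then show ?thesis using P(1) by blast
  qed
  have "\<forall>M c l f x A \<rho> U. admissible r M c l \<and> f \<in> borel_measurable borel \<and> A \<ge> 0 \<and> \<rho> > 0 \<and> well_approx i s f x A \<and>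
      (\<forall>m\<in>M. chain r (U m) \<and> U m r = op r (c m) (l m) f) \<longrightarrow>
      (\<exists>P. (\<forall>m\<in>M. P m \<in> polys_less r) \<and> (\<forall>F. finite F \<and> F \<subseteq> M \<longrightarrow>
         (\<Sum>m\<in>F. sqint {x - \<rho>..x + \<rho>} (\<lambda>y. U m 0 y - poly (P m) (of_real y))) \<le> ennreal (C * A\<^sup>2 * \<rho> powr (2 * s + 1))))"
    by (intro allI impI; elim conjE; rule main; assumption)
  moreover have "C > 0" using Cd Cg by (auto simp: C_def intro!: mult_pos_pos add_nonneg_pos)
  ultimately show ?thesis by (intro exI[of _ C] conjI)
qed

end

section \<open>Schwartz functions and frequency multipliers\<close>

lemma schwartzI:
  assumes D: "\<And>k x. (D k has_vector_derivative D (Suc k) x) (at x)"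
    and b: "\<And>j k. \<exists>C. \<forall>x. \<bar>x\<bar> ^ j * norm (D k x) \<le> C"
  shows "D 0 \<in> schwartz"
proof -
  have it: "iter_deriv UNIV k (D 0) = D k" for k
  proof (induction k)
    case 0
    then show ?case by (simp add: iter_deriv_def)
  next
    case (Suc k)
    have "iter_deriv UNIV (Suc k) (D 0) = (\<lambda>x. vector_derivative (iter_deriv UNIV k (D 0)) (at x))"
      by (simp add: iter_deriv_def)
    also have "\<dots> = D (Suc k)" unfolding Suc using D by (auto simp: vector_derivative_at)
    finally show ?case .
  qed
  have "bounded (range (\<lambda>x. x ^ j *\<^sub>R D k x))" for j k
  proof -
    obtain C where "\<And>x. \<bar>x\<bar> ^ j * norm (D k x) \<le> C" using b by blast
    then show ?thesis by (auto simp: bounded_iff power_abs intro!: exI[of _ C])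
  qed
  moreover have "D k differentiable (at x)" for k x
    using D[of k x] unfolding has_vector_derivative_def differentiable_def by blast
  ultimately show ?thesis
    by (simp add: schwartz_def smooth_on_def it)
qed

lemma schwartz_continuous: "\<phi> \<in> schwartz \<Longrightarrow> continuous_on UNIV \<phi>"
proof -
  assume "\<phi> \<in> schwartz"
  then have "\<forall>x. iter_deriv UNIV 0 \<phi> differentiable (at x)"
    by (auto simp: schwartz_def smooth_on_def)
  then show ?thesis
    by (auto simp: iter_deriv_def intro!: continuous_at_imp_continuous_on differentiable_imp_continuous_within)
qed

lemma schwartz_borel: "\<phi> \<in> schwartz \<Longrightarrow> \<phi> \<in> borel_measurable borel"
  by (intro borel_measurable_continuous_onI schwartz_continuous)

lemma schwartz_decay:
  assumes "\<phi> \<in> schwartz"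
  shows "\<exists>C\<ge>0. \<forall>x. (1 + \<bar>x\<bar>) ^ n * norm (\<phi> x) \<le> C"
proof -
  have "\<forall>j k. bounded (range (\<lambda>x. x ^ j *\<^sub>R iter_deriv UNIV k \<phi> x))"
    using assms by (simp add: schwartz_def)
  from this[rule_format, of _ 0] have b: "bounded (range (\<lambda>x. x ^ j *\<^sub>R \<phi> x))" for j
    by (simp add: iter_deriv_def)
  obtain A where A: "\<And>x. norm (\<phi> x) \<le> A" using b[of 0] by (auto simp: bounded_iff)
  obtain C where C: "\<And>x. \<bar>x\<bar> ^ n * norm (\<phi> x) \<le> C" using b[of n] by (auto simp: bounded_iff power_abs)
  have "(1 + \<bar>x\<bar>) ^ n * norm (\<phi> x) \<le> 2 ^ n * (A + C)" for x
  proof -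
    have "(1 + \<bar>x\<bar>) ^ n * norm (\<phi> x) \<le> 2 ^ n * (1 + \<bar>x\<bar> ^ n) * norm (\<phi> x)"
      by (intro mult_right_mono one_plus_abs_power_le) auto
    also have "\<dots> = 2 ^ n * (norm (\<phi> x) + \<bar>x\<bar> ^ n * norm (\<phi> x))" by (simp add: algebra_simps)
    also have "\<dots> \<le> 2 ^ n * (A + C)" by (intro mult_left_mono add_mono A C) auto
    finally show ?thesis .
  qed
  moreover have "0 \<le> 2 ^ n * (A + C)"
    using order_trans[OF norm_ge_zero A[of 0]] order_trans[OF _ C[of 0], of 0] by simp
  ultimately show ?thesis by blast
qed

lemma schwartz_weighted_integrable:
  assumes \<phi>: "\<phi> \<in> schwartz"
  shows "integrable lborel (\<lambda>y. of_real ((1 + \<bar>y\<bar>) powr a) * \<phi> y)"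
proof -
  have [measurable]: "\<phi> \<in> borel_measurable borel" using \<phi> by (rule schwartz_borel)
  obtain n :: nat where n: "a \<le> real n" using real_arch_simple by blast
  obtain C where C: "\<And>x. (1 + \<bar>x\<bar>) ^ (n + 2) * norm (\<phi> x) \<le> C" using schwartz_decay[OF \<phi>] by metis
  show ?thesis
  proof (rule integrable_decay)
    fix x :: real
    have "(1 + \<bar>x\<bar>) powr a \<le> (1 + \<bar>x\<bar>) powr real n" using n by (intro powr_mono) auto
    also have "\<dots> = (1 + \<bar>x\<bar>) ^ n" by (rule powr_realpow) auto
    finally have "(1 + \<bar>x\<bar>)\<^sup>2 * ((1 + \<bar>x\<bar>) powr a * norm (\<phi> x)) \<le> (1 + \<bar>x\<bar>)\<^sup>2 * ((1 + \<bar>x\<bar>) ^ n * norm (\<phi> x))"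
      by (intro mult_left_mono mult_right_mono) auto
    also have "\<dots> = (1 + \<bar>x\<bar>) ^ (n + 2) * norm (\<phi> x)" by (simp add: power_add power2_eq_square mult_ac)
    also have "\<dots> \<le> C" by (rule C)
    finally show "(1 + \<bar>x\<bar>)\<^sup>2 * norm (of_real ((1 + \<bar>x\<bar>) powr a) * \<phi> x) \<le> C" by (simp add: norm_mult)
  qed measurable
qed

lemma schwartz_integrable:
  assumes "\<phi> \<in> schwartz"
  shows "integrable lborel \<phi>"
  using schwartz_weighted_integrable[OF assms, of 0] by (simp add: add_nonneg_eq_0_iff)

lemma fourier_lborel:
  assumes [measurable]: "h \<in> borel_measurable borel"
  shows "fourier h \<xi> = (LINT x|lborel. h x * ee (- \<xi> * x))"
proof -
  have "cis (- 2 * pi * x * \<xi>) = ee (- \<xi> * x)" for x by (simp add: ee_def mult_ac)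
  then show ?thesis unfolding fourier_def by (subst integral_completion) simp_all
qed

lemma inv_fourier_lborel:
  assumes [measurable]: "h \<in> borel_measurable borel"
  shows "inv_fourier h x = (LINT \<xi>|lborel. h \<xi> * ee (x * \<xi>))"
proof -
  have "cis (2 * pi * x * \<xi>) = ee (x * \<xi>)" for \<xi> by (simp add: ee_def mult_ac)
  then show ?thesis unfolding inv_fourier_def by (subst integral_completion) simp_all
qed

text \<open>The weights are redistributed: (1 + |y|)^a \<phi>(y) and f times its weight are
  integrable, and Peetre's inequality makes the remaining kernel L bounded and thus accessible to
  \<open>bounded_kernel_swap\<close>.\<close>

lemma conv_swap:
  assumes a: "a \<ge> 0" and K: "\<And>u. norm (K u) \<le> C * wt a u" and Kc: "continuous_on UNIV K" and f: "wint a f"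
    and \<phi>: "integrable lborel (\<lambda>y. of_real ((1 + \<bar>y\<bar>) powr a) * \<phi> y)"
  shows "(LINT y|lborel. \<phi> y * conv K f y) = (LINT x|lborel. f x * (LINT y|lborel. \<phi> y * K (y - x)))"
    and "integrable lborel (\<lambda>y. \<phi> y * conv K f y)"
proof -
  note [measurable] = wint_borel[OF f] borel_measurable_continuous_onI[OF Kc]
  have p: "(1 + \<bar>y\<bar>) powr a \<noteq> 0" "(1 + \<bar>y\<bar>) powr a > 0" for y :: real by auto
  have \<phi>m [measurable]: "\<phi> \<in> borel_measurable borel"
  proof -
    have "(\<lambda>y. of_real (1 / (1 + \<bar>y\<bar>) powr a) * (of_real ((1 + \<bar>y\<bar>) powr a) * \<phi> y)) \<in> borel_measurable borel"
      using borel_measurable_integrable[OF \<phi>] by measurable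
    moreover have "(\<lambda>y. of_real (1 / (1 + \<bar>y\<bar>) powr a) * (of_real ((1 + \<bar>y\<bar>) powr a) * \<phi> y)) = \<phi>"
      by (auto simp: fun_eq_iff)
    ultimately show ?thesis by simp
  qed
  define G where "G y = of_real ((1 + \<bar>y\<bar>) powr a) * \<phi> y" for y
  define F where "F x = f x * of_real (wt a x)" for x
  define L where "L z = of_real (1 / ((1 + \<bar>fst z\<bar>) powr a * wt a (snd z))) * K (fst z - snd z)" for z :: "real \<times> real"
  have "integrable lborel (\<lambda>t. norm (f t) * wt a t)" using f by (simp add: wint_def)
  then have F: "integrable lborel F"
    by (rule Bochner_Integration.integrable_bound) (auto simp: F_def[abs_def] norm_mult)
  have "continuous_on UNIV (\<lambda>z::real \<times> real. K (fst z - snd z))"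
    by (rule continuous_on_compose2[OF Kc]) (auto intro!: continuous_intros)
  moreover have "continuous_on UNIV (\<lambda>z::real \<times> real. 1 / ((1 + \<bar>fst z\<bar>) powr a * wt a (snd z)))"
    unfolding wt_def by (intro continuous_intros) (auto simp: add_nonneg_eq_0_iff)
  ultimately have L: "continuous_on UNIV L"
    unfolding L_def[abs_def] by (intro continuous_on_mult continuous_on_of_real)
  have Lb: "norm (L z) \<le> C" for z
  proof -
    obtain y x where z: "z = (y, x)" by (cases z)
    have C: "C \<ge> 0" using order_trans[OF norm_ge_zero K[of 0]] by (simp add: wt_def)
    have "norm (K (y - x)) \<le> C * wt a (y - x)" by (rule K)
    also have "\<dots> \<le> C * ((1 + \<bar>y\<bar>) powr a * wt a x)" by (intro mult_left_mono wt_shift a C)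
    finally have "norm (K (y - x)) / ((1 + \<bar>y\<bar>) powr a * wt a x) \<le> C"
      using p(2)[of y] wt_pos(1)[of a x] by (subst pos_divide_le_eq) auto
    moreover have "norm (L z) = norm (K (y - x)) / ((1 + \<bar>y\<bar>) powr a * wt a x)"
      using p(2)[of y] wt_pos(1)[of a x] by (simp add: z L_def norm_mult norm_divide)
    ultimately show ?thesis by simp
  qed
  have 1: "(LINT x|lborel. F x * L (y, x)) * G y = \<phi> y * conv K f y" for y
  proof -
    have "\<phi> y * conv K f y = (LINT x|lborel. \<phi> y * (K (y - x) * f x))" by (simp add: conv_def)
    also have "\<dots> = (LINT x|lborel. (F x * L (y, x)) * G y)"
      using p by (intro Bochner_Integration.integral_cong refl) (simp add: F_def G_def L_def)
    finally show ?thesis by simp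
  qed
  have 2: "F x * (LINT y|lborel. G y * L (y, x)) = f x * (LINT y|lborel. \<phi> y * K (y - x))" for x
  proof -
    have "f x * (LINT y|lborel. \<phi> y * K (y - x)) = (LINT y|lborel. f x * (\<phi> y * K (y - x)))" by simp
    also have "\<dots> = (LINT y|lborel. F x * (G y * L (y, x)))"
      using p by (intro Bochner_Integration.integral_cong refl) (simp add: F_def G_def L_def)
    finally show ?thesis by simp
  qed
  have G: "integrable lborel G" using \<phi> by (simp add: G_def[abs_def])
  have swap: "(LINT y|lborel. G y * (LINT x|lborel. F x * L (y, x))) = (LINT x|lborel. F x * (LINT y|lborel. G y * L (y, x)))"
    by (rule bounded_kernel_swap[OF G F borel_measurable_continuous_onI[OF L] Lb])
  have "(LINT y|lborel. \<phi> y * conv K f y) = (LINT y|lborel. G y * (LINT x|lborel. F x * L (y, x)))"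
    by (intro Bochner_Integration.integral_cong refl) (subst 1[symmetric], rule mult.commute)
  also note swap
  also have "(LINT x|lborel. F x * (LINT y|lborel. G y * L (y, x))) = (LINT x|lborel. f x * (LINT y|lborel. \<phi> y * K (y - x)))"
    by (intro Bochner_Integration.integral_cong refl 2)
  finally show "(LINT y|lborel. \<phi> y * conv K f y) = (LINT x|lborel. f x * (LINT y|lborel. \<phi> y * K (y - x)))" .
  have [measurable]: "conv K f \<in> borel_measurable borel" unfolding conv_def[abs_def] by measurable
  show "integrable lborel (\<lambda>y. \<phi> y * conv K f y)"
  proof (rule Bochner_Integration.integrable_bound)
    show "integrable lborel (\<lambda>y. (C * wnorm a f) * norm (of_real ((1 + \<bar>y\<bar>) powr a) * \<phi> y))"
      using \<phi> by (intro integrable_mult_right integrable_norm)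
    show "AE y in lborel. norm (\<phi> y * conv K f y) \<le> norm ((C * wnorm a f) * norm (of_real ((1 + \<bar>y\<bar>) powr a) * \<phi> y))"
    proof (rule AE_I2)
      fix y
      have "norm (conv K f y) \<le> C * (1 + \<bar>y\<bar>) powr a * wnorm a f"
        by (rule conv_norm_le[OF a K _ f]) measurable
      then have "norm (\<phi> y) * norm (conv K f y) \<le> norm (\<phi> y) * (C * (1 + \<bar>y\<bar>) powr a * wnorm a f)"
        by (rule mult_left_mono) auto
      also have "\<dots> = (C * wnorm a f) * norm (of_real ((1 + \<bar>y\<bar>) powr a) * \<phi> y)"
        unfolding norm_mult by simp
      also have "\<dots> \<le> norm ((C * wnorm a f) * norm (of_real ((1 + \<bar>y\<bar>) powr a) * \<phi> y))"
        unfolding real_norm_def by (rule abs_ge_self)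
      finally show "norm (\<phi> y * conv K f y) \<le> \<dots>" by (simp add: norm_mult)
    qed
  qed measurable
qed

lemma gauss_schwartz:
  assumes n: "n \<noteq> 0"
  shows "(\<lambda>x. complex_of_real (gam (n * (x - x0)))) \<in> schwartz"
proof -
  define D where "D k x = of_real (n ^ k) * gd k (n * (x - x0))" for k x
  have "D 0 \<in> schwartz"
  proof (rule schwartzI)
    fix k x
    have "((\<lambda>x. gd k (n * (x - x0))) has_vector_derivative n *\<^sub>R gd (Suc k) (n * (x - x0))) (at x)"
      by (rule vector_diff_chain_at[unfolded o_def, OF _ gd_deriv])
         (auto intro!: derivative_eq_intros simp flip: has_real_derivative_iff_has_vector_derivative)
    from has_vector_derivative_mult_right[OF this, of "of_real (n ^ k)"]
    show "(D k has_vector_derivative D (Suc k) x) (at x)"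
      by (simp add: D_def[abs_def] scaleR_conv_of_real mult_ac)
  next
    fix j k
    show "\<exists>C. \<forall>x. \<bar>x\<bar> ^ j * norm (D k x) \<le> C"
    proof -
      obtain C where C: "\<And>u. (1 + \<bar>u\<bar>) ^ j * norm (gd k u) \<le> C" using gd_bounded by metis
      have "\<bar>x\<bar> ^ j * norm (D k x) \<le> \<bar>n\<bar> ^ k * ((1 + \<bar>x0\<bar>) * (1 + 1 / \<bar>n\<bar>)) ^ j * C" for x
      proof -
        have "\<bar>x\<bar> \<le> \<bar>x0\<bar> + \<bar>x - x0\<bar>" by linarith
        also have "\<bar>x - x0\<bar> = \<bar>n * (x - x0)\<bar> / \<bar>n\<bar>" using n by (simp add: abs_mult)
        also have "\<bar>x0\<bar> + \<bar>n * (x - x0)\<bar> / \<bar>n\<bar> \<le> (1 + \<bar>x0\<bar>) * (1 + 1 / \<bar>n\<bar>) * (1 + \<bar>n * (x - x0)\<bar>)"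
        proof -
          have "a + b * c \<le> (1 + a) * (1 + c) * (1 + b)" if "a \<ge> 0" "b \<ge> 0" "c \<ge> 0" for a b c :: real
            using that by (simp add: algebra_simps add_increasing)
          from this[of "\<bar>x0\<bar>" "\<bar>n * (x - x0)\<bar>" "1 / \<bar>n\<bar>"] show ?thesis by simp
        qed
        finally have "\<bar>x\<bar> ^ j \<le> ((1 + \<bar>x0\<bar>) * (1 + 1 / \<bar>n\<bar>) * (1 + \<bar>n * (x - x0)\<bar>)) ^ j" by (intro power_mono) auto
        then have "\<bar>x\<bar> ^ j * norm (gd k (n * (x - x0))) \<le> ((1 + \<bar>x0\<bar>) * (1 + 1 / \<bar>n\<bar>) * (1 + \<bar>n * (x - x0)\<bar>)) ^ j * norm (gd k (n * (x - x0)))"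
          by (rule mult_right_mono) auto
        also have "\<dots> = ((1 + \<bar>x0\<bar>) * (1 + 1 / \<bar>n\<bar>)) ^ j * ((1 + \<bar>n * (x - x0)\<bar>) ^ j * norm (gd k (n * (x - x0))))"
          by (simp add: power_mult_distrib mult_ac)
        also have "\<dots> \<le> ((1 + \<bar>x0\<bar>) * (1 + 1 / \<bar>n\<bar>)) ^ j * C"
          by (intro mult_left_mono C) auto
        finally have "\<bar>n\<bar> ^ k * (\<bar>x\<bar> ^ j * norm (gd k (n * (x - x0)))) \<le> \<bar>n\<bar> ^ k * (((1 + \<bar>x0\<bar>) * (1 + 1 / \<bar>n\<bar>)) ^ j * C)"
          by (rule mult_left_mono) auto
        then show ?thesis by (simp add: D_def norm_mult norm_power mult_ac)
      qed
      then show ?thesis by blast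
    qed
  qed
  then show ?thesis by (simp add: D_def[abs_def] gd_0)
qed

text \<open>Testing against concentrating Gaussians recovers the values of a continuous function of
  arbitrary growth.\<close>

lemma continuous_eq_0_of_schwartz:
  assumes F: "continuous_on UNIV F"
    and z: "\<And>\<phi>. \<phi> \<in> schwartz \<Longrightarrow> integrable lborel (\<lambda>x. F x * \<phi> x) \<and> (LINT x|lborel. F x * \<phi> x) = 0"
  shows "F x0 = (0::complex)"
proof -
  note [measurable] = borel_measurable_continuous_onI[OF F]
  define a where "a n = real (Suc n)" for n
  have a: "a n \<ge> 1" "a n > 0" for n by (auto simp: a_def)
  \<comment> \<open>The test integral is split at distance 1 from x0. The near part N tends to F(x0)
    after rescaling, the far part H to 0, while their sum is always 0.\<close>
  define N where "N n = (LINT x|lborel. indicator {x0 - 1..x0 + 1} x *\<^sub>R (F x * of_real (a n * gam (a n * (x - x0)))))" for n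
  define H where "H n = (LINT x|lborel. indicator (- {x0 - 1..x0 + 1}) x *\<^sub>R (F x * of_real (a n * gam (a n * (x - x0)))))" for n
  have int: "integrable lborel (\<lambda>x. F x * of_real (a n * gam (a n * (x - x0))))"
    and zero: "(LINT x|lborel. F x * of_real (a n * gam (a n * (x - x0)))) = 0" for n
  proof -
    have "integrable lborel (\<lambda>x. of_real (a n) * (F x * of_real (gam (a n * (x - x0)))))"
      using z[OF gauss_schwartz[of "a n" x0]] a(2)[of n] by (intro integrable_mult_right) simp
    then show "integrable lborel (\<lambda>x. F x * of_real (a n * gam (a n * (x - x0))))" by (simp add: mult_ac)
    have "(LINT x|lborel. of_real (a n) * (F x * of_real (gam (a n * (x - x0))))) = 0"
      using z[OF gauss_schwartz[of "a n" x0]] a(2)[of n] by simp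
    then show "(LINT x|lborel. F x * of_real (a n * gam (a n * (x - x0)))) = 0"
      by (simp only: of_real_mult mult.left_commute)
  qed
  have NH: "N n + H n = 0" for n
  proof -
    have "integrable lborel (\<lambda>x. indicator {x0 - 1..x0 + 1} x *\<^sub>R (F x * of_real (a n * gam (a n * (x - x0)))))"
      "integrable lborel (\<lambda>x. indicator (- {x0 - 1..x0 + 1}) x *\<^sub>R (F x * of_real (a n * gam (a n * (x - x0)))))"
      using int[of n] by (auto intro!: integrable_mult_indicator)
    then have "N n + H n = (LINT x|lborel. indicator {x0 - 1..x0 + 1} x *\<^sub>R (F x * of_real (a n * gam (a n * (x - x0))))
       + indicator (- {x0 - 1..x0 + 1}) x *\<^sub>R (F x * of_real (a n * gam (a n * (x - x0)))))"
      unfolding N_def H_def by (rule Bochner_Integration.integral_add[symmetric])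
    also have "\<dots> = (LINT x|lborel. F x * of_real (a n * gam (a n * (x - x0))))"
      by (intro Bochner_Integration.integral_cong refl) (auto split: split_indicator)
    finally show ?thesis using zero by simp
  qed
  \<comment> \<open>At distance at least 1 the concentrated Gaussian is at most a fixed Gaussian
    times a factor tending to 0. F times the fixed Gaussian is integrable by hypothesis, which
    provides the majorant for H.\<close>
  have gam_dom: "a n * gam (a n * v) \<le> gam v * (a n * exp (- (a n - 1)))" if "\<bar>v\<bar> \<ge> 1" for n v
  proof -
    have "1 \<le> v\<^sup>2" using that by (simp add: abs_le_square_iff[of 1 v, simplified])
    have "(a n - 1) * 1 \<le> pi * ((a n)\<^sup>2 - 1) * v\<^sup>2"
    proof (rule mult_mono)
      have "a n - 1 \<le> 1 * ((a n)\<^sup>2 - 1)" using a(1)[of n] by (simp add: power2_eq_square)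
      also have "\<dots> \<le> pi * ((a n)\<^sup>2 - 1)" using pi_gt3 a(1)[of n] by (intro mult_right_mono) auto
      finally show "a n - 1 \<le> pi * ((a n)\<^sup>2 - 1)" .
      show "0 \<le> pi * ((a n)\<^sup>2 - 1)" using a(1)[of n] by auto
    qed (use \<open>1 \<le> v\<^sup>2\<close> in auto)
    then have "exp (- pi * (a n * v)\<^sup>2) \<le> exp (- pi * v\<^sup>2 + - (a n - 1))"
      by (simp add: power_mult_distrib algebra_simps)
    then have "gam (a n * v) \<le> gam v * exp (- (a n - 1))" by (simp only: gam_def exp_add)
    then show ?thesis using a(2)[of n] by (simp add: mult.left_commute mult_left_mono)
  qed
  have aexp: "a n * exp (- (a n - 1)) \<le> 1" for n
  proof -
    have "a n \<le> exp (a n - 1)" using exp_ge_add_one_self[of "a n - 1"] by simp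
    then have "a n * exp (- (a n - 1)) \<le> exp (a n - 1) * exp (- (a n - 1))" by (rule mult_right_mono) auto
    then show ?thesis by (simp flip: exp_add)
  qed
  have aexp0: "(\<lambda>n. a n * exp (- (a n - 1))) \<longlonglongrightarrow> 0"
  proof -
    have "filterlim a at_top sequentially"
      unfolding a_def by (rule filterlim_compose[OF filterlim_real_sequentially filterlim_Suc])
    from filterlim_compose[OF tendsto_power_div_exp_0[of 1] this]
    have "(\<lambda>n. exp 1 * (a n ^ 1 / exp (a n))) \<longlonglongrightarrow> exp 1 * 0" by (rule tendsto_mult_left)
    then show ?thesis by (simp add: exp_diff mult.commute)
  qed
  have "H \<longlonglongrightarrow> integral\<^sup>L lborel (\<lambda>_::real. 0)"
    unfolding H_def
  proof (rule integral_dominated_convergence)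
    show "integrable lborel (\<lambda>x. norm (F x * complex_of_real (gam (1 * (x - x0)))))"
      using z[OF gauss_schwartz[of 1 x0]] by (intro integrable_norm) simp
    show "AE x in lborel. (\<lambda>n. indicator (- {x0 - 1..x0 + 1}) x *\<^sub>R (F x * of_real (a n * gam (a n * (x - x0))))) \<longlonglongrightarrow> 0"
    proof (rule AE_I2)
      fix x
      show "(\<lambda>n. indicator (- {x0 - 1..x0 + 1}) x *\<^sub>R (F x * of_real (a n * gam (a n * (x - x0))))) \<longlonglongrightarrow> 0"
      proof (cases "x \<in> {x0 - 1..x0 + 1}")
        case False
        have "(\<lambda>n. norm (F x) * gam (x - x0) * (a n * exp (- (a n - 1)))) \<longlonglongrightarrow> norm (F x) * gam (x - x0) * 0"
          by (intro tendsto_mult_left aexp0)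
        then have *: "(\<lambda>n. norm (F x) * gam (x - x0) * (a n * exp (- (a n - 1)))) \<longlonglongrightarrow> 0" by simp
        show ?thesis
        proof (rule Lim_null_comparison[OF _ *], intro always_eventually allI)
          fix n
          have "\<bar>x - x0\<bar> \<ge> 1" using False by (auto simp: abs_le_iff)
          from mult_left_mono[OF gam_dom[OF this, of n] norm_ge_zero[of "F x"]]
          show "norm (indicator (- {x0 - 1..x0 + 1}) x *\<^sub>R (F x * of_real (a n * gam (a n * (x - x0)))))
            \<le> norm (F x) * gam (x - x0) * (a n * exp (- (a n - 1)))"
            using False a(2)[of n] by (simp add: norm_mult abs_mult mult.assoc)
        qed
      qed simp
    qed
    show "AE x in lborel. norm (indicator (- {x0 - 1..x0 + 1}) x *\<^sub>R (F x * of_real (a n * gam (a n * (x - x0)))))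
       \<le> norm (F x * complex_of_real (gam (1 * (x - x0))))" for n
    proof (rule AE_I2)
      fix x
      show "norm (indicator (- {x0 - 1..x0 + 1}) x *\<^sub>R (F x * of_real (a n * gam (a n * (x - x0)))))
       \<le> norm (F x * complex_of_real (gam (1 * (x - x0))))"
      proof (cases "x \<in> {x0 - 1..x0 + 1}")
        case False
        then have "\<bar>x - x0\<bar> \<ge> 1" by (auto simp: abs_le_iff)
        from gam_dom[OF this, of n] have "a n * gam (a n * (x - x0)) \<le> gam (x - x0) * 1"
          using aexp[of n] by (meson gam_pos(2) mult_left_mono order_trans)
        from mult_left_mono[OF this norm_ge_zero[of "F x"]] show ?thesis
          using False a(2)[of n] by (simp add: norm_mult abs_mult)
      qed simp
    qed
  qed measurable
  then have H0: "H \<longlonglongrightarrow> 0" by simp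
  have "bounded (F ` {x0 - 1..x0 + 1})"
    using F by (intro compact_imp_bounded compact_continuous_image) (auto intro: continuous_on_subset)
  then obtain B where B: "\<forall>x\<in>{x0 - 1..x0 + 1}. norm (F x) \<le> B" unfolding bounded_iff by auto
  have Neq: "N n = (LINT v|lborel. indicator {- a n..a n} v *\<^sub>R (F (x0 + v / a n) * of_real (gam v)))" for n
  proof -
    have "N n = \<bar>1 / a n\<bar> *\<^sub>R (LINT v|lborel. indicator {x0 - 1..x0 + 1} (x0 + 1 / a n * v) *\<^sub>R
        (F (x0 + 1 / a n * v) * of_real (a n * gam (a n * ((x0 + 1 / a n * v) - x0)))))"
      unfolding N_def using a(2)[of n] by (intro lborel_integral_real_affine) auto
    also have "\<dots> = (LINT v|lborel. \<bar>1 / a n\<bar> *\<^sub>R (indicator {x0 - 1..x0 + 1} (x0 + 1 / a n * v) *\<^sub>R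
        (F (x0 + 1 / a n * v) * of_real (a n * gam (a n * ((x0 + 1 / a n * v) - x0))))))"
      by (rule integral_scaleR_right[symmetric])
    also have "\<dots> = (LINT v|lborel. indicator {- a n..a n} v *\<^sub>R (F (x0 + v / a n) * of_real (gam v)))"
    proof (intro Bochner_Integration.integral_cong refl)
      fix v
      have "indicator {x0 - 1..x0 + 1} (x0 + 1 / a n * v) = (indicator {- a n..a n} v :: real)"
        using a(2)[of n] by (auto simp: indicator_def field_simps)
      then show "\<bar>1 / a n\<bar> *\<^sub>R (indicator {x0 - 1..x0 + 1} (x0 + 1 / a n * v) *\<^sub>R
        (F (x0 + 1 / a n * v) * of_real (a n * gam (a n * ((x0 + 1 / a n * v) - x0)))))
        = indicator {- a n..a n} v *\<^sub>R (F (x0 + v / a n) * of_real (gam v))"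
        using a(2)[of n] by (simp add: scaleR_conv_of_real mult_ac)
    qed
    finally show ?thesis .
  qed
  have "N \<longlonglongrightarrow> (LINT v|lborel. F x0 * of_real (gam v))"
    unfolding Neq
  proof (rule integral_dominated_convergence)
    show "integrable lborel (\<lambda>v. B * gam v)" using gam_integrable by simp
    show "AE v in lborel. (\<lambda>n. indicator {- a n..a n} v *\<^sub>R (F (x0 + v / a n) * of_real (gam v))) \<longlonglongrightarrow> F x0 * of_real (gam v)"
    proof (rule AE_I2)
      fix v
      have "(\<lambda>n. v / a n) \<longlonglongrightarrow> 0" unfolding a_def by (rule LIMSEQ_Suc[OF lim_const_over_n])
      then have "(\<lambda>n. x0 + v / a n) \<longlonglongrightarrow> x0 + 0" by (intro tendsto_intros)
      then have "(\<lambda>n. F (x0 + v / a n)) \<longlonglongrightarrow> F x0"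
        by (intro continuous_on_tendsto_compose[OF F]) auto
      then have 1: "(\<lambda>n. F (x0 + v / a n) * of_real (gam v)) \<longlonglongrightarrow> F x0 * of_real (gam v)" by (intro tendsto_intros)
      obtain n0 :: nat where n0: "\<bar>v\<bar> \<le> real n0" using real_arch_simple by blast
      have "\<forall>\<^sub>F n in sequentially. F (x0 + v / a n) * of_real (gam v) = indicator {- a n..a n} v *\<^sub>R (F (x0 + v / a n) * of_real (gam v))"
        unfolding eventually_sequentially
      proof (intro exI[of _ n0] allI impI)
        fix n assume "n0 \<le> n"
        then have "v \<in> {- a n..a n}" using n0 by (auto simp: a_def abs_le_iff)
        then show "F (x0 + v / a n) * of_real (gam v) = indicator {- a n..a n} v *\<^sub>R (F (x0 + v / a n) * of_real (gam v))" by simp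
      qed
      from Lim_transform_eventually[OF 1 this]
      show "(\<lambda>n. indicator {- a n..a n} v *\<^sub>R (F (x0 + v / a n) * of_real (gam v))) \<longlonglongrightarrow> F x0 * of_real (gam v)" .
    qed
    show "AE v in lborel. norm (indicator {- a n..a n} v *\<^sub>R (F (x0 + v / a n) * of_real (gam v))) \<le> B * gam v" for n
    proof (rule AE_I2)
      fix v
      show "norm (indicator {- a n..a n} v *\<^sub>R (F (x0 + v / a n) * of_real (gam v))) \<le> B * gam v"
      proof (cases "v \<in> {- a n..a n}")
        case True
        then have "x0 + v / a n \<in> {x0 - 1..x0 + 1}" using a(2)[of n] by (auto simp: field_simps)
        then have "norm (F (x0 + v / a n)) * gam v \<le> B * gam v" using B by (intro mult_right_mono) auto
        then show ?thesis using True by (simp add: norm_mult)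
      next
        case False
        have "B \<ge> 0" using B order_trans[OF norm_ge_zero, of "F x0" B] by auto
        then show ?thesis using False by simp
      qed
    qed
  qed measurable
  then have "N \<longlonglongrightarrow> F x0" using gam_integral by simp
  with H0 have "(\<lambda>n. N n + H n) \<longlonglongrightarrow> F x0 + 0" by (rule tendsto_add[rotated])
  then have "(\<lambda>n::nat. 0 :: complex) \<longlonglongrightarrow> F x0" by (simp only: NH add_0_right)
  then show ?thesis using LIMSEQ_unique tendsto_const by blast
qed

lemma integrable_lebesgue_iff:
  fixes h :: "real \<Rightarrow> complex"
  assumes [measurable]: "h \<in> borel_measurable borel"
  shows "integrable lebesgue h \<longleftrightarrow> integrable lborel h" "integral\<^sup>L lebesgue h = integral\<^sup>L lborel h"
  by (auto simp: integrable_completion integral_completion)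

text \<open>The convolution is continuous and Fubini shows that it represents the distribution;
  \<open>continuous_eq_0_of_schwartz\<close> shows that no other continuous function does. So the
  definite description in \<open>freq_mult\<close> denotes it.\<close>

lemma freq_mult_eq_conv:
  assumes f: "wint a f" and a: "a \<ge> 0" and \<Psi>: "integrable lborel \<Psi>"
    and K: "\<And>u. norm (inv_fourier \<Psi> u) \<le> C * wt a u" and Kc: "continuous_on UNIV (inv_fourier \<Psi>)"
    and cont: "continuous_on UNIV (conv (inv_fourier \<Psi>) f)"
  shows "freq_mult f \<Psi> = conv (inv_fourier \<Psi>) f"
proof -
  have \<Psi>m: "\<Psi> \<in> borel_measurable borel" using borel_measurable_integrable[OF \<Psi>] by simp
  note [measurable] = wint_borel[OF f] \<Psi>m borel_measurable_continuous_onI[OF Kc]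
  let ?K = "inv_fourier \<Psi>"
  let ?F = "conv ?K f"
  define T where "T = distr_inv_fourier (distr_mult (distr_fourier (distr_of f)) \<Psi>)"
  have [measurable]: "?F \<in> borel_measurable borel" using cont by (rule borel_measurable_continuous_onI)
  have inner: "fourier (\<lambda>\<xi>. \<Psi> \<xi> * inv_fourier \<phi> \<xi>) x = (LINT y|lborel. \<phi> y * ?K (y - x))" if \<phi>: "\<phi> \<in> schwartz" for \<phi> x
  proof -
    note [measurable] = schwartz_borel[OF \<phi>]
    have "fourier (\<lambda>\<xi>. \<Psi> \<xi> * inv_fourier \<phi> \<xi>) x = (LINT \<xi>|lborel. (\<Psi> \<xi> * inv_fourier \<phi> \<xi>) * ee (- x * \<xi>))"
      unfolding inv_fourier_lborel[OF schwartz_borel[OF \<phi>]] by (rule fourier_lborel) measurable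
    also have "\<dots> = (LINT \<xi>|lborel. (\<Psi> \<xi> * ee (- x * \<xi>)) * (LINT y|lborel. \<phi> y * ee (\<xi> * y)))"
      unfolding inv_fourier_lborel[OF schwartz_borel[OF \<phi>]] by (simp add: mult_ac)
    also have "\<dots> = (LINT y|lborel. \<phi> y * (LINT \<xi>|lborel. (\<Psi> \<xi> * ee (- x * \<xi>)) * ee (\<xi> * y)))"
    proof (rule fourier_swap[OF _ schwartz_integrable[OF \<phi>]])
      show "integrable lborel (\<lambda>\<xi>. \<Psi> \<xi> * ee (- x * \<xi>))"
        by (rule Bochner_Integration.integrable_bound[OF \<Psi>]) (auto simp: norm_mult)
    qed
    also have "\<dots> = (LINT y|lborel. \<phi> y * ?K (y - x))"
    proof -
      have "ee (- x * \<xi>) * ee (\<xi> * y) = ee ((y - x) * \<xi>)" for \<xi> y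
        by (simp add: algebra_simps flip: ee_add)
      then show ?thesis
        by (simp only: inv_fourier_lborel[OF \<Psi>m] mult.assoc)
    qed
    finally show ?thesis .
  qed
  have rep: "represents ?F T"
    unfolding represents_def
  proof
    fix \<phi> assume \<phi>: "\<phi> \<in> schwartz"
    note [measurable] = schwartz_borel[OF \<phi>]
    note sw = conv_swap[OF a K Kc f schwartz_weighted_integrable[OF \<phi>]]
    have "T \<phi> = (LINT x|lebesgue. f x * (LINT y|lborel. \<phi> y * ?K (y - x)))"
      by (simp add: T_def distr_inv_fourier_def distr_mult_def distr_fourier_def distr_of_def inner[OF \<phi>])
    also have "\<dots> = (LINT x|lborel. f x * (LINT y|lborel. \<phi> y * ?K (y - x)))"
      by (intro integrable_lebesgue_iff) measurable
    also have "\<dots> = (LINT y|lborel. ?F y * \<phi> y)" unfolding sw(1)[symmetric] by (simp add: mult.commute)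
    finally have 1: "T \<phi> = (LINT y|lborel. ?F y * \<phi> y)" .
    have "integrable lborel (\<lambda>y. ?F y * \<phi> y)" using sw(2) by (simp add: mult.commute)
    moreover have m: "(\<lambda>y. ?F y * \<phi> y) \<in> borel_measurable borel" by measurable
    ultimately show "integrable lebesgue (\<lambda>x. ?F x * \<phi> x) \<and> distr_of ?F \<phi> = T \<phi>"
      unfolding distr_of_def integrable_lebesgue_iff[OF m] 1 by simp
  qed
  show ?thesis
    unfolding freq_mult_def T_def[symmetric]
  proof (rule the_equality)
    show "continuous_on UNIV ?F \<and> represents ?F T" using cont rep by simp
  next
    fix G assume G: "continuous_on UNIV G \<and> represents G T"
    then have [measurable]: "G \<in> borel_measurable borel" by (auto intro: borel_measurable_continuous_onI)
    have "G x - ?F x = 0" for x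
    proof (rule continuous_eq_0_of_schwartz[of "\<lambda>x. G x - ?F x"])
      show "continuous_on UNIV (\<lambda>x. G x - ?F x)" using G cont by (intro continuous_intros) auto
      fix \<phi> assume \<phi>: "\<phi> \<in> schwartz"
      note [measurable] = schwartz_borel[OF \<phi>]
      have m: "(\<lambda>y. G y * \<phi> y) \<in> borel_measurable borel" "(\<lambda>y. ?F y * \<phi> y) \<in> borel_measurable borel"
        by measurable
      have "integrable lebesgue (\<lambda>x. G x * \<phi> x) \<and> distr_of G \<phi> = T \<phi>"
        "integrable lebesgue (\<lambda>x. ?F x * \<phi> x) \<and> distr_of ?F \<phi> = T \<phi>"
        using G rep \<phi> unfolding represents_def by blast+
      then have "integrable lborel (\<lambda>x. G x * \<phi> x)" "(LINT x|lborel. G x * \<phi> x) = T \<phi>"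
        "integrable lborel (\<lambda>x. ?F x * \<phi> x)" "(LINT x|lborel. ?F x * \<phi> x) = T \<phi>"
        unfolding distr_of_def integrable_lebesgue_iff[OF m(1)] integrable_lebesgue_iff[OF m(2)] by blast+
      then show "integrable lborel (\<lambda>x. (G x - ?F x) * \<phi> x) \<and> (LINT x|lborel. (G x - ?F x) * \<phi> x) = 0"
        by (simp add: left_diff_distrib)
    qed
    then show "G = ?F" by (auto simp: fun_eq_iff)
  qed
qed

section \<open>Regularised symbols\<close>

lemma wt_nat: "wt (real n) u = 1 / (1 + \<bar>u\<bar>) ^ n"
  unfolding wt_def by (subst powr_minus, subst powr_realpow) (auto simp: divide_inverse)

lemma gd_wt: "\<exists>C>0. \<forall>u. norm (gd j u) \<le> C * wt (real n) u"
proof -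
  obtain C where C: "C > 0" "\<And>u. (1 + \<bar>u\<bar>) ^ n * norm (gd j u) \<le> C" using gd_bounded by metis
  have "norm (gd j u) \<le> C * wt (real n) u" for u
    using C(2)[of u] by (simp add: wt_nat pos_le_divide_eq add_pos_nonneg mult.commute)
  then show ?thesis using C(1) by blast
qed

text \<open>Turns the factor \<epsilon>^n, produced by differentiating gam(\<epsilon> u) n times,
  into decay in u uniformly in \<epsilon>.\<close>

lemma wt_scale:
  assumes "0 < \<epsilon>" "\<epsilon> \<le> 1"
  shows "\<epsilon> ^ n * wt (real n) (\<epsilon> * u) \<le> wt (real n) u"
proof -
  have "\<epsilon> * (1 + \<bar>u\<bar>) \<le> 1 + \<bar>\<epsilon> * u\<bar>" using assms by (simp add: abs_mult algebra_simps)
  then have "(\<epsilon> * (1 + \<bar>u\<bar>)) ^ n \<le> (1 + \<bar>\<epsilon> * u\<bar>) ^ n" using assms by (intro power_mono) auto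
  then show ?thesis
    by (simp add: wt_nat power_mult_distrib divide_simps add_pos_nonneg)
qed

definition leibniz :: "(nat \<Rightarrow> real \<Rightarrow> complex) \<Rightarrow> (nat \<Rightarrow> real \<Rightarrow> complex) \<Rightarrow> nat \<Rightarrow> real \<Rightarrow> complex" where
  "leibniz A G j u = (\<Sum>n\<le>j. of_nat (j choose n) * (A (j - n) u * G n u))"

lemma leibniz_deriv:
  assumes A: "\<And>j u. (A j has_vector_derivative A (Suc j) u) (at u)"
    and G: "\<And>j u. (G j has_vector_derivative G (Suc j) u) (at u)"
  shows "(leibniz A G j has_vector_derivative leibniz A G (Suc j) u) (at u)"
proof -
  have "((\<lambda>u. \<Sum>n\<le>j. of_nat (j choose n) * (A (j - n) u * G n u)) has_vector_derivative
     (\<Sum>n\<le>j. of_nat (j choose n) * (A (j - n) u * G (Suc n) u + A (Suc (j - n)) u * G n u))) (at u)"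
    by (intro has_vector_derivative_sum has_vector_derivative_mult_right has_vector_derivative_mult A G)
  also have "(\<Sum>n\<le>j. of_nat (j choose n) * (A (j - n) u * G (Suc n) u + A (Suc (j - n)) u * G n u)) = leibniz A G (Suc j) u"
  proof -
    have "leibniz A G (Suc j) u = A (Suc j) u * G 0 u + (\<Sum>n\<le>j. of_nat (Suc j choose Suc n) * (A (j - n) u * G (Suc n) u))"
      unfolding leibniz_def by (subst sum.atMost_Suc_shift) simp
    also have "(\<Sum>n\<le>j. of_nat (Suc j choose Suc n) * (A (j - n) u * G (Suc n) u))
       = (\<Sum>n\<le>j. of_nat (j choose n) * (A (j - n) u * G (Suc n) u)) + (\<Sum>n\<le>j. of_nat (j choose Suc n) * (A (j - n) u * G (Suc n) u))"
      by (simp add: sum.distrib[symmetric] distrib_right)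
    also have "A (Suc j) u * G 0 u + ((\<Sum>n\<le>j. of_nat (j choose n) * (A (j - n) u * G (Suc n) u)) + (\<Sum>n\<le>j. of_nat (j choose Suc n) * (A (j - n) u * G (Suc n) u)))
      = (\<Sum>n\<le>j. of_nat (j choose n) * (A (j - n) u * G (Suc n) u)) + (A (Suc j) u * G 0 u + (\<Sum>n\<le>j. of_nat (j choose Suc n) * (A (j - n) u * G (Suc n) u)))"
      by simp
    also have "A (Suc j) u * G 0 u + (\<Sum>n\<le>j. of_nat (j choose Suc n) * (A (j - n) u * G (Suc n) u))
      = (\<Sum>n\<le>Suc j. of_nat (j choose n) * (A (Suc j - n) u * G n u))"
      by (subst sum.atMost_Suc_shift) simp
    also have "\<dots> = (\<Sum>n\<le>j. of_nat (j choose n) * (A (Suc (j - n)) u * G n u))"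
      by (simp add: Suc_diff_le binomial_eq_0)
    finally show ?thesis by (simp add: sum.distrib[symmetric] distrib_left)
  qed
  finally show ?thesis by (simp add: leibniz_def[abs_def])
qed

lemma gd_scaled_deriv:
  "((\<lambda>u. of_real (\<epsilon> ^ n) * gd n (\<epsilon> * u)) has_vector_derivative of_real (\<epsilon> ^ Suc n) * gd (Suc n) (\<epsilon> * u)) (at u)"
proof -
  have "((\<lambda>u. gd n (\<epsilon> * u)) has_vector_derivative \<epsilon> *\<^sub>R gd (Suc n) (\<epsilon> * u)) (at u)"
    by (rule vector_diff_chain_at[unfolded o_def, OF _ gd_deriv])
       (auto intro!: derivative_eq_intros simp flip: has_real_derivative_iff_has_vector_derivative)
  from has_vector_derivative_mult_right[OF this, of "of_real (\<epsilon> ^ n)"] show ?thesis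
    by (simp add: scaleR_conv_of_real mult_ac)
qed

lemma one_minus_gam_le: "1 - gam u \<le> pi * u\<^sup>2"
  using exp_ge_add_one_self[of "- pi * u\<^sup>2"] by (simp add: gam_def)

context jump_symbol
begin

text \<open>The Gaussian average of the symbol at scale \<epsilon>. On the other side of the Fourier
  transform it multiplies the kernel by gam(\<epsilon> u), see
  \<open>inv_fourier_reg\<close>.\<close>

definition reg :: "real \<Rightarrow> real \<Rightarrow> real \<Rightarrow> real \<Rightarrow> complex" where
  "reg c l \<epsilon> = conv (\<lambda>u. of_real (gam (u / \<epsilon>) / \<epsilon>)) (\<lambda>\<eta>. \<theta> ((\<eta> - c) / l))"

lemma symbol_affine_outside: "l > 0 \<Longrightarrow> \<eta> \<notin> {c - l..c + l} \<Longrightarrow> \<theta> ((\<eta> - c) / l) = 0"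
  by (rule \<theta>_outside) (auto simp: field_simps)

lemma symbol_affine_weighted:
  assumes l: "l > 0" and a: "a \<ge> 0"
  shows "integrable lborel (\<lambda>\<eta>. of_real ((1 + \<bar>\<eta>\<bar>) powr a) * \<theta> ((\<eta> - c) / l))"
proof (rule integrable_compact_support[where a="c - l" and b="c + l" and B="(1 + \<bar>c\<bar> + l) powr a * B"])
  show "norm (of_real ((1 + \<bar>\<eta>\<bar>) powr a) * \<theta> ((\<eta> - c) / l)) \<le> (1 + \<bar>c\<bar> + l) powr a * B" for \<eta>
  proof (cases "\<eta> \<in> {c - l..c + l}")
    case True
    then have "(1 + \<bar>\<eta>\<bar>) powr a \<le> (1 + \<bar>c\<bar> + l) powr a" using a by (intro powr_mono2) auto
    then show ?thesis unfolding norm_mult using \<theta>_bound by (intro mult_mono) auto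
  next
    case False
    then show ?thesis using symbol_affine_outside[OF l False] B_nonneg by simp
  qed
qed (use symbol_affine_outside[OF l] in auto)

lemma symbol_affine_integrable: "l > 0 \<Longrightarrow> integrable lborel (\<lambda>\<eta>. \<theta> ((\<eta> - c) / l))"
  using symbol_affine_weighted[of l 0 c] by (simp add: add_nonneg_eq_0_iff)

text \<open>The affine image of \<theta> has compact support, so by Peetre's inequality the decay of
  K passes to the convolution.\<close>

lemma conv_symbol_decay:
  assumes l: "l > 0" and a: "a \<ge> 0" and K: "\<And>u. norm (K u) \<le> C * wt a u"
  shows "\<exists>D. \<forall>x. norm (conv K (\<lambda>\<eta>. \<theta> ((\<eta> - c) / l)) x) \<le> D * wt a x"
proof (intro exI allI)
  fix x
  let ?D = "LINT \<eta>|lborel. norm (of_real ((1 + \<bar>\<eta>\<bar>) powr a) * \<theta> ((\<eta> - c) / l))"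
  have C: "C \<ge> 0" using order_trans[OF norm_ge_zero K[of 0]] by (simp add: wt_def)
  have wts: "wt a (- u) = wt a u" for u by (simp add: wt_def)
  have pt: "norm (K (x - \<eta>) * \<theta> ((\<eta> - c) / l)) \<le> C * wt a x * norm (of_real ((1 + \<bar>\<eta>\<bar>) powr a) * \<theta> ((\<eta> - c) / l))" for \<eta>
  proof -
    have "norm (K (x - \<eta>)) \<le> C * wt a (x - \<eta>)" by (rule K)
    also have "wt a (x - \<eta>) = wt a (\<eta> - x)" using wts[of "x - \<eta>"] by simp
    also have "C * wt a (\<eta> - x) \<le> C * ((1 + \<bar>\<eta>\<bar>) powr a * wt a x)" by (intro mult_left_mono wt_shift a C)
    finally have "norm (K (x - \<eta>)) * norm (\<theta> ((\<eta> - c) / l)) \<le> C * ((1 + \<bar>\<eta>\<bar>) powr a * wt a x) * norm (\<theta> ((\<eta> - c) / l))"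
      by (rule mult_right_mono) auto
    then show ?thesis by (simp add: norm_mult mult_ac)
  qed
  have "norm (conv K (\<lambda>\<eta>. \<theta> ((\<eta> - c) / l)) x) \<le> (LINT \<eta>|lborel. C * wt a x * norm (of_real ((1 + \<bar>\<eta>\<bar>) powr a) * \<theta> ((\<eta> - c) / l)))"
  proof (cases "integrable lborel (\<lambda>\<eta>. K (x - \<eta>) * \<theta> ((\<eta> - c) / l))")
    case True
    show ?thesis unfolding conv_def
      by (rule order_trans[OF integral_norm_bound], rule integral_mono)
         (use True pt symbol_affine_weighted[OF l a] in \<open>auto intro!: integrable_mult_right integrable_norm\<close>)
  next
    case False
    then show ?thesis using C by (simp add: conv_def not_integrable_integral_eq)
  qed
  also have "\<dots> = C * ?D * wt a x" by simp
  finally show "norm (conv K (\<lambda>\<eta>. \<theta> ((\<eta> - c) / l)) x) \<le> C * ?D * wt a x" .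
qed

definition gauss_kernel :: "real \<Rightarrow> nat \<Rightarrow> real \<Rightarrow> complex" where
  "gauss_kernel \<epsilon> k u = of_real (1 / \<epsilon>) * (of_real ((1 / \<epsilon>) ^ k) * gd k (1 / \<epsilon> * u))"

lemma gauss_kernel_deriv:
  "(gauss_kernel \<epsilon> k has_vector_derivative gauss_kernel \<epsilon> (Suc k) u) (at u)"
  unfolding gauss_kernel_def[abs_def] by (rule has_vector_derivative_mult_right[OF gd_scaled_deriv])

lemma gauss_kernel_0: "gauss_kernel \<epsilon> 0 u = of_real (gam (u / \<epsilon>) / \<epsilon>)"
  by (simp add: gauss_kernel_def gd_0)

lemma gauss_kernel_wt:
  assumes \<epsilon>: "\<epsilon> > 0"
  shows "\<exists>C. \<forall>u. norm (gauss_kernel \<epsilon> k u) \<le> C * wt (real n) u"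
proof -
  obtain C where C: "C > 0" "\<And>u. norm (gd k u) \<le> C * wt (real n) u" using gd_wt by blast
  have "norm (gauss_kernel \<epsilon> k u) \<le> (1 / \<epsilon> * ((1 / \<epsilon>) ^ k * (C * (1 + \<epsilon>) ^ n))) * wt (real n) u" for u
  proof -
    have "1 + \<bar>u\<bar> \<le> (1 + \<epsilon>) * (1 + \<bar>1 / \<epsilon> * u\<bar>)" using \<epsilon> by (simp add: field_simps)
    then have "(1 + \<bar>u\<bar>) ^ n \<le> (1 + \<epsilon>) ^ n * (1 + \<bar>1 / \<epsilon> * u\<bar>) ^ n"
      unfolding power_mult_distrib[symmetric] by (intro power_mono) auto
    moreover have "1 / b \<le> e * (1 / a)" if "a \<le> e * b" "a > 0" "b > 0" for a b e :: real
      using that by (simp add: field_simps)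
    ultimately have w: "wt (real n) (1 / \<epsilon> * u) \<le> (1 + \<epsilon>) ^ n * wt (real n) u"
      unfolding wt_nat by (simp add: add_pos_nonneg)
    have "norm (gd k (1 / \<epsilon> * u)) \<le> C * ((1 + \<epsilon>) ^ n * wt (real n) u)"
      using C(2)[of "1 / \<epsilon> * u"] mult_left_mono[OF w, of C] C(1) by linarith
    then have "1 / \<epsilon> * ((1 / \<epsilon>) ^ k * norm (gd k (1 / \<epsilon> * u))) \<le> 1 / \<epsilon> * ((1 / \<epsilon>) ^ k * (C * ((1 + \<epsilon>) ^ n * wt (real n) u)))"
      using \<epsilon> by (intro mult_left_mono) auto
    moreover have "norm (gauss_kernel \<epsilon> k u) = 1 / \<epsilon> * ((1 / \<epsilon>) ^ k * norm (gd k (1 / \<epsilon> * u)))"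
      using \<epsilon> unfolding gauss_kernel_def norm_mult norm_of_real by simp
    ultimately show ?thesis by (simp only: mult.assoc)
  qed
  then show ?thesis by blast
qed

lemma reg_schwartz:
  assumes l: "l > 0" and \<epsilon>: "\<epsilon> > 0"
  shows "reg c l \<epsilon> \<in> schwartz"
proof -
  define D where "D k = conv (gauss_kernel \<epsilon> k) (\<lambda>\<eta>. \<theta> ((\<eta> - c) / l))" for k
  have "D 0 \<in> schwartz"
  proof (rule schwartzI)
    fix k x
    obtain C C' where "\<And>u. norm (gauss_kernel \<epsilon> k u) \<le> C * wt 0 u" "\<And>u. norm (gauss_kernel \<epsilon> (Suc k) u) \<le> C' * wt 0 u"
      using gauss_kernel_wt[OF \<epsilon>, of k 0] gauss_kernel_wt[OF \<epsilon>, of "Suc k" 0] by auto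
    then show "(D k has_vector_derivative D (Suc k) x) (at x)"
      unfolding D_def by (intro conv_deriv[OF order_refl _ _ gauss_kernel_deriv wint_integrable[OF symbol_affine_integrable[OF l]]])
  next
    fix j k
    obtain C where C: "\<And>u. norm (gauss_kernel \<epsilon> k u) \<le> C * wt (real j) u" using gauss_kernel_wt[OF \<epsilon>] by blast
    obtain E where E: "\<And>x. norm (D k x) \<le> E * wt (real j) x"
      using conv_symbol_decay[OF l _ C, of c] unfolding D_def by auto
    have "\<bar>x\<bar> ^ j * norm (D k x) \<le> E" for x
    proof -
      have "\<bar>x\<bar> ^ j * norm (D k x) \<le> (1 + \<bar>x\<bar>) ^ j * norm (D k x)" by (intro mult_right_mono power_mono) auto
      also have "\<dots> \<le> (1 + \<bar>x\<bar>) ^ j * (E * wt (real j) x)" by (intro mult_left_mono E) auto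
      also have "\<dots> = E" by (simp add: wt_nat add_nonneg_eq_0_iff)
      finally show ?thesis .
    qed
    then show "\<exists>C. \<forall>x. \<bar>x\<bar> ^ j * norm (D k x) \<le> C" by blast
  qed
  moreover have "D 0 = reg c l \<epsilon>" unfolding D_def reg_def by (simp add: gauss_kernel_0[abs_def])
  ultimately show ?thesis by simp
qed

lemma symbol_affine_fourier:
  assumes l: "l > 0"
  shows "(LINT \<eta>|lborel. \<theta> ((\<eta> - c) / l) * ee (u * \<eta>)) = ee (c * u) * kern l 0 u"
proof -
  have "(LINT \<eta>|lborel. \<theta> ((\<eta> - c) / l) * ee (u * \<eta>)) = \<bar>1\<bar> *\<^sub>R (LINT \<xi>|lborel. \<theta> (((c + 1 * \<xi>) - c) / l) * ee (u * (c + 1 * \<xi>)))"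
    by (rule lborel_integral_real_affine) auto
  also have "\<dots> = (LINT \<xi>|lborel. ee (c * u) * (\<theta> (\<xi> / l) * ee (u * \<xi>)))"
    by (simp add: distrib_left ee_add mult_ac)
  also have "\<dots> = ee (c * u) * kern l 0 u" by (simp add: kern_0_fourier[OF l])
  finally show ?thesis .
qed

text \<open>Fubini moves the average from the symbol onto the exponential, which is an eigenfunction
  of convolution with the Gaussian, with eigenvalue gam(\<epsilon> u).\<close>

lemma inv_fourier_reg:
  assumes l: "l > 0" and \<epsilon>: "\<epsilon> > 0"
  shows "inv_fourier (reg c l \<epsilon>) u = ee (c * u) * (kern l 0 u * of_real (gam (\<epsilon> * u)))"
proof -
  let ?K = "\<lambda>v. complex_of_real (gam (v / \<epsilon>) / \<epsilon>)"
  let ?\<theta> = "\<lambda>\<eta>. \<theta> ((\<eta> - c) / l)"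
  have Kc: "continuous_on UNIV ?K" using \<epsilon> by (intro continuous_intros) auto
  obtain C where C: "\<And>v. norm (?K v) \<le> C * wt 2 v"
    using gauss_kernel_wt[OF \<epsilon>, of 0 2] unfolding gauss_kernel_0 by auto
  have w: "wint 2 (\<lambda>\<xi>. ee (u * \<xi>))"
    using integrable_inverse_abs_square wt_nat[of 2] by (simp add: wint_def)
  have inner: "conv ?K (\<lambda>\<xi>. ee (u * \<xi>)) \<eta> = ee (u * \<eta>) * of_real (gam (\<epsilon> * u))" for \<eta>
  proof -
    have "conv ?K (\<lambda>\<xi>. ee (u * \<xi>)) \<eta> = \<bar>- \<epsilon>\<bar> *\<^sub>R (LINT v|lborel. ?K (\<eta> - (\<eta> + (- \<epsilon>) * v)) * ee (u * (\<eta> + (- \<epsilon>) * v)))"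
      unfolding conv_def using \<epsilon> by (intro lborel_integral_real_affine) auto
    also have "\<dots> = (LINT v|lborel. \<bar>- \<epsilon>\<bar> *\<^sub>R (?K (\<eta> - (\<eta> + (- \<epsilon>) * v)) * ee (u * (\<eta> + (- \<epsilon>) * v))))"
      by (rule integral_scaleR_right[symmetric])
    also have "\<dots> = (LINT v|lborel. ee (u * \<eta>) * (of_real (gam v) * ee (v * (- (\<epsilon> * u)))))"
    proof (intro Bochner_Integration.integral_cong refl)
      fix v
      have "ee (u * (\<eta> + (- \<epsilon>) * v)) = ee (u * \<eta>) * ee (v * (- (\<epsilon> * u)))"
        by (simp add: algebra_simps flip: ee_add)
      then show "\<bar>- \<epsilon>\<bar> *\<^sub>R (?K (\<eta> - (\<eta> + (- \<epsilon>) * v)) * ee (u * (\<eta> + (- \<epsilon>) * v))) = ee (u * \<eta>) * (of_real (gam v) * ee (v * (- (\<epsilon> * u))))"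
        using \<epsilon> by (simp add: scaleR_conv_of_real)
    qed
    also have "\<dots> = ee (u * \<eta>) * of_real (gam (- (\<epsilon> * u)))"
      by (simp only: integral_mult_right_zero gam_fourier)
    finally show ?thesis by simp
  qed
  have Ksym: "?K (\<eta> - \<xi>) = ?K (\<xi> - \<eta>)" for \<eta> \<xi>
    using gam_minus[of "(\<eta> - \<xi>) / \<epsilon>"] by (simp add: minus_divide_left)
  have "inv_fourier (reg c l \<epsilon>) u = (LINT \<xi>|lborel. reg c l \<epsilon> \<xi> * ee (u * \<xi>))"
    by (rule inv_fourier_lborel) (rule schwartz_borel[OF reg_schwartz[OF l \<epsilon>]])
  also have "\<dots> = (LINT \<xi>|lborel. ee (u * \<xi>) * (LINT \<eta>|lborel. ?\<theta> \<eta> * ?K (\<eta> - \<xi>)))"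
    unfolding reg_def conv_def by (simp only: Ksym[of _ "_"] mult.commute)
  also have "\<dots> = (LINT \<eta>|lborel. ?\<theta> \<eta> * conv ?K (\<lambda>\<xi>. ee (u * \<xi>)) \<eta>)"
    by (rule conv_swap(1)[OF _ C Kc w symbol_affine_weighted[OF l], symmetric]) auto
  also have "\<dots> = (LINT \<eta>|lborel. of_real (gam (\<epsilon> * u)) * (?\<theta> \<eta> * ee (u * \<eta>)))"
    unfolding inner by (simp add: mult_ac)
  also have "\<dots> = ee (c * u) * (kern l 0 u * of_real (gam (\<epsilon> * u)))"
    by (simp only: integral_mult_right_zero symbol_affine_fourier[OF l]) (simp add: mult_ac)
  finally show ?thesis .
qed

subsection \<open>The regularised kernels\<close>

text \<open>The j-th derivative of \<open>kern l 0 u * gam (\<epsilon> * u)\<close>, expanded by the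
  Leibniz rule.\<close>

definition rkern :: "real \<Rightarrow> real \<Rightarrow> nat \<Rightarrow> real \<Rightarrow> complex" where
  "rkern l \<epsilon> = leibniz (kern l) (\<lambda>n u. of_real (\<epsilon> ^ n) * gd n (\<epsilon> * u))"

lemma rkern_0: "rkern l \<epsilon> 0 u = kern l 0 u * of_real (gam (\<epsilon> * u))"
  by (simp add: rkern_def leibniz_def gd_0)

lemma rkern_deriv: "(rkern l \<epsilon> j has_vector_derivative rkern l \<epsilon> (Suc j) u) (at u)"
  unfolding rkern_def by (rule leibniz_deriv) (rule kern_deriv gd_scaled_deriv)+

lemma continuous_on_rkern: "continuous_on S (rkern l \<epsilon> j)"
  by (rule continuous_on_deriv[OF rkern_deriv])

lemma measurable_rkern [measurable]: "rkern l \<epsilon> j \<in> borel_measurable borel"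
  by (intro borel_measurable_continuous_onI continuous_on_rkern)

text \<open>The constant deteriorates as \<epsilon> tends to 0. It only guarantees that for fixed
  \<epsilon> the convolutions with f converge at every order j, including j = 0.\<close>

lemma rkern_rapid_decay:
  assumes l: "l > 0" and \<epsilon>: "0 < \<epsilon>" "\<epsilon> \<le> 1"
  shows "\<exists>C. \<forall>u. norm (rkern l \<epsilon> j u) \<le> C * wt (real N) u"
proof -
  obtain C1 where C1: "\<And>n u. norm (kern l n u) \<le> C1 n"
  proof -
    have "\<exists>C. \<forall>u. norm (kern l n u) \<le> C" for n using kern_bounds[of n] l by blast
    then show ?thesis using that by metis
  qed
  obtain C2 where C2: "\<And>n u. norm (gd n u) \<le> C2 n * wt (real N) u" "\<And>n. C2 n > 0"
    using gd_wt[of _ N] by metis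
  have w: "wt (real N) (\<epsilon> * u) \<le> 1 / \<epsilon> ^ N * wt (real N) u" for u
    using wt_scale[OF \<epsilon>, of N u] \<epsilon>(1) by (simp add: field_simps)
  have "norm (rkern l \<epsilon> j u) \<le> (\<Sum>n\<le>j. real (j choose n) * (C1 (j - n) * (\<epsilon> ^ n * (C2 n * (1 / \<epsilon> ^ N))))) * wt (real N) u" for u
  proof -
    have "norm (rkern l \<epsilon> j u) \<le> (\<Sum>n\<le>j. real (j choose n) * (C1 (j - n) * (\<epsilon> ^ n * (C2 n * (1 / \<epsilon> ^ N * wt (real N) u)))))"
      unfolding rkern_def leibniz_def
    proof (rule sum_norm_le)
      fix n assume "n \<in> {..j}"
      have "norm (gd n (\<epsilon> * u)) \<le> C2 n * (1 / \<epsilon> ^ N * wt (real N) u)"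
        using C2(1)[of n "\<epsilon> * u"] mult_left_mono[OF w[of u], of "C2 n"] C2(2)[of n] by linarith
      moreover have "0 \<le> C1 (j - n)" using order_trans[OF norm_ge_zero C1] .
      ultimately have "norm (kern l (j - n) u) * (\<epsilon> ^ n * norm (gd n (\<epsilon> * u))) \<le> C1 (j - n) * (\<epsilon> ^ n * (C2 n * (1 / \<epsilon> ^ N * wt (real N) u)))"
        using \<epsilon>(1) by (intro mult_mono C1 mult_left_mono) auto
      moreover have eq: "norm (of_nat (j choose n) * (kern l (j - n) u * (of_real (\<epsilon> ^ n) * gd n (\<epsilon> * u))))
          = real (j choose n) * (norm (kern l (j - n) u) * (\<epsilon> ^ n * norm (gd n (\<epsilon> * u))))"
        using \<epsilon>(1) by (simp add: norm_mult norm_power)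
      ultimately show "norm (of_nat (j choose n) * (kern l (j - n) u * (of_real (\<epsilon> ^ n) * gd n (\<epsilon> * u)))) \<le> real (j choose n) * (C1 (j - n) * (\<epsilon> ^ n * (C2 n * (1 / \<epsilon> ^ N * wt (real N) u))))"
        unfolding eq by (intro mult_left_mono) auto
    qed
    also have "\<dots> = (\<Sum>n\<le>j. real (j choose n) * (C1 (j - n) * (\<epsilon> ^ n * (C2 n * (1 / \<epsilon> ^ N))))) * wt (real N) u"
      by (simp only: sum_distrib_right mult.assoc)
    finally show ?thesis .
  qed
  then show ?thesis by blast
qed

text \<open>In the Leibniz expansion the terms n >= 1 carry \<epsilon>^n. The term n = 0 carries 1 -
  gam(\<epsilon> u) <= pi \<epsilon>^2 u^2, where u^2 is absorbed by the decay of the kernel because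
  r >= 1. The uniform decay in the second bound comes from \<open>wt_scale\<close>.\<close>

lemma rkern_close:
  assumes l: "l > 0" and r: "r \<ge> 1"
  shows "\<exists>C>0. \<forall>\<epsilon> u. 0 < \<epsilon> \<and> \<epsilon> \<le> 1 \<longrightarrow> norm (rkern l \<epsilon> r u - kern l r u) \<le> C * \<epsilon> \<and>
     norm (rkern l \<epsilon> r u - kern l r u) \<le> C * wt (real (Suc r)) u"
proof -
  obtain C1 where C1: "\<And>n u. norm (kern l n u) \<le> C1 n * wt (real (Suc n)) u" "\<And>n. C1 n > 0"
    using kern_wt[OF l order_refl] by metis
  have "\<exists>C>0. \<forall>u. norm (gd n u) \<le> C * wt (real n) u" for n by (rule gd_wt)
  then obtain C2 where C2: "\<And>n u. norm (gd n u) \<le> C2 n * wt (real n) u" "\<And>n. C2 n > 0"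
    by metis
  define S where "S = (\<Sum>n\<in>{1..r}. real (r choose n) * (C1 (r - n) * C2 n))"
  have S: "S \<ge> 0" unfolding S_def using C1(2) C2(2) by (intro sum_nonneg mult_nonneg_nonneg) (auto intro: less_imp_le)
  define C where "C = C1 r * pi + S + 1"
  have wt1: "wt (real n) u \<le> 1" for n u using wt_antimono[of 0 "real n" u] by simp
  have "norm (rkern l \<epsilon> r u - kern l r u) \<le> C * \<epsilon> \<and> norm (rkern l \<epsilon> r u - kern l r u) \<le> C * wt (real (Suc r)) u"
    if \<epsilon>: "0 < \<epsilon>" "\<epsilon> \<le> 1" for \<epsilon> u
  proof -
    let ?t = "\<lambda>n. of_nat (r choose n) * (kern l (r - n) u * (of_real (\<epsilon> ^ n) * gd n (\<epsilon> * u)))"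
    have t: "norm (?t n) \<le> real (r choose n) * (C1 (r - n) * C2 n) * (wt (real (Suc r)) u)"
      "norm (?t n) \<le> real (r choose n) * (C1 (r - n) * C2 n) * \<epsilon> ^ n" if "n \<le> r" for n
    proof -
      have eq: "norm (?t n) = real (r choose n) * (norm (kern l (r - n) u) * (\<epsilon> ^ n * norm (gd n (\<epsilon> * u))))"
        using \<epsilon>(1) by (simp add: norm_mult norm_power)
      have "\<epsilon> ^ n * norm (gd n (\<epsilon> * u)) \<le> \<epsilon> ^ n * (C2 n * wt (real n) (\<epsilon> * u))"
        using \<epsilon>(1) by (intro mult_left_mono C2) auto
      also have "\<dots> \<le> C2 n * wt (real n) u"
        using mult_left_mono[OF wt_scale[OF \<epsilon>, of n u], of "C2 n"] C2(2)[of n] by (simp add: mult.left_commute)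
      finally have "norm (kern l (r - n) u) * (\<epsilon> ^ n * norm (gd n (\<epsilon> * u))) \<le> (C1 (r - n) * wt (real (Suc (r - n))) u) * (C2 n * wt (real n) u)"
      proof (rule mult_mono[OF C1(1)])
        show "0 \<le> C1 (r - n) * wt (real (Suc (r - n))) u" using C1(2)[of "r - n"] by simp
      qed (use \<epsilon>(1) in auto)
      also have "\<dots> = C1 (r - n) * C2 n * (wt (real (Suc (r - n))) u * wt (real n) u)" by simp
      also have "wt (real (Suc (r - n))) u * wt (real n) u = wt (real (Suc r)) u"
        unfolding wt_mult using that by (simp add: of_nat_diff)
      finally show "norm (?t n) \<le> real (r choose n) * (C1 (r - n) * C2 n) * (wt (real (Suc r)) u)"
        unfolding eq mult.assoc[of "real (r choose n)"] by (rule mult_left_mono) auto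
      have "norm (gd n (\<epsilon> * u)) \<le> C2 n * 1"
        using C2(1)[of n "\<epsilon> * u"] mult_left_mono[OF wt1[of n "\<epsilon> * u"], of "C2 n"] C2(2)[of n] by linarith
      moreover have "norm (kern l (r - n) u) \<le> C1 (r - n) * 1"
        using C1(1)[of "r - n" u] mult_left_mono[OF wt1[of "Suc (r - n)" u], of "C1 (r - n)"] C1(2)[of "r - n"] by linarith
      ultimately have "norm (kern l (r - n) u) * (\<epsilon> ^ n * norm (gd n (\<epsilon> * u))) \<le> (C1 (r - n) * 1) * (\<epsilon> ^ n * (C2 n * 1))"
        using \<epsilon>(1) C1(2)[of "r - n"] by (intro mult_mono mult_left_mono) auto
      then have "norm (kern l (r - n) u) * (\<epsilon> ^ n * norm (gd n (\<epsilon> * u))) \<le> (C1 (r - n) * C2 n) * \<epsilon> ^ n" by (simp add: mult_ac)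
      then show "norm (?t n) \<le> real (r choose n) * (C1 (r - n) * C2 n) * \<epsilon> ^ n"
        unfolding eq mult.assoc[of "real (r choose n)"] by (rule mult_left_mono) auto
    qed
    have split: "rkern l \<epsilon> r u - kern l r u = kern l r u * of_real (gam (\<epsilon> * u) - 1) + (\<Sum>n\<in>{1..r}. ?t n)"
    proof -
      have "{..r} = insert 0 {1..r}" by auto
      then have "rkern l \<epsilon> r u = ?t 0 + (\<Sum>n\<in>{1..r}. ?t n)" by (simp add: rkern_def leibniz_def)
      then show ?thesis by (simp add: gd_0 algebra_simps)
    qed
    have k0: "norm (kern l r u * of_real (gam (\<epsilon> * u) - 1)) = norm (kern l r u) * (1 - gam (\<epsilon> * u))"
      using gam_le_1[of "\<epsilon> * u"] unfolding norm_mult norm_of_real by (simp add: abs_of_nonpos)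
    have a1: "norm (kern l r u) * (1 - gam (\<epsilon> * u)) \<le> C1 r * pi * \<epsilon>"
    proof -
      have "wt (real (Suc r)) u * u\<^sup>2 \<le> wt 2 u * (1 + \<bar>u\<bar>)\<^sup>2"
        using r by (intro mult_mono wt_antimono) (auto simp: abs_le_square_iff[symmetric])
      also have "\<dots> = 1" using wt_nat[of 2 u] by (simp add: add_nonneg_eq_0_iff)
      finally have w: "wt (real (Suc r)) u * u\<^sup>2 \<le> 1" .
      have "norm (kern l r u) * (1 - gam (\<epsilon> * u)) \<le> (C1 r * wt (real (Suc r)) u) * (pi * (\<epsilon> * u)\<^sup>2)"
        using C1(2)[of r] by (intro mult_mono C1 one_minus_gam_le) auto
      also have "\<dots> = C1 r * pi * \<epsilon>\<^sup>2 * (wt (real (Suc r)) u * u\<^sup>2)" by (simp add: power_mult_distrib)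
      also have "\<dots> \<le> C1 r * pi * \<epsilon>\<^sup>2 * 1" using C1(2)[of r] w by (intro mult_left_mono) auto
      also have "\<epsilon>\<^sup>2 \<le> \<epsilon>" using \<epsilon> by (simp add: power2_eq_square mult_left_le)
      then have "C1 r * pi * \<epsilon>\<^sup>2 * 1 \<le> C1 r * pi * \<epsilon>" using C1(2)[of r] by (simp add: mult_left_mono)
      finally show ?thesis .
    qed
    have a2: "norm (kern l r u) * (1 - gam (\<epsilon> * u)) \<le> C1 r * pi * wt (real (Suc r)) u"
    proof -
      have "norm (kern l r u) * (1 - gam (\<epsilon> * u)) \<le> (C1 r * wt (real (Suc r)) u) * pi"
      proof (rule mult_mono[OF C1(1)])
        show "1 - gam (\<epsilon> * u) \<le> pi" using pi_gt3 gam_pos(2)[of "\<epsilon> * u"] by linarith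
      qed (use C1(2)[of r] in auto)
      then show ?thesis by (simp add: mult_ac)
    qed
    have s1: "norm (\<Sum>n\<in>{1..r}. ?t n) \<le> S * \<epsilon>"
      unfolding S_def sum_distrib_right
    proof (rule sum_norm_le)
      fix n assume n: "n \<in> {1..r}"
      have "\<epsilon> ^ n \<le> \<epsilon> ^ 1" using n \<epsilon> by (intro power_decreasing) auto
      then have "real (r choose n) * (C1 (r - n) * C2 n) * \<epsilon> ^ n \<le> real (r choose n) * (C1 (r - n) * C2 n) * \<epsilon>"
        using C1(2)[of "r - n"] C2(2)[of n] by (intro mult_left_mono) auto
      moreover have "norm (?t n) \<le> real (r choose n) * (C1 (r - n) * C2 n) * \<epsilon> ^ n"
        by (rule t(2)) (use n in auto)
      ultimately show "norm (?t n) \<le> real (r choose n) * (C1 (r - n) * C2 n) * \<epsilon>"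
        by (rule order_trans[rotated])
    qed
    have s2: "norm (\<Sum>n\<in>{1..r}. ?t n) \<le> S * wt (real (Suc r)) u"
      unfolding S_def sum_distrib_right by (rule sum_norm_le, rule t(1)) auto
    have n1: "norm (rkern l \<epsilon> r u - kern l r u) \<le> norm (kern l r u) * (1 - gam (\<epsilon> * u)) + norm (\<Sum>n\<in>{1..r}. ?t n)"
      unfolding split k0[symmetric] by (rule norm_triangle_ineq)
    have "norm (rkern l \<epsilon> r u - kern l r u) \<le> (C1 r * pi + S) * \<epsilon>"
      unfolding distrib_right using n1 a1 s1 by linarith
    also have "\<dots> \<le> C * \<epsilon>" unfolding C_def using \<epsilon>(1) by (intro mult_right_mono) auto
    finally have 1: "norm (rkern l \<epsilon> r u - kern l r u) \<le> C * \<epsilon>" .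
    have "norm (rkern l \<epsilon> r u - kern l r u) \<le> (C1 r * pi + S) * wt (real (Suc r)) u"
      unfolding distrib_right using n1 a2 s2 by linarith
    also have "\<dots> \<le> C * wt (real (Suc r)) u" unfolding C_def by (intro mult_right_mono) auto
    finally show ?thesis using 1 by blast
  qed
  moreover have "C > 0" unfolding C_def using C1(2)[of r] S by (intro add_nonneg_pos add_nonneg_nonneg mult_nonneg_nonneg) auto
  ultimately show ?thesis by blast
qed

text \<open>Interpolation between the uniform smallness and the uniform decay.\<close>

lemma rkern_weighted_close:
  assumes l: "l > 0" and r: "r \<ge> 1" and \<beta>: "0 < \<beta>" "\<beta> < real (Suc r)" and \<delta>: "\<delta> > 0"
  shows "\<exists>\<epsilon>0>0. \<forall>\<epsilon> u. 0 < \<epsilon> \<and> \<epsilon> \<le> \<epsilon>0 \<longrightarrow> \<epsilon> \<le> 1 \<and> norm (rkern l \<epsilon> r u - kern l r u) \<le> \<delta> * wt \<beta> u"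
proof -
  obtain C where C: "C > 0" and C': "\<forall>\<epsilon> u. 0 < \<epsilon> \<and> \<epsilon> \<le> 1 \<longrightarrow> norm (rkern l \<epsilon> r u - kern l r u) \<le> C * \<epsilon> \<and>
     norm (rkern l \<epsilon> r u - kern l r u) \<le> C * wt (real (Suc r)) u"
    using rkern_close[OF l r] by (elim exE conjE) (rule that)
  \<comment> \<open>The difference d is written as d^(1-p) d^p, the first factor estimated by the
    smallness in \<epsilon>, the second by the decay; p makes the weight exponent (r + 1) p equal to
    \<beta>. Then \<epsilon>0 solves C \<epsilon>^(1-p) = \<delta>, capped at 1.\<close>
  define p where "p = \<beta> / real (Suc r)"
  have p: "0 < p" "p < 1" using \<beta> by (auto simp: p_def)
  define \<epsilon>0 where "\<epsilon>0 = min 1 ((\<delta> / C) powr (1 / (1 - p)))"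
  have \<epsilon>0: "\<epsilon>0 > 0" using C \<delta> by (simp add: \<epsilon>0_def)
  have "norm (rkern l \<epsilon> r u - kern l r u) \<le> \<delta> * wt \<beta> u" if \<epsilon>: "0 < \<epsilon>" "\<epsilon> \<le> \<epsilon>0" for \<epsilon> u
  proof -
    define d where "d = norm (rkern l \<epsilon> r u - kern l r u)"
    have \<epsilon>1: "\<epsilon> \<le> 1" using \<epsilon>(2) by (simp add: \<epsilon>0_def)
    have d: "0 \<le> d" "d \<le> C * \<epsilon>" "d \<le> C * wt (real (Suc r)) u"
      using C'[rule_format, of \<epsilon> u] \<epsilon>(1) \<epsilon>1 by (auto simp: d_def)
    have "d = d powr (1 - p) * d powr p" using d(1) by (simp flip: powr_add)
    also have "\<dots> \<le> (C * \<epsilon>) powr (1 - p) * (C * wt (real (Suc r)) u) powr p"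
      using d p by (intro mult_mono powr_mono2) auto
    also have "\<dots> = C powr (1 - p) * C powr p * (\<epsilon> powr (1 - p) * wt (real (Suc r)) u powr p)"
      by (simp add: powr_mult)
    also have "C powr (1 - p) * C powr p = C" using C by (simp flip: powr_add)
    also have "wt (real (Suc r)) u powr p = wt \<beta> u"
    proof -
      have "- real (Suc r) * p = - \<beta>" by (simp add: p_def del: of_nat_Suc)
      then show ?thesis unfolding wt_def powr_powr by simp
    qed
    also have "C * (\<epsilon> powr (1 - p) * wt \<beta> u) \<le> C * (\<delta> / C * wt \<beta> u)"
    proof (intro mult_left_mono mult_right_mono)
      have "\<epsilon> powr (1 - p) \<le> ((\<delta> / C) powr (1 / (1 - p))) powr (1 - p)"
        using \<epsilon> p by (intro powr_mono2) (auto simp: \<epsilon>0_def)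
      also have "\<dots> = \<delta> / C" using p C \<delta> by (simp add: powr_powr)
      finally show "\<epsilon> powr (1 - p) \<le> \<delta> / C" .
    qed (use C in auto)
    finally show ?thesis using C by (simp add: d_def)
  qed
  moreover have "\<epsilon>0 \<le> 1" by (simp add: \<epsilon>0_def)
  ultimately show ?thesis using \<epsilon>0 by (intro exI[of _ \<epsilon>0]) auto
qed

end

text \<open>The constant does not depend on p, so a bound on the sum over m of square integrals of
  polynomials carries over from one interval to another.\<close>

lemma poly_sqint_growth:
  assumes \<rho>: "\<rho> > 0" and X: "X > 0"
  shows "\<exists>C>0. \<forall>p\<in>polys_less r. sqint {- X..X} (\<lambda>t. poly p (of_real t)) \<le> ennreal C * sqint {x - \<rho>..x + \<rho>} (\<lambda>t. poly p (of_real t))"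
proof -
  obtain Cp where Cp: "Cp > 0" and Cp': "\<forall>p\<in>polys_less r. \<forall>x \<sigma> t N. \<sigma> > 0 \<and> N \<ge> 0 \<and>
     sqint {x - \<sigma>..x + \<sigma>} (\<lambda>t. poly p (of_real t)) \<le> ennreal N \<longrightarrow>
     (norm (poly p (of_real t)))\<^sup>2 \<le> Cp * (1 + \<bar>t - x\<bar> / \<sigma>) ^ (2 * (r - 1)) * N / \<sigma>"
    using poly_pointwise_bound[of r] by (elim exE conjE) (rule that)
  define D where "D = Cp * (1 + (X + \<bar>x\<bar>) / \<rho>) ^ (2 * (r - 1)) / \<rho>"
  have D: "D > 0" using Cp \<rho> X unfolding D_def by (intro divide_pos_pos mult_pos_pos zero_less_power add_pos_nonneg) auto
  have "sqint {- X..X} (\<lambda>t. poly p (of_real t)) \<le> ennreal (2 * X * D) * sqint {x - \<rho>..x + \<rho>} (\<lambda>t. poly p (of_real t))"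
    if p: "p \<in> polys_less r" for p
  proof (cases "sqint {x - \<rho>..x + \<rho>} (\<lambda>t. poly p (of_real t))")
    case (real N)
    have "norm (poly p (of_real t)) \<le> sqrt (D * N)" if t: "t \<in> {0 - X..0 + X}" for t
    proof (rule real_le_rsqrt)
      have "(norm (poly p (of_real t)))\<^sup>2 \<le> Cp * (1 + \<bar>t - x\<bar> / \<rho>) ^ (2 * (r - 1)) * N / \<rho>"
        using Cp'[rule_format, OF p, of \<rho> N x t] real \<rho> by auto
      also have "\<dots> \<le> Cp * (1 + (X + \<bar>x\<bar>) / \<rho>) ^ (2 * (r - 1)) * N / \<rho>"
        using Cp \<rho> t real by (intro divide_right_mono mult_right_mono mult_left_mono power_mono add_left_mono) (auto simp: abs_le_iff)
      finally show "(norm (poly p (of_real t)))\<^sup>2 \<le> D * N" by (simp add: D_def)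
    qed
    then have "sqint {0 - X..0 + X} (\<lambda>t. poly p (of_real t)) \<le> ennreal (2 * X * (sqrt (D * N))\<^sup>2)"
      using X D real by (intro sqint_le_bound) auto
    also have "2 * X * (sqrt (D * N))\<^sup>2 = 2 * X * D * N" using D real by simp
    also have "ennreal \<dots> = ennreal (2 * X * D) * ennreal N" using X D real by (intro ennreal_mult) auto
    finally show ?thesis using real by simp
  next
    case top
    then show ?thesis using X D by (simp add: ennreal_mult_top)
  qed
  moreover have "2 * X * D > 0" using X D by simp
  ultimately show ?thesis by blast
qed

context jump_symbol
begin

lemma reg_as_average:
  assumes \<epsilon>: "\<epsilon> > 0"
  shows "reg c l \<epsilon> \<xi> = (LINT v|lborel. of_real (gam v) * \<theta> ((\<xi> - \<epsilon> * v - c) / l))"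
proof -
  have "reg c l \<epsilon> \<xi> = \<bar>- \<epsilon>\<bar> *\<^sub>R (LINT v|lborel. of_real (gam ((\<xi> - (\<xi> + (- \<epsilon>) * v)) / \<epsilon>) / \<epsilon>) * \<theta> ((\<xi> + (- \<epsilon>) * v - c) / l))"
    unfolding reg_def conv_def using \<epsilon> by (intro lborel_integral_real_affine) auto
  also have "\<dots> = (LINT v|lborel. \<bar>- \<epsilon>\<bar> *\<^sub>R (of_real (gam ((\<xi> - (\<xi> + (- \<epsilon>) * v)) / \<epsilon>) / \<epsilon>) * \<theta> ((\<xi> + (- \<epsilon>) * v - c) / l)))"
    by (rule integral_scaleR_right[symmetric])
  also have "\<dots> = (LINT v|lborel. of_real (gam v) * \<theta> ((\<xi> - \<epsilon> * v - c) / l))"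
    using \<epsilon> by (intro Bochner_Integration.integral_cong refl) (simp add: scaleR_conv_of_real)
  finally show ?thesis .
qed

lemma reg_bounded:
  assumes \<epsilon>: "\<epsilon> > 0"
  shows "norm (reg c l \<epsilon> \<xi>) \<le> B"
proof -
  have "norm (reg c l \<epsilon> \<xi>) \<le> (LINT v|lborel. norm (complex_of_real (gam v) * \<theta> ((\<xi> - \<epsilon> * v - c) / l)))"
    unfolding reg_as_average[OF \<epsilon>] by (rule integral_norm_bound)
  also have "\<dots> \<le> (LINT v|lborel. B * gam v)"
  proof (rule integral_mono)
    show "integrable lborel (\<lambda>v. norm (complex_of_real (gam v) * \<theta> ((\<xi> - \<epsilon> * v - c) / l)))"
      by (rule Bochner_Integration.integrable_bound[OF integrable_mult_right[OF gam_integrable, of B]])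
         (use \<theta>_bound B_nonneg in \<open>auto simp: norm_mult abs_mult mult.commute intro!: mult_right_mono\<close>)
    show "integrable lborel (\<lambda>v. B * gam v)" by (intro integrable_mult_right gam_integrable)
    show "norm (complex_of_real (gam v) * \<theta> ((\<xi> - \<epsilon> * v - c) / l)) \<le> B * gam v" for v
      using \<theta>_bound by (simp add: norm_mult mult.commute mult_right_mono)
  qed
  also have "\<dots> = B" using gam_integral by simp
  finally show ?thesis .
qed

text \<open>A square integrable majorant uniform in \<epsilon>. Away from the support, |z| gam z <=
  C gives gam((\<xi> - \<eta>)/\<epsilon>)/\<epsilon> <= C/|\<xi> - \<eta>|, in which \<epsilon> no
  longer occurs.\<close>

lemma reg_dominated:
  assumes l: "l > 0"
  shows "\<exists>E\<ge>0. (\<forall>\<epsilon> \<xi>. \<epsilon> > 0 \<longrightarrow> norm (reg c l \<epsilon> \<xi>) \<le> E * wt 1 \<xi>) \<and> (\<forall>\<xi>. norm (\<theta> ((\<xi> - c) / l)) \<le> E * wt 1 \<xi>)"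
proof -
  \<comment> \<open>Chosen so that |\<xi>| > X and |\<eta> - c| <= l imply |\<xi> - \<eta>| >= (1 +
    |\<xi>|)/4.\<close>
  define X where "X = 2 * (\<bar>c\<bar> + l) + 1"
  have X: "X \<ge> 1" using l by (simp add: X_def)
  have w1: "wt 1 \<xi> = 1 / (1 + \<bar>\<xi>\<bar>)" for \<xi> using wt_nat[of 1 \<xi>] by simp
  have near: "B \<le> B * (1 + X) * wt 1 \<xi>" if "\<bar>\<xi>\<bar> \<le> X" for \<xi>
  proof -
    have "1 \<le> (1 + X) / (1 + \<bar>\<xi>\<bar>)" using that by simp
    from mult_left_mono[OF this B_nonneg] show ?thesis by (simp add: w1)
  qed
  obtain C where C: "\<And>v. \<bar>v\<bar> ^ 1 * gam v \<le> C" using power_mult_gam_bounded by metis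
  have C0: "C \<ge> 0" using C[of 0] by simp
  define I where "I = (LINT \<eta>|lborel. norm (\<theta> ((\<eta> - c) / l)))"
  have I0: "I \<ge> 0" by (simp add: I_def)
  define E where "E = B * (1 + X) + 4 * C * I"
  have E0: "E \<ge> 0" using B_nonneg X C0 I0 by (simp add: E_def)
  have "norm (reg c l \<epsilon> \<xi>) \<le> E * wt 1 \<xi>" if \<epsilon>: "\<epsilon> > 0" for \<epsilon> \<xi>
  proof (cases "\<bar>\<xi>\<bar> \<le> X")
    case True
    have "norm (reg c l \<epsilon> \<xi>) \<le> B * (1 + X) * wt 1 \<xi>"
      using reg_bounded[OF \<epsilon>] near[OF True] by (rule order_trans)
    also have "\<dots> \<le> E * wt 1 \<xi>" using C0 I0 by (intro mult_right_mono) (auto simp: E_def)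
    finally show ?thesis .
  next
    case False
    have pt: "norm (of_real (gam ((\<xi> - \<eta>) / \<epsilon>) / \<epsilon>) * \<theta> ((\<eta> - c) / l)) \<le> 4 * C * wt 1 \<xi> * norm (\<theta> ((\<eta> - c) / l))" for \<eta>
    proof (cases "\<eta> \<in> {c - l..c + l}")
      case True
      have "\<bar>\<xi> - \<eta>\<bar> \<ge> (1 + \<bar>\<xi>\<bar>) / 4" using True False X by (auto simp: X_def abs_le_iff)
      then have u: "\<bar>\<xi> - \<eta>\<bar> > 0" by (rule less_le_trans[rotated]) (simp add: add_pos_nonneg)
      with \<open>\<bar>\<xi> - \<eta>\<bar> \<ge> (1 + \<bar>\<xi>\<bar>) / 4\<close> have u: "\<bar>\<xi> - \<eta>\<bar> > 0" "1 / \<bar>\<xi> - \<eta>\<bar> \<le> 4 * wt 1 \<xi>"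
        by (auto simp: w1 divide_simps)
      have "gam ((\<xi> - \<eta>) / \<epsilon>) / \<epsilon> = (\<bar>(\<xi> - \<eta>) / \<epsilon>\<bar> ^ 1 * gam ((\<xi> - \<eta>) / \<epsilon>)) * (1 / \<bar>\<xi> - \<eta>\<bar>)"
        using \<epsilon> u(1) by (simp add: field_simps)
      also have "\<dots> \<le> C * (4 * wt 1 \<xi>)"
        using C[of "(\<xi> - \<eta>) / \<epsilon>"] u C0 by (intro mult_mono) auto
      finally have "gam ((\<xi> - \<eta>) / \<epsilon>) / \<epsilon> \<le> 4 * C * wt 1 \<xi>" by simp
      then have "gam ((\<xi> - \<eta>) / \<epsilon>) / \<epsilon> * norm (\<theta> ((\<eta> - c) / l)) \<le> 4 * C * wt 1 \<xi> * norm (\<theta> ((\<eta> - c) / l))"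
        by (rule mult_right_mono) auto
      then show ?thesis using \<epsilon> by (simp add: norm_mult norm_divide)
    next
      case False
      then show ?thesis using symbol_affine_outside[OF l False] by simp
    qed
    have it: "integrable lborel (\<lambda>\<eta>. 4 * C * wt 1 \<xi> * norm (\<theta> ((\<eta> - c) / l)))"
      by (intro integrable_mult_right integrable_norm symbol_affine_integrable[OF l])
    have "norm (reg c l \<epsilon> \<xi>) \<le> (LINT \<eta>|lborel. norm (of_real (gam ((\<xi> - \<eta>) / \<epsilon>) / \<epsilon>) * \<theta> ((\<eta> - c) / l)))"
      unfolding reg_def conv_def by (rule integral_norm_bound)
    also have "\<dots> \<le> (LINT \<eta>|lborel. 4 * C * wt 1 \<xi> * norm (\<theta> ((\<eta> - c) / l)))"
    proof (rule integral_mono[OF _ it pt])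
      show "integrable lborel (\<lambda>\<eta>. norm (of_real (gam ((\<xi> - \<eta>) / \<epsilon>) / \<epsilon>) * \<theta> ((\<eta> - c) / l)))"
      proof (rule integrable_norm, rule Bochner_Integration.integrable_bound[OF it])
        show "AE \<eta> in lborel. norm (of_real (gam ((\<xi> - \<eta>) / \<epsilon>) / \<epsilon>) * \<theta> ((\<eta> - c) / l)) \<le> norm (4 * C * wt 1 \<xi> * norm (\<theta> ((\<eta> - c) / l)))"
          using pt by (intro AE_I2) (auto intro: order_trans[OF _ abs_ge_self])
      qed measurable
    qed
    also have "\<dots> = 4 * C * I * wt 1 \<xi>" by (simp add: I_def)
    also have "\<dots> \<le> E * wt 1 \<xi>" using B_nonneg X by (intro mult_right_mono) (auto simp: E_def)
    finally show ?thesis .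
  qed
  moreover have "norm (\<theta> ((\<xi> - c) / l)) \<le> E * wt 1 \<xi>" for \<xi>
  proof (cases "\<bar>\<xi>\<bar> \<le> X")
    case True
    have "norm (\<theta> ((\<xi> - c) / l)) \<le> B * (1 + X) * wt 1 \<xi>"
      using \<theta>_bound near[OF True] by (rule order_trans)
    also have "\<dots> \<le> E * wt 1 \<xi>" using C0 I0 by (intro mult_right_mono) (auto simp: E_def)
    finally show ?thesis .
  next
    case False
    then have "\<xi> \<notin> {c - l..c + l}" using l by (auto simp: X_def abs_le_iff)
    then show ?thesis using symbol_affine_outside[OF l] E0 by simp
  qed
  ultimately show ?thesis using E0 by blast
qed

text \<open>The averages converge wherever the symbol is continuous, hence almost everywhere, and
  \<open>reg_dominated\<close> provides the majorant.\<close>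

lemma reg_tendsto:
  assumes l: "l > 0" and disc: "finite {\<xi>. \<not> isCont \<theta> \<xi>}"
    and \<epsilon>: "\<And>n. \<epsilon> n > 0" "\<epsilon> \<longlonglongrightarrow> 0"
  shows "(\<lambda>n. sqint UNIV (\<lambda>\<xi>. reg c l (\<epsilon> n) \<xi> - \<theta> ((\<xi> - c) / l))) \<longlonglongrightarrow> 0"
proof -
  obtain E where E: "E \<ge> 0" "\<And>\<epsilon> \<xi>. \<epsilon> > 0 \<Longrightarrow> norm (reg c l \<epsilon> \<xi>) \<le> E * wt 1 \<xi>" "\<And>\<xi>. norm (\<theta> ((\<xi> - c) / l)) \<le> E * wt 1 \<xi>"
    using reg_dominated[OF l] by blast
  have [measurable]: "reg c l (\<epsilon> n) \<in> borel_measurable borel" for n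
    by (rule schwartz_borel[OF reg_schwartz[OF l \<epsilon>(1)]])
  have pt: "(\<lambda>n. reg c l (\<epsilon> n) \<xi>) \<longlonglongrightarrow> \<theta> ((\<xi> - c) / l)" if cont: "isCont \<theta> ((\<xi> - c) / l)" for \<xi>
  proof -
    have "(\<lambda>n. LINT v|lborel. of_real (gam v) * \<theta> ((\<xi> - \<epsilon> n * v - c) / l)) \<longlonglongrightarrow> (LINT v|lborel. of_real (gam v) * \<theta> ((\<xi> - c) / l))"
    proof (rule integral_dominated_convergence)
      show "integrable lborel (\<lambda>v. B * gam v)" by (intro integrable_mult_right gam_integrable)
      show "AE v in lborel. (\<lambda>n. complex_of_real (gam v) * \<theta> ((\<xi> - \<epsilon> n * v - c) / l)) \<longlonglongrightarrow> of_real (gam v) * \<theta> ((\<xi> - c) / l)"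
      proof (intro AE_I2 tendsto_mult_left)
        fix v
        have "(\<lambda>n. (\<xi> - \<epsilon> n * v - c) / l) \<longlonglongrightarrow> (\<xi> - 0 * v - c) / l"
          using l by (intro tendsto_intros \<epsilon>(2)) auto
        then show "(\<lambda>n. \<theta> ((\<xi> - \<epsilon> n * v - c) / l)) \<longlonglongrightarrow> \<theta> ((\<xi> - c) / l)"
          by (intro isCont_tendsto_compose[OF cont]) simp
      qed
      show "AE v in lborel. norm (complex_of_real (gam v) * \<theta> ((\<xi> - \<epsilon> n * v - c) / l)) \<le> B * gam v" for n
        using \<theta>_bound by (auto simp: norm_mult mult.commute intro!: AE_I2 mult_right_mono)
    qed auto
    then show ?thesis using gam_integral by (simp add: reg_as_average[OF \<epsilon>(1)])
  qed
  have AEc: "AE \<xi> in lborel. isCont \<theta> ((\<xi> - c) / l)"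
  proof -
    have "finite ((\<lambda>z. c + l * z) ` {\<xi>. \<not> isCont \<theta> \<xi>})" using disc by simp
    then have "AE \<xi> in lborel. \<xi> \<notin> (\<lambda>z. c + l * z) ` {\<xi>. \<not> isCont \<theta> \<xi>}"
      by (intro AE_not_in finite_imp_null_set_lborel)
    then show ?thesis
    proof eventually_elim
      case (elim \<xi>)
      have "\<xi> = c + l * ((\<xi> - c) / l)" using l by simp
      then show ?case using elim by blast
    qed
  qed
  have "(\<lambda>n. sqint UNIV (\<lambda>\<xi>. reg c l (\<epsilon> n) \<xi> - \<theta> ((\<xi> - c) / l))) \<longlonglongrightarrow> (\<integral>\<^sup>+\<xi>. 0 \<partial>(lborel :: real measure))"
    unfolding sqint_def
  proof (rule nn_integral_dominated_convergence[where w="\<lambda>\<xi>. ennreal (4 * E\<^sup>2 * (1 / (1 + \<bar>\<xi>\<bar>)\<^sup>2))"])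
    have "integrable lborel (\<lambda>\<xi>::real. 4 * E\<^sup>2 * (1 / (1 + \<bar>\<xi>\<bar>)\<^sup>2))"
      by (intro integrable_mult_right integrable_inverse_abs_square)
    then show "(\<integral>\<^sup>+\<xi>. ennreal (4 * E\<^sup>2 * (1 / (1 + \<bar>\<xi>\<bar>)\<^sup>2)) \<partial>lborel) < \<infinity>"
      by (subst nn_integral_eq_integral) auto
    show "AE \<xi> in lborel. ennreal ((norm (reg c l (\<epsilon> n) \<xi> - \<theta> ((\<xi> - c) / l)))\<^sup>2) * indicator UNIV \<xi> \<le> ennreal (4 * E\<^sup>2 * (1 / (1 + \<bar>\<xi>\<bar>)\<^sup>2))" for n
    proof (rule AE_I2)
      fix \<xi>
      have "norm (reg c l (\<epsilon> n) \<xi> - \<theta> ((\<xi> - c) / l)) \<le> 2 * E * wt 1 \<xi>"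
        using norm_triangle_ineq4[of "reg c l (\<epsilon> n) \<xi>" "\<theta> ((\<xi> - c) / l)"] E(2)[OF \<epsilon>(1), of n \<xi>] E(3)[of \<xi>] by linarith
      then have "(norm (reg c l (\<epsilon> n) \<xi> - \<theta> ((\<xi> - c) / l)))\<^sup>2 \<le> (2 * E * wt 1 \<xi>)\<^sup>2" by (intro power_mono) auto
      also have "\<dots> = 4 * E\<^sup>2 * (1 / (1 + \<bar>\<xi>\<bar>)\<^sup>2)"
        using wt_nat[of 1 \<xi>] by (simp add: power_mult_distrib power_divide)
      finally show "ennreal ((norm (reg c l (\<epsilon> n) \<xi> - \<theta> ((\<xi> - c) / l)))\<^sup>2) * indicator UNIV \<xi> \<le> ennreal (4 * E\<^sup>2 * (1 / (1 + \<bar>\<xi>\<bar>)\<^sup>2))"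
        by (simp add: ennreal_leI)
    qed
    show "AE \<xi> in lborel. (\<lambda>n. ennreal ((norm (reg c l (\<epsilon> n) \<xi> - \<theta> ((\<xi> - c) / l)))\<^sup>2) * indicator UNIV \<xi>) \<longlonglongrightarrow> 0"
      using AEc
    proof eventually_elim
      case (elim \<xi>)
      have "(\<lambda>n. ennreal ((norm (reg c l (\<epsilon> n) \<xi> - \<theta> ((\<xi> - c) / l)))\<^sup>2)) \<longlonglongrightarrow> ennreal ((norm (\<theta> ((\<xi> - c) / l) - \<theta> ((\<xi> - c) / l)))\<^sup>2)"
        by (intro tendsto_intros pt elim)
      then show ?case by simp
    qed
  qed auto
  then show ?thesis by simp
qed

text \<open>The kernel of the regularised symbol is \<open>rkern\<close> with phase ee(c u);
  splitting this phase over y - t, the part in y cancels the demodulation and the part in t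
  modulates f.\<close>

lemma freq_mult_reg:
  assumes l: "l > 0" and \<epsilon>: "0 < \<epsilon>" "\<epsilon> \<le> 1" and f: "wint a f" and a: "a \<ge> 0"
  shows "ee (- c * x) * freq_mult f (reg c l \<epsilon>) x = conv (rkern l \<epsilon> 0) (modulate c f) x"
proof -
  have inv: "inv_fourier (reg c l \<epsilon>) = (\<lambda>u. ee (c * u) * rkern l \<epsilon> 0 u)"
    by (auto simp: inv_fourier_reg[OF l \<epsilon>(1)] rkern_0)
  obtain N :: nat where N: "a \<le> real N" using real_arch_simple by blast
  have rd: "\<exists>C. \<forall>u. norm (rkern l \<epsilon> j u) \<le> C * wt (real N) u" for j by (rule rkern_rapid_decay[OF l \<epsilon>])
  obtain C0 C1 where C: "\<And>u. norm (rkern l \<epsilon> 0 u) \<le> C0 * wt (real N) u" "\<And>u. norm (rkern l \<epsilon> (Suc 0) u) \<le> C1 * wt (real N) u"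
    using rd[of 0] rd[of "Suc 0"] by blast
  have fN: "wint (real N) f" by (rule wint_mono[OF f N])
  have N0: "real N \<ge> 0" by simp
  have conv_eq: "conv (inv_fourier (reg c l \<epsilon>)) f y = ee (c * y) * conv (rkern l \<epsilon> 0) (modulate c f) y" for y
  proof -
    have "ee (c * (y - t)) = ee (c * y) * ee (- c * t)" for t by (simp add: algebra_simps flip: ee_add)
    then have "conv (inv_fourier (reg c l \<epsilon>)) f y = (LINT t|lborel. ee (c * y) * (rkern l \<epsilon> 0 (y - t) * modulate c f t))"
      unfolding conv_def inv modulate_def by (intro Bochner_Integration.integral_cong refl) (simp add: mult_ac)
    then show ?thesis by (simp add: conv_def)
  qed
  have cont: "continuous_on UNIV (conv (rkern l \<epsilon> 0) (modulate c f))"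
    by (rule continuous_on_deriv[OF conv_deriv[OF N0 C rkern_deriv wint_modulate[OF fN]]])
  have "freq_mult f (reg c l \<epsilon>) = conv (inv_fourier (reg c l \<epsilon>)) f"
  proof (rule freq_mult_eq_conv[OF fN N0 schwartz_integrable[OF reg_schwartz[OF l \<epsilon>(1)]]])
    show "norm (inv_fourier (reg c l \<epsilon>) u) \<le> C0 * wt (real N) u" for u
      using C(1)[of u] by (simp add: inv norm_mult)
    show "continuous_on UNIV (inv_fourier (reg c l \<epsilon>))"
      unfolding inv by (intro continuous_intros continuous_on_rkern)
    show "continuous_on UNIV (conv (inv_fourier (reg c l \<epsilon>)) f)"
      unfolding conv_eq[abs_def] by (intro continuous_intros cont)
  qed
  then have "ee (- c * x) * freq_mult f (reg c l \<epsilon>) x = (ee (- (c * x)) * ee (c * x)) * conv (rkern l \<epsilon> 0) (modulate c f) x"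
    by (simp only: conv_eq mult.assoc) simp
  then show ?thesis by simp
qed

lemma reg_chain:
  assumes l: "l > 0" and \<epsilon>: "0 < \<epsilon>" "\<epsilon> \<le> 1" and f: "wint a f"
  shows "chain r (\<lambda>j. conv (rkern l \<epsilon> j) (modulate c f))"
  unfolding chain_def
proof (intro allI impI)
  fix j x assume "j < r"
  obtain N :: nat where N: "a \<le> real N" using real_arch_simple by blast
  obtain C0 C1 where C: "\<And>u. norm (rkern l \<epsilon> j u) \<le> C0 * wt (real N) u" "\<And>u. norm (rkern l \<epsilon> (Suc j) u) \<le> C1 * wt (real N) u"
    using rkern_rapid_decay[OF l \<epsilon>, of j N] rkern_rapid_decay[OF l \<epsilon>, of "Suc j" N] by blast
  show "(conv (rkern l \<epsilon> j) (modulate c f) has_vector_derivative conv (rkern l \<epsilon> (Suc j)) (modulate c f) x) (at x)"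
    by (rule conv_deriv[OF _ C rkern_deriv wint_modulate[OF wint_mono[OF f N]]]) simp
qed

text \<open>All error terms are measured in one weighted \<open>L\<^sup>1\<close> norm of \<open>f\<close>, so that the regularisation
  parameters can be chosen before \<open>f\<close>, with errors summable in \<open>m\<close>.\<close>

lemma regularised_error:
  assumes l: "l > 0" and \<epsilon>: "0 < \<epsilon>" "\<epsilon> \<le> 1" and \<beta>: "0 \<le> \<beta>" "\<beta> \<le> real (Suc r)" and f: "wint \<beta> f"
    and close: "\<And>u. norm (rkern l \<epsilon> r u - kern l r u) \<le> \<delta> * wt \<beta> u" and \<delta>: "\<delta> \<ge> 0"
    and U: "chain r U" "U r = op r c l f"
  shows "\<exists>q\<in>polys_less r. \<forall>X y. \<bar>y\<bar> \<le> X \<longrightarrow>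
     norm (conv (rkern l \<epsilon> 0) (modulate c f) y - poly q (of_real y) - U 0 y) \<le> X ^ r * (\<delta> * (1 + X) powr \<beta> * wnorm \<beta> f)"
proof -
  define V where "V j = conv (rkern l \<epsilon> j) (modulate c f)" for j
  have V: "chain r V" unfolding V_def[abs_def] by (rule reg_chain[OF l \<epsilon> f])
  obtain N :: nat where N: "\<beta> \<le> real N" using real_arch_simple by blast
  have fm: "wint \<beta> (modulate c f)" by (rule wint_modulate[OF f])
  have fN: "wint (real N) (modulate c f)" by (rule wint_mono[OF fm N])
  obtain C0 C1 where C: "\<And>u. norm (rkern l \<epsilon> r u) \<le> C0 * wt (real N) u" "\<And>u. norm (rkern l \<epsilon> (Suc r) u) \<le> C1 * wt (real N) u"
    using rkern_rapid_decay[OF l \<epsilon>, of r N] rkern_rapid_decay[OF l \<epsilon>, of "Suc r" N] by blast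
  have cV: "continuous_on UNIV (V r)"
    unfolding V_def by (rule continuous_on_deriv[OF conv_deriv[OF _ C rkern_deriv fN]]) simp
  have cU: "continuous_on UNIV (op r c l f)" by (rule op_continuous[OF l \<beta> f])
  \<comment> \<open>T is the error of the r-th derivatives. Its r-fold antiderivative Z with zero
    data at 0 inherits the smallness, and V - U - Z has vanishing r-th derivative, so it is the
    polynomial q.\<close>
  define T where "T y = V r y - op r c l f y" for y
  have "continuous_on UNIV T" unfolding T_def by (intro continuous_intros cV cU)
  then obtain Z where Z: "chain r Z" "Z r = T" "\<And>j. j < r \<Longrightarrow> Z j 0 = 0"
    using chain_exists[of T r 0] by blast
  have Tb: "norm (T y) \<le> \<delta> * (1 + \<bar>y\<bar>) powr \<beta> * wnorm \<beta> f" for y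
  proof -
    have "T y = conv (\<lambda>u. rkern l \<epsilon> r u - kern l r u) (modulate c f) y"
      unfolding T_def V_def op_def conv_def
      using conv_integrable[OF _ C(1) measurable_rkern fN, of y] op_integrable[OF l \<beta> f, of y c]
      by (simp add: left_diff_distrib)
    also have "norm \<dots> \<le> \<delta> * (1 + \<bar>y\<bar>) powr \<beta> * wnorm \<beta> (modulate c f)"
      by (rule conv_norm_le[OF \<beta>(1) close _ fm]) measurable
    finally show ?thesis by (simp add: wnorm_modulate)
  qed
  have "\<exists>q\<in>polys_less r. \<forall>x. (\<lambda>j x. (V j x - U j x) - Z j x) 0 x = poly q (of_real x)"
    by (rule chain_zero_poly) (auto intro!: chain_diff V U Z(1) simp: U(2) Z(2) T_def)
  then obtain q where q: "q \<in> polys_less r" "\<And>x. (V 0 x - U 0 x) - Z 0 x = poly q (of_real x)" by blast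
  have "norm (conv (rkern l \<epsilon> 0) (modulate c f) y - poly q (of_real y) - U 0 y) \<le> X ^ r * (\<delta> * (1 + X) powr \<beta> * wnorm \<beta> f)"
    if y: "\<bar>y\<bar> \<le> X" for X y
  proof -
    have "conv (rkern l \<epsilon> 0) (modulate c f) y - poly q (of_real y) - U 0 y = Z 0 y"
      using q(2)[of y] by (simp add: V_def[symmetric] algebra_simps)
    also have "norm (Z 0 y) \<le> X ^ r * (\<delta> * (1 + X) powr \<beta> * wnorm \<beta> f)"
    proof (rule chain_bound[OF Z(1) Z(3)])
      show "norm (Z r y) \<le> \<delta> * (1 + X) powr \<beta> * wnorm \<beta> f" if "\<bar>y - 0\<bar> \<le> X" for y
      proof -
        have "(1 + \<bar>y\<bar>) powr \<beta> \<le> (1 + X) powr \<beta>" using that \<beta>(1) by (intro powr_mono2) auto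
        then have "\<delta> * (1 + \<bar>y\<bar>) powr \<beta> * wnorm \<beta> f \<le> \<delta> * (1 + X) powr \<beta> * wnorm \<beta> f"
          using \<delta> by (intro mult_right_mono mult_left_mono) auto
        then show ?thesis using Tb[of y] by (simp add: Z(2))
      qed
    qed (use y in auto)
    finally show ?thesis .
  qed
  then show ?thesis using q(1) by blast
qed

text \<open>All that is needed about a single f, stated with finite subsets of M and uniform errors
  on compact sets. The natural number m is its own weight: (1/2)^(m + \<nu>) is summable over any
  index set of naturals and tends to 0 in \<nu>.\<close>

definition good_family ::
    "nat \<Rightarrow> nat \<Rightarrow> real \<Rightarrow> real \<Rightarrow> nat set \<Rightarrow> (nat \<Rightarrow> real) \<Rightarrow> (nat \<Rightarrow> real) \<Rightarrow> (nat \<Rightarrow> nat \<Rightarrow> real \<Rightarrow> complex) \<Rightarrow> (real \<Rightarrow> complex) \<Rightarrow> bool" where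
  "good_family r i s C M c l \<Psi> f \<longleftrightarrow> (\<exists>p g.
     (\<forall>m \<nu>. p m \<nu> \<in> polys_less r) \<and> (\<forall>m\<in>M. continuous_on UNIV (g m)) \<and>
     (\<forall>X>0. \<exists>K\<ge>0. \<forall>F. finite F \<and> F \<subseteq> M \<longrightarrow> (\<Sum>m\<in>F. sqint {- X..X} (g m)) \<le> ennreal K) \<and>
     (\<forall>m\<in>M. \<forall>\<nu>. continuous_on UNIV (\<lambda>x. ee (- c m * x) * freq_mult f (\<Psi> m \<nu>) x)) \<and>
     (\<forall>X>0. \<exists>K\<ge>0. \<forall>m\<in>M. \<forall>\<nu>. \<forall>x\<in>{- X..X}.
        norm (ee (- c m * x) * freq_mult f (\<Psi> m \<nu>) x - poly (p m \<nu>) (of_real x) - g m x) \<le> K * (1 / 2) ^ (m + \<nu>)) \<and>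
     (\<forall>x A \<rho>. A \<ge> 0 \<and> \<rho> > 0 \<and> well_approx i s f x A \<longrightarrow>
        (\<exists>P. (\<forall>m\<in>M. P m \<in> polys_less r) \<and> (\<forall>F. finite F \<and> F \<subseteq> M \<longrightarrow>
           (\<Sum>m\<in>F. sqint {x - \<rho>..x + \<rho>} (\<lambda>y. g m y - poly (P m) (of_real y))) \<le> ennreal (C * A\<^sup>2 * \<rho> powr (2 * s + 1))))))"

text \<open>The functions \<Psi> are fixed first, from \<open>rkern_weighted_close\<close> alone; f
  enters the errors only through its weighted norm. The constant C is that of
  \<open>oscillation_estimate\<close>, whose left side is unaffected by a polynomial change of
  U.\<close>

lemma multiplier_family:
  assumes \<mu>: "\<mu> > s" "\<mu> \<ge> real (i - 1)" "\<mu> < real r" and ir: "i \<le> r" and r: "r \<ge> 1"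
    and disc: "finite {\<xi>. \<not> isCont \<theta> \<xi>}"
  shows "\<exists>C>0. \<forall>M c l. admissible r M c l \<longrightarrow> (\<exists>\<Psi>.
     (\<forall>m\<in>M. (\<forall>\<nu>. \<Psi> m \<nu> \<in> schwartz) \<and> (\<lambda>\<nu>. sqint UNIV (\<lambda>\<xi>. \<Psi> m \<nu> \<xi> - \<theta> ((\<xi> - c m) / l m))) \<longlonglongrightarrow> 0) \<and>
     (\<forall>f x0 A0. f \<in> borel_measurable borel \<and> A0 \<ge> 0 \<and> well_approx i s f x0 A0 \<longrightarrow> good_family r i s C M c l \<Psi> f))"
proof -
  obtain C where C: "C > 0" and C': "\<forall>M c l f x A \<rho> U. admissible r M c l \<and> f \<in> borel_measurable borel \<and> A \<ge> 0 \<and> \<rho> > 0 \<and> well_approx i s f x A \<and>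
      (\<forall>m\<in>M. chain r (U m) \<and> U m r = op r (c m) (l m) f) \<longrightarrow>
      (\<exists>P. (\<forall>m\<in>M. P m \<in> polys_less r) \<and> (\<forall>F. finite F \<and> F \<subseteq> M \<longrightarrow>
         (\<Sum>m\<in>F. sqint {x - \<rho>..x + \<rho>} (\<lambda>y. U m 0 y - poly (P m) (of_real y))) \<le> ennreal (C * A\<^sup>2 * \<rho> powr (2 * s + 1))))"
    using oscillation_estimate[OF \<mu> ir] by (elim exE conjE) (rule that)
  \<comment> \<open>The midpoint of \<mu> + 1 and r + 1: above the former, f has finite weighted
    norm; below the latter, \<open>rkern_weighted_close\<close> applies.\<close>
  define \<beta> where "\<beta> = (\<mu> + 1 + real (Suc r)) / 2"
  have \<mu>0: "\<mu> \<ge> 0" using \<mu>(2) by (rule order_trans[rotated]) simp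
  have \<beta>: "\<beta> > \<mu> + 1" "0 < \<beta>" "\<beta> < real (Suc r)" using \<mu>(3) \<mu>0 by (auto simp: \<beta>_def)
  have main: "\<exists>\<Psi>. (\<forall>m\<in>M. (\<forall>\<nu>. \<Psi> m \<nu> \<in> schwartz) \<and> (\<lambda>\<nu>. sqint UNIV (\<lambda>\<xi>. \<Psi> m \<nu> \<xi> - \<theta> ((\<xi> - c m) / l m))) \<longlonglongrightarrow> 0) \<and>
     (\<forall>f x0 A0. f \<in> borel_measurable borel \<and> A0 \<ge> 0 \<and> well_approx i s f x0 A0 \<longrightarrow> good_family r i s C M c l \<Psi> f)"
    if adm: "admissible r M c l" for M c l
  proof -
    have l: "l m > 0" if "m \<in> M" for m using adm that by (auto simp: admissible_def)
    \<comment> \<open>The bound 1/(\<nu> + 1) forces convergence of the symbols; the weighted error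
      is made at most (1/2)^(m + \<nu>).\<close>
    have "\<exists>e. m \<in> M \<longrightarrow> 0 < e \<and> e \<le> 1 / real (Suc \<nu>) \<and> e \<le> 1 \<and> (\<forall>u. norm (rkern (l m) e r u - kern (l m) r u) \<le> (1 / 2) ^ (m + \<nu>) * wt \<beta> u)" for m \<nu>
    proof (cases "m \<in> M")
      case True
      obtain \<epsilon>0 where \<epsilon>0: "\<epsilon>0 > 0" and \<epsilon>0': "\<forall>\<epsilon> u. 0 < \<epsilon> \<and> \<epsilon> \<le> \<epsilon>0 \<longrightarrow> \<epsilon> \<le> 1 \<and> norm (rkern (l m) \<epsilon> r u - kern (l m) r u) \<le> (1 / 2) ^ (m + \<nu>) * wt \<beta> u"
        using rkern_weighted_close[OF l[OF True] r \<beta>(2,3), of "(1 / 2) ^ (m + \<nu>)"] by auto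
      define e where "e = min \<epsilon>0 (1 / real (Suc \<nu>))"
      have "0 < e" "e \<le> \<epsilon>0" "e \<le> 1 / real (Suc \<nu>)" using \<epsilon>0 by (auto simp: e_def)
      then show ?thesis using \<epsilon>0' by (intro exI[of _ e]) auto
    qed auto
    then obtain \<epsilon> where \<epsilon>: "\<And>m \<nu>. m \<in> M \<Longrightarrow> 0 < \<epsilon> m \<nu>" "\<And>m \<nu>. m \<in> M \<Longrightarrow> \<epsilon> m \<nu> \<le> 1 / real (Suc \<nu>)" "\<And>m \<nu>. m \<in> M \<Longrightarrow> \<epsilon> m \<nu> \<le> 1"
      "\<And>m \<nu> u. m \<in> M \<Longrightarrow> norm (rkern (l m) (\<epsilon> m \<nu>) r u - kern (l m) r u) \<le> (1 / 2) ^ (m + \<nu>) * wt \<beta> u"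
      by metis
    define \<Psi> where "\<Psi> m \<nu> = reg (c m) (l m) (\<epsilon> m \<nu>)" for m \<nu>
    have "(\<forall>\<nu>. \<Psi> m \<nu> \<in> schwartz) \<and> (\<lambda>\<nu>. sqint UNIV (\<lambda>\<xi>. \<Psi> m \<nu> \<xi> - \<theta> ((\<xi> - c m) / l m))) \<longlonglongrightarrow> 0" if m: "m \<in> M" for m
    proof
      show "\<forall>\<nu>. \<Psi> m \<nu> \<in> schwartz" unfolding \<Psi>_def using reg_schwartz[OF l[OF m] \<epsilon>(1)[OF m]] by blast
      have "\<epsilon> m \<longlonglongrightarrow> 0"
      proof (rule Lim_null_comparison)
        show "(\<lambda>\<nu>. 1 / real (Suc \<nu>)) \<longlonglongrightarrow> 0" by (rule LIMSEQ_Suc[OF lim_1_over_n])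
        show "\<forall>\<^sub>F \<nu> in sequentially. norm (\<epsilon> m \<nu>) \<le> 1 / real (Suc \<nu>)"
          using \<epsilon>(1,2)[OF m] by (intro always_eventually allI) (simp add: less_imp_le)
      qed
      then show "(\<lambda>\<nu>. sqint UNIV (\<lambda>\<xi>. \<Psi> m \<nu> \<xi> - \<theta> ((\<xi> - c m) / l m))) \<longlonglongrightarrow> 0"
        unfolding \<Psi>_def by (rule reg_tendsto[OF l[OF m] disc \<epsilon>(1)[OF m]])
    qed
    moreover have "good_family r i s C M c l \<Psi> f"
      if f: "f \<in> borel_measurable borel" and A0: "A0 \<ge> 0" and wa0: "well_approx i s f x0 A0" for f x0 A0
    proof -
      have wf: "wint \<beta> f" by (rule well_approx_wint[OF f wa0 A0 \<mu>(1,2) \<beta>(1)])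
      have b0: "0 \<le> \<beta>" "\<beta> \<le> real (Suc r)" using \<beta> by auto
      have "\<exists>U. m \<in> M \<longrightarrow> chain r U \<and> U r = op r (c m) (l m) f" for m
        using chain_exists[OF op_continuous[OF l b0 wf], of m r "c m" 0] by blast
      then obtain U where U: "\<And>m. m \<in> M \<Longrightarrow> chain r (U m)" "\<And>m. m \<in> M \<Longrightarrow> U m r = op r (c m) (l m) f" by metis
      have cU: "continuous_on UNIV (U m 0)" if "m \<in> M" for m
        using chain_continuous[OF U(1)[OF that], of 0] U(2)[OF that] op_continuous[OF l[OF that] b0 wf] by simp
      have osc: "\<exists>P. (\<forall>m\<in>M. P m \<in> polys_less r) \<and> (\<forall>F. finite F \<and> F \<subseteq> M \<longrightarrow>
         (\<Sum>m\<in>F. sqint {x - \<rho>..x + \<rho>} (\<lambda>y. U m 0 y - poly (P m) (of_real y))) \<le> ennreal (C * A\<^sup>2 * \<rho> powr (2 * s + 1)))"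
        if "A \<ge> 0" "\<rho> > 0" "well_approx i s f x A" for x A \<rho>
        by (rule C'[rule_format]) (use adm f that U in auto)
      define \<rho>0 where "\<rho>0 = \<bar>x0\<bar> + 1"
      have \<rho>0: "\<rho>0 > 0" by (simp add: \<rho>0_def)
      define K0 where "K0 \<rho> = C * A0\<^sup>2 * \<rho> powr (2 * s + 1)" for \<rho>
      have K0: "K0 \<rho> \<ge> 0" for \<rho> using C by (simp add: K0_def)
      \<comment> \<open>The antiderivatives U m are chosen independently for each m and need not be
        square summable in m. Subtracting the polynomials adapted to one fixed interval around x0
        makes them so.\<close>
      obtain P0 where P0: "\<And>m. m \<in> M \<Longrightarrow> P0 m \<in> polys_less r"
        "\<And>F. finite F \<Longrightarrow> F \<subseteq> M \<Longrightarrow> (\<Sum>m\<in>F. sqint {x0 - \<rho>0..x0 + \<rho>0} (\<lambda>y. U m 0 y - poly (P0 m) (of_real y))) \<le> ennreal (K0 \<rho>0)"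
        using osc[OF A0 \<rho>0 wa0] unfolding K0_def by blast
      define g where "g m y = U m 0 y - poly (P0 m) (of_real y)" for m y
      have cg: "continuous_on UNIV (g m)" if "m \<in> M" for m
        unfolding g_def by (intro continuous_intros cU that)
      have "\<exists>q\<in>polys_less r. m \<in> M \<longrightarrow> (\<forall>X y. \<bar>y\<bar> \<le> X \<longrightarrow>
          norm (conv (rkern (l m) (\<epsilon> m \<nu>) 0) (modulate (c m) f) y - poly q (of_real y) - U m 0 y) \<le> X ^ r * ((1 / 2) ^ (m + \<nu>) * (1 + X) powr \<beta> * wnorm \<beta> f))" for m \<nu>
      proof (cases "m \<in> M")
        case True
        have "\<exists>q\<in>polys_less r. \<forall>X y. \<bar>y\<bar> \<le> X \<longrightarrow>
          norm (conv (rkern (l m) (\<epsilon> m \<nu>) 0) (modulate (c m) f) y - poly q (of_real y) - U m 0 y) \<le> X ^ r * ((1 / 2) ^ (m + \<nu>) * (1 + X) powr \<beta> * wnorm \<beta> f)"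
          by (rule regularised_error[OF l[OF True] \<epsilon>(1)[OF True] \<epsilon>(3)[OF True] b0 wf \<epsilon>(4)[OF True] _ U(1)[OF True] U(2)[OF True]]) simp
        then show ?thesis by blast
      qed (blast intro: polys_less_0)
      then obtain q where q: "\<And>m \<nu>. q m \<nu> \<in> polys_less r"
        "\<And>m \<nu> X y. m \<in> M \<Longrightarrow> \<bar>y\<bar> \<le> X \<Longrightarrow>
          norm (conv (rkern (l m) (\<epsilon> m \<nu>) 0) (modulate (c m) f) y - poly (q m \<nu>) (of_real y) - U m 0 y) \<le> X ^ r * ((1 / 2) ^ (m + \<nu>) * (1 + X) powr \<beta> * wnorm \<beta> f)"
        by metis
      have fm: "ee (- c m * x) * freq_mult f (\<Psi> m \<nu>) x = conv (rkern (l m) (\<epsilon> m \<nu>) 0) (modulate (c m) f) x" if "m \<in> M" for m \<nu> x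
        unfolding \<Psi>_def by (rule freq_mult_reg[OF l[OF that] \<epsilon>(1)[OF that] \<epsilon>(3)[OF that] wf b0(1)])
      \<comment> \<open>q corrects the regularised multiplier to U m, and P0 corrects U m to g m;
        outside M the value 0 keeps p in \<open>polys_less r\<close>.\<close>
      define p where "p m \<nu> = (if m \<in> M then q m \<nu> + P0 m else 0)" for m \<nu>
      show ?thesis
        unfolding good_family_def
      proof (intro exI[of _ p] exI[of _ g] conjI allI ballI impI)
        show "p m \<nu> \<in> polys_less r" for m \<nu> using q(1) P0(1) by (auto simp: p_def intro: polys_less_add)
        show "continuous_on UNIV (g m)" if "m \<in> M" for m using cg[OF that] .
        show "continuous_on UNIV (\<lambda>x. ee (- c m * x) * freq_mult f (\<Psi> m \<nu>) x)" if m: "m \<in> M" for m \<nu>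
        proof -
          have "chain 1 (\<lambda>j. conv (rkern (l m) (\<epsilon> m \<nu>) j) (modulate (c m) f))"
            by (rule reg_chain[OF l[OF m] \<epsilon>(1)[OF m] \<epsilon>(3)[OF m] wf])
          then have "continuous_on UNIV (conv (rkern (l m) (\<epsilon> m \<nu>) 0) (modulate (c m) f))"
            unfolding chain_def by (intro continuous_on_deriv) auto
          then show ?thesis unfolding fm[OF m] .
        qed
      next
        fix X :: real assume X: "X > 0"
        \<comment> \<open>Large enough for the interval around x0 to contain both [-X, X] and the
          base interval of radius \<rho>0.\<close>
        define \<rho> where "\<rho> = \<bar>x0\<bar> + 1 + X"
        have \<rho>: "\<rho> > 0" using X by (simp add: \<rho>_def)
        obtain P where P: "\<And>m. m \<in> M \<Longrightarrow> P m \<in> polys_less r"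
          "\<And>F. finite F \<Longrightarrow> F \<subseteq> M \<Longrightarrow> (\<Sum>m\<in>F. sqint {x0 - \<rho>..x0 + \<rho>} (\<lambda>y. U m 0 y - poly (P m) (of_real y))) \<le> ennreal (K0 \<rho>)"
          using osc[OF A0 \<rho> wa0] unfolding K0_def by blast
        obtain E where E: "E > 0" "\<And>p. p \<in> polys_less r \<Longrightarrow> sqint {- X..X} (\<lambda>t. poly p (of_real t)) \<le> ennreal E * sqint {x0 - \<rho>0..x0 + \<rho>0} (\<lambda>t. poly p (of_real t))"
          using poly_sqint_growth[OF \<rho>0 X, of r x0] by blast
        \<comment> \<open>From g = (U - P) + (P - P0): the first term is controlled at radius
          \<rho>. The second is a polynomial controlled on the base interval by both approximations
          and carried to [-X, X] at the cost E.\<close>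
        define K where "K = 2 * K0 \<rho> + 2 * (E * (2 * K0 \<rho> + 2 * K0 \<rho>0))"
        show "\<exists>K\<ge>0. \<forall>F. finite F \<and> F \<subseteq> M \<longrightarrow> (\<Sum>m\<in>F. sqint {- X..X} (g m)) \<le> ennreal K"
        proof (intro exI[of _ K] conjI allI impI)
          show "K \<ge> 0" using K0 E(1) by (simp add: K_def)
          fix F assume "finite F \<and> F \<subseteq> M"
          then have F: "finite F" "F \<subseteq> M" by auto
          let ?a = "\<lambda>m. sqint {x0 - \<rho>..x0 + \<rho>} (\<lambda>y. U m 0 y - poly (P m) (of_real y))"
          let ?b = "\<lambda>m. sqint {x0 - \<rho>0..x0 + \<rho>0} (\<lambda>y. U m 0 y - poly (P0 m) (of_real y))"
          have "(\<Sum>m\<in>F. sqint {- X..X} (g m)) \<le> (\<Sum>m\<in>F. 2 * ?a m + 2 * (ennreal E * (2 * ?a m + 2 * ?b m)))"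
          proof (rule sum_mono)
            fix m assume "m \<in> F"
            then have m: "m \<in> M" using F by auto
            have [measurable]: "U m 0 \<in> borel_measurable borel" using cU[OF m] by (rule borel_measurable_continuous_onI)
            have "sqint {- X..X} (g m) = sqint {- X..X} (\<lambda>y. (U m 0 y - poly (P m) (of_real y)) + poly (P m - P0 m) (of_real y))"
              by (simp add: g_def[abs_def])
            also have "\<dots> \<le> 2 * sqint {- X..X} (\<lambda>y. U m 0 y - poly (P m) (of_real y)) + 2 * sqint {- X..X} (\<lambda>y. poly (P m - P0 m) (of_real y))"
              by (rule sqint_add) measurable
            also have "sqint {- X..X} (\<lambda>y. U m 0 y - poly (P m) (of_real y)) \<le> ?a m"
              by (rule sqint_mono) (auto simp: \<rho>_def)
            also have "sqint {- X..X} (\<lambda>y. poly (P m - P0 m) (of_real y)) \<le> ennreal E * (2 * ?a m + 2 * ?b m)"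
            proof -
              have "sqint {- X..X} (\<lambda>y. poly (P m - P0 m) (of_real y)) \<le> ennreal E * sqint {x0 - \<rho>0..x0 + \<rho>0} (\<lambda>y. poly (P m - P0 m) (of_real y))"
                by (intro E(2) polys_less_diff P(1) P0(1) m)
              also have "sqint {x0 - \<rho>0..x0 + \<rho>0} (\<lambda>y. poly (P m - P0 m) (of_real y))
                = sqint {x0 - \<rho>0..x0 + \<rho>0} (\<lambda>y. (- 1) * (U m 0 y - poly (P m) (of_real y)) + (U m 0 y - poly (P0 m) (of_real y)))"
                by simp
              also have "\<dots> \<le> 2 * sqint {x0 - \<rho>0..x0 + \<rho>0} (\<lambda>y. (- 1) * (U m 0 y - poly (P m) (of_real y))) + 2 * ?b m"
                by (rule sqint_add) measurable
              also have "sqint {x0 - \<rho>0..x0 + \<rho>0} (\<lambda>y. (- 1) * (U m 0 y - poly (P m) (of_real y))) \<le> ?a m"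
                using X by (intro sqint_mono) (auto simp: \<rho>_def \<rho>0_def norm_mult norm_minus_commute)
              finally show ?thesis by (simp add: mult_left_mono add_right_mono)
            qed
            finally show "sqint {- X..X} (g m) \<le> 2 * ?a m + 2 * (ennreal E * (2 * ?a m + 2 * ?b m))"
              by (simp add: mult_left_mono add_mono)
          qed
          also have "\<dots> = 2 * (\<Sum>m\<in>F. ?a m) + 2 * (ennreal E * (2 * (\<Sum>m\<in>F. ?a m) + 2 * (\<Sum>m\<in>F. ?b m)))"
            by (simp add: sum.distrib sum_distrib_left distrib_left)
          also have "\<dots> \<le> 2 * ennreal (K0 \<rho>) + 2 * (ennreal E * (2 * ennreal (K0 \<rho>) + 2 * ennreal (K0 \<rho>0)))"
            by (intro add_mono mult_left_mono P(2) P0(2) F) auto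
          also have "\<dots> = ennreal K"
            using K0[of \<rho>] K0[of \<rho>0] E(1) by (simp add: K_def ennreal_mult)
          finally show "(\<Sum>m\<in>F. sqint {- X..X} (g m)) \<le> ennreal K" .
        qed
      next
        fix X :: real assume X: "X > 0"
        show "\<exists>K\<ge>0. \<forall>m\<in>M. \<forall>\<nu>. \<forall>x\<in>{- X..X}.
          norm (ee (- c m * x) * freq_mult f (\<Psi> m \<nu>) x - poly (p m \<nu>) (of_real x) - g m x) \<le> K * (1 / 2) ^ (m + \<nu>)"
        proof (intro exI[of _ "X ^ r * ((1 + X) powr \<beta> * wnorm \<beta> f)"] conjI ballI allI)
          show "0 \<le> X ^ r * ((1 + X) powr \<beta> * wnorm \<beta> f)" using X by simp
          fix m \<nu> x assume m: "m \<in> M" and x: "x \<in> {- X..X}"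
          have "ee (- c m * x) * freq_mult f (\<Psi> m \<nu>) x - poly (p m \<nu>) (of_real x) - g m x
            = conv (rkern (l m) (\<epsilon> m \<nu>) 0) (modulate (c m) f) x - poly (q m \<nu>) (of_real x) - U m 0 x"
            unfolding fm[OF m] using m by (simp add: p_def g_def)
          also have "norm \<dots> \<le> X ^ r * ((1 / 2) ^ (m + \<nu>) * (1 + X) powr \<beta> * wnorm \<beta> f)"
            using x by (intro q(2) m) (auto simp: abs_le_iff)
          finally show "norm (ee (- c m * x) * freq_mult f (\<Psi> m \<nu>) x - poly (p m \<nu>) (of_real x) - g m x)
             \<le> X ^ r * ((1 + X) powr \<beta> * wnorm \<beta> f) * (1 / 2) ^ (m + \<nu>)"
            by (simp only: mult_ac)
        qed
      next
        fix x A \<rho> :: real assume "A \<ge> 0 \<and> \<rho> > 0 \<and> well_approx i s f x A"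
        then obtain P where P: "\<And>m. m \<in> M \<Longrightarrow> P m \<in> polys_less r"
          "\<And>F. finite F \<Longrightarrow> F \<subseteq> M \<Longrightarrow> (\<Sum>m\<in>F. sqint {x - \<rho>..x + \<rho>} (\<lambda>y. U m 0 y - poly (P m) (of_real y))) \<le> ennreal (C * A\<^sup>2 * \<rho> powr (2 * s + 1))"
          using osc[of A \<rho> x] by blast
        show "\<exists>P. (\<forall>m\<in>M. P m \<in> polys_less r) \<and> (\<forall>F. finite F \<and> F \<subseteq> M \<longrightarrow>
           (\<Sum>m\<in>F. sqint {x - \<rho>..x + \<rho>} (\<lambda>y. g m y - poly (P m) (of_real y))) \<le> ennreal (C * A\<^sup>2 * \<rho> powr (2 * s + 1)))"
          using P P0(1) by (intro exI[of _ "\<lambda>m. P m - P0 m"]) (auto simp: g_def intro: polys_less_diff)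
      qed
    qed
    ultimately show ?thesis by (intro exI[of _ \<Psi>]) blast
  qed
  then show ?thesis using C by blast
qed

end

section \<open>The maximal function\<close>

lemma ennreal_powr_two: "ennreal_powr x 2 = x\<^sup>2"
proof (cases x)
  case (real a)
  then show ?thesis by (simp add: ennreal_powr_def powr_numeral ennreal_power)
qed (simp add: ennreal_powr_def)

lemma ennreal_powr_half_le_iff:
  assumes "A \<ge> 0"
  shows "ennreal_powr x (1 / 2) \<le> ennreal A \<longleftrightarrow> x \<le> ennreal (A\<^sup>2)"
proof (cases x)
  case (real a)
  have "a powr (1 / 2) \<le> A \<longleftrightarrow> (a powr (1 / 2))\<^sup>2 \<le> A\<^sup>2"
    using assms by (simp add: power_mono_iff)
  also have "(a powr (1 / 2))\<^sup>2 = a" using real by (simp add: powr_power2)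
  finally show ?thesis using real assms by (simp add: ennreal_powr_def)
qed (simp add: ennreal_powr_def top_unique)

lemma l2_norm_power2: "(l2_norm M v)\<^sup>2 = (\<integral>\<^sup>+m. ennreal ((norm (v m))\<^sup>2) \<partial>count_space M)"
proof -
  define S where "S = (\<integral>\<^sup>+m. ennreal ((norm (v m))\<^sup>2) \<partial>count_space M)"
  have "(ennreal_powr S (1 / 2))\<^sup>2 = S"
  proof (cases S)
    case (real a)
    then show ?thesis by (simp add: ennreal_powr_def ennreal_power powr_power2)
  qed (simp add: ennreal_powr_def)
  then show ?thesis by (simp add: l2_norm_def S_def)
qed

text \<open>The square of the norm of L2(Q, l2); for a one-element collection it reduces to
  \<open>sqint\<close> (\<open>l2sqint_single\<close>).\<close>

definition l2sqint :: "real set \<Rightarrow> 'm set \<Rightarrow> ('m \<Rightarrow> real \<Rightarrow> complex) \<Rightarrow> ennreal" where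
  "l2sqint Q M h = (\<integral>\<^sup>+y\<in>Q. (l2_norm M (\<lambda>m. h m y))\<^sup>2 \<partial>lebesgue)"

text \<open>A series of non-negative terms over a set of naturals is the supremum of finite partial
  sums, so estimates for finite F extend to all of M.\<close>

lemma nn_integral_count_space_nat_le:
  fixes M :: "nat set"
  assumes "\<And>F. finite F \<Longrightarrow> F \<subseteq> M \<Longrightarrow> sum f F \<le> K"
  shows "(\<integral>\<^sup>+m. f m \<partial>count_space M) \<le> K"
proof -
  have "(\<integral>\<^sup>+m. f m \<partial>count_space M) = (\<integral>\<^sup>+m. f m * indicator M m \<partial>count_space UNIV)"
    by (cases "M = UNIV") (auto simp: nn_integral_count_space_indicator)
  also have "\<dots> = (SUP n. \<Sum>m<n. f m * indicator M m)"
    unfolding nn_integral_count_space_nat by (rule suminf_eq_SUP)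
  also have "\<dots> \<le> K"
  proof (rule SUP_least)
    fix n
    have "(\<Sum>m<n. f m * indicator M m) = (\<Sum>m<n. if m \<in> M then f m else 0)"
      by (intro sum.cong) (auto simp: indicator_def)
    also have "\<dots> = sum f ({..<n} \<inter> M)" by (simp add: sum.inter_restrict)
    finally have "(\<Sum>m<n. f m * indicator M m) = sum f ({..<n} \<inter> M)" .
    then show "(\<Sum>m<n. f m * indicator M m) \<le> K" using assms[of "{..<n} \<inter> M"] by simp
  qed
  finally show ?thesis .
qed

text \<open>Monotonicity replaces Q by a Borel set S containing it, after which Tonelli exchanges
  the sum over m with the integral.\<close>

lemma l2sqint_le:
  fixes M :: "nat set"
  assumes h: "\<And>m. m \<in> M \<Longrightarrow> h m \<in> borel_measurable borel" and S: "S \<in> sets borel" "Q \<subseteq> S"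
    and K: "\<And>F. finite F \<Longrightarrow> F \<subseteq> M \<Longrightarrow> (\<Sum>m\<in>F. sqint S (h m)) \<le> K"
  shows "l2sqint Q M h \<le> K"
proof -
  have "l2sqint Q M h = (\<integral>\<^sup>+y. (\<integral>\<^sup>+m. ennreal ((norm (h m y))\<^sup>2) \<partial>count_space M) * indicator Q y \<partial>lborel)"
    unfolding l2sqint_def l2_norm_power2 by (rule nn_integral_completion)
  also have "\<dots> \<le> (\<integral>\<^sup>+y. \<integral>\<^sup>+m. ennreal ((norm (h m y))\<^sup>2) * indicator S y \<partial>count_space M \<partial>lborel)"
    using S(2) by (intro nn_integral_mono) (auto split: split_indicator)
  also have "\<dots> = (\<integral>\<^sup>+m. \<integral>\<^sup>+y. ennreal ((norm (h m y))\<^sup>2) * indicator S y \<partial>lborel \<partial>count_space M)"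
  proof (rule nn_integral_count_space_nn_integral)
    fix m assume "m \<in> M"
    note [measurable] = h[OF this] S(1)
    show "(\<lambda>y. ennreal ((norm (h m y))\<^sup>2) * indicator S y) \<in> borel_measurable lborel" by measurable
  qed auto
  also have "\<dots> \<le> K" using K unfolding sqint_def by (rule nn_integral_count_space_nat_le)
  finally show ?thesis .
qed

lemma l2sqint_single:
  assumes "AE y in lborel. norm (h y) = norm (h' y)"
  shows "l2sqint Q {()} (\<lambda>_. h) = sqint Q h'"
  unfolding l2sqint_def l2_norm_power2 nn_integral_completion sqint_def
  using assms by (intro nn_integral_cong_AE, eventually_elim) (auto simp: nn_integral_count_space_finite)

lemma L2_norm_on_le_iff:
  "A \<ge> 0 \<Longrightarrow> L2_norm_on I M h \<le> ennreal A \<longleftrightarrow> l2sqint I M h \<le> ennreal (A\<^sup>2)"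
  by (simp add: L2_norm_on_def l2sqint_def ennreal_powr_half_le_iff)

text \<open>Squaring removes the root: the factors |Q|^(-s) and |Q|^(-1/2) become the power 2s + 1
  that occurs in \<open>well_approx\<close>.\<close>

lemma maximal_term_le_iff:
  assumes q: "measure lebesgue Q = q" "q > 0" and A: "A \<ge> 0"
  shows "ennreal (1 / q powr s) * ennreal_powr (ennreal (1 / q) *
      (\<integral>\<^sup>+y\<in>Q. ennreal_powr (l2_norm M (\<lambda>m. h m y)) 2 \<partial>lebesgue)) (1 / 2) \<le> ennreal A
    \<longleftrightarrow> l2sqint Q M h \<le> ennreal (A\<^sup>2 * q powr (2 * s + 1))"
proof -
  have eq: "(\<integral>\<^sup>+y\<in>Q. ennreal_powr (l2_norm M (\<lambda>m. h m y)) 2 \<partial>lebesgue) = l2sqint Q M h"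
    by (simp add: ennreal_powr_two l2sqint_def)
  show ?thesis
  proof (cases "l2sqint Q M h")
    case (real S)
    define x where "x = (1 / q powr s) * (S / q) powr (1 / 2)"
    have x: "x \<ge> 0" unfolding x_def by simp
    have "ennreal (1 / q powr s) * ennreal_powr (ennreal (1 / q) * ennreal S) (1 / 2) = ennreal x"
      using q(2) real by (simp add: ennreal_powr_def x_def flip: ennreal_mult)
    moreover have "x \<le> A \<longleftrightarrow> S \<le> A\<^sup>2 * q powr (2 * s + 1)"
    proof -
      have "x\<^sup>2 = S / q powr (2 * s + 1)"
        using q(2) real(1) by (simp add: x_def power_mult_distrib power_divide powr_power2 powr_add)
      then have "x\<^sup>2 \<le> A\<^sup>2 \<longleftrightarrow> S \<le> A\<^sup>2 * q powr (2 * s + 1)"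
        using q(2) by (simp add: pos_divide_le_eq)
      then show ?thesis using x A by (simp add: power_mono_iff)
    qed
    moreover have "0 \<le> A\<^sup>2 * q powr (2 * s + 1)" by simp
    ultimately show ?thesis using real A by (simp add: eq ennreal_le_iff)
  next
    case top
    have "ennreal (1 / q) * l2sqint Q M h = top" using top q(2) by (simp add: ennreal_mult_top)
    then have "ennreal (1 / q powr s) * ennreal_powr (ennreal (1 / q) * l2sqint Q M h) (1 / 2) = top"
      using q(2) by (simp add: ennreal_powr_def ennreal_mult_top)
    then show ?thesis using top by (simp only: eq) (simp add: top_unique)
  qed
qed

text \<open>The strict inequality yields an actual polynomial from the infimum. The centred interval
  has length 2 \<sigma>, and 2^(2s+1) is the square of the factor 2^(s + 1/2).\<close>

lemma well_approx_of_maximal: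
  assumes f': "AE y in lborel. f y = f' y" and lt: "maximal_fun i 2 s {()} (\<lambda>_. f) x < ennreal A"
  shows "well_approx i s f' x (A * 2 powr (s + 1 / 2))"
  unfolding well_approx_def
proof (intro allI impI)
  fix \<sigma> :: real assume \<sigma>: "\<sigma> > 0"
  define Q where "Q = {x - \<sigma>..x + \<sigma>}"
  have Q: "measure lebesgue Q = 2 * \<sigma>" using \<sigma> by (simp add: Q_def)
  have A: "A \<ge> 0"
    by (rule ccontr) (use lt in \<open>simp add: ennreal_neg\<close>)
  have "Q \<in> {Q. is_interval Q \<and> bounded Q \<and> measure lebesgue Q > 0 \<and> x \<in> Q}"
    using Q \<sigma> by (auto simp: Q_def is_interval_cc)
  from le_less_trans[OF SUP_upper[OF this] lt[unfolded maximal_fun_def]]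
  obtain P where P: "P () \<in> polys_less i" and
    le: "ennreal (1 / (2 * \<sigma>) powr s) * ennreal_powr (ennreal (1 / (2 * \<sigma>)) *
      (\<integral>\<^sup>+y\<in>Q. ennreal_powr (l2_norm {()} (\<lambda>m. f y - poly (P m) (complex_of_real y))) 2 \<partial>lebesgue)) (1 / 2) < ennreal A"
    unfolding INF_less_iff Q by auto
  have "l2sqint Q {()} (\<lambda>_ y. f y - poly (P ()) (of_real y)) \<le> ennreal (A\<^sup>2 * (2 * \<sigma>) powr (2 * s + 1))"
    using maximal_term_le_iff[OF Q _ A, of s "{()}" "\<lambda>m y. f y - poly (P m) (of_real y)"] \<sigma> less_imp_le[OF le]
    by (simp add: unit_eq)
  moreover have "l2sqint Q {()} (\<lambda>_ y. f y - poly (P ()) (of_real y)) = sqint Q (\<lambda>y. f' y - poly (P ()) (of_real y))"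
    by (rule l2sqint_single) (use f' in eventually_elim, simp)
  moreover have "A\<^sup>2 * (2 * \<sigma>) powr (2 * s + 1) = (A * 2 powr (s + 1 / 2))\<^sup>2 * \<sigma> powr (2 * s + 1)"
    using \<sigma> by (simp add: power_mult_distrib powr_power2 powr_mult distrib_left)
  ultimately show "\<exists>p\<in>polys_less i. sqint {x - \<sigma>..x + \<sigma>} (\<lambda>t. f' t - poly p (of_real t)) \<le> ennreal ((A * 2 powr (s + 1 / 2))\<^sup>2 * \<sigma> powr (2 * s + 1))"
    using P unfolding Q_def by auto
qed

text \<open>The segment between two points of Q lies in Q, so its length is at most |Q|. Hence
  estimates on centred intervals of radius |Q| cover every Q containing x.\<close>

lemma interval_subset_measure:
  assumes Q: "is_interval (Q :: real set)" "bounded Q" and x: "x \<in> Q"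
  shows "Q \<subseteq> {x - measure lebesgue Q..x + measure lebesgue Q}"
proof
  fix y assume y: "y \<in> Q"
  have "Q \<in> lmeasurable" using Q by (intro measurable_convex) (auto simp: is_interval_convex)
  moreover have "{u..v} \<subseteq> Q" if "u \<in> Q" "v \<in> Q" for u v
    using Q(1)[unfolded is_interval_1] that by (meson atLeastAtMost_iff subsetI)
  ultimately have "measure lebesgue {u..v} \<le> measure lebesgue Q" if "u \<in> Q" "v \<in> Q" for u v
    using that by (intro measure_mono_fmeasurable) simp_all
  from this[OF x y] this[OF y x] show "y \<in> {x - measure lebesgue Q..x + measure lebesgue Q}"
    by (cases "x \<le> y") simp_all
qed

text \<open>The root of C comes from the square root in the maximal function, and 2^(s + 1/2) from
  \<open>well_approx_of_maximal\<close>. No further power of 2 arises since \<rho> is |Q|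
  itself.\<close>

lemma maximal_fun_le_of_oscillation:
  fixes M :: "nat set"
  assumes g: "\<And>m. m \<in> M \<Longrightarrow> continuous_on UNIV (g m)" and C: "C > 0" and f': "AE y in lborel. f y = f' y"
    and osc: "\<And>A \<rho>. A \<ge> 0 \<Longrightarrow> \<rho> > 0 \<Longrightarrow> well_approx i s f' x A \<Longrightarrow>
        \<exists>P. (\<forall>m\<in>M. P m \<in> polys_less r) \<and> (\<forall>F. finite F \<and> F \<subseteq> M \<longrightarrow>
           (\<Sum>m\<in>F. sqint {x - \<rho>..x + \<rho>} (\<lambda>y. g m y - poly (P m) (of_real y))) \<le> ennreal (C * A\<^sup>2 * \<rho> powr (2 * s + 1)))"
  shows "maximal_fun r 2 s M g x \<le> ennreal (sqrt C * 2 powr (s + 1 / 2)) * maximal_fun i 2 s {()} (\<lambda>_. f) x"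
proof -
  define C1 where "C1 = sqrt C * 2 powr (s + 1 / 2)"
  have C1: "C1 > 0" using C by (simp add: C1_def)
  show ?thesis
  proof (cases "maximal_fun i 2 s {()} (\<lambda>_. f) x")
    case top
    then show ?thesis using C1 by (simp add: C1_def[symmetric] ennreal_mult_top)
  next
    case (real A0)
    \<comment> \<open>Proved for every A above the value A0, as near-optimal polynomials are
      available only above the infimum; A then decreases to A0.\<close>
    have main: "maximal_fun r 2 s M g x \<le> ennreal (C1 * A)" if A: "A > A0" for A
      unfolding maximal_fun_def
    proof (rule SUP_least)
      fix Q assume "Q \<in> {Q. is_interval Q \<and> bounded Q \<and> measure lebesgue Q > 0 \<and> x \<in> Q}"
      then have Q: "is_interval Q" "bounded Q" "measure lebesgue Q > 0" "x \<in> Q" by auto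
      define \<rho> where "\<rho> = measure lebesgue Q"
      have \<rho>: "\<rho> > 0" using Q(3) by (simp add: \<rho>_def)
      have sub: "Q \<subseteq> {x - \<rho>..x + \<rho>}" unfolding \<rho>_def by (rule interval_subset_measure[OF Q(1,2,4)])
      have A0: "A > 0" using A real(1) by simp
      have "maximal_fun i 2 s {()} (\<lambda>_. f) x < ennreal A" using A real A0 by (simp add: ennreal_less_iff)
      then have wa: "well_approx i s f' x (A * 2 powr (s + 1 / 2))" by (rule well_approx_of_maximal[OF f'])
      obtain P where P: "\<And>m. m \<in> M \<Longrightarrow> P m \<in> polys_less r" "\<And>F. finite F \<Longrightarrow> F \<subseteq> M \<Longrightarrow>
          (\<Sum>m\<in>F. sqint {x - \<rho>..x + \<rho>} (\<lambda>y. g m y - poly (P m) (of_real y))) \<le> ennreal (C * (A * 2 powr (s + 1 / 2))\<^sup>2 * \<rho> powr (2 * s + 1))"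
        using osc[OF _ \<rho> wa] A0 by auto
      have "l2sqint Q M (\<lambda>m y. g m y - poly (P m) (of_real y)) \<le> ennreal (C * (A * 2 powr (s + 1 / 2))\<^sup>2 * \<rho> powr (2 * s + 1))"
      proof (rule l2sqint_le[OF _ _ sub P(2)])
        show "(\<lambda>y. g m y - poly (P m) (of_real y)) \<in> borel_measurable borel" if "m \<in> M" for m
          by (intro borel_measurable_continuous_onI continuous_intros g that)
      qed auto
      also have "C * (A * 2 powr (s + 1 / 2))\<^sup>2 = (C1 * A)\<^sup>2"
        using C by (simp add: C1_def power_mult_distrib)
      finally have le: "l2sqint Q M (\<lambda>m y. g m y - poly (P m) (of_real y)) \<le> ennreal ((C1 * A)\<^sup>2 * \<rho> powr (2 * s + 1))" .
      have C1A: "0 \<le> C1 * A" using C1 A0 by simp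
      have "(INF P \<in> {P. \<forall>m\<in>M. P m \<in> polys_less r}. ennreal (1 / \<rho> powr s) * ennreal_powr (ennreal (1 / \<rho>) *
           (\<integral>\<^sup>+y\<in>Q. ennreal_powr (l2_norm M (\<lambda>m. g m y - poly (P m) (complex_of_real y))) 2 \<partial>lebesgue)) (1 / 2))
         \<le> ennreal (C1 * A)"
        by (rule INF_lower2[of P], use P(1) in simp, rule iffD2[OF maximal_term_le_iff[OF \<rho>_def[symmetric] \<rho> C1A] le])
      then show "(INF P \<in> {P. \<forall>m\<in>M. P m \<in> polys_less r}. ennreal (1 / measure lebesgue Q powr s) *
          ennreal_powr (ennreal (1 / measure lebesgue Q) *
           (\<integral>\<^sup>+y\<in>Q. ennreal_powr (l2_norm M (\<lambda>m. g m y - poly (P m) (complex_of_real y))) 2 \<partial>lebesgue)) (1 / 2))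
         \<le> ennreal (C1 * A)" unfolding \<rho>_def .
    qed
    have "maximal_fun r 2 s M g x \<le> ennreal (C1 * A0)"
    proof (rule ennreal_le_epsilon)
      fix e :: real assume e: "e > 0"
      have "maximal_fun r 2 s M g x \<le> ennreal (C1 * (A0 + e / C1))"
        by (rule main) (use e C1 in simp)
      also have "C1 * (A0 + e / C1) = C1 * A0 + e" using C1 by (simp add: distrib_left)
      also have "ennreal (C1 * A0 + e) = ennreal (C1 * A0) + ennreal e"
        using C1 real(1) e by (intro ennreal_plus) auto
      finally show "maximal_fun r 2 s M g x \<le> ennreal (C1 * A0) + ennreal e" .
    qed
    then show ?thesis using real C1 by (simp add: C1_def[symmetric] ennreal_mult)
  qed
qed

section \<open>Borel representatives and membership in L2 spaces\<close>

lemma lebesgue_measurable_AE: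
  assumes h: "h \<in> borel_measurable lebesgue" and eq: "AE x in lborel. h x = h' x"
  shows "h' \<in> borel_measurable (lebesgue :: real measure)"
proof (rule measurableI)
  fix A :: "'a set" assume A: "A \<in> sets borel"
  have "AE x in lebesgue. h x = h' x" using eq by (rule AE_completion)
  then have ae: "AE x in lebesgue. x \<in> h -` A \<inter> space lebesgue \<longleftrightarrow> x \<in> h' -` A \<inter> space lebesgue"
    by eventually_elim simp
  show "h' -` A \<inter> space lebesgue \<in> sets lebesgue"
    by (rule completion.in_sets_AE[OF ae measurable_sets[OF h A]]) auto
qed simp

lemma lebesgue_integral_AE:
  fixes h h' :: "real \<Rightarrow> complex"
  assumes eq: "AE x in lborel. h x = h' x"
  shows "integral\<^sup>L lebesgue h = integral\<^sup>L lebesgue h'"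
proof (cases "h \<in> borel_measurable lebesgue")
  case True
  then show ?thesis
    by (intro integral_cong_AE lebesgue_measurable_AE[OF True eq] AE_completion eq)
next
  case False
  \<comment> \<open>Neither function is measurable in this case, so both integrals take the default
    value 0.\<close>
  have "AE x in lborel. h' x = h x" using eq by eventually_elim simp
  then have "h' \<notin> borel_measurable lebesgue" using False lebesgue_measurable_AE by blast
  then have "\<not> integrable lebesgue h" "\<not> integrable lebesgue h'" using False by auto
  then show ?thesis by (simp add: not_integrable_integral_eq)
qed

lemma freq_mult_AE:
  assumes "AE x in lborel. f x = f' x"
  shows "freq_mult f \<psi> = freq_mult f' \<psi>"
proof -
  have "distr_of f = distr_of f'"
    unfolding distr_of_def by (intro ext lebesgue_integral_AE, use assms in eventually_elim) simp
  then show ?thesis by (simp add: freq_mult_def)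
qed

lemma lebesgue_ex_borel:
  fixes f :: "real \<Rightarrow> complex"
  assumes f: "f \<in> borel_measurable lebesgue"
  shows "\<exists>f'\<in>borel_measurable borel. AE x in lborel. f x = f' x"
proof -
  have "(\<lambda>x. Re (f x)) \<in> borel_measurable lebesgue" "(\<lambda>x. Im (f x)) \<in> borel_measurable lebesgue"
    using f by (auto intro: borel_measurable_Re borel_measurable_Im)
  from this[THEN completion_ex_borel_measurable_real] obtain u v
    where uv: "u \<in> borel_measurable lborel" "v \<in> borel_measurable lborel"
    and ae: "AE x in lborel. Re (f x) = u x" "AE x in lborel. Im (f x) = v x"
    by blast
  have [measurable]: "u \<in> borel_measurable borel" "v \<in> borel_measurable borel" using uv by simp_all
  have "AE x in lborel. f x = Complex (u x) (v x)" using ae by eventually_elim (simp add: complex_eq_iff)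
  moreover have "(\<lambda>x. Complex (u x) (v x)) \<in> borel_measurable borel"
    unfolding Complex_eq by measurable
  ultimately show ?thesis by (intro bexI)
qed

lemma L2_norm_on_le:
  fixes M :: "nat set"
  assumes "\<And>m. m \<in> M \<Longrightarrow> continuous_on UNIV (h m)" and "I \<subseteq> {- X..X}" and "A \<ge> 0"
    and "\<And>F. finite F \<Longrightarrow> F \<subseteq> M \<Longrightarrow> (\<Sum>m\<in>F. sqint {- X..X} (h m)) \<le> ennreal (A\<^sup>2)"
  shows "L2_norm_on I M h \<le> ennreal A"
  unfolding L2_norm_on_le_iff[OF assms(3)]
  by (rule l2sqint_le[OF borel_measurable_continuous_onI[OF assms(1)] _ assms(2,4)]) auto

lemma in_L2_onI:
  fixes M :: "nat set"
  assumes h: "\<And>m. m \<in> M \<Longrightarrow> continuous_on UNIV (h m)" and I: "I \<subseteq> {- X..X}" and K: "K \<ge> 0"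
    and le: "\<And>F. finite F \<Longrightarrow> F \<subseteq> M \<Longrightarrow> (\<Sum>m\<in>F. sqint {- X..X} (h m)) \<le> ennreal K"
  shows "in_L2_on I M h"
  unfolding in_L2_on_def
proof
  show "\<forall>m\<in>M. h m \<in> borel_measurable (lebesgue_on I)"
    using h by (intro ballI measurable_restrict_space1 measurable_completion) (simp add: borel_measurable_continuous_onI)
  have "L2_norm_on I M h \<le> ennreal (sqrt K)"
    by (rule L2_norm_on_le[OF h I]) (use K le in auto)
  then show "L2_norm_on I M h < \<infinity>" by (rule le_less_trans) simp
qed

lemma sum_power_half_le:
  assumes "finite F"
  shows "(\<Sum>m\<in>F. (1 / 2 :: real) ^ m) \<le> 2"
proof -
  have "(\<Sum>m\<in>F. (1 / 2 :: real) ^ m) \<le> (\<Sum>m. (1 / 2) ^ m)"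
    using assms by (intro sum_le_suminf) auto
  then show ?thesis using suminf_geometric[of "1 / 2 :: real"] by simp
qed

text \<open>A pointwise error L (1/2)^(m + \<nu>) is square summable over m, which gives convergence
  in norm. Membership of h in the space then follows from that of h - g and g.\<close>

lemma tendsto_L2_onI:
  fixes M :: "nat set"
  assumes h: "\<And>m \<nu>. m \<in> M \<Longrightarrow> continuous_on UNIV (h \<nu> m)" and g: "\<And>m. m \<in> M \<Longrightarrow> continuous_on UNIV (g m)"
    and I: "I \<subseteq> {- X..X}" and X: "X > 0"
    and K: "K \<ge> 0" "\<And>F. finite F \<Longrightarrow> F \<subseteq> M \<Longrightarrow> (\<Sum>m\<in>F. sqint {- X..X} (g m)) \<le> ennreal K"
    and L: "L \<ge> 0" "\<And>m \<nu> x. m \<in> M \<Longrightarrow> x \<in> {- X..X} \<Longrightarrow> norm (h \<nu> m x - g m x) \<le> L * (1 / 2) ^ (m + \<nu>)"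
  shows "tendsto_L2_on I M h g"
proof -
  \<comment> \<open>The square is the interval length 2 X times L^2 (1/4)^\<nu> times 2, a bound for
    the sum of (1/2)^m.\<close>
  define A where "A \<nu> = sqrt (4 * X) * L * (1 / 2) ^ \<nu>" for \<nu> :: nat
  have A: "A \<nu> \<ge> 0" for \<nu> using X L(1) by (simp add: A_def)
  have diff: "(\<Sum>m\<in>F. sqint {- X..X} (\<lambda>x. h \<nu> m x - g m x)) \<le> ennreal ((A \<nu>)\<^sup>2)" if F: "finite F" "F \<subseteq> M" for F \<nu>
  proof -
    have "(\<Sum>m\<in>F. sqint {- X..X} (\<lambda>x. h \<nu> m x - g m x)) \<le> (\<Sum>m\<in>F. ennreal (2 * X * (L * (1 / 2) ^ (m + \<nu>))\<^sup>2))"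
    proof (rule sum_mono)
      fix m assume "m \<in> F"
      then have m: "m \<in> M" using F by auto
      have "sqint {0 - X..0 + X} (\<lambda>x. h \<nu> m x - g m x) \<le> ennreal (2 * X * (L * (1 / 2) ^ (m + \<nu>))\<^sup>2)"
        by (rule sqint_le_bound) (use L(2)[OF m] L(1) X in auto)
      then show "sqint {- X..X} (\<lambda>x. h \<nu> m x - g m x) \<le> ennreal (2 * X * (L * (1 / 2) ^ (m + \<nu>))\<^sup>2)" by simp
    qed
    also have "\<dots> = ennreal (\<Sum>m\<in>F. 2 * X * (L * (1 / 2) ^ (m + \<nu>))\<^sup>2)"
      using X by (intro sum_ennreal) simp
    also have "\<dots> \<le> ennreal ((A \<nu>)\<^sup>2)"
    proof (rule ennreal_leI)
      have "(\<Sum>m\<in>F. 2 * X * (L * (1 / 2) ^ (m + \<nu>))\<^sup>2) \<le> (\<Sum>m\<in>F. 2 * X * (L * (1 / 2) ^ \<nu>)\<^sup>2 * (1 / 2) ^ m)"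
      proof (rule sum_mono)
        fix m
        have "((1 / 2) ^ m)\<^sup>2 \<le> (1 / 2 :: real) ^ m"
          unfolding power_mult[symmetric] by (rule power_decreasing) auto
        from mult_left_mono[OF this, of "2 * X * (L * (1 / 2) ^ \<nu>)\<^sup>2"]
        show "2 * X * (L * (1 / 2) ^ (m + \<nu>))\<^sup>2 \<le> 2 * X * (L * (1 / 2) ^ \<nu>)\<^sup>2 * (1 / 2) ^ m"
          using X by (simp add: power_add power_mult_distrib mult_ac)
      qed
      also have "\<dots> \<le> 2 * X * (L * (1 / 2) ^ \<nu>)\<^sup>2 * 2"
        unfolding sum_distrib_left[symmetric] using X by (intro mult_left_mono sum_power_half_le F(1)) simp
      also have "\<dots> = (A \<nu>)\<^sup>2" using X by (simp add: A_def power_mult_distrib)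
      finally show "(\<Sum>m\<in>F. 2 * X * (L * (1 / 2) ^ (m + \<nu>))\<^sup>2) \<le> (A \<nu>)\<^sup>2" .
    qed
    finally show ?thesis .
  qed
  have "in_L2_on I M (h \<nu>)" for \<nu>
  proof (rule in_L2_onI[OF h I])
    show "2 * (A \<nu>)\<^sup>2 + 2 * K \<ge> 0" using K(1) by simp
    fix F assume F: "finite F" "F \<subseteq> M"
    have "(\<Sum>m\<in>F. sqint {- X..X} (h \<nu> m)) \<le> (\<Sum>m\<in>F. 2 * sqint {- X..X} (\<lambda>x. h \<nu> m x - g m x) + 2 * sqint {- X..X} (g m))"
    proof (rule sum_mono)
      fix m assume "m \<in> F"
      then have m: "m \<in> M" using F by auto
      have "sqint {- X..X} (\<lambda>x. (h \<nu> m x - g m x) + g m x) \<le> 2 * sqint {- X..X} (\<lambda>x. h \<nu> m x - g m x) + 2 * sqint {- X..X} (g m)"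
        by (intro sqint_add borel_measurable_continuous_onI continuous_intros h g m) auto
      then show "sqint {- X..X} (h \<nu> m) \<le> 2 * sqint {- X..X} (\<lambda>x. h \<nu> m x - g m x) + 2 * sqint {- X..X} (g m)" by simp
    qed
    also have "\<dots> = 2 * (\<Sum>m\<in>F. sqint {- X..X} (\<lambda>x. h \<nu> m x - g m x)) + 2 * (\<Sum>m\<in>F. sqint {- X..X} (g m))"
      by (simp add: sum.distrib sum_distrib_left)
    also have "\<dots> \<le> 2 * ennreal ((A \<nu>)\<^sup>2) + 2 * ennreal K"
      by (intro add_mono mult_left_mono diff K(2) F) auto
    also have "\<dots> = ennreal (2 * (A \<nu>)\<^sup>2 + 2 * K)"
      using K(1) by (simp add: ennreal_mult)
    finally show "(\<Sum>m\<in>F. sqint {- X..X} (h \<nu> m)) \<le> ennreal (2 * (A \<nu>)\<^sup>2 + 2 * K)" .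
  qed
  moreover have "in_L2_on I M g" by (rule in_L2_onI[OF g I K])
  moreover have "(\<lambda>\<nu>. L2_norm_on I M (\<lambda>m x. h \<nu> m x - g m x)) \<longlonglongrightarrow> 0"
  proof (rule tendsto_sandwich[of "\<lambda>_. 0"])
    have "A \<longlonglongrightarrow> sqrt (4 * X) * L * 0"
      unfolding A_def[abs_def] by (intro tendsto_mult tendsto_const LIMSEQ_power_zero) auto
    then show "(\<lambda>\<nu>. ennreal (A \<nu>)) \<longlonglongrightarrow> 0"
      by (simp add: tendsto_ennreal_iff[of A _ 0, simplified] A flip: ennreal_0)
    show "\<forall>\<^sub>F \<nu> in sequentially. L2_norm_on I M (\<lambda>m x. h \<nu> m x - g m x) \<le> ennreal (A \<nu>)"
      by (intro always_eventually allI L2_norm_on_le[OF _ I A diff] continuous_on_diff h g)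
  qed auto
  ultimately show ?thesis by (simp add: tendsto_L2_on_def)
qed

lemma tendsto_L2_on_single:
  assumes h: "\<And>\<nu>. h \<nu> \<in> borel_measurable borel" "\<And>\<nu>. sqint UNIV (h \<nu>) < \<infinity>"
    and g: "g \<in> borel_measurable borel" "sqint UNIV g < \<infinity>"
    and lim: "(\<lambda>\<nu>. sqint UNIV (\<lambda>x. h \<nu> x - g x)) \<longlonglongrightarrow> 0"
  shows "tendsto_L2_on UNIV {()} (\<lambda>\<nu> _. h \<nu>) (\<lambda>_. g)"
proof -
  have le: "L2_norm_on UNIV {()} (\<lambda>_. u) \<le> ennreal A \<longleftrightarrow> sqint UNIV u \<le> ennreal (A\<^sup>2)" if "A \<ge> 0" for A and u :: "real \<Rightarrow> complex"
    using L2_norm_on_le_iff[OF that, of UNIV "{()}" "\<lambda>_. u"] l2sqint_single[of u u UNIV] by simp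
  have in_L2: "in_L2_on UNIV {()} (\<lambda>_. u)" if u: "u \<in> borel_measurable borel" "sqint UNIV u < \<infinity>" for u
  proof -
    obtain S where S: "S \<ge> 0" "sqint UNIV u = ennreal S" using u(2) by (cases "sqint UNIV u") auto
    then have "L2_norm_on UNIV {()} (\<lambda>_. u) \<le> ennreal (sqrt S)" using le[of "sqrt S" u] by simp
    then have "L2_norm_on UNIV {()} (\<lambda>_. u) < \<infinity>" by (rule le_less_trans) simp
    moreover have "u \<in> borel_measurable (lebesgue_on UNIV)"
      using u(1) by (intro measurable_restrict_space1 measurable_completion) simp
    ultimately show ?thesis by (simp add: in_L2_on_def)
  qed
  have "(\<lambda>\<nu>. L2_norm_on UNIV {()} (\<lambda>_ x. h \<nu> x - g x)) \<longlonglongrightarrow> 0"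
  proof (rule order_tendstoI)
    fix a :: ennreal assume "0 < a"
    then have "\<exists>e>0. ennreal e < a"
    proof (cases a)
      case (real b)
      with \<open>0 < a\<close> show ?thesis by (intro exI[of _ "b / 2"]) (auto simp: ennreal_less_iff)
    qed (auto intro: exI[of _ 1])
    then obtain e where e: "0 < e" "ennreal e < a" by blast
    have "\<forall>\<^sub>F \<nu> in sequentially. sqint UNIV (\<lambda>x. h \<nu> x - g x) < ennreal (e\<^sup>2)"
      using e(1) by (intro order_tendstoD[OF lim]) simp
    then show "\<forall>\<^sub>F \<nu> in sequentially. L2_norm_on UNIV {()} (\<lambda>_ x. h \<nu> x - g x) < a"
    proof eventually_elim
      case (elim \<nu>)
      then have "L2_norm_on UNIV {()} (\<lambda>_ x. h \<nu> x - g x) \<le> ennreal e"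
        using e(1) by (subst le) auto
      then show ?case using e(2) by (rule le_less_trans)
    qed
  qed simp
  then show ?thesis using in_L2 h g by (simp add: tendsto_L2_on_def)
qed

lemma schwartz_sqint_finite:
  assumes \<phi>: "\<phi> \<in> schwartz"
  shows "sqint UNIV \<phi> < \<infinity>"
proof -
  obtain C where C: "C \<ge> 0" "\<And>x. (1 + \<bar>x\<bar>) ^ 0 * norm (\<phi> x) \<le> C" using schwartz_decay[OF \<phi>] by blast
  have int: "integrable lborel (\<lambda>x. C * norm (\<phi> x))"
    by (intro integrable_mult_right integrable_norm schwartz_integrable[OF \<phi>])
  have "sqint UNIV \<phi> \<le> (\<integral>\<^sup>+x. ennreal (C * norm (\<phi> x)) \<partial>lborel)"
    unfolding sqint_def using C(2)
    by (intro nn_integral_mono) (auto simp: power2_eq_square intro!: ennreal_leI mult_right_mono)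
  also have "\<dots> < \<infinity>" using C(1) int by (subst nn_integral_eq_integral) auto
  finally show ?thesis .
qed

context jump_symbol
begin

lemma symbol_affine_sqint_finite:
  assumes l: "l > 0"
  shows "sqint UNIV (\<lambda>\<xi>. \<theta> ((\<xi> - c) / l)) < \<infinity>"
proof -
  have "sqint UNIV (\<lambda>\<xi>. \<theta> ((\<xi> - c) / l)) = sqint {c - l..c + l} (\<lambda>\<xi>. \<theta> ((\<xi> - c) / l))"
    by (rule sqint_UNIV) (rule symbol_affine_outside[OF l])
  also have "\<dots> \<le> ennreal (2 * l * B\<^sup>2)"
    by (rule sqint_le_bound) (use \<theta>_bound B_nonneg l in auto)
  finally show ?thesis by (rule le_less_trans) simp
qed

text \<open>Transfers \<open>multiplier_family\<close> to the notions of the theorem: f is replaced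
  by a Borel function equal to it almost everywhere, which leaves \<open>freq_mult\<close>
  unchanged, and bounds over finite sets become norm statements.\<close>

lemma multiplier_estimate:
  assumes \<mu>: "\<mu> > s" "\<mu> \<ge> real (i - 1)" "\<mu> < real r" and ir: "i \<le> r" and r: "r \<ge> 1"
    and disc: "finite {\<xi>. \<not> isCont \<theta> \<xi>}"
  shows "\<exists>C>0. \<forall>M c l. admissible r M c l \<longrightarrow> (\<exists>\<Psi>.
     (\<forall>m\<in>M. (\<forall>\<nu>. \<Psi> m \<nu> \<in> schwartz) \<and> tendsto_L2_on UNIV {()} (\<lambda>\<nu> _. \<Psi> m \<nu>) (\<lambda>_ \<xi>. \<theta> ((\<xi> - c m) / l m))) \<and>
     (\<forall>f. f \<in> borel_measurable lebesgue \<and> (\<exists>x. maximal_fun i 2 s {()} (\<lambda>_. f) x < \<infinity>) \<longrightarrow> (\<exists>p g.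
        (\<forall>m\<in>M. \<forall>\<nu>. p m \<nu> \<in> polys_less r) \<and> in_L2_loc M g \<and>
        (\<forall>I. is_interval I \<and> bounded I \<longrightarrow> tendsto_L2_on I M
           (\<lambda>\<nu> m x. cis (- 2 * pi * c m * x) * freq_mult f (\<Psi> m \<nu>) x - poly (p m \<nu>) (complex_of_real x)) g) \<and>
        (\<forall>x. maximal_fun r 2 s M g x \<le> ennreal C * maximal_fun i 2 s {()} (\<lambda>_. f) x))))"
proof -
  obtain C where C: "C > 0" and C': "\<forall>M c l. admissible r M c l \<longrightarrow> (\<exists>\<Psi>.
     (\<forall>m\<in>M. (\<forall>\<nu>. \<Psi> m \<nu> \<in> schwartz) \<and> (\<lambda>\<nu>. sqint UNIV (\<lambda>\<xi>. \<Psi> m \<nu> \<xi> - \<theta> ((\<xi> - c m) / l m))) \<longlonglongrightarrow> 0) \<and>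
     (\<forall>f x0 A0. f \<in> borel_measurable borel \<and> A0 \<ge> 0 \<and> well_approx i s f x0 A0 \<longrightarrow> good_family r i s C M c l \<Psi> f))"
    using multiplier_family[OF assms] by (elim exE conjE) (rule that)
  define D where "D = sqrt C * 2 powr (s + 1 / 2)"
  have D: "D > 0" using C by (simp add: D_def)
  have main: "\<exists>\<Psi>.
     (\<forall>m\<in>M. (\<forall>\<nu>. \<Psi> m \<nu> \<in> schwartz) \<and> tendsto_L2_on UNIV {()} (\<lambda>\<nu> _. \<Psi> m \<nu>) (\<lambda>_ \<xi>. \<theta> ((\<xi> - c m) / l m))) \<and>
     (\<forall>f. f \<in> borel_measurable lebesgue \<and> (\<exists>x. maximal_fun i 2 s {()} (\<lambda>_. f) x < \<infinity>) \<longrightarrow> (\<exists>p g.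
        (\<forall>m\<in>M. \<forall>\<nu>. p m \<nu> \<in> polys_less r) \<and> in_L2_loc M g \<and>
        (\<forall>I. is_interval I \<and> bounded I \<longrightarrow> tendsto_L2_on I M
           (\<lambda>\<nu> m x. cis (- 2 * pi * c m * x) * freq_mult f (\<Psi> m \<nu>) x - poly (p m \<nu>) (complex_of_real x)) g) \<and>
        (\<forall>x. maximal_fun r 2 s M g x \<le> ennreal D * maximal_fun i 2 s {()} (\<lambda>_. f) x)))"
    if adm: "admissible r M c l" for M c l
  proof -
    have l: "l m > 0" if "m \<in> M" for m using adm that by (auto simp: admissible_def)
    obtain \<Psi> where \<Psi>': "\<forall>m\<in>M. (\<forall>\<nu>. \<Psi> m \<nu> \<in> schwartz) \<and> (\<lambda>\<nu>. sqint UNIV (\<lambda>\<xi>. \<Psi> m \<nu> \<xi> - \<theta> ((\<xi> - c m) / l m))) \<longlonglongrightarrow> 0"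
      and good: "\<forall>f x0 A0. f \<in> borel_measurable borel \<and> A0 \<ge> 0 \<and> well_approx i s f x0 A0 \<longrightarrow> good_family r i s C M c l \<Psi> f"
      using C'[THEN spec, THEN spec, THEN spec, THEN mp, OF adm] by (elim exE conjE) (rule that)
    have \<Psi>: "\<Psi> m \<nu> \<in> schwartz" "(\<lambda>\<nu>. sqint UNIV (\<lambda>\<xi>. \<Psi> m \<nu> \<xi> - \<theta> ((\<xi> - c m) / l m))) \<longlonglongrightarrow> 0" if "m \<in> M" for m \<nu>
      using \<Psi>' that by auto
    have L2: "tendsto_L2_on UNIV {()} (\<lambda>\<nu> _. \<Psi> m \<nu>) (\<lambda>_ \<xi>. \<theta> ((\<xi> - c m) / l m))" if m: "m \<in> M" for m
    proof (rule tendsto_L2_on_single)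
      show "(\<lambda>\<xi>. \<theta> ((\<xi> - c m) / l m)) \<in> borel_measurable borel" by measurable
    qed (use \<Psi>[OF m] in \<open>auto intro: schwartz_borel schwartz_sqint_finite[unfolded infinity_ennreal_def] symbol_affine_sqint_finite[OF l[OF m], unfolded infinity_ennreal_def]\<close>)
    have est: "\<exists>p g. (\<forall>m\<in>M. \<forall>\<nu>. p m \<nu> \<in> polys_less r) \<and> in_L2_loc M g \<and>
        (\<forall>I. is_interval I \<and> bounded I \<longrightarrow> tendsto_L2_on I M
           (\<lambda>\<nu> m x. cis (- 2 * pi * c m * x) * freq_mult f (\<Psi> m \<nu>) x - poly (p m \<nu>) (complex_of_real x)) g) \<and>
        (\<forall>x. maximal_fun r 2 s M g x \<le> ennreal D * maximal_fun i 2 s {()} (\<lambda>_. f) x)"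
      if f: "f \<in> borel_measurable lebesgue" and fin: "maximal_fun i 2 s {()} (\<lambda>_. f) x0 < \<infinity>" for f x0
    proof -
      obtain f' where f': "f' \<in> borel_measurable borel" and ae: "AE x in lborel. f x = f' x"
        using lebesgue_ex_borel[OF f] by blast
      obtain A where A: "A \<ge> 0" "maximal_fun i 2 s {()} (\<lambda>_. f) x0 = ennreal A"
        using fin by (cases "maximal_fun i 2 s {()} (\<lambda>_. f) x0") auto
      \<comment> \<open>A + 1 in place of A, because \<open>well_approx_of_maximal\<close> requires
        a strict bound.\<close>
      have "well_approx i s f' x0 ((A + 1) * 2 powr (s + 1 / 2))"
        by (rule well_approx_of_maximal[OF ae]) (use A in \<open>simp add: ennreal_less_iff\<close>)
      then have "good_family r i s C M c l \<Psi> f'"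
        by (intro good[rule_format] conjI) (use f' A in auto)
      then obtain p g where p: "\<forall>m \<nu>. p m \<nu> \<in> polys_less r" and g': "\<forall>m\<in>M. continuous_on UNIV (g m)"
        and gK: "\<forall>X>0. \<exists>K\<ge>0. \<forall>F. finite F \<and> F \<subseteq> M \<longrightarrow> (\<Sum>m\<in>F. sqint {- X..X} (g m)) \<le> ennreal K"
        and cF: "\<forall>m\<in>M. \<forall>\<nu>. continuous_on UNIV (\<lambda>x. ee (- c m * x) * freq_mult f' (\<Psi> m \<nu>) x)"
        and err: "\<forall>X>0. \<exists>K\<ge>0. \<forall>m\<in>M. \<forall>\<nu>. \<forall>x\<in>{- X..X}.
          norm (ee (- c m * x) * freq_mult f' (\<Psi> m \<nu>) x - poly (p m \<nu>) (of_real x) - g m x) \<le> K * (1 / 2) ^ (m + \<nu>)"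
        and osc: "\<forall>x A \<rho>. A \<ge> 0 \<and> \<rho> > 0 \<and> well_approx i s f' x A \<longrightarrow>
          (\<exists>P. (\<forall>m\<in>M. P m \<in> polys_less r) \<and> (\<forall>F. finite F \<and> F \<subseteq> M \<longrightarrow>
           (\<Sum>m\<in>F. sqint {x - \<rho>..x + \<rho>} (\<lambda>y. g m y - poly (P m) (of_real y))) \<le> ennreal (C * A\<^sup>2 * \<rho> powr (2 * s + 1))))"
        unfolding good_family_def by (elim exE conjE) (rule that)
      have g: "continuous_on UNIV (g m)" if "m \<in> M" for m using g' that by blast
      have cis_ee: "cis (- 2 * pi * c m * x) * freq_mult f (\<Psi> m \<nu>) x = ee (- c m * x) * freq_mult f' (\<Psi> m \<nu>) x" for m \<nu> x
        unfolding freq_mult_AE[OF ae] ee_def by (simp add: mult_ac)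
      have bdd: "\<exists>X>0. I \<subseteq> {- X..X}" if "bounded I" for I :: "real set"
      proof -
        from that obtain X where "X > 0" "\<forall>x\<in>I. norm x \<le> X" using bounded_pos by blast
        then show ?thesis by (intro exI[of _ X]) (auto simp: abs_le_iff)
      qed
      show ?thesis
      proof (intro exI[of _ p] exI[of _ g] conjI allI impI ballI)
        show "p m \<nu> \<in> polys_less r" for m \<nu> using p by blast
        show "in_L2_loc M g"
          unfolding in_L2_loc_def
        proof (intro allI impI)
          fix I :: "real set" assume "is_interval I \<and> bounded I"
          then obtain X where X: "X > 0" "I \<subseteq> {- X..X}" using bdd by blast
          obtain K where "K \<ge> 0" "\<forall>F. finite F \<and> F \<subseteq> M \<longrightarrow> (\<Sum>m\<in>F. sqint {- X..X} (g m)) \<le> ennreal K" using gK X(1) by blast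
          then show "in_L2_on I M g" by (intro in_L2_onI[OF g X(2)]) auto
        qed
      next
        fix I :: "real set" assume "is_interval I \<and> bounded I"
        then obtain X where X: "X > 0" "I \<subseteq> {- X..X}" using bdd by blast
        obtain K where K: "K \<ge> 0" "\<forall>F. finite F \<and> F \<subseteq> M \<longrightarrow> (\<Sum>m\<in>F. sqint {- X..X} (g m)) \<le> ennreal K" using gK X(1) by blast
        obtain L where L: "L \<ge> 0" "\<forall>m\<in>M. \<forall>\<nu>. \<forall>x\<in>{- X..X}.
          norm (ee (- c m * x) * freq_mult f' (\<Psi> m \<nu>) x - poly (p m \<nu>) (of_real x) - g m x) \<le> L * (1 / 2) ^ (m + \<nu>)"
          using err X(1) by blast
        show "tendsto_L2_on I M (\<lambda>\<nu> m x. cis (- 2 * pi * c m * x) * freq_mult f (\<Psi> m \<nu>) x - poly (p m \<nu>) (complex_of_real x)) g"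
          unfolding cis_ee
        proof (rule tendsto_L2_onI[OF _ g X(2,1) K(1) _ L(1)])
          show "continuous_on UNIV (\<lambda>x. ee (- c m * x) * freq_mult f' (\<Psi> m \<nu>) x - poly (p m \<nu>) (complex_of_real x))" if "m \<in> M" for m \<nu>
            by (rule continuous_on_diff[OF cF[THEN bspec, THEN spec, OF that]]) (intro continuous_intros)
        qed (use K(2) L(2) in auto)
      next
        fix x
        show "maximal_fun r 2 s M g x \<le> ennreal D * maximal_fun i 2 s {()} (\<lambda>_. f) x"
          unfolding D_def by (rule maximal_fun_le_of_oscillation[OF g C ae osc[THEN spec, THEN spec, THEN spec, THEN mp]]) auto
      qed
    qed
    show ?thesis
      by (rule exI[of _ \<Psi>], rule conjI, intro ballI conjI allI, rule \<Psi>(1), assumption, rule L2, assumption,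
          intro allI impI, elim conjE exE, rule est)
  qed
  show ?thesis by (intro exI[of _ D] conjI allI impI, rule D, rule main)
qed

text \<open>If c = 0, the factor |\<xi>|^r is itself |\<xi> + c|^r and K = B suffices. Otherwise, on
  the support, |\<xi>| <= l and |\<xi> + c| >= \<delta>, so K = l^r B / \<delta>^r suffices.\<close>

lemma vanishing_of_gap:
  assumes l: "l > 0" and gap: "c \<noteq> 0 \<Longrightarrow> \<exists>\<delta>>0. \<forall>\<xi>. \<theta> (\<xi> / l) \<noteq> 0 \<longrightarrow> \<delta> \<le> \<bar>\<xi> + c\<bar>"
  shows "vanishing r c l"
proof (cases "c = 0")
  case True
  then show ?thesis unfolding vanishing_def
    using mult_right_mono[OF \<theta>_bound] by (intro exI[of _ B] allI) (simp add: mult.commute[of _ "norm _"])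
next
  case False
  then obtain \<delta> where \<delta>: "\<delta> > 0" "\<And>\<xi>. \<theta> (\<xi> / l) \<noteq> 0 \<Longrightarrow> \<delta> \<le> \<bar>\<xi> + c\<bar>" using gap by blast
  have "\<bar>\<xi>\<bar> ^ r * norm (\<theta> (\<xi> / l)) \<le> (l ^ r * B / \<delta> ^ r) * \<bar>\<xi> + c\<bar> ^ r" for \<xi>
  proof (cases "\<theta> (\<xi> / l) = 0")
    case False
    then have "\<bar>\<xi> / l\<bar> \<le> 1" using \<theta>_outside[of "\<xi> / l"] by fastforce
    then have "\<bar>\<xi>\<bar> \<le> l" using l by (simp add: abs_divide)
    then have "\<bar>\<xi>\<bar> ^ r * norm (\<theta> (\<xi> / l)) \<le> l ^ r * B"
      using l by (intro mult_mono power_mono \<theta>_bound) auto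
    also have "\<dots> = (l ^ r * B / \<delta> ^ r) * \<delta> ^ r" using \<delta>(1) by simp
    also have "\<dots> \<le> (l ^ r * B / \<delta> ^ r) * \<bar>\<xi> + c\<bar> ^ r"
      using \<delta>(1) \<delta>(2)[OF False] l B_nonneg by (intro mult_left_mono power_mono) auto
    finally show ?thesis .
  qed (use l \<delta>(1) B_nonneg in simp)
  then show ?thesis unfolding vanishing_def by blast
qed

end

section \<open>The two bumps and the final statement\<close>

lemma smooth_on_unit_reflect:
  assumes sm: "smooth_on {0..1} \<psi>"
  shows "smooth_on {0..1} (\<lambda>x. \<psi> (1 - x))"
proof -
  have D: "(iter_deriv {0..1} k \<psi> has_vector_derivative iter_deriv {0..1} (Suc k) \<psi> x) (at x within {0..1})"
    if "x \<in> {0..1}" for k x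
    using sm that unfolding smooth_on_def by (auto simp: iter_deriv_def vector_derivative_works)
  let ?E = "\<lambda>k x. (- 1) ^ k * iter_deriv {0..1} k \<psi> (1 - x)"
  have E: "(?E k has_vector_derivative ?E (Suc k) x) (at x within {0..1})" if x: "x \<in> {0..1}" for k x
  proof -
    have im: "(\<lambda>x. 1 - x) ` {0..1} = {0..1::real}" by (auto intro!: image_eqI[of _ _ "1 - x" for x])
    have "((\<lambda>x. 1 - x) has_vector_derivative (- 1 :: real)) (at x within {0..1})"
      by (auto intro!: derivative_eq_intros simp: has_real_derivative_iff_has_vector_derivative[symmetric])
    then have "(iter_deriv {0..1} k \<psi> \<circ> (\<lambda>x. 1 - x) has_vector_derivative (- 1) *\<^sub>R iter_deriv {0..1} (Suc k) \<psi> (1 - x)) (at x within {0..1})"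
      by (rule vector_diff_chain_within) (use D[of "1 - x" k] x im in auto)
    from has_vector_derivative_mult_right[OF this, of "(- 1) ^ k"] show ?thesis by (simp add: o_def)
  qed
  have eq: "\<forall>x\<in>{0..1}. iter_deriv {0..1} k (\<lambda>x. \<psi> (1 - x)) x = ?E k x" for k
  proof (induction k)
    case 0
    then show ?case by (simp add: iter_deriv_def)
  next
    case (Suc k)
    show ?case
    proof
      fix x :: real assume x: "x \<in> {0..1}"
      have "(iter_deriv {0..1} k (\<lambda>x. \<psi> (1 - x)) has_vector_derivative ?E (Suc k) x) (at x within {0..1})"
        by (rule has_vector_derivative_transform[OF x _ E[OF x]]) (use Suc in simp)
      then have "vector_derivative (iter_deriv {0..1} k (\<lambda>x. \<psi> (1 - x))) (at x within {0..1}) = ?E (Suc k) x"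
        by (rule vector_derivative_within_closed_interval[OF zero_less_one x])
      then show "iter_deriv {0..1} (Suc k) (\<lambda>x. \<psi> (1 - x)) x = ?E (Suc k) x" by (simp add: iter_deriv_def)
    qed
  qed
  show ?thesis unfolding smooth_on_def
  proof (intro allI ballI)
    fix k and x :: real assume x: "x \<in> {0..1}"
    have "(iter_deriv {0..1} k (\<lambda>x. \<psi> (1 - x)) has_vector_derivative ?E (Suc k) x) (at x within {0..1})"
      by (rule has_vector_derivative_transform[OF x _ E[OF x]]) (use eq in simp)
    then show "iter_deriv {0..1} k (\<lambda>x. \<psi> (1 - x)) differentiable (at x within {0..1})"
      by (rule differentiableI_vector)
  qed
qed

lemma isCont_unit_supported:
  assumes sm: "smooth_on {0..1} h" and 0: "\<And>x. x \<notin> {0..1} \<Longrightarrow> h x = 0" and x: "x \<noteq> 0" "x \<noteq> 1"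
  shows "isCont h x"
proof (cases "x \<in> {0..1}")
  case True
  then have x: "x \<in> {0<..<1}" using x by auto
  have "iter_deriv {0..1} 0 h differentiable (at x within {0..1})" using sm True by (auto simp: smooth_on_def)
  then have "continuous (at x within {0..1}) h" by (simp add: iter_deriv_def differentiable_imp_continuous_within)
  then have "continuous (at x within {0<..<1}) h" by (rule continuous_within_subset) auto
  then show ?thesis using x by (simp add: at_within_open[of x "{0<..<1}"])
next
  case False
  then have "x \<in> - {0..1}" by simp
  then have "\<forall>\<^sub>F y in nhds x. y \<in> - {0..1}" by (intro eventually_nhds_in_open) auto
  then have "\<forall>\<^sub>F y in nhds x. h y = 0" by eventually_elim (use 0 in simp)
  then show ?thesis by (subst isCont_cong[of h "\<lambda>_. 0"]) auto
qed

theorem theorem2: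
  fixes i r :: nat and s :: real and \<psi> :: "nat \<Rightarrow> real \<Rightarrow> complex"
  assumes "r \<ge> 1" and "- 1 / 2 < s" and "s \<le> real i" and "real r > max s (real i - 1)"
    and "\<And>\<sigma>. \<sigma> \<in> {1, 2} \<Longrightarrow> smooth_on {0..1} (\<psi> \<sigma>)"
    and "\<And>\<sigma> x. \<sigma> \<in> {1, 2} \<Longrightarrow> x \<notin> {0..1} \<Longrightarrow> \<psi> \<sigma> x = 0"
    and "closure {x. \<psi> 1 x \<noteq> 0} \<subseteq> {0..2/3}"
    and "closure {x. \<psi> 2 x \<noteq> 0} \<subseteq> {1/3..1}"
    and "\<And>x. x \<in> {0..1} \<Longrightarrow> \<psi> 1 x + \<psi> 2 x = 1"
  shows "\<exists>C::real. C > 0 \<and>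
    (\<forall>(M :: nat set) (a :: nat \<Rightarrow> real) (b :: nat \<Rightarrow> real).
      (\<forall>m\<in>M. a m < b m) \<and> disjoint_family_on (\<lambda>m. {a m..b m}) M \<and>
      (\<forall>m\<in>M. 0 \<notin> {a m<..<b m}) \<longrightarrow>
      (\<exists>\<Psi> :: nat \<Rightarrow> nat \<Rightarrow> nat \<Rightarrow> real \<Rightarrow> complex.
        (\<forall>\<sigma>\<in>{1, 2}. \<forall>m\<in>M. (\<forall>\<nu>. \<Psi> \<sigma> m \<nu> \<in> schwartz) \<and>
          tendsto_L2_on UNIV {()} (\<lambda>\<nu> _. \<Psi> \<sigma> m \<nu>)
            (\<lambda>_ \<xi>. \<psi> \<sigma> ((\<xi> - a m) / (b m - a m)))) \<and>
        (\<forall>f :: real \<Rightarrow> complex.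
          f \<in> borel_measurable lebesgue \<and>
          (\<exists>x. maximal_fun i 2 s {()} (\<lambda>_. f) x < \<infinity>) \<longrightarrow>
          (\<exists>(p :: nat \<Rightarrow> nat \<Rightarrow> nat \<Rightarrow> complex poly) (g :: nat \<Rightarrow> nat \<Rightarrow> real \<Rightarrow> complex).
            (\<forall>\<sigma>\<in>{1, 2}. \<forall>m\<in>M. \<forall>\<nu>. p \<sigma> m \<nu> \<in> polys_less r) \<and>
            (\<forall>\<sigma>\<in>{1, 2}. in_L2_loc M (g \<sigma>)) \<and>
            (\<forall>I. is_interval I \<and> bounded I \<longrightarrow>
              tendsto_L2_on I M
                (\<lambda>\<nu> m x. cis (- 2 * pi * a m * x) * freq_mult f (\<Psi> 1 m \<nu>) x
                   - poly (p 1 m \<nu>) (complex_of_real x)) (g 1) \<and>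
              tendsto_L2_on I M
                (\<lambda>\<nu> m x. cis (- 2 * pi * b m * x) * freq_mult f (\<Psi> 2 m \<nu>) x
                   - poly (p 2 m \<nu>) (complex_of_real x)) (g 2)) \<and>
            (\<forall>\<sigma>\<in>{1, 2}. \<forall>x.
              maximal_fun r 2 s M (g \<sigma>) x \<le> ennreal C * maximal_fun i 2 s {()} (\<lambda>_. f) x)))))"
proof -
  \<comment> \<open>The midpoint leaves room on both sides: above s and i - 1 for the growth of f,
    below r for the series over the annuli.\<close>
  define \<mu> where "\<mu> = (max s (real (i - 1)) + real r) / 2"
  \<comment> \<open>The difference \<open>i - 1\<close> is truncated, so for i = 0 the second claim
    rests on r >= 1.\<close>
  have ir: "i \<le> r" and "real (i - 1) < real r" using assms(1,4) by auto
  then have \<mu>: "\<mu> > s" "\<mu> \<ge> real (i - 1)" "\<mu> < real r" using assms(4) by (auto simp: \<mu>_def)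
  have sm: "smooth_on {0..1} (\<psi> 1)" "smooth_on {0..1} (\<psi> 2)" using assms(5)[of 1] assms(5)[of 2] by simp_all
  have out: "x \<notin> {0..1} \<Longrightarrow> \<psi> 1 x = 0" "x \<notin> {0..1} \<Longrightarrow> \<psi> 2 x = 0" for x
    using assms(6)[of 1 x] assms(6)[of 2 x] by simp_all
  have sp: "\<psi> 1 x \<noteq> 0 \<Longrightarrow> x \<in> {0..2/3}" "\<psi> 2 x \<noteq> 0 \<Longrightarrow> x \<in> {1/3..1}" for x
    using subset_trans[OF closure_subset assms(7)] subset_trans[OF closure_subset assms(8)] by blast+
  \<comment> \<open>Reflection moves the jump of the right bump from 1 to 0, where
    \<open>jump_symbol_right\<close> expects it; then \<theta>(x) = \<psi> 2 (1 + x) is supported in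
    [-2/3, 0].\<close>
  define h where "h x = \<psi> 2 (1 - x)" for x
  define \<theta> where "\<theta> x = h (- x)" for x
  have h: "smooth_on {0..1} h" unfolding h_def by (rule smooth_on_unit_reflect[OF sm(2)])
  have "smooth_seq (\<lambda>k. iter_deriv {0..1} k (\<psi> 1))"
    by (rule smooth_on_unit_seq[OF sm(1)]) (rule ccontr, drule sp(1), simp)
  from jump_symbol_left[OF this, of "\<psi> 1"] out(1) obtain B1 where "jump_symbol (\<psi> 1) 1 B1"
    by (auto simp: iter_deriv_def simp del: One_nat_def)
  then interpret L: jump_symbol "\<psi> 1" 1 B1 .
  have "smooth_seq (\<lambda>k. iter_deriv {0..1} k h)"
    by (rule smooth_on_unit_seq[OF h]) (rule ccontr, unfold h_def, drule sp(2), simp)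
  moreover have "h x = 0" if "x \<notin> {0..1}" for x
    unfolding h_def by (rule out(2)) (use that in auto)
  ultimately obtain B2 where "jump_symbol \<theta> (- 1) B2"
    unfolding \<theta>_def[abs_def] using jump_symbol_right[of "\<lambda>k. iter_deriv {0..1} k h" h]
    by (auto simp: iter_deriv_def)
  then interpret R: jump_symbol \<theta> "- 1" B2 .
  have "isCont (\<psi> 1) \<xi>" if "\<xi> \<noteq> 0" "\<xi> \<noteq> 1" for \<xi>
    by (rule isCont_unit_supported[OF sm(1) _ that]) (rule out(1))
  then have "{\<xi>. \<not> isCont (\<psi> 1) \<xi>} \<subseteq> {0, 1}" by blast
  then have discL: "finite {\<xi>. \<not> isCont (\<psi> 1) \<xi>}" by (rule finite_subset) simp
  have "isCont \<theta> \<xi>" if "\<xi> \<noteq> 0" "\<xi> \<noteq> - 1" for \<xi>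
  proof -
    have "isCont (\<psi> 2) (1 - (- \<xi>))"
      by (rule isCont_unit_supported[OF sm(2)]) (rule out(2), assumption, use that in simp_all)
    moreover have "isCont (\<lambda>x::real. 1 - (- x)) \<xi>" by (intro continuous_intros)
    ultimately show ?thesis unfolding \<theta>_def[abs_def] h_def by (rule isCont_o2[rotated])
  qed
  then have "{\<xi>. \<not> isCont \<theta> \<xi>} \<subseteq> {0, - 1}" by blast
  then have discR: "finite {\<xi>. \<not> isCont \<theta> \<xi>}" by (rule finite_subset) simp
  let ?est = "\<lambda>C \<theta> M c l. \<exists>\<Psi>.
     (\<forall>m\<in>M. (\<forall>\<nu>. \<Psi> m \<nu> \<in> schwartz) \<and> tendsto_L2_on UNIV {()} (\<lambda>\<nu> _. \<Psi> m \<nu>) (\<lambda>_ \<xi>. \<theta> ((\<xi> - c m) / l m))) \<and>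
     (\<forall>f. f \<in> borel_measurable lebesgue \<and> (\<exists>x. maximal_fun i 2 s {()} (\<lambda>_. f) x < \<infinity>) \<longrightarrow> (\<exists>p g.
        (\<forall>m\<in>M. \<forall>\<nu>. p m \<nu> \<in> polys_less r) \<and> in_L2_loc M g \<and>
        (\<forall>I. is_interval I \<and> bounded I \<longrightarrow> tendsto_L2_on I M
           (\<lambda>\<nu> m x. cis (- 2 * pi * c m * x) * freq_mult f (\<Psi> m \<nu>) x - poly (p m \<nu>) (complex_of_real x)) g) \<and>
        (\<forall>x. maximal_fun r 2 s M g x \<le> ennreal C * maximal_fun i 2 s {()} (\<lambda>_. f) x)))"
  obtain C1 where C1: "C1 > 0" "\<forall>M c l. L.admissible r M c l \<longrightarrow> ?est C1 (\<psi> 1) M c l"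
    using L.multiplier_estimate[OF \<mu> ir assms(1) discL] by (elim exE conjE) (rule that)
  obtain C2 where C2: "C2 > 0" "\<forall>M c l. R.admissible r M c l \<longrightarrow> ?est C2 \<theta> M c l"
    using R.multiplier_estimate[OF \<mu> ir assms(1) discR] by (elim exE conjE) (rule that)
  define C where "C = max C1 C2"
  have C: "C > 0" "C1 \<le> C" "C2 \<le> C" using C1(1) by (auto simp: C_def)
  show ?thesis
  proof (rule exI[of _ C], intro conjI allI impI, rule C(1), elim conjE)
    fix M :: "nat set" and a b :: "nat \<Rightarrow> real"
    assume ab: "\<forall>m\<in>M. a m < b m" and disj: "disjoint_family_on (\<lambda>m. {a m..b m}) M" and zero: "\<forall>m\<in>M. 0 \<notin> {a m<..<b m}"
    define l where "l m = b m - a m" for m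
    have l: "l m > 0" if "m \<in> M" for m using ab that by (simp add: l_def)
    have "civ 1 (a m) (l m) = {a m..b m}" "civ (- 1) (b m) (l m) = {a m..b m}" for m
      by (auto simp: civ_def l_def)
    moreover have "L.vanishing r (a m) (l m)" if m: "m \<in> M" for m
    proof (rule L.vanishing_of_gap[OF l[OF m]])
      assume "a m \<noteq> 0"
      \<comment> \<open>If a_m > 0, then \<xi> >= 0 gives \<xi> + a_m >= a_m. If a_m < 0, then b_m
        <= 0 because 0 is not inside the interval, and \<xi> <= 2 l_m/3 keeps \<xi> + a_m at least
        l_m/3 below b_m.\<close>
      have "(if a m > 0 then a m else l m / 3) \<le> \<bar>\<xi> + a m\<bar>" if "\<psi> 1 (\<xi> / l m) \<noteq> 0" for \<xi>
      proof -
        have "0 \<le> \<xi>" "\<xi> \<le> 2 / 3 * l m" using sp(1)[OF that] l[OF m] by (auto simp: field_simps)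
        moreover have "b m = a m + l m" by (simp add: l_def)
        ultimately show ?thesis using zero[rule_format, OF m] \<open>a m \<noteq> 0\<close> by auto
      qed
      then show "\<exists>\<delta>>0. \<forall>\<xi>. \<psi> 1 (\<xi> / l m) \<noteq> 0 \<longrightarrow> \<delta> \<le> \<bar>\<xi> + a m\<bar>"
        using l[OF m] by (intro exI[of _ "if a m > 0 then a m else l m / 3"]) simp
    qed
    moreover have "R.vanishing r (b m) (l m)" if m: "m \<in> M" for m
    proof (rule R.vanishing_of_gap[OF l[OF m]])
      assume "b m \<noteq> 0"
      \<comment> \<open>The mirror image: b_m < 0 gives \<xi> + b_m <= b_m, while b_m > 0 forces a_m
        >= 0 and \<xi> >= - 2 l_m/3 keeps \<xi> + b_m at least l_m/3 above a_m.\<close>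
      have "(if b m < 0 then - b m else l m / 3) \<le> \<bar>\<xi> + b m\<bar>" if "\<theta> (\<xi> / l m) \<noteq> 0" for \<xi>
      proof -
        have "1 / 3 \<le> 1 + \<xi> / l m" "1 + \<xi> / l m \<le> 1" using sp(2)[of "1 + \<xi> / l m"] that by (auto simp: \<theta>_def h_def)
        then have "- 2 / 3 * l m \<le> \<xi>" "\<xi> \<le> 0" using l[OF m] by (auto simp: field_simps)
        moreover have "b m = a m + l m" by (simp add: l_def)
        ultimately show ?thesis using zero[rule_format, OF m] \<open>b m \<noteq> 0\<close> by auto
      qed
      then show "\<exists>\<delta>>0. \<forall>\<xi>. \<theta> (\<xi> / l m) \<noteq> 0 \<longrightarrow> \<delta> \<le> \<bar>\<xi> + b m\<bar>"
        using l[OF m] \<open>b m \<noteq> 0\<close> by (intro exI[of _ "if b m < 0 then - b m else l m / 3"]) simp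
    qed
    ultimately have adm: "L.admissible r M a l" "R.admissible r M b l"
      using l disj by (simp_all add: L.admissible_def R.admissible_def del: One_nat_def)
    obtain \<Psi>1 where \<Psi>1: "\<forall>m\<in>M. (\<forall>\<nu>. \<Psi>1 m \<nu> \<in> schwartz) \<and> tendsto_L2_on UNIV {()} (\<lambda>\<nu> _. \<Psi>1 m \<nu>) (\<lambda>_ \<xi>. \<psi> 1 ((\<xi> - a m) / l m))"
      and est1: "\<forall>f. f \<in> borel_measurable lebesgue \<and> (\<exists>x. maximal_fun i 2 s {()} (\<lambda>_. f) x < \<infinity>) \<longrightarrow> (\<exists>p g.
        (\<forall>m\<in>M. \<forall>\<nu>. p m \<nu> \<in> polys_less r) \<and> in_L2_loc M g \<and>
        (\<forall>I. is_interval I \<and> bounded I \<longrightarrow> tendsto_L2_on I M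
           (\<lambda>\<nu> m x. cis (- 2 * pi * a m * x) * freq_mult f (\<Psi>1 m \<nu>) x - poly (p m \<nu>) (complex_of_real x)) g) \<and>
        (\<forall>x. maximal_fun r 2 s M g x \<le> ennreal C1 * maximal_fun i 2 s {()} (\<lambda>_. f) x))"
      using C1(2)[THEN spec, THEN spec, THEN spec, THEN mp, OF adm(1)] by (elim exE conjE) (rule that)
    obtain \<Psi>2 where \<Psi>2: "\<forall>m\<in>M. (\<forall>\<nu>. \<Psi>2 m \<nu> \<in> schwartz) \<and> tendsto_L2_on UNIV {()} (\<lambda>\<nu> _. \<Psi>2 m \<nu>) (\<lambda>_ \<xi>. \<theta> ((\<xi> - b m) / l m))"
      and est2: "\<forall>f. f \<in> borel_measurable lebesgue \<and> (\<exists>x. maximal_fun i 2 s {()} (\<lambda>_. f) x < \<infinity>) \<longrightarrow> (\<exists>p g.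
        (\<forall>m\<in>M. \<forall>\<nu>. p m \<nu> \<in> polys_less r) \<and> in_L2_loc M g \<and>
        (\<forall>I. is_interval I \<and> bounded I \<longrightarrow> tendsto_L2_on I M
           (\<lambda>\<nu> m x. cis (- 2 * pi * b m * x) * freq_mult f (\<Psi>2 m \<nu>) x - poly (p m \<nu>) (complex_of_real x)) g) \<and>
        (\<forall>x. maximal_fun r 2 s M g x \<le> ennreal C2 * maximal_fun i 2 s {()} (\<lambda>_. f) x))"
      using C2(2)[THEN spec, THEN spec, THEN spec, THEN mp, OF adm(2)] by (elim exE conjE) (rule that)
    have \<theta>_eq: "(\<lambda>_ \<xi>. \<theta> ((\<xi> - b m) / l m)) = (\<lambda>_ \<xi>. \<psi> 2 ((\<xi> - a m) / (b m - a m)))" if "m \<in> M" for m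
    proof -
      have "1 + (\<xi> - b m) / l m = (\<xi> - a m) / (b m - a m)" for \<xi>
        using l[OF that] by (simp add: l_def field_simps)
      then show ?thesis by (simp add: \<theta>_def h_def)
    qed
    have up1: "ennreal C1 * y \<le> ennreal C * y" and up2: "ennreal C2 * y \<le> ennreal C * y" for y
      using C by (auto intro!: mult_right_mono ennreal_leI)
    define \<Psi> where "\<Psi> \<sigma> = (if \<sigma> = (1::nat) then \<Psi>1 else \<Psi>2)" for \<sigma>
    have \<Psi>: "\<Psi> 1 = \<Psi>1" "\<Psi> 2 = \<Psi>2" by (simp_all add: \<Psi>_def)
    show "\<exists>\<Psi> :: nat \<Rightarrow> nat \<Rightarrow> nat \<Rightarrow> real \<Rightarrow> complex.
        (\<forall>\<sigma>\<in>{1, 2}. \<forall>m\<in>M. (\<forall>\<nu>. \<Psi> \<sigma> m \<nu> \<in> schwartz) \<and>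
          tendsto_L2_on UNIV {()} (\<lambda>\<nu> _. \<Psi> \<sigma> m \<nu>)
            (\<lambda>_ \<xi>. \<psi> \<sigma> ((\<xi> - a m) / (b m - a m)))) \<and>
        (\<forall>f :: real \<Rightarrow> complex.
          f \<in> borel_measurable lebesgue \<and>
          (\<exists>x. maximal_fun i 2 s {()} (\<lambda>_. f) x < \<infinity>) \<longrightarrow>
          (\<exists>(p :: nat \<Rightarrow> nat \<Rightarrow> nat \<Rightarrow> complex poly) (g :: nat \<Rightarrow> nat \<Rightarrow> real \<Rightarrow> complex).
            (\<forall>\<sigma>\<in>{1, 2}. \<forall>m\<in>M. \<forall>\<nu>. p \<sigma> m \<nu> \<in> polys_less r) \<and>
            (\<forall>\<sigma>\<in>{1, 2}. in_L2_loc M (g \<sigma>)) \<and>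
            (\<forall>I. is_interval I \<and> bounded I \<longrightarrow>
              tendsto_L2_on I M
                (\<lambda>\<nu> m x. cis (- 2 * pi * a m * x) * freq_mult f (\<Psi> 1 m \<nu>) x
                   - poly (p 1 m \<nu>) (complex_of_real x)) (g 1) \<and>
              tendsto_L2_on I M
                (\<lambda>\<nu> m x. cis (- 2 * pi * b m * x) * freq_mult f (\<Psi> 2 m \<nu>) x
                   - poly (p 2 m \<nu>) (complex_of_real x)) (g 2)) \<and>
            (\<forall>\<sigma>\<in>{1, 2}. \<forall>x.
              maximal_fun r 2 s M (g \<sigma>) x \<le> ennreal C * maximal_fun i 2 s {()} (\<lambda>_. f) x)))"
    proof (rule exI[of _ \<Psi>], rule conjI)
      show "\<forall>\<sigma>\<in>{1, 2}. \<forall>m\<in>M. (\<forall>\<nu>. \<Psi> \<sigma> m \<nu> \<in> schwartz) \<and>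
          tendsto_L2_on UNIV {()} (\<lambda>\<nu> _. \<Psi> \<sigma> m \<nu>) (\<lambda>_ \<xi>. \<psi> \<sigma> ((\<xi> - a m) / (b m - a m)))"
      proof (intro ballI)
        fix \<sigma> :: nat and m assume "\<sigma> \<in> {1, 2}" and m: "m \<in> M"
        then consider "\<sigma> = 1" | "\<sigma> = 2" by blast
        then show "(\<forall>\<nu>. \<Psi> \<sigma> m \<nu> \<in> schwartz) \<and>
          tendsto_L2_on UNIV {()} (\<lambda>\<nu> _. \<Psi> \<sigma> m \<nu>) (\<lambda>_ \<xi>. \<psi> \<sigma> ((\<xi> - a m) / (b m - a m)))"
          by cases (simp_all only: simp_thms \<Psi> \<Psi>1[THEN bspec, OF m, unfolded l_def] \<Psi>2[THEN bspec, OF m, unfolded \<theta>_eq[OF m]])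
      qed
    next
      show "\<forall>f :: real \<Rightarrow> complex.
          f \<in> borel_measurable lebesgue \<and>
          (\<exists>x. maximal_fun i 2 s {()} (\<lambda>_. f) x < \<infinity>) \<longrightarrow>
          (\<exists>(p :: nat \<Rightarrow> nat \<Rightarrow> nat \<Rightarrow> complex poly) (g :: nat \<Rightarrow> nat \<Rightarrow> real \<Rightarrow> complex).
            (\<forall>\<sigma>\<in>{1, 2}. \<forall>m\<in>M. \<forall>\<nu>. p \<sigma> m \<nu> \<in> polys_less r) \<and>
            (\<forall>\<sigma>\<in>{1, 2}. in_L2_loc M (g \<sigma>)) \<and>
            (\<forall>I. is_interval I \<and> bounded I \<longrightarrow>
              tendsto_L2_on I M
                (\<lambda>\<nu> m x. cis (- 2 * pi * a m * x) * freq_mult f (\<Psi> 1 m \<nu>) x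
                   - poly (p 1 m \<nu>) (complex_of_real x)) (g 1) \<and>
              tendsto_L2_on I M
                (\<lambda>\<nu> m x. cis (- 2 * pi * b m * x) * freq_mult f (\<Psi> 2 m \<nu>) x
                   - poly (p 2 m \<nu>) (complex_of_real x)) (g 2)) \<and>
            (\<forall>\<sigma>\<in>{1, 2}. \<forall>x.
              maximal_fun r 2 s M (g \<sigma>) x \<le> ennreal C * maximal_fun i 2 s {()} (\<lambda>_. f) x))"
      proof (rule allI, rule impI)
        fix f :: "real \<Rightarrow> complex"
        assume f: "f \<in> borel_measurable lebesgue \<and> (\<exists>x. maximal_fun i 2 s {()} (\<lambda>_. f) x < \<infinity>)"
        obtain p1 g1 where 1: "\<forall>m\<in>M. \<forall>\<nu>. p1 m \<nu> \<in> polys_less r" "in_L2_loc M g1"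
          "\<forall>I. is_interval I \<and> bounded I \<longrightarrow> tendsto_L2_on I M
           (\<lambda>\<nu> m x. cis (- 2 * pi * a m * x) * freq_mult f (\<Psi>1 m \<nu>) x - poly (p1 m \<nu>) (complex_of_real x)) g1"
          "\<forall>x. maximal_fun r 2 s M g1 x \<le> ennreal C1 * maximal_fun i 2 s {()} (\<lambda>_. f) x"
          using est1[THEN spec, THEN mp, OF f] by (elim exE conjE) (rule that)
        obtain p2 g2 where 2: "\<forall>m\<in>M. \<forall>\<nu>. p2 m \<nu> \<in> polys_less r" "in_L2_loc M g2"
          "\<forall>I. is_interval I \<and> bounded I \<longrightarrow> tendsto_L2_on I M
           (\<lambda>\<nu> m x. cis (- 2 * pi * b m * x) * freq_mult f (\<Psi>2 m \<nu>) x - poly (p2 m \<nu>) (complex_of_real x)) g2"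
          "\<forall>x. maximal_fun r 2 s M g2 x \<le> ennreal C2 * maximal_fun i 2 s {()} (\<lambda>_. f) x"
          using est2[THEN spec, THEN mp, OF f] by (elim exE conjE) (rule that)
        have 3: "maximal_fun r 2 s M g1 x \<le> ennreal C * maximal_fun i 2 s {()} (\<lambda>_. f) x"
          "maximal_fun r 2 s M g2 x \<le> ennreal C * maximal_fun i 2 s {()} (\<lambda>_. f) x" for x
          using 1(4) 2(4) up1 up2 by (blast intro: order_trans)+
        define p where "p \<sigma> = (if \<sigma> = (1::nat) then p1 else p2)" for \<sigma>
        define g where "g \<sigma> = (if \<sigma> = (1::nat) then g1 else g2)" for \<sigma>
        have pg: "p 1 = p1" "p 2 = p2" "g 1 = g1" "g 2 = g2" by (simp_all add: p_def g_def)
        show "\<exists>(p :: nat \<Rightarrow> nat \<Rightarrow> nat \<Rightarrow> complex poly) (g :: nat \<Rightarrow> nat \<Rightarrow> real \<Rightarrow> complex).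
            (\<forall>\<sigma>\<in>{1, 2}. \<forall>m\<in>M. \<forall>\<nu>. p \<sigma> m \<nu> \<in> polys_less r) \<and>
            (\<forall>\<sigma>\<in>{1, 2}. in_L2_loc M (g \<sigma>)) \<and>
            (\<forall>I. is_interval I \<and> bounded I \<longrightarrow>
              tendsto_L2_on I M
                (\<lambda>\<nu> m x. cis (- 2 * pi * a m * x) * freq_mult f (\<Psi> 1 m \<nu>) x
                   - poly (p 1 m \<nu>) (complex_of_real x)) (g 1) \<and>
              tendsto_L2_on I M
                (\<lambda>\<nu> m x. cis (- 2 * pi * b m * x) * freq_mult f (\<Psi> 2 m \<nu>) x
                   - poly (p 2 m \<nu>) (complex_of_real x)) (g 2)) \<and>
            (\<forall>\<sigma>\<in>{1, 2}. \<forall>x.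
              maximal_fun r 2 s M (g \<sigma>) x \<le> ennreal C * maximal_fun i 2 s {()} (\<lambda>_. f) x)"
          by (rule exI[of _ p], rule exI[of _ g]) (use 1 2 3 in \<open>simp add: pg \<Psi> del: One_nat_def\<close>)
      qed
    qed
  qed
qed

end
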